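(* Let $T\subset S^3_{\mathrm{eq}}$ be an ideal CCT of width $k\ge 3$. Then there exists an ideal $(k+1)$-CCT $T'$ in $S^3_{\mathrm{eq}}$ extending $T$.
   Context: Spheres are unit spheres; $S^4\subset\mathbb{R}^5$ and $S^3_{\mathrm{eq}}=\{x\in S^4:x_5=0\}$. Polytopal complexes are finite collections of spherical polytopes closed under faces with pairwise intersections common faces; a cube is a polytope combinatorially equivalent to some $[0,1]^j$. CCTs: Let $\mathfrak{C}$ be the unit cube tiling of $\mathbb{R}^3$ with vertex set $\mathbb{Z}^3$ and $\mathfrak{C}[k]$ its subcomplex induced by vertices $v$ with $0\le v_1+v_2+v_3\le k$; let $\Lambda$ be the lattice generated by $(3,-3,0)$ and $(-2,-2,4)$ and $\mathfrak{T}[k]=\mathfrak{C}[k]/\Lambda$. A $k$-CCT is a geometric cubical complex $T$ with a combinatorial isomorphism $\varphi_T:\mathfrak{T}[k]\to T$; layer $\ell$ is the image of the vertex classes with coordinate sum $\ell$; $R(T,I)$ is the subcomplex induced by layers in $I$. A CCT $T'$ of width $\ell>k$ extends the $k$-CCT $T$ if $R(T',\{0,\dots,k\})=T$. Symmetry: $r_{1,2}$ rotates the $(x_1,x_2)$-plane of $\mathbb{R}^5$ by $\pi/2$ (fixing other coordinates), $r_{3,4}$ rotates the $(x_3,x_4)$-plane by $\pi/3$, $s$ is $x_4\mapsto -x_4$. $T$ is symmetric if $s$, $r_{3,4}^2$, $r_{3,4}r_{1,2}$ map $T$ to itself and correspond via $\varphi_T$ respectively to the automorphisms of $\mathfrak{T}[k]$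 induced by swapping the first two coordinates, translation by $(-1,1,0)$, and translation by $(0,-1,1)$. $\mathcal{C}_\lambda=\{x\in S^3_{\mathrm{eq}}: x_1^2+x_2^2=1-\lambda/2,\ x_3^2+x_4^2=\lambda/2\}$; $\pi_1(y)=\frac{(y_1,y_2,0,0,0)}{\sqrt2\|(y_1,y_2)\|}+\frac{(0,0,y_3,y_4,0)}{\sqrt2\|(y_3,y_4)\|}$ on $S^3_{\mathrm{eq}}\setminus(\mathcal{C}_0\cup\mathcal{C}_2)$; $\pi_0(y)=\frac{(y_1,y_2,0,0,0)}{\|(y_1,y_2)\|}$ on $S^3_{\mathrm{eq}}\setminus\mathcal{C}_2$. A symmetric 2-CCT is transversal if $\pi_1$ is defined and injective on it; a symmetric $k$-CCT is transversal if $R(T,\{i-1,i,i+1\})$ is transversal for all $1\le i\le k-1$. Slope of a transversal symmetric 2-CCT: for a layer-2 vertex $s$, $t=r_{3,4}^2s$, $u$ the middle vertex of the unique length-2 edge path from $s$ to $t$, $m$ the midpoint of $[s,t]$, $\alpha(T)$ is the angle at $m$ between the segments $[m,\pi_0(m)]$ and $[m,u]$. A transversal symmetric $k$-CCT $T$ ($k\ge 2$) is ideal if $\alpha(R(T,\{k-2,k-1,k\}))>\pi/2$ and the closure of the component of $S^3_{\mathrm{eq}}\setminus T$ containing $\mathcal{C}_0$ meets layer $k$.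
   Formalization: In the definition of symmetric, r_{3,4}^2 is matched with translation by (1,-1,0) instead of (-1,1,0); with the printed sign no symmetric CCT exists, since (r_{3,4}r_{1,2})^4 = r_{3,4}^4 while 4(0,-1,1) ≡ (-1,1,0) mod Λ. *)

theory Defs
  imports "HOL-Analysis.Analysis"
begin

section \<open>Spherical polytopes and polytopal complexes\<close>

definition sph_hull :: "(real^5) set \<Rightarrow> (real^5) set" where
  "sph_hull V = convex_cone hull V \<inter> sphere 0 1"

definition sph_polytope :: "(real^5) set \<Rightarrow> bool" where
  "sph_polytope P \<longleftrightarrow>
     (\<exists>V a. finite V \<and> V \<subseteq> sphere 0 1 \<and> (\<forall>v\<in>V. 0 < a \<bullet> v) \<and> P = sph_hull V)"

text \<open>As for \<^const>\<open>face_of\<close>, the empty set and \<open>P\<close> itself count as faces of \<open>P\<close>;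
  accordingly all complexes below contain the empty face.\<close>

definition sph_face_of :: "(real^5) set \<Rightarrow> (real^5) set \<Rightarrow> bool" (infixr "sph'_face'_of" 50) where
  "F sph_face_of P \<longleftrightarrow> (\<exists>a. (\<forall>x\<in>P. 0 \<le> a \<bullet> x) \<and> F = {x \<in> P. a \<bullet> x = 0})"

definition polytopal_complex :: "(real^5) set set \<Rightarrow> bool" where
  "polytopal_complex T \<longleftrightarrow>
     finite T \<and> (\<forall>P\<in>T. sph_polytope P) \<and>
     (\<forall>P\<in>T. \<forall>F. F sph_face_of P \<longrightarrow> F \<in> T) \<and>
     (\<forall>P\<in>T. \<forall>Q\<in>T. (P \<inter> Q) sph_face_of P \<and> (P \<inter> Q) sph_face_of Q)"

text \<open>The model \<open>[0,1]\<^sup>j\<close> is placed in the coordinate subspace of a \<open>j\<close>-element set \<open>J\<close> of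
  coordinates of \<open>\<real>\<^sup>5\<close>. This loses nothing, as polytopes in \<open>S\<^sup>4\<close> have dimension at most 4.\<close>

definition model_cube :: "5 set \<Rightarrow> (real^5) set" where
  "model_cube J = cbox 0 (\<chi> i. if i \<in> J then 1 else 0)"

definition sph_cube :: "(real^5) set \<Rightarrow> bool" where
  "sph_cube P \<longleftrightarrow> sph_polytope P \<and>
     (\<exists>J h. bij_betw h {F. F face_of model_cube J} {F. F sph_face_of P} \<and>
        (\<forall>F G. F face_of model_cube J \<and> G face_of model_cube J \<longrightarrow> (h F \<subseteq> h G \<longleftrightarrow> F \<subseteq> G)))"

definition cubical_complex :: "(real^5) set set \<Rightarrow> bool" where
  "cubical_complex T \<longleftrightarrow> polytopal_complex T \<and> (\<forall>P\<in>T. P \<noteq> {} \<longrightarrow> sph_cube P)"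

definition induced_subcomplex :: "(real^5) set set \<Rightarrow> (real^5) set \<Rightarrow> (real^5) set set" where
  "induced_subcomplex T W = {P \<in> T. \<forall>x. {x} sph_face_of P \<longrightarrow> x \<in> W}"

definition adjacent :: "(real^5) set set \<Rightarrow> real^5 \<Rightarrow> real^5 \<Rightarrow> bool" where
  "adjacent T x y \<longleftrightarrow> x \<noteq> y \<and> {x} \<in> T \<and> {y} \<in> T \<and> sph_hull {x, y} \<in> T"

section \<open>The cube tiling and its quotients\<close>

definition int_points :: "(real^3) set" where
  "int_points = {v. \<forall>i. v $ i \<in> \<int>}"

definition coord_sum :: "real^3 \<Rightarrow> real" where
  "coord_sum v = v $ 1 + v $ 2 + v $ 3"

definition cube_tiling :: "(real^3) set set" where
  "cube_tiling =
     insert {} {cbox v (v + (\<chi> i. if i \<in> I then 1 else 0)) | v I. v \<in> int_points}"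

definition cube_strip :: "nat \<Rightarrow> (real^3) set set" where
  "cube_strip k =
     {F \<in> cube_tiling. \<forall>v. {v} face_of F \<longrightarrow> 0 \<le> coord_sum v \<and> coord_sum v \<le> real k}"

definition Lam :: "(real^3) set" where
  "Lam = {of_int a *\<^sub>R vector [3, -3, 0] + of_int b *\<^sub>R vector [-2, -2, 4] | a b. True}"

definition orbit :: "(real^3) set \<Rightarrow> (real^3) set set" where
  "orbit F = (\<lambda>l. (+) l ` F) ` Lam"

definition torus_complex :: "nat \<Rightarrow> (real^3) set set set" where
  "torus_complex k = orbit ` cube_strip k"

definition orbit_le :: "(real^3) set set \<Rightarrow> (real^3) set set \<Rightarrow> bool" where
  "orbit_le C D \<longleftrightarrow> (\<exists>F\<in>C. \<exists>G\<in>D. F \<subseteq> G)"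

definition induced :: "(real^3 \<Rightarrow> real^3) \<Rightarrow> (real^3) set set \<Rightarrow> (real^3) set set" where
  "induced f C = (\<lambda>F. f ` F) ` C"

section \<open>Cross-bedding cubical tori (CCTs)\<close>

type_synonym labelling = "(real^3) set set \<Rightarrow> (real^5) set"

definition is_cct :: "nat \<Rightarrow> (real^5) set set \<Rightarrow> labelling \<Rightarrow> bool" where
  "is_cct k T \<phi> \<longleftrightarrow> cubical_complex T \<and> bij_betw \<phi> (torus_complex k) T \<and>
     (\<forall>C\<in>torus_complex k. \<forall>D\<in>torus_complex k. \<phi> C \<subseteq> \<phi> D \<longleftrightarrow> orbit_le C D)"

definition layer :: "labelling \<Rightarrow> nat \<Rightarrow> (real^5) set" where
  "layer \<phi> l = (\<Union>v\<in>{v \<in> int_points. coord_sum v = real l}. \<phi> (orbit {v}))"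

definition restr :: "(real^5) set set \<Rightarrow> labelling \<Rightarrow> nat set \<Rightarrow> (real^5) set set" where
  "restr T \<phi> I = induced_subcomplex T (\<Union>l\<in>I. layer \<phi> l)"

text \<open>\<open>restr T \<phi> {j..j+m}\<close> is regarded as an \<open>m\<close>-CCT by moving its lowest layer \<open>j\<close> to layer 0.
  The translation vector is invariant under the swap of the first two coordinates, so that symmetry
  is inherited.\<close>

definition shift_lab :: "nat \<Rightarrow> labelling \<Rightarrow> labelling" where
  "shift_lab j \<phi> = (\<lambda>C. \<phi> (induced ((+) (vector [0, 0, real j])) C))"

definition extends :: "nat \<Rightarrow> (real^5) set set \<Rightarrow> labelling \<Rightarrow> nat \<Rightarrow> (real^5) set set \<Rightarrow> bool" where
  "extends l T' \<phi>' k T \<longleftrightarrow> k < l \<and> restr T' \<phi>' {0..k} = T"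

section \<open>Symmetry\<close>

definition rot :: "5 \<Rightarrow> 5 \<Rightarrow> real \<Rightarrow> real^5 \<Rightarrow> real^5" where
  "rot i j \<theta> x = (\<chi> m. if m = i then cos \<theta> * x $ i - sin \<theta> * x $ j
                     else if m = j then sin \<theta> * x $ i + cos \<theta> * x $ j
                     else x $ m)"

definition r12 :: "real^5 \<Rightarrow> real^5" where "r12 = rot 1 2 (pi / 2)"
definition r34 :: "real^5 \<Rightarrow> real^5" where "r34 = rot 3 4 (pi / 3)"
definition refl4 :: "real^5 \<Rightarrow> real^5" where "refl4 x = (\<chi> m. if m = 4 then - x $ m else x $ m)"

definition swap12 :: "real^3 \<Rightarrow> real^3" where "swap12 v = vector [v $ 2, v $ 1, v $ 3]"

definition corresponds ::
  "nat \<Rightarrow> (real^5) set set \<Rightarrow> labelling \<Rightarrow> (real^5 \<Rightarrow> real^5) \<Rightarrow> (real^3 \<Rightarrow> real^3) \<Rightarrow> bool" where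
  "corresponds k T \<phi> g f \<longleftrightarrow>
     (\<lambda>P. g ` P) ` T = T \<and> (\<forall>C\<in>torus_complex k. g ` \<phi> C = \<phi> (induced f C))"

text \<open>The sign of \<open>(1,-1,0)\<close> is forced by the two other conditions: conjugating \<open>r34 \<circ> r12\<close> by
  \<open>refl4\<close> gives \<open>r34\<inverse> \<circ> r12\<close>, which thus corresponds to translation by \<open>(-1,0,1)\<close>, so \<open>r34\<^sup>2\<close>
  corresponds to translation by \<open>(0,-1,1) - (-1,0,1) = (1,-1,0)\<close>. With \<open>(-1,1,0)\<close> instead,
  no CCT would be symmetric; see lemma \<open>opposite_sign_inconsistent\<close> below.\<close>

definition symmetric_cct :: "nat \<Rightarrow> (real^5) set set \<Rightarrow> labelling \<Rightarrow> bool" where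
  "symmetric_cct k T \<phi> \<longleftrightarrow> is_cct k T \<phi> \<and>
     corresponds k T \<phi> refl4 swap12 \<and>
     corresponds k T \<phi> (r34 \<circ> r34) ((+) (vector [1, -1, 0])) \<and>
     corresponds k T \<phi> (r34 \<circ> r12) ((+) (vector [0, -1, 1]))"

lemma opposite_sign_inconsistent:
  assumes cct: "is_cct k T \<phi>"
    and a: "corresponds k T \<phi> (r34 \<circ> r34) ((+) (vector [-1, 1, 0]))"
    and b: "corresponds k T \<phi> (r34 \<circ> r12) ((+) (vector [0, -1, 1]))"
  shows False
proof -
  let ?C = "\<lambda>v. orbit {v}"
  have ind: "induced ((+) w) (?C v) = ?C (w + v)" for v w
    by (auto simp: induced_def orbit_def image_image add_ac)
  have tile: "{v} \<in> cube_tiling" if "v \<in> int_points" for v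
  proof -
    have "cbox v (v + (\<chi> i. if i \<in> {} then 1 else 0)) = {v}"
      by (simp flip: zero_vec_def)
    with that show ?thesis unfolding cube_tiling_def by blast
  qed
  have mem: "?C v \<in> torus_complex k" if "v \<in> int_points" "coord_sum v = 0" for v
    unfolding torus_complex_def cube_strip_def using that tile
    by (auto intro!: imageI simp: face_of_singleton)
  have ip: "vector [of_int p, of_int q, of_int r] \<in> int_points" for p q r
    by (auto simp: int_points_def forall_3)
  define v where "v = (\<lambda>n::nat. vector [0, - real n, real n] :: real^3)"
  have vi: "v n \<in> int_points" and vs: "coord_sum (v n) = 0" for n
    using ip[of 0 "- int n" "int n"] by (auto simp: v_def coord_sum_def)
  have step: "(r34 \<circ> r12) ` \<phi> (?C (v n)) = \<phi> (?C (v (Suc n)))" for n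
  proof -
    have "vector [0, -1, 1] + v n = v (Suc n)"
      by (simp add: v_def vec_eq_iff forall_3)
    then show ?thesis
      using b mem[OF vi vs] by (simp add: corresponds_def ind)
  qed
  let ?g = "r34 \<circ> r12"
  have four: "?g ` ?g ` ?g ` ?g ` \<phi> (?C (v 0)) = \<phi> (?C (v 4))"
    by (simp only: step) (simp add: eval_nat_numeral)
  have s60: "sin (pi / 3) * sin (pi / 3) = (3 / 4 :: real)"
    by (simp add: sin_60)
  have c34: "?g (?g (?g (?g x))) = r34 (r34 (r34 (r34 x)))" for x
  proof -
    have comm: "r12 (r34 y) = r34 (r12 y)" for y
      by (simp add: vec_eq_iff r12_def r34_def rot_def)
    have "r12 (r12 (r12 (r12 y))) = y" for y
      by (simp add: vec_eq_iff r12_def rot_def)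
    then show ?thesis by (simp add: comm)
  qed
  have orb_eq: "?C x = ?C y" if "x - y \<in> Lam" for x y
  proof -
    have add: "p + q \<in> Lam" and neg: "- p \<in> Lam" if pq: "p \<in> Lam" "q \<in> Lam" for p q
    proof -
      obtain a b c d where p: "p = of_int a *\<^sub>R vector [3, -3, 0] + of_int b *\<^sub>R vector [-2, -2, 4]"
        and q: "q = of_int c *\<^sub>R vector [3, -3, 0] + of_int d *\<^sub>R vector [-2, -2, 4]"
        using pq unfolding Lam_def by blast
      have "p + q = of_int (a + c) *\<^sub>R vector [3, -3, 0] + of_int (b + d) *\<^sub>R vector [-2, -2, 4]"
        by (simp add: p q algebra_simps)
      then show "p + q \<in> Lam" unfolding Lam_def by blast
      have "- p = of_int (- a) *\<^sub>R vector [3, -3, 0] + of_int (- b) *\<^sub>R vector [-2, -2, 4]"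
        by (simp add: p)
      then show "- p \<in> Lam" unfolding Lam_def by blast
    qed
    have "?C p \<subseteq> ?C q" if "p - q \<in> Lam" for p q
    proof
      fix S assume "S \<in> ?C p"
      then obtain l where l: "l \<in> Lam" "S = {l + p}" by (auto simp: orbit_def)
      have "S = {(l + (p - q)) + q}" using l by simp
      moreover have "l + (p - q) \<in> Lam" using add l that by blast
      ultimately show "S \<in> ?C q"
        unfolding orbit_def by (intro image_eqI[where x = "l + (p - q)"]) simp_all
    qed
    from this[OF that] this[of y x] neg[OF that that] show ?thesis by auto
  qed
  define w :: "real^3" where "w = vector [-1, 1, 0]"
  have w: "w \<in> int_points" "coord_sum w = 0"
    using ip[of "-1" 1 0] by (auto simp: w_def coord_sum_def)
  have "v 4 - w = of_int 1 *\<^sub>R vector [3, -3, 0] + of_int 1 *\<^sub>R vector [-2, -2, 4]"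
    by (simp add: v_def w_def vec_eq_iff forall_3)
  then have "v 4 - w \<in> Lam" unfolding Lam_def by blast
  then have v4: "?C (v 4) = ?C w" by (rule orb_eq)
  have two: "r34 ` r34 ` \<phi> (?C (v 0)) = \<phi> (?C w)"
  proof -
    have "vector [-1, 1, 0] + v 0 = w" by (simp add: v_def w_def vec_eq_iff forall_3)
    then show ?thesis
      using a mem[OF vi vs, of 0] by (simp add: corresponds_def ind image_comp)
  qed
  have inj: "inj r34"
  proof (rule inj_on_inverseI)
    fix x :: "real^5"
    show "rot 3 4 (- pi / 3) (r34 x) = x"
      by (simp add: vec_eq_iff r34_def rot_def algebra_simps cos_60 s60)
  qed
  have "r34 ` r34 ` r34 ` r34 ` \<phi> (?C (v 0)) = r34 ` r34 ` \<phi> (?C (v 0))"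
  proof -
    have "r34 ` r34 ` r34 ` r34 ` X = ?g ` ?g ` ?g ` ?g ` X" for X
      unfolding image_image c34 ..
    from this[of "\<phi> (?C (v 0))"] show ?thesis using four two v4 by metis
  qed
  then have "\<phi> (?C w) = \<phi> (?C (v 0))"
    using two by (metis inj inj_image_eq_iff)
  moreover have "inj_on \<phi> (torus_complex k)"
    using cct by (auto simp: is_cct_def bij_betw_def)
  ultimately have "?C w = ?C (v 0)"
    using mem w vi vs by (meson inj_onD)
  moreover have "(0::real^3) \<in> Lam"
    unfolding Lam_def by (auto intro!: exI[of _ 0])
  ultimately have "{0 + w} \<in> ?C (v 0)"
    unfolding orbit_def by blast
  then obtain c d where
    "w = of_int c *\<^sub>R vector [3, -3, 0] + of_int d *\<^sub>R vector [-2, -2, 4] + v 0"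
    by (auto simp: orbit_def Lam_def)
  then have "4 * real_of_int d = 0" "3 * real_of_int c - 2 * real_of_int d = - 1"
    by (auto simp: v_def w_def vec_eq_iff forall_3)
  then have "3 * c = - 1" by linarith
  then show False by presburger
qed

section \<open>Transversal and ideal CCTs\<close>

definition S3eq :: "(real^5) set" where
  "S3eq = {x \<in> sphere 0 1. x $ 5 = 0}"

definition Clif :: "real \<Rightarrow> (real^5) set" where
  "Clif l = {x \<in> S3eq. (x $ 1)\<^sup>2 + (x $ 2)\<^sup>2 = 1 - l / 2 \<and> (x $ 3)\<^sup>2 + (x $ 4)\<^sup>2 = l / 2}"

definition part12 :: "real^5 \<Rightarrow> real^5" where
  "part12 y = (\<chi> i. if i = 1 \<or> i = 2 then y $ i else 0)"

definition part34 :: "real^5 \<Rightarrow> real^5" where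
  "part34 y = (\<chi> i. if i = 3 \<or> i = 4 then y $ i else 0)"

definition proj1 :: "real^5 \<Rightarrow> real^5" where
  "proj1 y = part12 y /\<^sub>R (sqrt 2 * norm (part12 y)) + part34 y /\<^sub>R (sqrt 2 * norm (part34 y))"

definition proj0 :: "real^5 \<Rightarrow> real^5" where
  "proj0 y = part12 y /\<^sub>R norm (part12 y)"

definition transversal2 :: "(real^5) set set \<Rightarrow> labelling \<Rightarrow> bool" where
  "transversal2 T \<phi> \<longleftrightarrow> symmetric_cct 2 T \<phi> \<and>
     \<Union>T \<subseteq> S3eq - (Clif 0 \<union> Clif 2) \<and> inj_on proj1 (\<Union>T)"

definition transversal :: "nat \<Rightarrow> (real^5) set set \<Rightarrow> labelling \<Rightarrow> bool" where
  "transversal k T \<phi> \<longleftrightarrow> symmetric_cct k T \<phi> \<and>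
     (\<forall>i. 1 \<le> i \<and> i + 1 \<le> k \<longrightarrow>
        transversal2 (restr T \<phi> {i - 1, i, i + 1}) (shift_lab (i - 1) \<phi>))"

text \<open>Angle at \<open>m\<close> between the great-circle segments \<open>[m,a]\<close> and \<open>[m,b]\<close> of the unit sphere:
  the angle between the tangential components of \<open>a\<close> and \<open>b\<close> at \<open>m\<close>.\<close>

definition tangent_at :: "real^5 \<Rightarrow> real^5 \<Rightarrow> real^5" where
  "tangent_at m a = a - (a \<bullet> m) *\<^sub>R m"

definition sph_angle :: "real^5 \<Rightarrow> real^5 \<Rightarrow> real^5 \<Rightarrow> real" where
  "sph_angle m a b =
     arccos ((tangent_at m a \<bullet> tangent_at m b) / (norm (tangent_at m a) * norm (tangent_at m b)))"

definition slope_at :: "(real^5) set set \<Rightarrow> real^5 \<Rightarrow> real" where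
  "slope_at T s =
     (let t = (r34 \<circ> r34) s;
          u = (THE u. adjacent T s u \<and> adjacent T u t);
          m = (s + t) /\<^sub>R norm (s + t)
      in sph_angle m (proj0 m) u)"

text \<open>The choice of the layer-2 vertex is immaterial: the symmetries act transitively on each layer
  and preserve \<^const>\<open>slope_at\<close>.\<close>

definition slope :: "(real^5) set set \<Rightarrow> labelling \<Rightarrow> real" where
  "slope T \<phi> = slope_at T (SOME s. s \<in> layer \<phi> 2)"

definition ideal_cct :: "nat \<Rightarrow> (real^5) set set \<Rightarrow> labelling \<Rightarrow> bool" where
  "ideal_cct k T \<phi> \<longleftrightarrow> 2 \<le> k \<and> transversal k T \<phi> \<and>
     pi / 2 < slope (restr T \<phi> {k - 2, k - 1, k}) (shift_lab (k - 2) \<phi>) \<and>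
     (\<exists>K \<in> components (S3eq - \<Union>T). Clif 0 \<subseteq> K \<and> closure K \<inter> layer \<phi> k \<noteq> {})"

end

theory Submission
  imports Defs
begin

text \<open>By symmetry a transversal CCT is determined by one vertex per layer. In complex coordinates
  \<open>(z, u)\<close> of \<open>\<real>\<^sup>4\<close>, scaled so that the vertices have \<open>u\<close> a sixth root of unity, the vertex in
  layer \<open>n\<close> is \<open>z = i^v\<^sub>3 \<eta>\<^sub>n\<close>, and planarity of the two kinds of squares forces
  \<open>\<eta>\<^sub>n = w\<^sub>n + i w\<^sub>n\<^sub>+\<^sub>1\<close> (in a suitable frame) for a real sequence with
  \<open>w\<^sub>n\<^sub>+\<^sub>2 = 2 w\<^sub>n\<^sub>+\<^sub>1 + b (2 w\<^sub>n\<^sub>+\<^sub>1 - w\<^sub>n)\<close>, \<open>b > 0\<close>. Transversality gives \<open>w\<^sub>n > 0\<close> for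
  \<open>n \<ge> 1\<close> and \<open>w\<^sub>n w\<^sub>n\<^sub>+\<^sub>2 < w\<^sub>n\<^sub>+\<^sub>1\<^sup>2\<close>.

  If \<open>w\<^sub>0 < 2 w\<^sub>1\<close>, the sequence grows, \<open>b\<close> does not depend on \<open>n\<close>, and continuing the recurrence
  for ever gives convex cubes that fit together to an ideal CCT of every width; the first new layer
  is the extension. If \<open>w\<^sub>0 \<ge> 2 w\<^sub>1\<close>, the sequence shrinks, so layer \<open>k \<ge> 3\<close> lies on the far side of
  the torus formed by layers 0 to 2. This torus is a radial graph, hence it separates layer \<open>k\<close> from
  the component of \<open>\<C>\<^sub>0\<close>, and the CCT is not ideal.\<close>

section \<open>Finitely generated cones and their faces\<close>

text \<open>All convex geometry is done with cones over the spherical cells and with linear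
  functionals, so that a vertex matters only up to a positive factor; this is what allows the
  scaling of \<open>u\<close>. The suitable frame exists because planarity of a square in direction
  3 and one other direction makes the gaps \<open>H l - \<i> * H (l + 1)\<close> positive multiples
  of one another: divided by their common direction they become real, so the imaginary part of one
  layer is the real part of the next, and one real sequence remains.

  That the cubes fit together is a statement about face lattices and intersections. The lattice of a
  cell is read off from crossing diagonals; intersections are reduced to the disjointness of open
  cells, checked in half-planes where cubes become trapezoids. The factor \<open>b\<close> of a
  given CCT might change with the layer; two overlapping recurrences agree as soon as
  \<open>2 * w (l + 1) - w l\<close> is nonzero, which growth guarantees. In the shrinking case the
  separation comes from two explicit closed sets that cover the sphere and meet only in the
  torus.\<close>

definition cspan :: "('i \<Rightarrow> real^5) \<Rightarrow> 'i set \<Rightarrow> (real^5) set" where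
  "cspan p A = {(\<Sum>i\<in>A. c i *\<^sub>R p i) | c. \<forall>i\<in>A. 0 \<le> c i}"

text \<open>Strictly positive weights on every generator give the relative interior of the cone,
  also when the generators are dependent. Open cells are compared in this form.\<close>

definition ocone :: "('i \<Rightarrow> real^5) \<Rightarrow> 'i set \<Rightarrow> (real^5) set" where
  "ocone p A = {(\<Sum>i\<in>A. c i *\<^sub>R p i) | c. \<forall>i\<in>A. 0 < c i}"

lemma cspanI: "(\<And>i. i \<in> A \<Longrightarrow> 0 \<le> c i) \<Longrightarrow> (\<Sum>i\<in>A. c i *\<^sub>R p i) \<in> cspan p A"
  unfolding cspan_def by blast

lemma ocone_subset_cspan: "ocone p A \<subseteq> cspan p A"
  unfolding cspan_def ocone_def using less_imp_le by blast

lemma cspan_add: "x \<in> cspan p A \<Longrightarrow> y \<in> cspan p A \<Longrightarrow> x + y \<in> cspan p A"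
proof -
  assume "x \<in> cspan p A" "y \<in> cspan p A"
  then obtain c d where "x = (\<Sum>i\<in>A. c i *\<^sub>R p i)" "y = (\<Sum>i\<in>A. d i *\<^sub>R p i)"
    "\<forall>i\<in>A. 0 \<le> c i" "\<forall>i\<in>A. 0 \<le> d i"
    by (auto simp: cspan_def)
  then show ?thesis
    by (auto simp: cspan_def sum.distrib scaleR_add_left intro!: exI[of _ "\<lambda>i. c i + d i"])
qed

lemma cspan_scale:
  assumes "x \<in> cspan p A" "0 \<le> r"
  shows "r *\<^sub>R x \<in> cspan p A"
proof -
  obtain c where "x = (\<Sum>i\<in>A. c i *\<^sub>R p i)" "\<forall>i\<in>A. 0 \<le> c i"
    using assms(1) by (auto simp: cspan_def)
  with assms(2) show ?thesis
    by (auto simp: cspan_def scaleR_sum_right intro!: exI[of _ "\<lambda>i. r * c i"])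
qed

lemma ocone_scale:
  assumes "x \<in> ocone p A" "0 < r"
  shows "r *\<^sub>R x \<in> ocone p A"
proof -
  obtain c where "x = (\<Sum>i\<in>A. c i *\<^sub>R p i)" "\<forall>i\<in>A. 0 < c i"
    using assms(1) by (auto simp: ocone_def)
  with assms(2) show ?thesis
    by (auto simp: ocone_def scaleR_sum_right intro!: exI[of _ "\<lambda>i. r * c i"])
qed

lemma cspan_gen: "finite A \<Longrightarrow> i \<in> A \<Longrightarrow> p i \<in> cspan p A"
  unfolding cspan_def
  by (auto intro!: exI[of _ "\<lambda>j. if j = i then 1 else 0"] simp: if_distrib[of "\<lambda>c. c *\<^sub>R _"] cong: if_cong)

lemma cspan_mono:
  assumes "B \<subseteq> A" "finite A"
  shows "cspan p B \<subseteq> cspan p A"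
proof
  fix x assume "x \<in> cspan p B"
  then obtain c where c: "x = (\<Sum>i\<in>B. c i *\<^sub>R p i)" "\<forall>i\<in>B. 0 \<le> c i"
    by (auto simp: cspan_def)
  have "x = (\<Sum>i\<in>A. (if i \<in> B then c i else 0) *\<^sub>R p i)"
    unfolding c(1) using assms by (intro sum.mono_neutral_cong_left) auto
  then show "x \<in> cspan p A"
    using c(2) by (auto simp: cspan_def intro!: exI[of _ "\<lambda>i. if i \<in> B then c i else 0"])
qed

lemma cspan_empty [simp]: "cspan p {} = {0}"
  by (auto simp: cspan_def)

lemma convex_cone_hull_image:
  assumes "finite A"
  shows "convex_cone hull (p ` A) = cspan p A"
proof
  have "convex_cone (cspan p A)"
    unfolding convex_cone_iff using cspan_add cspan_scale cspanI[of A "\<lambda>_. 0" p] by auto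
  then show "convex_cone hull (p ` A) \<subseteq> cspan p A"
    using cspan_gen[OF assms] by (intro hull_minimal) auto
  have "(\<Sum>i\<in>B. c i *\<^sub>R p i) \<in> convex_cone hull (p ` A)" if "B \<subseteq> A" "\<forall>i\<in>A. 0 \<le> c i" for B c
    using finite_subset[OF that(1) assms] that
  proof (induction B rule: finite_induct)
    case (insert x F)
    then have "p x \<in> convex_cone hull (p ` A)"
      by (auto intro: hull_inc)
    then have "c x *\<^sub>R p x \<in> convex_cone hull (p ` A)"
      using insert.prems by (intro convex_cone_hull_mul) auto
    then show ?case
      using insert by (auto intro: convex_cone_hull_add)
  qed (auto simp: convex_cone_hull_contains_0)
  then show "cspan p A \<subseteq> convex_cone hull (p ` A)"
    by (auto simp: cspan_def)
qed

lemma sph_hull_image: "finite A \<Longrightarrow> sph_hull (p ` A) = cspan p A \<inter> sphere 0 1"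
  by (simp add: sph_hull_def convex_cone_hull_image)

lemma sph_hull_empty [simp]: "sph_hull {} = {}"
  by (auto simp: sph_hull_def)

lemma inner_sum_scale: "a \<bullet> (\<Sum>i\<in>A. c i *\<^sub>R p i) = (\<Sum>i\<in>A. c i * (a \<bullet> p i))"
  by (simp add: inner_sum_right)

lemma inner_cspan_nonneg:
  "x \<in> cspan p A \<Longrightarrow> (\<And>i. i \<in> A \<Longrightarrow> 0 \<le> a \<bullet> p i) \<Longrightarrow> 0 \<le> a \<bullet> x"
  by (auto simp: cspan_def inner_sum_scale intro!: sum_nonneg)

lemma inner_ocone_zero_iff:
  assumes "x \<in> ocone p A" "finite A" "\<And>i. i \<in> A \<Longrightarrow> 0 \<le> a \<bullet> p i"
  shows "a \<bullet> x = 0 \<longleftrightarrow> (\<forall>i\<in>A. a \<bullet> p i = 0)"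
proof -
  obtain c where c: "x = (\<Sum>i\<in>A. c i *\<^sub>R p i)" "\<forall>i\<in>A. 0 < c i"
    using assms(1) by (auto simp: ocone_def)
  show ?thesis
    unfolding c(1) inner_sum_scale using c(2) assms(2,3)
    by (subst sum_nonneg_eq_0_iff) (auto simp: less_imp_le, metis less_irrefl)
qed

lemma inner_ocone_nonneg:
  "x \<in> ocone p A \<Longrightarrow> (\<And>i. i \<in> A \<Longrightarrow> 0 \<le> a \<bullet> p i) \<Longrightarrow> 0 \<le> a \<bullet> x"
  using inner_cspan_nonneg ocone_subset_cspan by blast

text \<open>If \<open>a\<close> vanishes on a combination whose terms
  \<open>c i * (a \<bullet> p i)\<close> are all nonnegative, each term vanishes, so only generators
  in the kernel of \<open>a\<close> carry weight.\<close>

lemma cspan_face: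
  assumes "finite A" "\<And>i. i \<in> A \<Longrightarrow> 0 \<le> a \<bullet> p i"
  shows "cspan p A \<inter> {x. a \<bullet> x = 0} = cspan p {i \<in> A. a \<bullet> p i = 0}"
proof
  show "cspan p {i \<in> A. a \<bullet> p i = 0} \<subseteq> cspan p A \<inter> {x. a \<bullet> x = 0}"
    using cspan_mono[of "{i \<in> A. a \<bullet> p i = 0}" A p] assms(1)
    by (auto simp: cspan_def inner_sum_scale)
  show "cspan p A \<inter> {x. a \<bullet> x = 0} \<subseteq> cspan p {i \<in> A. a \<bullet> p i = 0}"
  proof
    fix x assume x: "x \<in> cspan p A \<inter> {x. a \<bullet> x = 0}"
    then obtain c where c: "x = (\<Sum>i\<in>A. c i *\<^sub>R p i)" "\<forall>i\<in>A. 0 \<le> c i"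
      by (auto simp: cspan_def)
    have "(\<Sum>i\<in>A. c i * (a \<bullet> p i)) = 0"
      using x c(1) by (simp add: inner_sum_scale)
    then have z: "\<forall>i\<in>A. c i * (a \<bullet> p i) = 0"
      using assms c(2) by (subst (asm) sum_nonneg_eq_0_iff) auto
    have "x = (\<Sum>i\<in>{i \<in> A. a \<bullet> p i = 0}. c i *\<^sub>R p i)"
      unfolding c(1) using assms(1) z by (intro sum.mono_neutral_right) auto
    then show "x \<in> cspan p {i \<in> A. a \<bullet> p i = 0}"
      using c(2) by (auto simp: cspan_def)
  qed
qed

lemma sph_hull_face:
  assumes "finite A" "\<And>i. i \<in> A \<Longrightarrow> 0 \<le> a \<bullet> p i"
  shows "{x \<in> sph_hull (p ` A). a \<bullet> x = 0} = sph_hull (p ` {i \<in> A. a \<bullet> p i = 0})"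
  using cspan_face[of A a p] assms by (auto simp: sph_hull_image)

lemma unit_mem_sph_hull:
  assumes "finite A" "x \<in> cspan p A" "x \<noteq> 0"
  shows "x /\<^sub>R norm x \<in> sph_hull (p ` A)"
  using assms cspan_scale[of x p A "inverse (norm x)"] by (auto simp: sph_hull_image)

text \<open>Turns the faces of a cell into zero sets of functionals on finitely many labelled
  generators, which makes the face lattice a combinatorial matter.\<close>

lemma sph_face_of_sph_hull_iff:
  assumes "finite A" "\<And>i. i \<in> A \<Longrightarrow> p i \<noteq> 0"
  shows "F sph_face_of sph_hull (p ` A) \<longleftrightarrow>
    (\<exists>a. (\<forall>i\<in>A. 0 \<le> a \<bullet> p i) \<and> F = sph_hull (p ` {i \<in> A. a \<bullet> p i = 0}))"
proof -
  have "(\<forall>x\<in>sph_hull (p ` A). 0 \<le> a \<bullet> x) \<longleftrightarrow> (\<forall>i\<in>A. 0 \<le> a \<bullet> p i)" for a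
  proof
    assume L: "\<forall>x\<in>sph_hull (p ` A). 0 \<le> a \<bullet> x"
    show "\<forall>i\<in>A. 0 \<le> a \<bullet> p i"
    proof
      fix i assume i: "i \<in> A"
      then have "0 \<le> a \<bullet> (p i /\<^sub>R norm (p i))"
        using L assms cspan_gen unit_mem_sph_hull by metis
      then show "0 \<le> a \<bullet> p i"
        using assms(2)[OF i] by (simp add: zero_le_mult_iff)
    qed
  qed (auto simp: sph_hull_image assms(1) intro: inner_cspan_nonneg)
  then show ?thesis
    unfolding sph_face_of_def using sph_hull_face[OF assms(1)] by (metis (no_types, lifting))
qed

text \<open>\<open>sph_polytope\<close> asks for unit generators; normalising \<open>p i\<close>
  multiplies it by a positive factor and leaves the cone unchanged.\<close>

lemma sph_polytope_image:
  assumes "finite A" "\<And>i. i \<in> A \<Longrightarrow> 0 < a \<bullet> p i"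
  shows "sph_polytope (sph_hull (p ` A))"
proof -
  let ?q = "\<lambda>i. p i /\<^sub>R norm (p i)"
  have nz: "p i \<noteq> 0" if "i \<in> A" for i
    using assms(2)[OF that] by auto
  have "cspan ?q A = cspan p A"
  proof -
    have "p i \<in> cspan ?q A" if "i \<in> A" for i
      using cspan_scale[OF cspan_gen[of A i ?q], of "norm (p i)"] assms nz that by simp
    moreover have "?q i \<in> cspan p A" if "i \<in> A" for i
      using cspan_scale[OF cspan_gen[of A i p], of "inverse (norm (p i))"] assms that by simp
    ultimately have "convex_cone hull (p ` A) = convex_cone hull (?q ` A)"
      using assms(1) by (intro subset_antisym hull_minimal)
        (auto simp: convex_cone_hull_image[symmetric] convex_cone_convex_cone_hull)
    then show ?thesis
      using assms(1) by (simp add: convex_cone_hull_image)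
  qed
  then have "sph_hull (p ` A) = sph_hull (?q ` A)"
    using assms(1) by (simp add: sph_hull_image)
  moreover have "?q ` A \<subseteq> sphere 0 1" "\<forall>v\<in>?q ` A. 0 < a \<bullet> v"
    using nz assms(2) by (auto simp: zero_less_mult_iff)
  ultimately show ?thesis
    unfolding sph_polytope_def using assms(1) by blast
qed


section \<open>Combinatorial cubes\<close>

text \<open>A vertex of a cube is encoded by the set of directions that lead to it from the base
  vertex; \<open>ivl A B\<close> is then the vertex set of the face with base vertex
  \<open>A\<close> and directions \<open>B - A\<close>.\<close>

definition ivl :: "'a set \<Rightarrow> 'a set \<Rightarrow> 'a set set" where
  "ivl A B = {S. A \<subseteq> S \<and> S \<subseteq> B}"

definition subcubes :: "'a set \<Rightarrow> 'a set set set" where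
  "subcubes I = {W. W = {} \<or> (\<exists>A B. A \<subseteq> B \<and> B \<subseteq> I \<and> W = ivl A B)}"

lemma ivl_empty: "ivl {} I = Pow I"
  by (auto simp: ivl_def)

lemma finite_ivl [simp]: "finite (ivl A (B :: 'a::finite set))"
  by (rule finite_subset[OF subset_UNIV]) simp

lemma subcubes_Pow: "W \<in> subcubes I \<Longrightarrow> W \<subseteq> Pow I"
  by (auto simp: subcubes_def ivl_def)

text \<open>Closure under order intervals puts \<open>Inf W\<close> and \<open>Sup W\<close> into
  the finite family \<open>W\<close>, and then everything between these two.\<close>

lemma subcubes_of_convex:
  fixes W :: "'a::finite set set"
  assumes "W \<subseteq> Pow I"
    and "\<And>S S' S''. S \<in> W \<Longrightarrow> S' \<in> W \<Longrightarrow> S \<inter> S' \<subseteq> S'' \<Longrightarrow> S'' \<subseteq> S \<union> S' \<Longrightarrow> S'' \<in> W"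
  shows "W \<in> subcubes I"
proof (cases "W = {}")
  case False
  have i: "Inf W \<in> W"
    using assms(2)[OF _ _ order_refl] by (intro finite_Inf_in False) auto
  have s: "Sup W \<in> W"
    using assms(2)[OF _ _ _ order_refl] by (intro finite_Sup_in False) auto
  have "S \<in> W" if "Inf W \<subseteq> S" "S \<subseteq> Sup W" for S
    by (rule assms(2)[OF i s]) (use that in blast)+
  then have "W = ivl (Inf W) (Sup W)"
    unfolding ivl_def by blast
  moreover have "Inf W \<subseteq> Sup W" "Sup W \<subseteq> I"
    using i s assms(1) by (blast, blast)
  ultimately show ?thesis
    unfolding subcubes_def by blast
qed (simp add: subcubes_def)

text \<open>Pairs of diagonals \<open>{S, S'}\<close> and \<open>{T, T'}\<close> of the six squares and of two of the diagonal
  rectangles of the 3-cube. In the realisations below the diagonals of these quadrilaterals cross,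
  and this alone determines the face lattice.\<close>

definition rects :: "(3 set \<times> 3 set \<times> 3 set \<times> 3 set) set" where
  "rects = {({}, {1,2}, {1}, {2}), ({3}, {1,2,3}, {1,3}, {2,3}),
            ({}, {1,3}, {1}, {3}), ({}, {2,3}, {2}, {3}),
            ({1}, {1,2,3}, {1,2}, {1,3}), ({2}, {1,2,3}, {1,2}, {2,3}),
            ({}, {1,2,3}, {3}, {1,2}), ({1}, {2,3}, {2}, {1,3})}"

text \<open>The shape of the zero set of a functional that is nonnegative on the vertices: where two
  diagonals cross, it vanishes at both ends of one exactly when it vanishes at both ends of the
  other.\<close>

definition rect_closed :: "3 set set \<Rightarrow> bool" where
  "rect_closed W \<longleftrightarrow> (\<forall>(S, S', T, T')\<in>rects. S \<in> W \<and> S' \<in> W \<longleftrightarrow> T \<in> W \<and> T' \<in> W)"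

lemma rects_Un: "(S, S', T, T') \<in> rects \<Longrightarrow> S \<union> S' = T \<union> T'"
  unfolding rects_def by (elim insertE) auto

lemma rects_distinct: "(S, S', T, T') \<in> rects \<Longrightarrow> distinct [S, S', T, T']"
proof -
  have ne: "X \<noteq> Y" if "(1 \<in> X) \<noteq> (1 \<in> Y) \<or> (2 \<in> X) \<noteq> (2 \<in> Y) \<or> (3 \<in> X) \<noteq> (3 \<in> Y)" for X Y :: "3 set"
    using that by blast
  have "\<forall>(S, S', T, T')\<in>rects. distinct [S, S', T, T']"
    unfolding rects_def ball_simps split distinct.simps list.set by (intro conjI) (simp_all add: ne)
  then show "(S, S', T, T') \<in> rects \<Longrightarrow> distinct [S, S', T, T']"
    by blast
qed

text \<open>Every pair of antipodal vertices is a diagonal of one of the last two rectangles. Hence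
  one antipodal pair forces a second, and the squares then force all eight vertices. Eight Boolean
  values make this a finite check.\<close>

lemma bool_cube_convex:
  fixes f :: "bool \<Rightarrow> bool \<Rightarrow> bool \<Rightarrow> bool"
  assumes r: "(f False False False \<and> f True True False) = (f True False False \<and> f False True False)"
      "(f False False True \<and> f True True True) = (f True False True \<and> f False True True)"
      "(f False False False \<and> f True False True) = (f True False False \<and> f False False True)"
      "(f False False False \<and> f False True True) = (f False True False \<and> f False False True)"
      "(f True False False \<and> f True True True) = (f True True False \<and> f True False True)"
      "(f False True False \<and> f True True True) = (f True True False \<and> f False True True)"
      "(f False False False \<and> f True True True) = (f False False True \<and> f True True False)"
      "(f True False False \<and> f False True True) = (f False True False \<and> f True False True)"
    and h: "f x y z" "f x' y' z'" "x = x' \<Longrightarrow> x'' = x" "y = y' \<Longrightarrow> y'' = y" "z = z' \<Longrightarrow> z'' = z"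
  shows "f x'' y'' z''"
  using h
  apply (cases x; cases x'; cases y; cases y'; cases z; cases z')
  apply (simp_all only: simp_thms)
  using r apply -
  by (cases x''; cases y''; cases z''; (simp only: simp_thms)?; argo)+

lemma rect_closed_convex:
  assumes "rect_closed W" "S \<in> W" "S' \<in> W" "S \<inter> S' \<subseteq> S''" "S'' \<subseteq> S \<union> S'"
  shows "S'' \<in> W"
proof -
  define m :: "bool \<Rightarrow> bool \<Rightarrow> bool \<Rightarrow> 3 set" where
    "m x y z = (if x then insert 1 else id) ((if y then insert 2 else id) (if z then {3} else {}))" for x y z
  have m: "m (1 \<in> T) (2 \<in> T) (3 \<in> T) = T" for T
    by (simp add: m_def set_eq_iff forall_3)
  have "m (1 \<in> S'') (2 \<in> S'') (3 \<in> S'') \<in> W"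
  proof (rule bool_cube_convex[where f = "\<lambda>x y z. m x y z \<in> W"])
    show "m (1 \<in> S) (2 \<in> S) (3 \<in> S) \<in> W" "m (1 \<in> S') (2 \<in> S') (3 \<in> S') \<in> W"
      using assms(2,3) by (simp_all only: m)
  next
    show "(1 \<in> S) = (1 \<in> S') \<Longrightarrow> (1 \<in> S'') = (1 \<in> S)"
      "(2 \<in> S) = (2 \<in> S') \<Longrightarrow> (2 \<in> S'') = (2 \<in> S)"
      "(3 \<in> S) = (3 \<in> S') \<Longrightarrow> (3 \<in> S'') = (3 \<in> S)"
      using assms(4,5) by blast+
  qed (use assms(1) in \<open>simp_all add: rect_closed_def rects_def m_def\<close>)
  then show ?thesis by (simp only: m)
qed

lemma rect_closed_subcubes:
  assumes "rect_closed W" "W \<subseteq> Pow I"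
  shows "W \<in> subcubes I"
  using assms rect_closed_convex by (intro subcubes_of_convex) blast+

text \<open>Hypotheses on eight labelled vectors that make their cone a cone over a cube: the
  supporting functionals of the six facets show that every subcube is a face, the crossing diagonals
  show that nothing else is.\<close>

definition cube_config :: "(3 set \<Rightarrow> real^5) \<Rightarrow> bool" where
  "cube_config p \<longleftrightarrow> (\<exists>a. \<forall>S. 0 < a \<bullet> p S) \<and>
     (\<forall>i. \<exists>a. \<forall>S. 0 \<le> a \<bullet> p S \<and> (a \<bullet> p S = 0 \<longleftrightarrow> i \<notin> S)) \<and>
     (\<forall>i. \<exists>a. \<forall>S. 0 \<le> a \<bullet> p S \<and> (a \<bullet> p S = 0 \<longleftrightarrow> i \<in> S)) \<and>
     (\<forall>(S, S', T, T')\<in>rects. \<exists>\<alpha> \<beta> \<gamma> \<delta>. 0 < \<alpha> \<and> 0 < \<beta> \<and> 0 < \<gamma> \<and> 0 < \<delta> \<and>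
        \<alpha> *\<^sub>R p S + \<beta> *\<^sub>R p S' = \<gamma> *\<^sub>R p T + \<delta> *\<^sub>R p T')"

lemma cube_config_nz: "cube_config p \<Longrightarrow> p S \<noteq> 0"
  unfolding cube_config_def by (metis inner_zero_right less_irrefl)

lemma cube_config_pointed: "cube_config p \<Longrightarrow> \<exists>a. \<forall>S. 0 < a \<bullet> p S"
  and cube_config_facet0: "cube_config p \<Longrightarrow> \<forall>i. \<exists>a. \<forall>S. 0 \<le> a \<bullet> p S \<and> (a \<bullet> p S = 0 \<longleftrightarrow> i \<notin> S)"
  and cube_config_facet1: "cube_config p \<Longrightarrow> \<forall>i. \<exists>a. \<forall>S. 0 \<le> a \<bullet> p S \<and> (a \<bullet> p S = 0 \<longleftrightarrow> i \<in> S)"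
  unfolding cube_config_def by (elim conjE, assumption)+

lemma cube_config_rect:
  assumes "cube_config p" "(S, S', T, T') \<in> rects"
  obtains \<alpha> \<beta> \<gamma> \<delta> where "0 < \<alpha>" "0 < \<beta>" "0 < \<gamma>" "0 < \<delta>"
    "\<alpha> *\<^sub>R p S + \<beta> *\<^sub>R p S' = \<gamma> *\<^sub>R p T + \<delta> *\<^sub>R p T'"
proof -
  have "\<forall>(S, S', T, T')\<in>rects. \<exists>\<alpha> \<beta> \<gamma> \<delta>. 0 < \<alpha> \<and> 0 < \<beta> \<and> 0 < \<gamma> \<and> 0 < \<delta> \<and>
        \<alpha> *\<^sub>R p S + \<beta> *\<^sub>R p S' = \<gamma> *\<^sub>R p T + \<delta> *\<^sub>R p T'"
    using assms(1) unfolding cube_config_def by (elim conjE)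
  from bspec[OF this assms(2)] show ?thesis
    using that by auto
qed

text \<open>The sum of the functionals of the facets through a face vanishes exactly on the
  intersection of these facets.\<close>

lemma cube_config_exposed:
  assumes "cube_config p"
  obtains a where "\<And>S. 0 \<le> a \<bullet> p S" "\<And>S. a \<bullet> p S = 0 \<longleftrightarrow> S \<in> ivl A B"
proof -
  obtain f where f: "\<And>i S. 0 \<le> f i \<bullet> p S" "\<And>i S. f i \<bullet> p S = 0 \<longleftrightarrow> i \<notin> S"
    using choice[OF cube_config_facet0[OF assms]] by blast
  obtain g where g: "\<And>i S. 0 \<le> g i \<bullet> p S" "\<And>i S. g i \<bullet> p S = 0 \<longleftrightarrow> i \<in> S"
    using choice[OF cube_config_facet1[OF assms]] by blast
  let ?a = "(\<Sum>i\<in>A. g i) + (\<Sum>i\<in>-B. f i)"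
  have e: "?a \<bullet> p S = (\<Sum>i\<in>A. g i \<bullet> p S) + (\<Sum>i\<in>-B. f i \<bullet> p S)" for S
    by (simp add: inner_add_left inner_sum_left)
  have n: "0 \<le> (\<Sum>i\<in>A. g i \<bullet> p S)" "0 \<le> (\<Sum>i\<in>-B. f i \<bullet> p S)" for S
    using f g by (auto intro: sum_nonneg)
  have "?a \<bullet> p S = 0 \<longleftrightarrow> (\<forall>i\<in>A. g i \<bullet> p S = 0) \<and> (\<forall>i\<in>-B. f i \<bullet> p S = 0)" for S
    unfolding e add_nonneg_eq_0_iff[OF n] using f(1) g(1) by (simp add: sum_nonneg_eq_0_iff)
  then have "?a \<bullet> p S = 0 \<longleftrightarrow> S \<in> ivl A B" for S
    using f g by (auto simp: ivl_def)
  then show ?thesis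
    using n e that[of ?a] by simp
qed

lemma cube_config_exposed_subcube:
  assumes "cube_config p" "W \<in> subcubes I"
  obtains a where "\<And>S. 0 \<le> a \<bullet> p S" "\<And>S. a \<bullet> p S = 0 \<longleftrightarrow> S \<in> W"
proof (cases "W = {}")
  case True
  then show ?thesis
    using cube_config_pointed[OF assms(1)] that by (metis empty_iff less_imp_le less_irrefl)
next
  case False
  then obtain A B where "W = ivl A B"
    using assms(2) unfolding subcubes_def by blast
  then show ?thesis
    using cube_config_exposed[OF assms(1)] that by metis
qed

lemma cube_config_faces:
  assumes "cube_config p"
  shows "F sph_face_of sph_hull (p ` Pow I) \<longleftrightarrow> (\<exists>W\<in>subcubes I. F = sph_hull (p ` W))"
proof
  assume "F sph_face_of sph_hull (p ` Pow I)"
  then obtain a where a: "\<forall>S\<in>Pow I. 0 \<le> a \<bullet> p S"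
    and F: "F = sph_hull (p ` {S \<in> Pow I. a \<bullet> p S = 0})"
    using sph_face_of_sph_hull_iff[of "Pow I" p F] cube_config_nz[OF assms] by auto
  let ?W = "{S \<in> Pow I. a \<bullet> p S = 0}"
  have "rect_closed ?W"
    unfolding rect_closed_def
  proof clarify
    fix S S' T T' assume r: "(S, S', T, T') \<in> rects"
    obtain \<alpha> \<beta> \<gamma> \<delta> where pos: "0 < \<alpha>" "0 < \<beta>" "0 < \<gamma>" "0 < \<delta>"
      and rel: "\<alpha> *\<^sub>R p S + \<beta> *\<^sub>R p S' = \<gamma> *\<^sub>R p T + \<delta> *\<^sub>R p T'"
      using cube_config_rect[OF assms r] .
    have "\<alpha> * (a \<bullet> p S) + \<beta> * (a \<bullet> p S') = \<gamma> * (a \<bullet> p T) + \<delta> * (a \<bullet> p T')"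
      using arg_cong[OF rel, of "(\<bullet>) a"] by (simp add: inner_add_right)
    moreover have z: "u * x + v * y = 0 \<longleftrightarrow> x = 0 \<and> y = 0" if "0 < u" "0 < v" "0 \<le> x" "0 \<le> y" for u v x y :: real
      using that by (subst add_nonneg_eq_0_iff) auto
    moreover have "0 \<le> a \<bullet> p S" "0 \<le> a \<bullet> p S'" "0 \<le> a \<bullet> p T" "0 \<le> a \<bullet> p T'" if "S \<union> S' \<subseteq> I"
      using a that rects_Un[OF r] by auto
    ultimately have "a \<bullet> p S = 0 \<and> a \<bullet> p S' = 0 \<longleftrightarrow> a \<bullet> p T = 0 \<and> a \<bullet> p T' = 0" if "S \<union> S' \<subseteq> I"
      using pos that by metis
    then show "S \<in> ?W \<and> S' \<in> ?W \<longleftrightarrow> T \<in> ?W \<and> T' \<in> ?W"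
      using rects_Un[OF r] by auto
  qed
  then have "?W \<in> subcubes I"
    by (intro rect_closed_subcubes) auto
  then show "\<exists>W\<in>subcubes I. F = sph_hull (p ` W)"
    using F by blast
next
  assume "\<exists>W\<in>subcubes I. F = sph_hull (p ` W)"
  then obtain W where W: "W \<in> subcubes I" "F = sph_hull (p ` W)" by blast
  obtain a where a: "\<And>S. 0 \<le> a \<bullet> p S" "\<And>S. a \<bullet> p S = 0 \<longleftrightarrow> S \<in> W"
    using cube_config_exposed_subcube[OF assms W(1)] by blast
  have "W = {S \<in> Pow I. a \<bullet> p S = 0}"
    using a(2) subcubes_Pow[OF W(1)] by auto
  then show "F sph_face_of sph_hull (p ` Pow I)"
    using a(1) W(2) sph_face_of_sph_hull_iff[of "Pow I" p F] cube_config_nz[OF assms] by auto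
qed

lemma cube_config_vertex_in:
  assumes "cube_config p" "W \<in> subcubes I" "p S \<in> cspan p W"
  shows "S \<in> W"
proof -
  obtain a where a: "\<And>S. 0 \<le> a \<bullet> p S" "\<And>S. a \<bullet> p S = 0 \<longleftrightarrow> S \<in> W"
    using cube_config_exposed_subcube[OF assms(1,2)] by blast
  have "a \<bullet> x = 0" if "x \<in> cspan p W" for x
    using that a(2) by (auto simp: cspan_def inner_sum_scale intro!: sum.neutral)
  then show ?thesis
    using a(2) assms(3) by blast
qed

lemma cube_config_hull_subset_iff:
  assumes "cube_config p" "W \<in> subcubes I" "W' \<in> subcubes I"
  shows "sph_hull (p ` W) \<subseteq> sph_hull (p ` W') \<longleftrightarrow> W \<subseteq> W'"
proof
  assume L: "sph_hull (p ` W) \<subseteq> sph_hull (p ` W')"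
  show "W \<subseteq> W'"
  proof
    fix S assume S: "S \<in> W"
    have nz: "p S \<noteq> 0" by (rule cube_config_nz[OF assms(1)])
    then have "p S /\<^sub>R norm (p S) \<in> sph_hull (p ` W')"
      using S L unit_mem_sph_hull[OF _ cspan_gen[of W S p]] by auto
    then have "p S /\<^sub>R norm (p S) \<in> cspan p W'"
      by (simp add: sph_hull_image)
    then have "norm (p S) *\<^sub>R (p S /\<^sub>R norm (p S)) \<in> cspan p W'"
      by (rule cspan_scale) simp
    then show "S \<in> W'"
      using nz cube_config_vertex_in[OF assms(1,3)] by simp
  qed
next
  assume "W \<subseteq> W'"
  then show "sph_hull (p ` W) \<subseteq> sph_hull (p ` W')"
    using cspan_mono[of W W' p] by (auto simp: sph_hull_image)
qed

lemma cube_config_polytope: "cube_config p \<Longrightarrow> sph_polytope (sph_hull (p ` W))"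
  using cube_config_pointed sph_polytope_image[of W _ p] by fastforce

text \<open>Let \<open>X\<close> be the union of the supports of all representations of
  \<open>x\<close>. Averaging yields one representation that is positive on all of \<open>X\<close>,
  and a relation between crossing diagonals moves weight from either diagonal to the other, so
  \<open>X\<close> is \<open>rect_closed\<close> and hence a subcube.\<close>

lemma cube_config_ocone:
  assumes cc: "cube_config p" and x: "x \<in> cspan p (Pow I)" "x \<noteq> 0"
  obtains A B where "A \<subseteq> B" "B \<subseteq> I" "x \<in> ocone p (ivl A B)"
proof -
  define R where "R = {c. (\<forall>T. 0 \<le> c T) \<and> x = (\<Sum>T\<in>Pow I. c T *\<^sub>R p T)}"
  define X where "X = {S. S \<subseteq> I \<and> (\<exists>c\<in>R. 0 < c S)}"
  have mid: "(\<lambda>T. (c T + d T) / 2) \<in> R" if "c \<in> R" "d \<in> R" for c d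
  proof -
    have "(\<Sum>T\<in>Pow I. ((c T + d T) / 2) *\<^sub>R p T)
        = (1/2) *\<^sub>R ((\<Sum>T\<in>Pow I. c T *\<^sub>R p T) + (\<Sum>T\<in>Pow I. d T *\<^sub>R p T))"
      by (simp add: scaleR_sum_right sum.distrib[symmetric] scaleR_add_left[symmetric] add_divide_distrib)
    also have "\<dots> = x"
      using that by (simp add: R_def scaleR_half_double)
    finally show ?thesis
      using that by (simp add: R_def)
  qed
  have exch: "\<exists>c\<in>R. 0 < c T \<and> 0 < c T'"
    if d: "d \<in> R" "0 < d S" "0 < d S'" and I: "S \<subseteq> I" "S' \<subseteq> I" "T \<subseteq> I" "T' \<subseteq> I"
      and dist: "distinct [S, S', T, T']"
      and pos: "0 < \<alpha>" "0 < \<beta>" "0 < \<gamma>" "0 < \<delta>"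
      and rel: "\<alpha> *\<^sub>R p S + \<beta> *\<^sub>R p S' = \<gamma> *\<^sub>R p T + \<delta> *\<^sub>R p T'" for d S S' T T' \<alpha> \<beta> \<gamma> \<delta>
  proof -
    \<comment> \<open>The largest multiple of the relation that can be subtracted without making the
      weight at \<open>S\<close> or \<open>S'\<close> negative. One of these two may drop to zero;
      what counts is that \<open>T\<close> and \<open>T'\<close> gain.\<close>
    define t where "t = min (d S / \<alpha>) (d S' / \<beta>)"
    have t: "0 < t" "t * \<alpha> \<le> d S" "t * \<beta> \<le> d S'"
      using d pos by (auto simp: t_def min_def field_simps)
    define h where "h U = (if U = S then - (t * \<alpha>) else 0) + (if U = S' then - (t * \<beta>) else 0)
      + (if U = T then t * \<gamma> else 0) + (if U = T' then t * \<delta> else 0)" for U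
    have "(\<Sum>U\<in>Pow I. h U *\<^sub>R p U) =
        t *\<^sub>R (\<gamma> *\<^sub>R p T + \<delta> *\<^sub>R p T') - t *\<^sub>R (\<alpha> *\<^sub>R p S + \<beta> *\<^sub>R p S')"
      using I by (simp add: h_def scaleR_add_left sum.distrib if_distrib[of "\<lambda>c. c *\<^sub>R _"]
          scaleR_add_right cong: if_cong)
    then have "(\<Sum>U\<in>Pow I. h U *\<^sub>R p U) = 0"
      by (simp add: rel)
    then have "x = (\<Sum>U\<in>Pow I. (d U + h U) *\<^sub>R p U)"
      using d(1) by (simp add: R_def scaleR_add_left sum.distrib)
    moreover have "0 \<le> d U + h U" for U
    proof -
      have "0 \<le> d U" using d(1) by (simp add: R_def)
      then show ?thesis
        using t mult_pos_pos[OF t(1) pos(3)] mult_pos_pos[OF t(1) pos(4)] dist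
        by (cases "U = S"; cases "U = S'"; cases "U = T"; cases "U = T'") (simp_all add: h_def)
    qed
    ultimately have "(\<lambda>U. d U + h U) \<in> R"
      by (simp add: R_def)
    moreover have "h T = t * \<gamma>" "h T' = t * \<delta>" "0 \<le> d T" "0 \<le> d T'"
      using dist d(1) by (auto simp: h_def R_def)
    then have "0 < d T + h T" "0 < d T' + h T'"
      using t(1) pos by (simp_all add: add_nonneg_pos)
    ultimately show ?thesis by (intro bexI[of _ "\<lambda>U. d U + h U"] conjI)
  qed
  have both: "\<exists>d\<in>R. 0 < d S \<and> 0 < d S'" if SX: "S \<in> X" "S' \<in> X" for S S'
  proof -
    obtain c c' where c: "c \<in> R" "0 < c S" "c' \<in> R" "0 < c' S'"
      using SX by (auto simp: X_def)
    have "0 \<le> c' S" "0 \<le> c S'"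
      using c by (auto simp: R_def)
    then show ?thesis
      using mid[OF c(1,3)] c by (intro bexI[of _ "\<lambda>T. (c T + c' T) / 2"]) auto
  qed
  have "rect_closed X"
    unfolding rect_closed_def
  proof clarify
    fix S S' T T' assume r: "(S, S', T, T') \<in> rects"
    obtain \<alpha> \<beta> \<gamma> \<delta> where pos: "0 < \<alpha>" "0 < \<beta>" "0 < \<gamma>" "0 < \<delta>"
      and rel: "\<alpha> *\<^sub>R p S + \<beta> *\<^sub>R p S' = \<gamma> *\<^sub>R p T + \<delta> *\<^sub>R p T'"
      using cube_config_rect[OF cc r] .
    note D = rects_distinct[OF r]
    have D': "distinct [T, T', S, S']" using D by auto
    show "S \<in> X \<and> S' \<in> X \<longleftrightarrow> T \<in> X \<and> T' \<in> X"
    proof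
      assume a: "S \<in> X \<and> S' \<in> X"
      then obtain d where d: "d \<in> R" "0 < d S" "0 < d S'" using both by blast
      have I: "S \<subseteq> I" "S' \<subseteq> I" "T \<subseteq> I" "T' \<subseteq> I"
        using a rects_Un[OF r] by (auto simp: X_def)
      show "T \<in> X \<and> T' \<in> X"
        using exch[OF d I D pos rel] I by (auto simp: X_def)
    next
      assume a: "T \<in> X \<and> T' \<in> X"
      then obtain d where d: "d \<in> R" "0 < d T" "0 < d T'" using both by blast
      have I: "T \<subseteq> I" "T' \<subseteq> I" "S \<subseteq> I" "S' \<subseteq> I"
        using a rects_Un[OF r] by (auto simp: X_def)
      show "S \<in> X \<and> S' \<in> X"
        using exch[OF d I D' pos(3,4,1,2) rel[symmetric]] I by (auto simp: X_def)
    qed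
  qed
  then have X: "X \<in> subcubes I"
    by (intro rect_closed_subcubes) (auto simp: X_def)
  obtain c0 where c0: "c0 \<in> R"
  proof -
    obtain c where "x = (\<Sum>T\<in>Pow I. c T *\<^sub>R p T)" "\<forall>T\<in>Pow I. 0 \<le> c T"
      using x(1) by (auto simp: cspan_def)
    \<comment> \<open>\<open>R\<close> asks for nonnegative weights at all indices, so the
      unspecified ones outside \<open>Pow I\<close> are set to zero.\<close>
    then have "(\<lambda>T. if T \<in> Pow I then c T else 0) \<in> R"
      by (auto simp: R_def intro!: sum.cong)
    then show ?thesis using that by blast
  qed
  have "\<exists>c\<in>R. \<forall>S\<in>Y. 0 < c S" if "Y \<subseteq> X" for Y
    using finite[of Y] that
  proof (induction Y rule: finite_induct)
    case empty
    then show ?case using c0 by blast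
  next
    case (insert S Y)
    then obtain c where c: "c \<in> R" "\<forall>S\<in>Y. 0 < c S" by blast
    obtain d where d: "d \<in> R" "0 < d S" using insert.prems by (auto simp: X_def)
    have nn: "0 \<le> d T" "0 \<le> c T" for T
      using c d by (auto simp: R_def)
    have "\<forall>T\<in>insert S Y. 0 < (c T + d T) / 2"
      using c(2) d(2) nn by (auto intro: add_pos_nonneg add_nonneg_pos)
    with mid[OF c(1) d(1)] show ?case by (intro bexI[of _ "\<lambda>T. (c T + d T) / 2"])
  qed
  then obtain c where c: "c \<in> R" "\<forall>S\<in>X. 0 < c S" by blast
  have "x = (\<Sum>T\<in>X. c T *\<^sub>R p T)"
  proof -
    have "x = (\<Sum>T\<in>Pow I. c T *\<^sub>R p T)" using c by (simp add: R_def)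
    also have "\<dots> = (\<Sum>T\<in>X. c T *\<^sub>R p T)"
    proof (rule sum.mono_neutral_right)
      show "\<forall>T\<in>Pow I - X. c T *\<^sub>R p T = 0"
      proof
        fix T assume T: "T \<in> Pow I - X"
        have "0 \<le> c T" using c by (simp add: R_def)
        moreover have "\<not> 0 < c T" using T c(1) by (auto simp: X_def)
        ultimately show "c T *\<^sub>R p T = 0" by simp
      qed
    qed (auto simp: X_def)
    finally show ?thesis .
  qed
  then have o: "x \<in> ocone p X" using c(2) by (auto simp: ocone_def)
  moreover have "X \<noteq> {}"
    using o x(2) by (auto simp: ocone_def)
  ultimately show ?thesis
    using X that unfolding subcubes_def by blast
qed

text \<open>The faces of the first cell whose vertices lie in the second cone have a largest member:
  the sum of all their vertices lies in both cones, hence in the interior of a single such face, and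
  a functional exposing that face vanishes on every summand. This largest face is the
  intersection.\<close>

lemma cube_config_inter_face:
  assumes p: "cube_config p" and q: "cube_config q"
    and uniq: "\<And>A B A' B' x. A \<subseteq> B \<Longrightarrow> B \<subseteq> I \<Longrightarrow> A' \<subseteq> B' \<Longrightarrow> B' \<subseteq> J \<Longrightarrow>
      x \<in> ocone p (ivl A B) \<Longrightarrow> x \<in> ocone q (ivl A' B') \<Longrightarrow> p ` ivl A B = q ` ivl A' B'"
  shows "(sph_hull (p ` Pow I) \<inter> sph_hull (q ` Pow J)) sph_face_of sph_hull (p ` Pow I)"
proof -
  let ?P = "sph_hull (p ` Pow I)" and ?Q = "sph_hull (q ` Pow J)"
  define \<W> where "\<W> = {W \<in> subcubes I. W \<noteq> {} \<and> p ` W \<subseteq> cspan q (Pow J)}"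
  have common: "\<exists>W\<in>\<W>. x \<in> ocone p W" if x: "x \<in> cspan p (Pow I)" "x \<in> cspan q (Pow J)" "x \<noteq> 0" for x
  proof -
    obtain A B where AB: "A \<subseteq> B" "B \<subseteq> I" "x \<in> ocone p (ivl A B)"
      using cube_config_ocone[OF p x(1,3)] by blast
    obtain A' B' where AB': "A' \<subseteq> B'" "B' \<subseteq> J" "x \<in> ocone q (ivl A' B')"
      using cube_config_ocone[OF q x(2,3)] by blast
    have "p ` ivl A B = q ` ivl A' B'"
      using uniq AB AB' by blast
    moreover have "q ` ivl A' B' \<subseteq> cspan q (Pow J)"
      using AB'(2) by (auto simp: ivl_def intro!: cspan_gen)
    moreover have "A \<in> ivl A B" "ivl A B \<in> subcubes I"
      using AB by (auto simp: ivl_def subcubes_def)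
    ultimately have "ivl A B \<in> \<W>"
      by (auto simp: \<W>_def)
    then show ?thesis using AB(3) by blast
  qed
  show ?thesis
  proof (cases "\<W> = {}")
    case True
    have "?P \<inter> ?Q = {}"
    proof (rule ccontr)
      assume "?P \<inter> ?Q \<noteq> {}"
      then obtain x where "x \<in> cspan p (Pow I)" "x \<in> cspan q (Pow J)" "norm x = 1"
        by (auto simp: sph_hull_image)
      then show False
        using common[of x] True by fastforce
    qed
    moreover have "{} \<in> subcubes I" by (simp add: subcubes_def)
    ultimately show ?thesis
      unfolding cube_config_faces[OF p] by (intro bexI[of _ "{}"]) auto
  next
    case False
    define x where "x = (\<Sum>S\<in>\<Union>\<W>. p S)"
    have "x = (\<Sum>S\<in>\<Union>\<W>. 1 *\<^sub>R p S)" by (simp add: x_def)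
    then have xo: "x \<in> ocone p (\<Union>\<W>)"
      unfolding ocone_def by (auto intro!: exI[of _ "\<lambda>_. 1"])
    have UI: "\<Union>\<W> \<subseteq> Pow I"
      using subcubes_Pow by (fastforce simp: \<W>_def)
    have xp: "x \<in> cspan p (Pow I)"
      using xo ocone_subset_cspan cspan_mono[OF UI finite] by blast
    have "(\<Sum>S\<in>Y. p S) \<in> cspan q (Pow J)" if "Y \<subseteq> \<Union>\<W>" for Y
      using finite[of Y] that
    proof (induction Y rule: finite_induct)
      case empty
      then show ?case using cspanI[of "Pow J" "\<lambda>_. 0" q] by simp
    next
      case (insert S Y)
      then have "p S \<in> cspan q (Pow J)" by (auto simp: \<W>_def)
      then show ?case using insert cspan_add by simp
    qed
    then have xq: "x \<in> cspan q (Pow J)" by (simp add: x_def)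
    obtain b where b: "\<And>S. 0 < b \<bullet> p S" using cube_config_pointed[OF p] by blast
    have "\<Union>\<W> \<noteq> {}"
      using False by (auto simp: \<W>_def)
    then have "0 < b \<bullet> x"
      unfolding x_def inner_sum_right using b by (intro sum_pos) auto
    then have "x \<noteq> 0" by auto
    then obtain W where W: "W \<in> \<W>" "x \<in> ocone p W"
      using common xp xq by blast
    have Ws: "W \<in> subcubes I" using W by (simp add: \<W>_def)
    obtain a where a: "\<And>S. 0 \<le> a \<bullet> p S" "\<And>S. a \<bullet> p S = 0 \<longleftrightarrow> S \<in> W"
      using cube_config_exposed_subcube[OF p Ws] by blast
    have "a \<bullet> x = 0"
      using inner_ocone_zero_iff[OF W(2), of a] a by auto
    then have max: "\<Union>\<W> \<subseteq> W"
      using inner_ocone_zero_iff[OF xo, of a] a by auto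
    have "?P \<inter> ?Q = sph_hull (p ` W)"
    proof
      show "?P \<inter> ?Q \<subseteq> sph_hull (p ` W)"
      proof
        fix y assume y: "y \<in> ?P \<inter> ?Q"
        then have y': "y \<in> cspan p (Pow I)" "y \<in> cspan q (Pow J)" "norm y = 1"
          by (auto simp: sph_hull_image)
        then obtain W' where "W' \<in> \<W>" "y \<in> ocone p W'"
          using common[of y] by fastforce
        then show "y \<in> sph_hull (p ` W)"
          using max ocone_subset_cspan[of p W'] cspan_mono[of W' W p] y'(3) by (auto simp: sph_hull_image)
      qed
      have "cspan p W \<subseteq> cspan p (Pow I)"
        using subcubes_Pow[OF Ws] by (intro cspan_mono) auto
      moreover have "cspan p W \<subseteq> cspan q (Pow J)"
        unfolding convex_cone_hull_image[OF finite, symmetric]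
        using W(1) convex_cone_hull_image[of "Pow J" q] convex_cone_convex_cone_hull[of "q ` Pow J"]
        by (intro hull_minimal) (auto simp: \<W>_def convex_cone_convex_cone_hull)
      ultimately show "sph_hull (p ` W) \<subseteq> ?P \<inter> ?Q"
        by (auto simp: sph_hull_image)
    qed
    then show ?thesis
      unfolding cube_config_faces[OF p] using Ws by blast
  qed
qed


section \<open>Boxes\<close>

definition ind :: "'n set \<Rightarrow> real^'n" where
  "ind S = (\<chi> i. if i \<in> S then 1 else 0)"

lemma ind_nth [simp]: "ind S $ i = (if i \<in> S then 1 else 0)"
  by (simp add: ind_def)

lemma ind_eq_iff: "ind S = ind T \<longleftrightarrow> S = T"
  by (auto simp: vec_eq_iff split: if_splits)

lemma ind_empty [simp]: "ind {} = 0"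
  by (simp add: vec_eq_iff)

lemma extreme_point_of_cbox_cart:
  fixes a b :: "real^'n"
  shows "x extreme_point_of cbox a b \<longleftrightarrow> x \<in> cbox a b \<and> (\<forall>i. x $ i = a $ i \<or> x $ i = b $ i)"
proof
  assume x: "x extreme_point_of cbox a b"
  then have xb: "x \<in> cbox a b"
    by (simp add: extreme_point_of_def)
  have "x $ i = a $ i \<or> x $ i = b $ i" for i
  proof (rule ccontr)
    assume ne: "\<not> (x $ i = a $ i \<or> x $ i = b $ i)"
    define d where "d = min (x $ i - a $ i) (b $ i - x $ i)"
    have "a $ i \<le> x $ i" "x $ i \<le> b $ i"
      using xb by (auto simp: mem_box_cart)
    then have d: "0 < d" "a $ i \<le> x $ i - d" "x $ i + d \<le> b $ i"
      using ne by (auto simp: d_def)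
    have m: "x + axis i d \<in> cbox a b" "x - axis i d \<in> cbox a b"
      using xb d by (auto simp: mem_box_cart axis_def)
    have "x + axis i d \<noteq> x - axis i d"
      using d(1) by (auto simp: vec_eq_iff axis_def intro!: exI[of _ i])
    moreover have "x = (1 - 1/2) *\<^sub>R (x + axis i d) + (1/2) *\<^sub>R (x - axis i d)"
      by (simp add: vec_eq_iff axis_def field_simps)
    ultimately have "x \<in> open_segment (x + axis i d) (x - axis i d)"
      unfolding in_segment by (intro conjI exI[of _ "1/2"]) auto
    then show False
      using x m by (auto simp: extreme_point_of_def)
  qed
  with xb show "x \<in> cbox a b \<and> (\<forall>i. x $ i = a $ i \<or> x $ i = b $ i)" by blast
next
  assume x: "x \<in> cbox a b \<and> (\<forall>i. x $ i = a $ i \<or> x $ i = b $ i)"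
  show "x extreme_point_of cbox a b"
    unfolding extreme_point_of_def
  proof (intro conjI ballI notI)
    fix y z assume yz: "y \<in> cbox a b" "z \<in> cbox a b" and "x \<in> open_segment y z"
    then obtain u where u: "0 < u" "u < 1" "x = (1 - u) *\<^sub>R y + u *\<^sub>R z" and ne: "y \<noteq> z"
      by (auto simp: in_segment)
    have "y $ i = z $ i" for i
    proof -
      have b: "a $ i \<le> y $ i" "y $ i \<le> b $ i" "a $ i \<le> z $ i" "z $ i \<le> b $ i"
        using yz by (auto simp: mem_box_cart)
      have e: "x $ i = (1 - u) * y $ i + u * z $ i" using u(3) by simp
      from x have "x $ i = a $ i \<or> x $ i = b $ i" by blast
      then have "(1 - u) * (y $ i - a $ i) + u * (z $ i - a $ i) = 0 \<or>
          (1 - u) * (b $ i - y $ i) + u * (b $ i - z $ i) = 0"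
        using e by (auto simp: algebra_simps)
      then show ?thesis
        using b u by (auto simp: add_nonneg_eq_0_iff)
    qed
    then show False using ne by (simp add: vec_eq_iff)
  qed (use x in blast)
qed

lemma box_vertex_iff: "{x} face_of cbox v (v + ind I) \<longleftrightarrow> (\<exists>S\<subseteq>I. x = v + ind S)"
proof -
  have "x \<in> cbox v (v + ind I) \<and> (\<forall>i. x $ i = v $ i \<or> x $ i = (v + ind I) $ i) \<longleftrightarrow> (\<exists>S\<subseteq>I. x = v + ind S)"
  proof
    assume L: "x \<in> cbox v (v + ind I) \<and> (\<forall>i. x $ i = v $ i \<or> x $ i = (v + ind I) $ i)"
    have "x $ i = v $ i + ind {i. x $ i \<noteq> v $ i} $ i" for i
      using L by (auto split: if_splits)
    then have "x = v + ind {i. x $ i \<noteq> v $ i}"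
      by (simp add: vec_eq_iff)
    moreover have "{i. x $ i \<noteq> v $ i} \<subseteq> I"
      using L by (auto split: if_splits)
    ultimately show "\<exists>S\<subseteq>I. x = v + ind S" by blast
  qed (auto simp: mem_box_cart)
  then show ?thesis
    by (simp add: face_of_singleton extreme_point_of_cbox_cart)
qed

lemma model_cube_eq: "model_cube J = cbox 0 (0 + ind J)"
  by (simp add: model_cube_def ind_def)

lemma model_cube_hull: "model_cube J = convex hull (ind ` Pow J)"
proof -
  have "{x. x extreme_point_of model_cube J} = ind ` Pow J"
    using box_vertex_iff[of _ 0 J] by (auto simp: model_cube_eq face_of_singleton)
  then show ?thesis
    using Krein_Milman_Minkowski[of "model_cube J"] by (simp add: model_cube_eq)
qed

lemma model_cube_face_hull:
  assumes "F face_of model_cube J"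
  shows "F = convex hull (ind ` {S. S \<subseteq> J \<and> ind S \<in> F})"
proof
  obtain S' where S': "S' \<subseteq> ind ` Pow J" "F = convex hull S'"
  proof -
    have "compact (ind ` Pow J)" by (intro finite_imp_compact finite_imageI) simp
    then show ?thesis
      using assms that unfolding model_cube_hull by (rule face_of_convex_hull_subset) blast+
  qed
  have "S' \<subseteq> F" unfolding S'(2) by (rule hull_subset)
  then have "S' \<subseteq> ind ` {S. S \<subseteq> J \<and> ind S \<in> F}"
    using S'(1) by blast
  then show "F \<subseteq> convex hull (ind ` {S. S \<subseteq> J \<and> ind S \<in> F})"
    using S'(2) hull_mono by blast
  have "convex F" using assms by (rule face_of_imp_convex)
  then show "convex hull (ind ` {S. S \<subseteq> J \<and> ind S \<in> F}) \<subseteq> F"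
    by (intro hull_minimal) auto
qed

lemma model_cube_face_subcube:
  assumes "F face_of model_cube J"
  shows "{S. S \<subseteq> J \<and> ind S \<in> F} \<in> subcubes J"
proof (rule subcubes_of_convex)
  fix S S' S''
  assume S: "S \<in> {S. S \<subseteq> J \<and> ind S \<in> F}" and S': "S' \<in> {S. S \<subseteq> J \<and> ind S \<in> F}"
    and i: "S \<inter> S' \<subseteq> S''" and u: "S'' \<subseteq> S \<union> S'"
  \<comment> \<open>The vertex opposite to \<open>S''\<close> in the subcube spanned by
    \<open>S\<close> and \<open>S'\<close>: the segments from \<open>S\<close> to \<open>S'\<close>
    and from \<open>S''\<close> to \<open>T\<close> have the same midpoint, and a face that contains
    an inner point of a segment contains its ends.\<close>
  define T where "T = (S \<union> S') - (S'' - S \<inter> S')"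
  have sJ: "S'' \<subseteq> J" "T \<subseteq> J"
    using S S' u by (auto simp: T_def)
  have vJ: "ind R \<in> model_cube J" if "R \<subseteq> J" for R
    using that by (auto simp: model_cube_eq mem_box_cart)
  have sum: "ind S + ind S' = ind S'' + ind T"
    using i u by (auto simp: vec_eq_iff T_def)
  have "(1/2) *\<^sub>R ind S + (1/2) *\<^sub>R ind S' \<in> F"
    using S S' face_of_imp_convex[OF assms] by (intro convexD) auto
  then have m: "(1/2) *\<^sub>R ind S'' + (1/2) *\<^sub>R ind T \<in> F"
    using arg_cong[OF sum, of "scaleR (1/2)"] by (simp add: scaleR_add_right)
  show "S'' \<in> {S. S \<subseteq> J \<and> ind S \<in> F}"
  proof (cases "S'' = T")
    case True
    have "(1/2) *\<^sub>R ind T + (1/2) *\<^sub>R ind T = ind T" by (simp add: vec_eq_iff)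
    then show ?thesis
      using m True sJ by simp
  next
    case False
    then have "(1/2) *\<^sub>R ind S'' + (1/2) *\<^sub>R ind T \<in> open_segment (ind S'') (ind T)"
      unfolding in_segment ind_eq_iff by (auto intro!: exI[of _ "1/2"])
    then have "ind S'' \<in> F"
      using assms m vJ sJ unfolding face_of_def by blast
    then show ?thesis using sJ by simp
  qed
qed auto

lemma model_cube_face_exists:
  assumes "W \<in> subcubes J"
  shows "\<exists>F. F face_of model_cube J \<and> {S. S \<subseteq> J \<and> ind S \<in> F} = W"
proof (cases "W = {}")
  case True
  then show ?thesis by (intro exI[of _ "{}"]) (auto simp: empty_face_of)
next
  case False
  then obtain A B where AB: "A \<subseteq> B" "B \<subseteq> J" "W = ivl A B"
    using assms by (auto simp: subcubes_def)
  let ?F = "{x \<in> model_cube J. (\<forall>i\<in>A. x $ i = 1) \<and> (\<forall>i\<in>J - B. x $ i = 0)}"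
  have mc: "x \<in> model_cube J \<longleftrightarrow> (\<forall>i. 0 \<le> x $ i \<and> x $ i \<le> (if i \<in> J then 1 else 0))" for x
    by (simp add: model_cube_eq mem_box_cart)
  have le1: "x $ i \<le> 1" if "x \<in> model_cube J" for x i
  proof -
    have "x $ i \<le> (if i \<in> J then 1 else 0)" using that mc by blast
    then show ?thesis by (auto split: if_splits)
  qed
  have "?F face_of model_cube J"
    unfolding face_of_def
  proof (intro conjI ballI impI)
    show "convex ?F"
    proof (rule convexI)
      fix x y :: "real^5" and u v :: real
      assume "x \<in> ?F" "y \<in> ?F" and uv: "0 \<le> u" "0 \<le> v" "u + v = 1"
      moreover have "convex (model_cube J)" by (simp add: model_cube_eq)
      ultimately have "u *\<^sub>R x + v *\<^sub>R y \<in> model_cube J"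
        using convexD by blast
      with \<open>x \<in> ?F\<close> \<open>y \<in> ?F\<close> uv show "u *\<^sub>R x + v *\<^sub>R y \<in> ?F"
        by simp
    qed
    fix a b x assume a: "a \<in> model_cube J" "b \<in> model_cube J" "x \<in> ?F" "x \<in> open_segment a b"
    then obtain u where u: "0 < u" "u < 1" "x = (1 - u) *\<^sub>R a + u *\<^sub>R b"
      by (auto simp: in_segment)
    have one: "a $ i = 1 \<and> b $ i = 1" if "i \<in> A" for i
    proof -
      have "i \<in> J" using that AB by blast
      then have "a $ i \<le> 1" "b $ i \<le> 1" using a(1,2) le1 by auto
      moreover have "(1 - u) * (1 - a $ i) + u * (1 - b $ i) = 0"
        using a(3) that u(3) by (simp add: algebra_simps)
      ultimately show ?thesis using u by (auto simp: add_nonneg_eq_0_iff)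
    qed
    have zero: "a $ i = 0 \<and> b $ i = 0" if "i \<in> J - B" for i
    proof -
      have "0 \<le> a $ i" "0 \<le> b $ i" using a(1,2) unfolding mc by blast+
      moreover have "(1 - u) * a $ i + u * b $ i = 0"
        using a(3) that u(3) by simp
      ultimately show ?thesis using u by (auto simp: add_nonneg_eq_0_iff)
    qed
    show "a \<in> ?F" "b \<in> ?F" using a one zero by auto
  qed auto
  moreover have "{S. S \<subseteq> J \<and> ind S \<in> ?F} = W"
    unfolding AB(3) ivl_def using AB by (auto simp: mc split: if_splits)
  ultimately show ?thesis by blast
qed

text \<open>Both face lattices are identified with \<open>subcubes I\<close>: the faces of the model
  cube through the vertices they contain, those of the spherical cell through
  \<open>cube_config_faces\<close>.\<close>

lemma cube_config_sph_cube:
  assumes p: "cube_config p"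
  shows "sph_cube (sph_hull (p ` Pow I))"
proof -
  \<comment> \<open>The model cube sits in a coordinate subspace of \<open>real^5\<close>, so the
    three directions are injected into the five coordinates.\<close>
  define f :: "3 \<Rightarrow> 5" where "f i = (if i = 1 then 1 else if i = 2 then 2 else 3)" for i
  have inj: "inj f"
    unfolding inj_def forall_3 by (simp add: f_def)
  then have injf: "inj ((`) f)"
    by (intro injI) (simp add: inj_image_eq_iff)
  let ?J = "f ` I"
  define V where "V F = {S. S \<subseteq> I \<and> ind (f ` S) \<in> F}" for F
  have WV: "{S. S \<subseteq> ?J \<and> ind S \<in> F} = (`) f ` V F" for F
    by (auto simp: V_def subset_image_iff)
  have sub: "(`) f ` W \<in> subcubes ?J \<longleftrightarrow> W \<in> subcubes I" if W: "W \<subseteq> Pow I" for W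
  proof
    assume "(`) f ` W \<in> subcubes ?J"
    then have "(`) f ` W = {} \<or> (\<exists>A B. A \<subseteq> B \<and> B \<subseteq> ?J \<and> (`) f ` W = ivl A B)"
      unfolding subcubes_def by (rule CollectD)
    then consider "(`) f ` W = {}" | A B where "A \<subseteq> B" "B \<subseteq> ?J" "(`) f ` W = ivl A B"
      by metis
    then show "W \<in> subcubes I"
    proof cases
      case 2
      then obtain A0 B0 where AB: "B0 \<subseteq> I" "B = f ` B0" "A0 \<subseteq> B0" "A = f ` A0"
        by (metis subset_image_iff)
      have "S \<in> W \<longleftrightarrow> f ` S \<in> ivl A B" for S
        using 2(3) inj by (metis image_iff inj_image_eq_iff)
      then have "W = ivl A0 B0"
        using AB inj by (auto simp: ivl_def inj_image_subset_iff)
      then show ?thesis using AB by (auto simp: subcubes_def)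
    qed (auto simp: subcubes_def)
  next
    assume "W \<in> subcubes I"
    then have "W = {} \<or> (\<exists>A B. A \<subseteq> B \<and> B \<subseteq> I \<and> W = ivl A B)"
      unfolding subcubes_def by (rule CollectD)
    then consider "W = {}" | A B where "A \<subseteq> B" "B \<subseteq> I" "W = ivl A B"
      by metis
    then show "(`) f ` W \<in> subcubes ?J"
    proof cases
      case 2
      have "(`) f ` W = ivl (f ` A) (f ` B)"
      proof
        show "ivl (f ` A) (f ` B) \<subseteq> (`) f ` W"
        proof
          fix S assume S: "S \<in> ivl (f ` A) (f ` B)"
          then obtain S0 where "S0 \<subseteq> B" "S = f ` S0"
            by (auto simp: ivl_def subset_image_iff)
          then show "S \<in> (`) f ` W"
            using S inj 2(3) by (auto simp: ivl_def inj_image_subset_iff)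
        qed
      qed (auto simp: 2(3) ivl_def)
      then show ?thesis
        using 2(1,2) unfolding subcubes_def by (intro CollectI disjI2 exI[of _ "f ` A"] exI[of _ "f ` B"]) auto
    qed (auto simp: subcubes_def)
  qed
  have Vsub: "V F \<in> subcubes I" if "F face_of model_cube ?J" for F
    using model_cube_face_subcube[OF that] WV[of F] sub[of "V F"] by (auto simp: V_def)
  have Vmono: "V F \<subseteq> V G \<longleftrightarrow> F \<subseteq> G" if F: "F face_of model_cube ?J" and G: "G face_of model_cube ?J" for F G
  proof
    assume "V F \<subseteq> V G"
    have "F = convex hull (ind ` (`) f ` V F)" "G = convex hull (ind ` (`) f ` V G)"
      using model_cube_face_hull[OF F] model_cube_face_hull[OF G] unfolding WV .
    moreover have "convex hull (ind ` (`) f ` V F) \<subseteq> convex hull (ind ` (`) f ` V G)"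
      using \<open>V F \<subseteq> V G\<close> by (intro hull_mono image_mono)
    ultimately show "F \<subseteq> G" by simp
  qed (auto simp: V_def)
  define h where "h F = sph_hull (p ` V F)" for F
  have hmono: "h F \<subseteq> h G \<longleftrightarrow> F \<subseteq> G" if "F face_of model_cube ?J" "G face_of model_cube ?J" for F G
    unfolding h_def using cube_config_hull_subset_iff[OF p Vsub[OF that(1)] Vsub[OF that(2)]] Vmono[OF that] by simp
  have "bij_betw h {F. F face_of model_cube ?J} {F. F sph_face_of sph_hull (p ` Pow I)}"
    unfolding bij_betw_def
  proof
    show "inj_on h {F. F face_of model_cube ?J}"
    proof (rule inj_onI)
      fix F G assume "F \<in> {F. F face_of model_cube ?J}" "G \<in> {F. F face_of model_cube ?J}" "h F = h G"
      then show "F = G" using hmono[of F G] hmono[of G F] by auto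
    qed
    show "h ` {F. F face_of model_cube ?J} = {F. F sph_face_of sph_hull (p ` Pow I)}"
    proof
      show "h ` {F. F face_of model_cube ?J} \<subseteq> {F. F sph_face_of sph_hull (p ` Pow I)}"
        using Vsub unfolding cube_config_faces[OF p] h_def by blast
      show "{F. F sph_face_of sph_hull (p ` Pow I)} \<subseteq> h ` {F. F face_of model_cube ?J}"
      proof
        fix F' assume "F' \<in> {F. F sph_face_of sph_hull (p ` Pow I)}"
        then obtain W where W: "W \<in> subcubes I" "F' = sph_hull (p ` W)"
          unfolding cube_config_faces[OF p] by blast
        then obtain F where F: "F face_of model_cube ?J" "{S. S \<subseteq> ?J \<and> ind S \<in> F} = (`) f ` W"
          using model_cube_face_exists[of "(`) f ` W" ?J] sub[OF subcubes_Pow[OF W(1)]] by blast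
        have "V F = W"
          using F(2) inj_image_eq_iff[OF injf, of "V F" W] unfolding WV by simp
        then show "F' \<in> h ` {F. F face_of model_cube ?J}"
          using W F by (auto simp: h_def)
      qed
    qed
  qed
  then show ?thesis
    unfolding sph_cube_def using cube_config_polytope[OF p] hmono by blast
qed

section \<open>Cells of the cube tiling modulo the lattice\<close>

definition cell :: "real^3 \<Rightarrow> 3 set \<Rightarrow> (real^3) set" where
  "cell v I = cbox v (v + ind I)"

lemma cube_tiling_eq: "cube_tiling = insert {} {cell v I | v I. v \<in> int_points}"
  by (simp add: cube_tiling_def cell_def ind_def)

lemma cell_vertex_iff: "{x} face_of cell v I \<longleftrightarrow> (\<exists>S\<subseteq>I. x = v + ind S)"
  unfolding cell_def by (rule box_vertex_iff)

lemma cell_empty [simp]: "cell v {} = {v}"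
  by (simp add: cell_def)

lemma coord_sum_add [simp]: "coord_sum (v + w) = coord_sum v + coord_sum w"
  by (simp add: coord_sum_def)

lemma coord_sum_ind [simp]: "coord_sum (ind S) = real (card S)"
proof -
  have "card S = (\<Sum>i\<in>UNIV. if i \<in> S then 1 else 0)"
    by (simp add: sum.If_cases)
  then show ?thesis
    by (simp add: coord_sum_def sum_3)
qed

lemma int_points_add: "v \<in> int_points \<Longrightarrow> w \<in> int_points \<Longrightarrow> v + w \<in> int_points"
  by (simp add: int_points_def)

lemma int_points_ind: "ind S \<in> int_points"
  by (simp add: int_points_def)

lemma cell_in_strip_iff:
  assumes "v \<in> int_points"
  shows "cell v I \<in> cube_strip k \<longleftrightarrow> 0 \<le> coord_sum v \<and> coord_sum v + card I \<le> k"
proof -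
  have "cell v I \<in> cube_tiling"
    using assms by (auto simp: cube_tiling_eq)
  moreover have "(\<forall>x. (\<exists>S\<subseteq>I. x = v + ind S) \<longrightarrow> 0 \<le> coord_sum x \<and> coord_sum x \<le> k) \<longleftrightarrow>
     0 \<le> coord_sum v \<and> coord_sum v + card I \<le> k" (is "?L \<longleftrightarrow> ?R")
  proof
    assume ?L
    from this[rule_format, of "v + ind {}"] this[rule_format, of "v + ind I"] show ?R
      by force
  next
    assume R: ?R
    have "card S \<le> card I" if "S \<subseteq> I" for S
      using that by (simp add: card_mono)
    then have "real (card S) \<le> card I" if "S \<subseteq> I" for S
      using that by simp
    then have "coord_sum v + real (card S) \<le> k" if "S \<subseteq> I" for S
      using R that by (meson add_left_mono order_trans)
    then show ?L using R by auto
  qed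
  ultimately show ?thesis
    by (simp add: cube_strip_def cell_vertex_iff)
qed

lemma cube_strip_eq:
  "cube_strip k = insert {} {cell v I | v I. v \<in> int_points \<and> 0 \<le> coord_sum v \<and> coord_sum v + card I \<le> k}"
proof -
  have "{} \<in> cube_strip k"
    by (auto simp: cube_strip_def cube_tiling_def face_of_singleton extreme_point_of_def)
  moreover have "F \<in> cube_tiling" if "F \<in> cube_strip k" for F
    using that by (simp add: cube_strip_def)
  ultimately show ?thesis
    using cell_in_strip_iff[of _ _ k] unfolding cube_tiling_eq by blast
qed

lemma int_points_coord_sum_nat:
  assumes "v \<in> int_points" "0 \<le> coord_sum v"
  shows "coord_sum v = real (nat \<lfloor>coord_sum v\<rfloor>)"
proof -
  have "coord_sum v \<in> \<int>"
    using assms(1) by (simp add: coord_sum_def int_points_def)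
  then show ?thesis
    using assms(2) by (auto elim!: Ints_cases)
qed

text \<open>The extreme corners decide: \<open>v - u\<close> has integer coordinates between 0 and
  1, so it is an indicator vector.\<close>

lemma cell_subset_iff:
  assumes "v \<in> int_points" "u \<in> int_points"
  shows "cell v I \<subseteq> cell u J \<longleftrightarrow> (\<exists>A. v = u + ind A \<and> A \<inter> I = {} \<and> A \<union> I \<subseteq> J)"
proof
  assume "cell v I \<subseteq> cell u J"
  moreover have "v \<in> cell v I" "v + ind I \<in> cell v I"
    by (auto simp: cell_def mem_box_cart)
  ultimately have "v \<in> cell u J" "v + ind I \<in> cell u J" by blast+
  then have b: "u $ i \<le> v $ i" "v $ i + ind I $ i \<le> u $ i + ind J $ i" for i
    by (auto simp: cell_def mem_box_cart)
  define A where "A = {i. v $ i \<noteq> u $ i}"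
  have A: "v $ i = u $ i + 1" if "i \<in> A" for i
  proof -
    have "v $ i - u $ i \<in> \<int>" using assms by (simp add: int_points_def)
    then obtain n where n: "v $ i - u $ i = of_int n" by (auto elim: Ints_cases)
    have "0 \<le> ind I $ i" "ind J $ i \<le> 1" by simp_all
    then have "0 < real_of_int n" "real_of_int n \<le> 1"
      using b[of i] n that by (auto simp: A_def)
    then have "n = 1" by linarith
    then show ?thesis using n by simp
  qed
  have "v = u + ind A"
    using A by (auto simp: vec_eq_iff A_def)
  moreover have "i \<notin> I" if "i \<in> A" for i
    using b(2)[of i] A[OF that] by (auto split: if_splits)
  moreover have "i \<in> J" if "i \<in> A \<union> I" for i
    using b[of i] A[of i] that by (auto split: if_splits)
  ultimately show "\<exists>A. v = u + ind A \<and> A \<inter> I = {} \<and> A \<union> I \<subseteq> J" by blast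
next
  assume "\<exists>A. v = u + ind A \<and> A \<inter> I = {} \<and> A \<union> I \<subseteq> J"
  then obtain A where A: "v = u + ind A" "A \<inter> I = {}" "A \<union> I \<subseteq> J" by blast
  show "cell v I \<subseteq> cell u J"
  proof
    fix x assume "x \<in> cell v I"
    then have "v $ i \<le> x $ i \<and> x $ i \<le> v $ i + ind I $ i" for i
      by (auto simp: cell_def mem_box_cart)
    then have "u $ i + ind A $ i \<le> x $ i \<and> x $ i \<le> u $ i + ind A $ i + ind I $ i" for i
      by (simp add: A(1))
    moreover have "0 \<le> ind A $ i" "ind A $ i + ind I $ i \<le> ind J $ i" for i
      using A(2,3) by auto
    ultimately show "x \<in> cell u J"
      unfolding cell_def mem_box_cart vector_add_component by (smt (verit))
  qed
qed

lemma cell_eq_iff: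
  assumes "v \<in> int_points" "u \<in> int_points"
  shows "cell v I = cell u J \<longleftrightarrow> v = u \<and> I = J"
proof
  assume "cell v I = cell u J"
  then obtain A B where A: "v = u + ind A" "A \<inter> I = {}" "A \<union> I \<subseteq> J"
    and B: "u = v + ind B" "B \<inter> J = {}" "B \<union> J \<subseteq> I"
    using cell_subset_iff[OF assms] cell_subset_iff[OF assms(2,1)] by (metis subset_refl)
  then have "A = {}" by blast
  then show "v = u \<and> I = J" using A B by auto
qed simp

lemma cell_nonempty: "v \<in> cell v I"
  by (simp add: cell_def mem_box_cart)

lemma Lam_int_points: "l \<in> Lam \<Longrightarrow> l \<in> int_points"
  by (auto simp: Lam_def int_points_def forall_3)

lemma Lam_add: "p \<in> Lam \<Longrightarrow> q \<in> Lam \<Longrightarrow> p + q \<in> Lam"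
proof -
  assume "p \<in> Lam" "q \<in> Lam"
  then obtain a b c d where p: "p = of_int a *\<^sub>R vector [3, -3, 0] + of_int b *\<^sub>R vector [-2, -2, 4]"
    and q: "q = of_int c *\<^sub>R vector [3, -3, 0] + of_int d *\<^sub>R vector [-2, -2, 4]"
    unfolding Lam_def by blast
  have "p + q = of_int (a + c) *\<^sub>R vector [3, -3, 0] + of_int (b + d) *\<^sub>R vector [-2, -2, 4]"
    by (simp add: p q algebra_simps)
  then show "p + q \<in> Lam" unfolding Lam_def by blast
qed

lemma Lam_uminus: "p \<in> Lam \<Longrightarrow> - p \<in> Lam"
proof -
  assume "p \<in> Lam"
  then obtain a b where p: "p = of_int a *\<^sub>R vector [3, -3, 0] + of_int b *\<^sub>R vector [-2, -2, 4]"
    unfolding Lam_def by blast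
  have "- p = of_int (- a) *\<^sub>R vector [3, -3, 0] + of_int (- b) *\<^sub>R vector [-2, -2, 4]"
    by (simp add: p)
  then show "- p \<in> Lam" unfolding Lam_def by blast
qed

lemma Lam_zero: "0 \<in> Lam"
  unfolding Lam_def by (auto intro!: exI[of _ 0])

lemma Lam_iff:
  "l \<in> Lam \<longleftrightarrow> (\<exists>a b. l $ 1 = 3 * of_int a - 2 * of_int b \<and> l $ 2 = - 3 * of_int a - 2 * of_int b \<and> l $ 3 = 4 * of_int b)"
  by (simp add: Lam_def vec_eq_iff forall_3 algebra_simps)

lemma coord_sum_Lam: "l \<in> Lam \<Longrightarrow> coord_sum l = 0"
  by (auto simp: Lam_iff coord_sum_def)

text \<open>Ensures that the quotient never identifies two vertices of one cell. A lattice vector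
  with entries in {-1, 0, 1} has third entry 0, as this is a multiple of 4, and then first entry 0,
  as this is a multiple of 3.\<close>

lemma Lam_ind_diff:
  fixes S S' :: "3 set"
  assumes "ind S - ind S' \<in> Lam"
  shows "S = S'"
proof -
  obtain a b where ab: "(ind S - ind S') $ 1 = 3 * of_int a - 2 * of_int b"
    "(ind S - ind S') $ 2 = - 3 * of_int a - 2 * of_int b" "(ind S - ind S') $ 3 = 4 * of_int b"
    using assms unfolding Lam_iff by blast
  have bd: "\<bar>(ind S - ind S') $ i\<bar> \<le> 1" for i by simp
  have "\<bar>4 * real_of_int b\<bar> \<le> 1" using bd[of 3] unfolding ab .
  then have b: "b = 0" by linarith
  have "\<bar>3 * real_of_int a\<bar> \<le> 1" using bd[of 1] unfolding ab b by simp
  then have a: "a = 0" by linarith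
  have "ind S - ind S' = 0"
    unfolding vec_eq_iff forall_3 ab a b by simp
  then show ?thesis by (simp add: ind_eq_iff)
qed

lemma translate_cell: "(+) l ` cell v I = cell (l + v) I"
proof -
  have "(+) l ` cbox v (v + ind I) = cbox (l + v) (l + (v + ind I))"
    by (rule cbox_translation[symmetric])
  then show ?thesis by (simp add: cell_def add.assoc)
qed

lemma orbit_cell: "orbit (cell v I) = {cell (l + v) I | l. l \<in> Lam}"
  by (auto simp: orbit_def translate_cell)

lemma orbit_empty: "orbit {} = {{}}"
  using Lam_zero by (auto simp: orbit_def)

lemma orbit_translate: "l \<in> Lam \<Longrightarrow> orbit (cell (l + v) I) = orbit (cell v I)"
proof -
  assume l: "l \<in> Lam"
  have "\<exists>l''. l' + (l + v) = l'' + v \<and> l'' \<in> Lam" if "l' \<in> Lam" for l'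
    using Lam_add[OF that l] by (intro exI[of _ "l' + l"]) (simp add: add.assoc)
  moreover have "\<exists>l''. l' + v = l'' + (l + v) \<and> l'' \<in> Lam" if "l' \<in> Lam" for l'
    using Lam_add[OF that Lam_uminus[OF l]] by (intro exI[of _ "l' - l"]) simp
  ultimately show ?thesis
    unfolding orbit_cell by (auto, metis+)
qed

lemma orbit_cell_eq_iff:
  assumes "v \<in> int_points" "u \<in> int_points"
  shows "orbit (cell v I) = orbit (cell u J) \<longleftrightarrow> I = J \<and> (\<exists>l\<in>Lam. v = l + u)"
proof
  assume "orbit (cell v I) = orbit (cell u J)"
  moreover have "cell v I \<in> orbit (cell v I)"
    using Lam_zero unfolding orbit_cell by force
  ultimately obtain l where "l \<in> Lam" "cell v I = cell (l + u) J"
    by (auto simp: orbit_cell)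
  then show "I = J \<and> (\<exists>l\<in>Lam. v = l + u)"
    using cell_eq_iff[OF assms(1), of "l + u" I J] assms(2) Lam_int_points int_points_add by blast
qed (auto simp: orbit_translate)

lemma orbit_le_cell_iff:
  assumes "v \<in> int_points" "u \<in> int_points"
  shows "orbit_le (orbit (cell v I)) (orbit (cell u J)) \<longleftrightarrow>
    (\<exists>l\<in>Lam. \<exists>A. v = l + u + ind A \<and> A \<inter> I = {} \<and> A \<union> I \<subseteq> J)"
proof
  assume "orbit_le (orbit (cell v I)) (orbit (cell u J))"
  then obtain l m where lm: "l \<in> Lam" "m \<in> Lam" "cell (l + v) I \<subseteq> cell (m + u) J"
    by (auto simp: orbit_le_def orbit_cell)
  then obtain A where A: "l + v = m + u + ind A" "A \<inter> I = {}" "A \<union> I \<subseteq> J"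
    using cell_subset_iff[of "l + v" "m + u" I J] assms Lam_int_points int_points_add by blast
  have "v = (m - l) + u + ind A"
    using A(1) by (simp add: algebra_simps)
  moreover have "m - l \<in> Lam"
    using Lam_add[OF lm(2) Lam_uminus[OF lm(1)]] by simp
  ultimately show "\<exists>l\<in>Lam. \<exists>A. v = l + u + ind A \<and> A \<inter> I = {} \<and> A \<union> I \<subseteq> J"
    using A by blast
next
  assume "\<exists>l\<in>Lam. \<exists>A. v = l + u + ind A \<and> A \<inter> I = {} \<and> A \<union> I \<subseteq> J"
  then obtain l A where A: "l \<in> Lam" "v = l + u + ind A" "A \<inter> I = {}" "A \<union> I \<subseteq> J" by blast
  then have "cell v I \<subseteq> cell (l + u) J"
    using cell_subset_iff[of v "l + u" I J] assms Lam_int_points int_points_add by blast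
  moreover have "cell v I \<in> orbit (cell v I)"
    using Lam_zero unfolding orbit_cell by force
  moreover have "cell (l + u) J \<in> orbit (cell u J)"
    using A(1) by (auto simp: orbit_cell)
  ultimately show "orbit_le (orbit (cell v I)) (orbit (cell u J))"
    unfolding orbit_le_def by blast
qed

text \<open>Among the vertices of a cell only the lowest, \<open>v\<close>, and the highest,
  \<open>v + ind I\<close>, constrain its membership in the strip.\<close>

definition strip_cell :: "nat \<Rightarrow> real^3 \<Rightarrow> 3 set \<Rightarrow> bool" where
  "strip_cell k v I \<longleftrightarrow> v \<in> int_points \<and> 0 \<le> coord_sum v \<and> coord_sum v + card I \<le> k"

lemma torus_complex_eq:
  "torus_complex k = insert (orbit {}) {orbit (cell v I) | v I. strip_cell k v I}"
  unfolding torus_complex_def cube_strip_eq strip_cell_def by blast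

lemma torus_complexE:
  assumes "C \<in> torus_complex k"
  obtains "C = orbit {}" | v I where "strip_cell k v I" "C = orbit (cell v I)"
  using assms unfolding torus_complex_eq by blast

lemma torus_complexI: "strip_cell k v I \<Longrightarrow> orbit (cell v I) \<in> torus_complex k"
  unfolding torus_complex_eq by blast

lemma orbit_empty_in: "orbit {} \<in> torus_complex k"
  unfolding torus_complex_eq by blast

lemma orbit_le_empty: "orbit_le (orbit {}) (orbit F)"
  using Lam_zero by (auto simp: orbit_le_def orbit_def)

lemma not_orbit_le_empty: "\<not> orbit_le (orbit (cell v I)) (orbit {})"
  using cell_nonempty by (force simp: orbit_le_def orbit_empty orbit_cell)

lemma orbit_cell_ne_empty: "orbit (cell v I) \<noteq> orbit {}"
  using not_orbit_le_empty orbit_le_empty by metis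

lemma induced_translate: "induced ((+) t) (orbit F) = orbit ((+) t ` F)"
  unfolding induced_def orbit_def image_image by (simp add: add.left_commute)

lemma induced_translate_cell: "induced ((+) t) (orbit (cell v I)) = orbit (cell (t + v) I)"
  by (simp add: induced_translate translate_cell)


section \<open>Coordinates\<close>

lemma exhaust_5: "x = 1 \<or> x = 2 \<or> x = 3 \<or> x = 4 \<or> x = 5" for x :: 5
proof (induct x)
  case (of_int z)
  then have "z = 0 \<or> z = 1 \<or> z = 2 \<or> z = 3 \<or> z = 4" by fastforce
  then show ?case by auto
qed

lemma forall_5: "(\<forall>i::5. P i) \<longleftrightarrow> P 1 \<and> P 2 \<and> P 3 \<and> P 4 \<and> P 5"
  by (metis exhaust_5)

lemma UNIV_5: "UNIV = {1, 2, 3, 4, 5::5}"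
  using exhaust_5 by auto

lemma sum_5: "sum f (UNIV :: 5 set) = f 1 + f 2 + f 3 + f 4 + f 5"
  unfolding UNIV_5 by (simp add: ac_simps)

lemma set3_cases:
  "S = {} \<or> S = {1} \<or> S = {2} \<or> S = {3} \<or> S = {1,2} \<or> S = {1,3} \<or> S = {2,3} \<or> S = {1,2,3}" for S :: "3 set"
proof -
  define m :: "bool \<Rightarrow> bool \<Rightarrow> bool \<Rightarrow> 3 set" where
    "m x y z = (if x then insert 1 else id) ((if y then insert 2 else id) (if z then {3} else {}))" for x y z
  have "m (1 \<in> S) (2 \<in> S) (3 \<in> S) = S"
    by (simp add: m_def set_eq_iff forall_3)
  moreover have "m x y z \<in> {{}, {1}, {2}, {3}, {1,2}, {1,3}, {2,3}, {1,2,3}}" for x y z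
    by (cases x; cases y; cases z) (simp_all add: m_def)
  ultimately have "S \<in> {{}, {1}, {2}, {3}, {1,2}, {1,3}, {2,3}, {1,2,3}}"
    by metis
  then show ?thesis by (simp only: insert_iff empty_iff simp_thms)
qed

text \<open>Points of the equatorial hyperplane as pairs of complex numbers. \<open>e\<close>
  rotates the first plane; \<open>s\<close>, which will be 1 or -1, turns the second by a half turn
  or not. The two absorb the position in which a given CCT happens to lie.\<close>

definition emb :: "complex \<Rightarrow> real \<Rightarrow> complex \<Rightarrow> complex \<Rightarrow> real^5" where
  "emb e s z w = (\<chi> i. if i = 1 then Re (e * z) else if i = 2 then Im (e * z)
     else if i = 3 then s * Re w else if i = 4 then s * Im w else 0)"

lemma emb_nth [simp]:
  "emb e s z w $ 1 = Re (e * z)" "emb e s z w $ 2 = Im (e * z)"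
  "emb e s z w $ 3 = s * Re w" "emb e s z w $ 4 = s * Im w" "emb e s z w $ 5 = 0"
  by (simp_all add: emb_def)

lemma emb_add: "emb e s z w + emb e s z' w' = emb e s (z + z') (w + w')"
  by (simp add: vec_eq_iff forall_5 algebra_simps)

lemma emb_scale: "c *\<^sub>R emb e s z w = emb e s (c *\<^sub>R z) (c *\<^sub>R w)"
  by (simp add: vec_eq_iff forall_5 algebra_simps)

lemma emb_zero: "emb e s 0 0 = 0"
  by (simp add: vec_eq_iff forall_5)

lemma emb_sum: "(\<Sum>i\<in>A. c i *\<^sub>R emb e s (z i) (w i)) = emb e s (\<Sum>i\<in>A. c i *\<^sub>R z i) (\<Sum>i\<in>A. c i *\<^sub>R w i)"
  by (induction A rule: infinite_finite_induct) (simp_all add: emb_zero emb_scale emb_add)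

locale frame =
  fixes e :: complex and s :: real
  assumes norm_e: "norm e = 1" and s2: "s * s = 1"
begin

lemma inner_e: "(e * z) \<bullet> (e * z') = z \<bullet> z'"
proof -
  have "Re e * Re e + Im e * Im e = 1"
    using norm_e by (simp add: cmod_def power2_eq_square)
  moreover have "(e * z) \<bullet> (e * z') = (Re e * Re e + Im e * Im e) * (z \<bullet> z')"
    by (simp add: inner_complex_def algebra_simps)
  ultimately show ?thesis by simp
qed

lemma emb_inner: "emb e s z w \<bullet> emb e s z' w' = z \<bullet> z' + w \<bullet> w'"
proof -
  have "emb e s z w \<bullet> emb e s z' w' = (e * z) \<bullet> (e * z') + (s * s) * (w \<bullet> w')"
    by (simp add: inner_vec_def sum_5 inner_complex_def algebra_simps)
  then show ?thesis by (simp add: inner_e s2)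
qed

lemma emb_norm: "norm (emb e s z w) = sqrt ((norm z)\<^sup>2 + (norm w)\<^sup>2)"
  by (simp add: norm_eq_sqrt_inner[of "emb e s z w"] emb_inner power2_norm_eq_inner)

lemma emb_eq_iff: "emb e s z w = emb e s z' w' \<longleftrightarrow> z = z' \<and> w = w'"
proof
  assume "emb e s z w = emb e s z' w'"
  then have "emb e s (z - z') (w - w') = 0"
    using emb_add[of e s "z - z'" "w - w'" z' w'] by simp
  then have "(norm (z - z'))\<^sup>2 + (norm (w - w'))\<^sup>2 = 0"
    using emb_norm[of "z - z'" "w - w'"] by (metis norm_zero real_sqrt_eq_zero_cancel_iff)
  then show "z = z' \<and> w = w'"
    by (simp add: add_nonneg_eq_0_iff)
qed simp

lemma emb_eq_0_iff: "emb e s z w = 0 \<longleftrightarrow> z = 0 \<and> w = 0"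
  using emb_eq_iff[of z w 0 0] by (simp add: emb_zero)

end

lemma emb_surj:
  assumes "frame e s" "x $ 5 = 0"
  obtains z w where "x = emb e s z w"
proof -
  interpret frame e s by fact
  have e0: "e \<noteq> 0" using norm_e by auto
  have "emb e s (Complex (x $ 1) (x $ 2) / e) (Complex (s * x $ 3) (s * x $ 4)) = x"
    using assms(2) e0 s2 by (simp add: vec_eq_iff forall_5 mult.assoc[symmetric])
  then show ?thesis using that by metis
qed

text \<open>A vertex up to a positive factor, scaled so that its second component has modulus 1. The
  phases are dictated by the symmetries: translation by (1,-1,0) turns the second component by 2 pi
  / 3, translation by (0,-1,1) turns the first by pi / 2 and the second by pi / 3.\<close>

definition pt :: "complex \<Rightarrow> real \<Rightarrow> (nat \<Rightarrow> complex) \<Rightarrow> real^3 \<Rightarrow> real^5" where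
  "pt e s h v = emb e s (cis (pi / 2 * v $ 3) * h (nat \<lfloor>coord_sum v\<rfloor>)) (cis (pi / 3 * (v $ 1 - v $ 2)))"

text \<open>Lattice vectors change both phases by full turns: \<open>v $ 3\<close> by multiples of 4
  and \<open>v $ 1 - v $ 2\<close> by multiples of 6.\<close>

lemma pt_Lam:
  assumes "l \<in> Lam"
  shows "pt e s h (l + v) = pt e s h v"
proof -
  obtain a b :: int where ab: "l $ 1 = 3 * a - 2 * b" "l $ 2 = - 3 * a - 2 * b" "l $ 3 = 4 * b"
    using assms by (auto simp: Lam_iff)
  have "cis (pi / 2 * (l + v) $ 3) = cis (pi / 2 * v $ 3) * cis (2 * pi * b)"
    by (simp add: ab cis_mult algebra_simps)
  moreover have "cis (pi / 3 * ((l + v) $ 1 - (l + v) $ 2)) = cis (pi / 3 * (v $ 1 - v $ 2)) * cis (2 * pi * a)"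
    by (simp add: ab cis_mult algebra_simps)
  moreover have "cis (2 * pi * of_int n) = 1" for n
    by (rule complex_eqI) (simp_all only: cis.sel cos_int_2pin sin_int_2pin one_complex.sel)
  ultimately show ?thesis
    using coord_sum_Lam[OF assms] by (simp add: pt_def)
qed

text \<open>With \<open>lw\<close>, the two components of the vertices of a cell in a frame that
  turns with its base vertex in layer \<open>n\<close>. The phases of the base vertex drop out of
  all inner products.\<close>

definition lz :: "(nat \<Rightarrow> complex) \<Rightarrow> nat \<Rightarrow> 3 set \<Rightarrow> complex" where
  "lz h n S = (if 3 \<in> S then \<i> else 1) * h (n + card S)"

definition lw :: "3 set \<Rightarrow> complex" where
  "lw S = cis (pi / 3 * ((if 1 \<in> S then 1 else 0) - (if 2 \<in> S then 1 else 0)))"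

lemma pt_local:
  assumes "coord_sum v = real n"
  shows "pt e s h (v + ind S) = emb e s (cis (pi / 2 * v $ 3) * lz h n S) (cis (pi / 3 * (v $ 1 - v $ 2)) * lw S)"
proof -
  have "nat \<lfloor>coord_sum (v + ind S)\<rfloor> = n + card S"
    using assms by (simp flip: of_nat_add)
  moreover have "cis (pi / 2 * (v + ind S) $ 3) = cis (pi / 2 * v $ 3) * (if 3 \<in> S then \<i> else 1)"
    by (simp add: distrib_left cis_mult[symmetric])
  moreover have "cis (pi / 3 * ((v + ind S) $ 1 - (v + ind S) $ 2)) = cis (pi / 3 * (v $ 1 - v $ 2)) * lw S"
    by (simp add: lw_def cis_mult algebra_simps)
  ultimately show ?thesis
    by (simp add: pt_def lz_def mult.assoc)
qed

lemma frame_cis: "frame (cis t) 1"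
  by (simp add: frame_def)

lemma cis_inner: "(cis t * z) \<bullet> (cis t * z') = z \<bullet> z'"
  using frame.inner_e[OF frame_cis] .

lemma (in frame) pt_inner:
  assumes "coord_sum v = real n"
  shows "emb e s (cis (pi / 2 * v $ 3) * z) (cis (pi / 3 * (v $ 1 - v $ 2)) * w) \<bullet> pt e s h (v + ind S)
    = z \<bullet> lz h n S + w \<bullet> lw S"
  unfolding pt_local[OF assms] emb_inner cis_inner ..

lemma lw_simps:
  "lw {} = 1" "lw {3} = 1" "lw {1,2} = 1" "lw {1,2,3} = 1"
  "lw {1} = Complex (1/2) (sqrt 3 / 2)" "lw {1,3} = Complex (1/2) (sqrt 3 / 2)"
  "lw {2} = Complex (1/2) (- sqrt 3 / 2)" "lw {2,3} = Complex (1/2) (- sqrt 3 / 2)"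
  by (simp_all add: lw_def complex_eq_iff cos_60 sin_60)

lemma lz_simps:
  "lz h n {} = h n" "lz h n {3} = \<i> * h (n + 1)" "lz h n {1,2} = h (n + 2)" "lz h n {1,2,3} = \<i> * h (n + 3)"
  "lz h n {1} = h (n + 1)" "lz h n {1,3} = \<i> * h (n + 2)"
  "lz h n {2} = h (n + 1)" "lz h n {2,3} = \<i> * h (n + 2)"
  by (simp_all add: lz_def numeral_3_eq_3)

section \<open>Growing solutions of the recurrence\<close>

definition eta :: "(nat \<Rightarrow> real) \<Rightarrow> nat \<Rightarrow> complex" where
  "eta w n = Complex (w n) (w (n + 1))"

lemma eta_sel [simp]: "Re (eta w n) = w n" "Im (eta w n) = w (n + 1)"
  by (simp_all add: eta_def)

text \<open>Only \<open>w 0\<close> may fail to be positive, and \<open>w02\<close> and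
  \<open>det0\<close> control it. The conditions on the first terms are inherited by every shifted
  sequence, so layers 0 to 2 stand for any three consecutive layers.\<close>

locale growing = frame +
  fixes w :: "nat \<Rightarrow> real" and b :: real
  assumes rec: "w (n + 2) = 2 * w (n + 1) + b * (2 * w (n + 1) - w n)"
    and b_pos: "0 < b" and w1: "0 < w 1" and d0: "w 0 < 2 * w 1"
    and w02: "0 < w 0 + w 2" and det0: "w 0 * w 2 < w 1 * w 1"
begin

lemma w_d: "0 < w (n + 1) \<and> w n < 2 * w (n + 1)"
proof (induction n)
  case 0
  then show ?case using w1 d0 by simp
next
  case (Suc n)
  then have "0 < b * (2 * w (n + 1) - w n)" using b_pos by simp
  then have "2 * w (n + 1) < w (n + 2)" using rec[of n] by simp
  then show ?case using Suc by (simp add: numeral_2_eq_2)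
qed

lemma w_pos: "0 < n \<Longrightarrow> 0 < w n"
  using w_d[of "n - 1"] by simp

lemma w_d': "w n < 2 * w (n + 1)"
  using w_d by blast

lemma w_double: "2 * w (n + 1) < w (n + 2)"
  using rec[of n] mult_pos_pos[OF b_pos, of "2 * w (n + 1) - w n"] w_d'[of n] by simp

lemma w_two: "w n < w (n + 2)"
  using w_double[of n] w_d'[of n] by simp

lemma w_sum_pos: "0 < w n + w (n + 2)"
proof (cases n)
  case 0
  then show ?thesis using w02 by (simp add: numeral_2_eq_2)
next
  case (Suc m)
  then show ?thesis using w_pos[of n] w_pos[of "n + 2"] by simp
qed

lemma w_mono:
  assumes "0 < n" "n \<le> m"
  shows "w n \<le> w m"
  using assms(2,1)
proof (induction m rule: dec_induct)
  case (step m)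
  then have "0 < m" by simp
  then have "w m \<le> w (Suc m)"
    using w_double[of "m - 1"] w_pos[of m] by (simp add: numeral_2_eq_2)
  then show ?case using step by simp
qed simp

text \<open>The Casorati determinant \<open>w (n + 1) * w (n + 1) - w n * w (n + 2)\<close> of the
  sequence and its shift is multiplied by the positive \<open>b\<close> at every step.\<close>

lemma w_det: "w n * w (n + 2) < w (n + 1) * w (n + 1)"
proof (induction n)
  case 0
  then show ?case using det0 by (simp add: numeral_2_eq_2)
next
  case (Suc n)
  have r1: "w (n + 2) = 2 * w (n + 1) + b * (2 * w (n + 1) - w n)" by (rule rec)
  have r2: "w (n + 3) = 2 * w (n + 2) + b * (2 * w (n + 2) - w (n + 1))"
    using rec[of "n + 1"] by (simp add: eval_nat_numeral)
  have "w (n + 2) * w (n + 2) - w (n + 1) * w (n + 3) = b * (w (n + 1) * w (n + 1) - w n * w (n + 2))"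
    unfolding r2 r1 by algebra
  moreover have "0 < b * (w (n + 1) * w (n + 1) - w n * w (n + 2))"
    using Suc b_pos by simp
  ultimately show ?case by (simp add: eval_nat_numeral)
qed

lemma growing_shift: "growing (cis t * e) s (\<lambda>n. w (n + j)) b"
proof -
  have "frame (cis t * e) s"
    using norm_e s2 by (simp add: frame_def norm_mult)
  moreover have "w (n + 2 + j) = 2 * w (n + 1 + j) + b * (2 * w (n + 1 + j) - w (n + j))" for n
    using rec[of "n + j"] by (simp add: ac_simps)
  ultimately show ?thesis
    unfolding growing_def growing_axioms_def
    using b_pos w_d[of j] w_sum_pos[of j] w_det[of j] by (simp add: add.commute)
qed

abbreviation h :: "nat \<Rightarrow> complex" where "h \<equiv> eta w"

abbreviation dl :: "nat \<Rightarrow> real" where "dl n \<equiv> 2 * w (n + 1) - w n"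

text \<open>With \<open>fw\<close>, the linear forms that vanish on the four vertices of a facet,
  signed so as to be nonnegative on the cube. \<open>t\<close> says whether these vertices are the
  ones that contain the direction \<open>i\<close>.\<close>

definition fz :: "nat \<Rightarrow> 3 \<Rightarrow> bool \<Rightarrow> complex" where
  "fz n i t = (if i = 3 then (if t then Complex (dl (n + 1)) (dl (n + 2)) else Complex (- dl (n + 1)) (dl n))
     else Complex 0 (if t then -1 else 1))"

definition fw :: "nat \<Rightarrow> 3 \<Rightarrow> bool \<Rightarrow> complex" where
  "fw n i t =
    (if i = 3 then (if t then Complex (dl (n + 1) * w (n + 2) - dl (n + 2) * w (n + 1)) 0
        else Complex (dl (n + 1) * w n - dl n * w (n + 1)) 0)
     else (if t then Complex (w (n + 3)) ((2 * w (n + 2) - w (n + 3)) / sqrt 3 * (if i = 1 then 1 else -1))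
        else Complex (- w (n + 1)) ((w (n + 1) - 2 * w (n + 2)) / sqrt 3 * (if i = 2 then 1 else -1))))"

definition facet :: "nat \<Rightarrow> 3 \<Rightarrow> bool \<Rightarrow> complex \<Rightarrow> complex \<Rightarrow> real" where
  "facet n i t z u = fz n i t \<bullet> z + fw n i t \<bullet> u"

lemma sqrt3_cancel: "x / sqrt 3 * (sqrt 3 / 2) = x / 2" "x * sqrt 3 / (sqrt 3 * 2) = x / 2" "sqrt 3 * x / (sqrt 3 * 2) = x / 2"
  by simp_all

lemma facet_values:
  "facet n 3 False (lz h n S) (lw S) = (if 3 \<in> S then dl (n + 1) * (w (n + card S - 1) + w (n + card S + 1)) else 0)"
  "facet n 3 True (lz h n S) (lw S) = (if 3 \<in> S then 0 else dl (n + 1) * (w (n + card S) + w (n + card S + 2)))"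
  "facet n 1 False (lz h n S) (lw S) = (if 1 \<in> S then (if 2 \<in> S then w (n + 3) - w (n + 1) else dl (n + 1)) else 0)"
  "facet n 2 False (lz h n S) (lw S) = (if 2 \<in> S then (if 1 \<in> S then w (n + 3) - w (n + 1) else dl (n + 1)) else 0)"
  "facet n 1 True (lz h n S) (lw S) = (if 1 \<in> S then 0 else (if 2 \<in> S then w (n + 3) - 2 * w (n + 2) else w (n + 3) - w (n + 1)))"
  "facet n 2 True (lz h n S) (lw S) = (if 2 \<in> S then 0 else (if 1 \<in> S then w (n + 3) - 2 * w (n + 2) else w (n + 3) - w (n + 1)))"
proof -
  have r2: "w (Suc (Suc n)) = 2 * w (Suc n) + b * (2 * w (Suc n) - w n)" for n
    using rec[of n] by (simp add: numeral_2_eq_2)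
  \<comment> \<open>Rewriting by \<open>r\<close> leaves only \<open>w n\<close>,
    \<open>w (Suc n)\<close> and \<open>b\<close>, so that the identities for direction 3 become
    polynomial.\<close>
  note r = r2[of "Suc (Suc n)", unfolded r2[of "Suc n"] r2[of n]] r2[of "Suc n", unfolded r2[of n]] r2[of n]
  note e = eval_nat_numeral
  show "facet n 3 False (lz h n S) (lw S) = (if 3 \<in> S then dl (n + 1) * (w (n + card S - 1) + w (n + card S + 1)) else 0)"
    using set3_cases[of S]
    by (elim disjE) (simp_all add: facet_def fz_def fw_def lz_simps lw_simps inner_complex_def e r algebra_simps add_divide_distrib)
  show "facet n 3 True (lz h n S) (lw S) = (if 3 \<in> S then 0 else dl (n + 1) * (w (n + card S) + w (n + card S + 2)))"
    using set3_cases[of S]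
    by (elim disjE) (simp_all add: facet_def fz_def fw_def lz_simps lw_simps inner_complex_def e r algebra_simps add_divide_distrib)
  show "facet n 1 False (lz h n S) (lw S) = (if 1 \<in> S then (if 2 \<in> S then w (n + 3) - w (n + 1) else dl (n + 1)) else 0)"
    using set3_cases[of S]
    by (elim disjE) (simp_all add: facet_def fz_def fw_def lz_simps lw_simps inner_complex_def e sqrt3_cancel field_simps)
  show "facet n 2 False (lz h n S) (lw S) = (if 2 \<in> S then (if 1 \<in> S then w (n + 3) - w (n + 1) else dl (n + 1)) else 0)"
    using set3_cases[of S]
    by (elim disjE) (simp_all add: facet_def fz_def fw_def lz_simps lw_simps inner_complex_def e sqrt3_cancel field_simps)
  show "facet n 1 True (lz h n S) (lw S) = (if 1 \<in> S then 0 else (if 2 \<in> S then w (n + 3) - 2 * w (n + 2) else w (n + 3) - w (n + 1)))"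
    using set3_cases[of S]
    by (elim disjE) (simp_all add: facet_def fz_def fw_def lz_simps lw_simps inner_complex_def e sqrt3_cancel field_simps)
  show "facet n 2 True (lz h n S) (lw S) = (if 2 \<in> S then 0 else (if 1 \<in> S then w (n + 3) - 2 * w (n + 2) else w (n + 3) - w (n + 1)))"
    using set3_cases[of S]
    by (elim disjE) (simp_all add: facet_def fz_def fw_def lz_simps lw_simps inner_complex_def e sqrt3_cancel field_simps)
qed

text \<open>Growth makes every nonzero entry of \<open>facet_values\<close> positive: from index 2
  on each term exceeds twice its predecessor and also the term before that, and
  \<open>w_sum_pos\<close> takes care of the sums in which \<open>w 0\<close> may occur.\<close>

lemma facet_sign:
  "0 \<le> facet n i t (lz h n S) (lw S) \<and> (facet n i t (lz h n S) (lw S) = 0 \<longleftrightarrow> (i \<in> S) = t)"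
proof -
  have p: "0 < dl (n + 1)" "0 < w (n + 3) - w (n + 1)" "0 < w (n + 3) - 2 * w (n + 2)" for n
    using w_d'[of "n + 1"] w_two[of "n + 1"] w_double[of "n + 1"] by (simp_all add: eval_nat_numeral)
  have q: "0 < w (n + m - 1) + w (n + m + 1)" if "0 < m" for m
    using w_sum_pos[of "n + m - 1"] that by (cases m) simp_all
  have "0 < card S" if "3 \<in> S" using that by (auto simp: card_gt_0_iff)
  then have q': "0 < dl (n + 1) * (w (n + card S - 1) + w (n + card S + 1))" if "3 \<in> S"
    using that p(1)[of n] q by (intro mult_pos_pos) auto
  have q'': "0 < dl (n + 1) * (w (n + card S) + w (n + card S + 2))"
    using p(1)[of n] w_sum_pos[of "n + card S"] by (intro mult_pos_pos) auto
  consider "i = 1" | "i = 2" | "i = 3" using exhaust_3[of i] by blast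
  then show ?thesis
  proof cases
    case 1
    then show ?thesis
      using p[of n] facet_values(3,5)[of n S] by (cases t) auto
  next
    case 2
    then show ?thesis
      using p[of n] facet_values(4,6)[of n S] by (cases t) auto
  next
    case 3
    show ?thesis
      unfolding 3 using q' q'' facet_values(1,2)[of n S] by (cases t; cases "3 \<in> S") (simp_all only: if_True if_False; force)+
  qed
qed

end


context growing
begin

section \<open>The cubes of the model are convex\<close>

lemma facet_pt:
  assumes "coord_sum v = real n"
  shows "emb e s (cis (pi / 2 * v $ 3) * fz n i t) (cis (pi / 3 * (v $ 1 - v $ 2)) * fw n i t) \<bullet> pt e s h (v + ind S)
    = facet n i t (lz h n S) (lw S)"
  unfolding pt_inner[OF assms] facet_def ..

lemma Re_lw: "1/2 \<le> Re (lw S)"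
  using set3_cases[of S] by (elim disjE) (simp_all add: lw_simps)

text \<open>For the squares in directions 1 and 2 the weights are those of the recurrence. For all
  but the last of the rectangles that involve direction 3 they come from
  \<open>h m - \<i> * h (m + 1)\<close> being the positive real \<open>w m + w (m + 2)\<close>: the
  gaps \<open>?A\<close>, \<open>?B\<close>, \<open>?C\<close> are multiples of each other. The last
  rectangle is symmetric under exchange of directions 1 and 2, so its weights are all 1.\<close>

lemma rect_relation:
  assumes "(S, S', T, T') \<in> rects"
  shows "\<exists>\<alpha> \<beta> \<gamma> \<delta>. 0 < \<alpha> \<and> 0 < \<beta> \<and> 0 < \<gamma> \<and> 0 < \<delta> \<and>
     \<alpha> *\<^sub>R lz h n S + \<beta> *\<^sub>R lz h n S' = \<gamma> *\<^sub>R lz h n T + \<delta> *\<^sub>R lz h n T' \<and>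
     \<alpha> *\<^sub>R lw S + \<beta> *\<^sub>R lw S' = \<gamma> *\<^sub>R lw T + \<delta> *\<^sub>R lw T'"
proof -
  have r2: "w (Suc (Suc n)) = 2 * w (Suc n) + b * (2 * w (Suc n) - w n)" for n
    using rec[of n] by (simp add: numeral_2_eq_2)
  note r = r2[of "Suc (Suc n)", unfolded r2[of "Suc n"] r2[of n]] r2[of "Suc n", unfolded r2[of n]] r2[of n]
  have p: "0 < w n + w (n + 2)" "0 < w (n + 1) + w (n + 3)" "0 < w (n + 2) + w (n + 4)"
    using w_sum_pos[of n] w_sum_pos[of "n + 1"] w_sum_pos[of "n + 2"] by (simp_all add: eval_nat_numeral)
  note d = lz_simps lw_simps complex_eq_iff eta_sel eval_nat_numeral
  let ?A = "w n + w (n + 2)" and ?B = "w (n + 1) + w (n + 3)" and ?C = "w (n + 2) + w (n + 4)"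
  have 1: ?thesis if "S = {}" "S' = {1,2}" "T = {1}" "T' = {2}"
    unfolding that
    by (rule exI[of _ "b"], rule exI[of _ "1"], rule exI[of _ "1 + b"], rule exI[of _ "1 + b"])
       (use b_pos in \<open>simp add: d, simp add: r algebra_simps\<close>)
  have 2: ?thesis if "S = {3}" "S' = {1,2,3}" "T = {1,3}" "T' = {2,3}"
    unfolding that
    by (rule exI[of _ "b"], rule exI[of _ "1"], rule exI[of _ "1 + b"], rule exI[of _ "1 + b"])
       (use b_pos in \<open>simp add: d, simp add: r algebra_simps\<close>)
  have 3: ?thesis if "S = {}" "S' = {1,3}" "T = {1}" "T' = {3}"
    unfolding that
    by (rule exI[of _ "?B"], rule exI[of _ "?A"], rule exI[of _ "?A"], rule exI[of _ "?B"])
       (use p(1,2) in \<open>simp add: d, (simp add: algebra_simps)?\<close>)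
  have 4: ?thesis if "S = {}" "S' = {2,3}" "T = {2}" "T' = {3}"
    unfolding that
    by (rule exI[of _ "?B"], rule exI[of _ "?A"], rule exI[of _ "?A"], rule exI[of _ "?B"])
       (use p(1,2) in \<open>simp add: d, (simp add: algebra_simps)?\<close>)
  have 5: ?thesis if "S = {1}" "S' = {1,2,3}" "T = {1,2}" "T' = {1,3}"
    unfolding that
    by (rule exI[of _ "?C"], rule exI[of _ "?B"], rule exI[of _ "?B"], rule exI[of _ "?C"])
       (use p(2,3) in \<open>simp add: d, (simp add: algebra_simps)?\<close>)
  have 6: ?thesis if "S = {2}" "S' = {1,2,3}" "T = {1,2}" "T' = {2,3}"
    unfolding that
    by (rule exI[of _ "?C"], rule exI[of _ "?B"], rule exI[of _ "?B"], rule exI[of _ "?C"])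
       (use p(2,3) in \<open>simp add: d, (simp add: algebra_simps)?\<close>)
  have 7: ?thesis if "S = {}" "S' = {1,2,3}" "T = {3}" "T' = {1,2}"
    unfolding that
    by (rule exI[of _ "?C"], rule exI[of _ "?A"], rule exI[of _ "?C"], rule exI[of _ "?A"])
       (use p(1,3) in \<open>simp add: d, (simp add: algebra_simps)?\<close>)
  have 8: ?thesis if "S = {1}" "S' = {2,3}" "T = {2}" "T' = {1,3}"
    unfolding that 
    by (rule exI[of _ "1"], rule exI[of _ "1"], rule exI[of _ "1"], rule exI[of _ "1"])
       (simp add: d, (simp add: algebra_simps)?)
  show ?thesis
    using assms unfolding rects_def insert_iff empty_iff prod.inject simp_thms
    by (elim disjE conjE) (rule 1 2 3 4 5 6 7 8; assumption)+
qed

lemma model_config: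
  assumes "v \<in> int_points" "0 \<le> coord_sum v"
  shows "cube_config (\<lambda>S. pt e s h (v + ind S))"
proof -
  obtain n where n: "coord_sum v = real n"
    using int_points_coord_sum_nat[OF assms] by blast
  let ?c = "cis (pi / 2 * v $ 3)" and ?d = "cis (pi / 3 * (v $ 1 - v $ 2))"
  \<comment> \<open>In the second plane all vertices of a cube lie within pi / 3 of the base vertex,
    whose direction therefore serves as pointing functional.\<close>
  have "0 < emb e s (?c * 0) (?d * 1) \<bullet> pt e s h (v + ind S)" for S
    unfolding pt_inner[OF n] using Re_lw[of S] by (simp add: inner_complex_def)
  then have 1: "\<exists>a. \<forall>S. 0 < a \<bullet> pt e s h (v + ind S)" by blast
  have f: "0 \<le> emb e s (?c * fz n i t) (?d * fw n i t) \<bullet> pt e s h (v + ind S) \<and>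
      (emb e s (?c * fz n i t) (?d * fw n i t) \<bullet> pt e s h (v + ind S) = 0 \<longleftrightarrow> (i \<in> S) = t)" for i t S
    unfolding facet_pt[OF n] by (rule facet_sign)
  have 2: "\<exists>a. \<forall>S. 0 \<le> a \<bullet> pt e s h (v + ind S) \<and> (a \<bullet> pt e s h (v + ind S) = 0 \<longleftrightarrow> i \<notin> S)" for i
    using f[of i False] by (intro exI) auto
  have 3: "\<exists>a. \<forall>S. 0 \<le> a \<bullet> pt e s h (v + ind S) \<and> (a \<bullet> pt e s h (v + ind S) = 0 \<longleftrightarrow> i \<in> S)" for i
    using f[of i True] by (intro exI) auto
  have 4: "\<exists>\<alpha> \<beta> \<gamma> \<delta>. 0 < \<alpha> \<and> 0 < \<beta> \<and> 0 < \<gamma> \<and> 0 < \<delta> \<and>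
        \<alpha> *\<^sub>R pt e s h (v + ind S) + \<beta> *\<^sub>R pt e s h (v + ind S') = \<gamma> *\<^sub>R pt e s h (v + ind T) + \<delta> *\<^sub>R pt e s h (v + ind T')"
    if r: "(S, S', T, T') \<in> rects" for S S' T T'
  proof -
    obtain \<alpha> \<beta> \<gamma> \<delta> where pos: "0 < \<alpha>" "0 < \<beta>" "0 < \<gamma>" "0 < \<delta>"
      and z: "\<alpha> *\<^sub>R lz h n S + \<beta> *\<^sub>R lz h n S' = \<gamma> *\<^sub>R lz h n T + \<delta> *\<^sub>R lz h n T'"
      and u: "\<alpha> *\<^sub>R lw S + \<beta> *\<^sub>R lw S' = \<gamma> *\<^sub>R lw T + \<delta> *\<^sub>R lw T'"
      using rect_relation[OF r, of n] by blast
    have m: "\<alpha> *\<^sub>R pt e s h (v + ind S) + \<beta> *\<^sub>R pt e s h (v + ind S')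
        = emb e s (?c * (\<alpha> *\<^sub>R lz h n S + \<beta> *\<^sub>R lz h n S')) (?d * (\<alpha> *\<^sub>R lw S + \<beta> *\<^sub>R lw S'))" for \<alpha> \<beta> S S'
      unfolding pt_local[OF n] emb_scale emb_add by (simp add: distrib_left)
    show ?thesis
      using pos m z u by metis
  qed
  show ?thesis
    unfolding cube_config_def
  proof (intro conjI allI)
    show "\<forall>(S, S', T, T')\<in>rects. \<exists>\<alpha> \<beta> \<gamma> \<delta>. 0 < \<alpha> \<and> 0 < \<beta> \<and> 0 < \<gamma> \<and> 0 < \<delta> \<and>
        \<alpha> *\<^sub>R pt e s h (v + ind S) + \<beta> *\<^sub>R pt e s h (v + ind S') = \<gamma> *\<^sub>R pt e s h (v + ind T) + \<delta> *\<^sub>R pt e s h (v + ind T')"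
      by (rule ballI) (simp only: split_paired_all split, rule 4)
  qed (rule 1 2 3)+
qed

section \<open>Open cells are disjoint\<close>

definition Yb :: "nat \<Rightarrow> real \<Rightarrow> real \<Rightarrow> real" where
  "Yb n a c = w (n + 1) * a + w (n + 2) * c"

definition Yt :: "nat \<Rightarrow> real \<Rightarrow> real \<Rightarrow> real" where
  "Yt n a c = w (n + 3) * a + w (n + 2) * c"

definition Rt :: "nat \<Rightarrow> real \<Rightarrow> real \<Rightarrow> complex \<Rightarrow> real" where
  "Rt n a c z = dl n * (Im z - w (n + 1) * (a + c / 2)) - dl (n + 1) * (Re z - w n * (a + c / 2))"

definition Lt :: "nat \<Rightarrow> real \<Rightarrow> real \<Rightarrow> complex \<Rightarrow> real" where
  "Lt n a c z = dl (n + 1) * (Re z + w (n + 2) * (a + c / 2)) + dl (n + 2) * (Im z - w (n + 1) * (a + c / 2))"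

text \<open>The section of a cube with base layer \<open>n\<close> by the half-plane \<open>u \<in> \<real>\<^sub>\<ge>\<^sub>0 (a + c \<omega>)\<close> is a
  trapezoid bounded by the lines \<open>Im z = Yb\<close>, \<open>Im z = Yt\<close>, \<open>Rt = 0\<close> and \<open>Lt = 0\<close>.\<close>

definition slab :: "nat \<Rightarrow> real \<Rightarrow> real \<Rightarrow> complex \<Rightarrow> bool" where
  "slab n a c z \<longleftrightarrow> Yb n a c \<le> Im z \<and> Im z < Yt n a c \<and> 0 \<le> Rt n a c z \<and> 0 < Lt n a c z"

text \<open>In sector coordinates \<open>x\<close>, \<open>y\<close> of the second plane the base
  vertex of a cube lies on one of the two boundary rays. \<open>t\<close> records which, so that
  \<open>sides t x y\<close> is always the coordinate along the ray of the base vertex.\<close>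

definition sides :: "bool \<Rightarrow> real \<Rightarrow> real \<Rightarrow> real" where
  "sides t x y = (if t then x else y)"

text \<open>With exchanged coordinates the top of one trapezoid is the bottom of the next,
  \<open>Yt n a c = Yb (n + 1) c a\<close>; the rest is monotonicity of the sequence. The parity
  condition says that the coordinates are exchanged at each step up.\<close>

lemma Yt_le_Yb:
  assumes "0 \<le> x" "0 \<le> y" "n < m" "t = t' \<longleftrightarrow> even (m - n)"
  shows "Yt n (sides t x y) (sides t y x) \<le> Yb m (sides t' x y) (sides t' y x)"
proof -
  have 2: "w (n + 2) \<le> w (m + 1)" "w (n + 3) \<le> w (m + 2)"
    using assms(3) by (auto intro!: w_mono)
  show ?thesis
  proof (cases "t = t'")
    case True
    then have "n + 2 \<le> m" using assms(3,4) by (cases "m = n + 1") auto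
    then have "w (n + 3) \<le> w (m + 1)" "w (n + 2) \<le> w (m + 2)"
      by (auto intro!: w_mono)
    then show ?thesis
      using assms(1,2) True by (auto simp: sides_def Yt_def Yb_def intro!: add_mono mult_right_mono)
  next
    case False
    then have "sides t' x y = sides t y x" "sides t' y x = sides t x y"
      by (auto simp: sides_def)
    moreover have "0 \<le> sides t x y" "0 \<le> sides t y x"
      using assms by (auto simp: sides_def)
    moreover from this have "w (n + 3) * sides t x y \<le> w (m + 2) * sides t x y"
        "w (n + 2) * sides t y x \<le> w (m + 1) * sides t y x"
      using 2 by (auto intro: mult_right_mono)
    ultimately show ?thesis
      unfolding Yt_def Yb_def by simp
  qed
qed

text \<open>The side \<open>Lt = 0\<close> passes through the upper left corner of the trapezoid, at
  height \<open>Yt n a c\<close> and abscissa \<open>- Yt (n + 1) a c\<close>. In this form the sign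
  of \<open>Lt\<close> follows from two separate inequalities; \<open>Rt_corner\<close> does the
  same on the right.\<close>

lemma Lt_corner: "Lt n a c z = dl (n + 1) * (Re z + Yt (n + 1) a c) + dl (n + 2) * (Im z - Yt n a c)"
proof -
  have r2: "w (Suc (Suc n)) = 2 * w (Suc n) + b * (2 * w (Suc n) - w n)" for n
    using rec[of n] by (simp add: numeral_2_eq_2)
  note r = r2[of "Suc (Suc n)", unfolded r2[of "Suc n"] r2[of n]] r2[of "Suc n", unfolded r2[of n]] r2[of n]
  show ?thesis
    by (simp add: Lt_def Yt_def eval_nat_numeral r algebra_simps add_divide_distrib)
qed

lemma Rt_corner:
  "Rt n a c z = dl n * (Im z - Yt n a c) - dl (n + 1) * (Re z - (w (n + 2) * a + w (n + 1) * c))"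
proof -
  have r2: "w (Suc (Suc n)) = 2 * w (Suc n) + b * (2 * w (Suc n) - w n)" for n
    using rec[of n] by (simp add: numeral_2_eq_2)
  note r = r2[of "Suc n", unfolded r2[of n]] r2[of n]
  show ?thesis
    by (simp add: Rt_def Yt_def eval_nat_numeral r algebra_simps add_divide_distrib)
qed

text \<open>Neighbouring cubes in direction 3 share a facet: the right side of a trapezoid is, after
  a quarter turn, the left side of the one a level below. As \<open>slab\<close> is closed on the
  right and open on the left, the common line belongs to only one of the two.\<close>

lemma Rt_Lt: "Rt (n + 1) a c z = - Lt n a c (\<i> * z)"
  by (simp add: Rt_def Lt_def eval_nat_numeral algebra_simps)

lemma slab_Im_pos: "slab n a c z \<Longrightarrow> 0 \<le> a \<Longrightarrow> 0 \<le> c \<Longrightarrow> 0 < a + c \<Longrightarrow> 0 < Im z"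
proof -
  assume "slab n a c z" "0 \<le> a" "0 \<le> c" "0 < a + c"
  moreover have "0 < w (n + 1)" "0 < w (n + 2)" by (auto intro: w_pos)
  ultimately have "0 < Yb n a c"
    unfolding Yb_def by (cases "a = 0") (auto intro: add_pos_nonneg add_nonneg_pos)
  then show ?thesis using \<open>slab n a c z\<close> by (simp add: slab_def)
qed

lemma slab_level_unique:
  assumes "0 \<le> x" "0 \<le> y"
    and "slab n (sides t x y) (sides t y x) z" "slab m (sides t' x y) (sides t' y x) z"
    and "t = t' \<longleftrightarrow> even (n + m)"
  shows "n = m"
proof (rule ccontr)
  assume "n \<noteq> m"
  then consider "n < m" | "m < n" by linarith
  then show False
  proof cases
    case 1
    then have "t = t' \<longleftrightarrow> even (m - n)" using assms(5) by (auto simp: even_diff_nat)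
    from Yt_le_Yb[OF assms(1,2) 1 this] show False
      using assms(3,4) by (simp add: slab_def)
  next
    case 2
    then have "t' = t \<longleftrightarrow> even (n - m)" using assms(5) by (auto simp add: even_diff_nat)
    from Yt_le_Yb[OF assms(1,2) 2 this] show False
      using assms(3,4) by (simp add: slab_def)
  qed
qed

text \<open>For \<open>m = n + 1\<close> the two trapezoids lie on opposite sides of a common line.
  Otherwise one of them lies beyond an upper corner of the other, and \<open>Lt_corner\<close> or
  \<open>Rt_corner\<close> gives the wrong sign.\<close>

lemma slab_quarter_turn:
  assumes xy: "0 \<le> x" "0 \<le> y"
    and S: "slab n (sides t x y) (sides t y x) (\<i> * z)" and S': "slab m (sides t' x y) (sides t' y x) z"
    and par: "t = t' \<longleftrightarrow> odd (n + m)"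
  shows False
proof -
  let ?a = "sides t x y" and ?c = "sides t y x" and ?a' = "sides t' x y" and ?c' = "sides t' y x"
  have nn: "0 \<le> ?a" "0 \<le> ?c" "0 \<le> ?a'" "0 \<le> ?c'"
    using xy by (auto simp: sides_def)
  have dp: "0 < dl n" "0 < dl (n + 1)" "0 < dl (n + 2)" for n
    using w_d'[of n] w_d'[of "n + 1"] w_d'[of "n + 2"] by simp_all
  consider "m = n + 1" | "n + 1 < m" | "m \<le> n" by linarith
  then show False
  proof cases
    case 1
    then have "t = t'" using par by simp
    then show False
      using S S' Rt_Lt[of n ?a ?c z] 1 by (simp add: slab_def)
  next
    case 2
    have "t = t' \<longleftrightarrow> even (m - (n + 1))"
      using par 2 by (auto simp: even_diff_nat)
    from Yt_le_Yb[OF xy 2 this] have "Yt (n + 1) ?a ?c \<le> Im z"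
      using S' by (simp add: slab_def)
    then have "dl (n + 1) * (Re (\<i> * z) + Yt (n + 1) ?a ?c) \<le> 0"
      using dp(2)[of n] by (intro mult_nonneg_nonpos) auto
    moreover have "dl (n + 2) * (Im (\<i> * z) - Yt n ?a ?c) \<le> 0"
      using S dp(3)[of n] by (intro mult_nonneg_nonpos) (auto simp: slab_def)
    ultimately have "Lt n ?a ?c (\<i> * z) \<le> 0"
      unfolding Lt_corner by linarith
    then show False using S by (simp add: slab_def)
  next
    case 3
    have "w (m + 2) * ?a' + w (m + 1) * ?c' \<le> w (n + 1) * ?a + w (n + 2) * ?c"
    proof (cases "t = t'")
      case True
      then have "m < n" using par 3 by (cases "m = n") auto
      then have "w (m + 2) \<le> w (n + 1)" "w (m + 1) \<le> w (n + 2)"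
        by (auto intro!: w_mono)
      then show ?thesis
        using nn True by (auto intro!: add_mono mult_right_mono)
    next
      case False
      then have "?a' = ?c" "?c' = ?a" by (auto simp: sides_def)
      moreover have "w (m + 2) \<le> w (n + 2)" "w (m + 1) \<le> w (n + 1)"
        using 3 by (auto intro!: w_mono)
      ultimately have "w (m + 2) * ?a' \<le> w (n + 2) * ?c" "w (m + 1) * ?c' \<le> w (n + 1) * ?a"
        using nn by (auto intro!: mult_right_mono)
      then show ?thesis by linarith
    qed
    also have "\<dots> \<le> Re z"
      using S by (simp add: slab_def Yb_def)
    finally have "0 \<le> dl (m + 1) * (Re z - (w (m + 2) * ?a' + w (m + 1) * ?c'))"
      using dp(2)[of m] by (intro mult_nonneg_nonneg) auto
    moreover have "dl m * (Im z - Yt m ?a' ?c') < 0"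
      using S' dp(1)[of m] by (intro mult_pos_neg) (auto simp: slab_def)
    ultimately have "Rt m ?a' ?c' z < 0"
      unfolding Rt_corner by linarith
    then show False using S' by (simp add: slab_def)
  qed
qed

end

section \<open>Sixth roots of unity and sectors of the plane\<close>

definition om :: complex where "om = cis (pi / 3)"

lemma om_Complex: "om = Complex (1/2) (sqrt 3 / 2)"
  by (simp add: om_def complex_eq_iff cos_60 sin_60)

lemma cis_int_mod:
  fixes d :: int
  assumes "0 < k"
  shows "cis (2 * pi / real k * of_int d) = cis (2 * pi / real k) ^ nat (d mod int k)"
proof -
  have "real_of_int d = real k * of_int (d div int k) + real (nat (d mod int k))"
  proof -
    have "real (nat (d mod int k)) = real_of_int (d mod int k)" using assms by simp
    then show ?thesis
      by (metis mult_div_mod_eq of_int_add of_int_mult of_int_of_nat_eq)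
  qed
  then have "cis (2 * pi / real k * of_int d) = cis (2 * pi * of_int (d div int k) + real (nat (d mod int k)) * (2 * pi / real k))"
    using assms by (simp add: field_simps del: of_nat_nat)
  also have "\<dots> = cis (2 * pi * of_int (d div int k)) * cis (2 * pi / real k) ^ nat (d mod int k)"
    by (subst Complex.DeMoivre, subst cis_mult, rule refl)
  also have "cis (2 * pi * of_int (d div int k)) = 1"
    by (rule complex_eqI) (simp_all only: cis.sel cos_int_2pin sin_int_2pin one_complex.sel)
  finally show ?thesis by (simp only: mult_1_left)
qed

lemma cis_pi3_int: "cis (pi / 3 * of_int d) = om ^ nat (d mod 6)"
  using cis_int_mod[of 6 d] by (simp add: om_def)

lemma cis_pi2_int: "cis (pi / 2 * of_int d) = \<i> ^ nat (d mod 4)"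
  using cis_int_mod[of 4 d] by simp

text \<open>The sectors are half-open. After a relative turn by a power of \<open>om\<close> other
  than 1, comparing coefficients in the basis 1, \<open>om\<close> produces one of the wrong
  sign.\<close>

lemma sector_unique:
  fixes i j :: int
  assumes eq: "cis (pi / 3 * of_int i) * (of_real x + of_real y * om) = cis (pi / 3 * of_int j) * (of_real x' + of_real y' * om)"
    and pos: "0 < x" "0 \<le> y" "0 < x'" "0 \<le> y'"
  shows "6 dvd (j - i) \<and> x = x' \<and> y = y'"
proof -
  define d where "d = j - i"
  have c: "cis (- (pi / 3 * of_int i)) * cis (pi / 3 * of_int i) = 1"
      "cis (- (pi / 3 * of_int i)) * cis (pi / 3 * of_int j) = cis (pi / 3 * of_int d)"
    by (simp_all add: cis_mult d_def field_simps)
  have "cis (- (pi / 3 * of_int i)) * (cis (pi / 3 * of_int i) * (of_real x + of_real y * om))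
      = cis (- (pi / 3 * of_int i)) * (cis (pi / 3 * of_int j) * (of_real x' + of_real y' * om))"
    unfolding eq ..
  then have "of_real x + of_real y * om = cis (pi / 3 * of_int d) * (of_real x' + of_real y' * om)"
    unfolding mult.assoc[symmetric] c by simp
  then have E: "of_real x + of_real y * om = om ^ nat (d mod 6) * (of_real x' + of_real y' * om)"
    unfolding cis_pi3_int .
  have s: "sqrt 3 * sqrt 3 = (3::real)" "sqrt 3 * (sqrt 3 * t) = 3 * t" for t by (simp_all add: mult.assoc[symmetric])
  have o2: "om ^ 2 = om - 1" by (simp add: om_Complex power2_eq_square complex_eq_iff s)
  have o3: "om ^ 3 = -1" using o2 by (simp add: power3_eq_cube power2_eq_square om_Complex complex_eq_iff s)
  have o4: "om ^ 4 = - om" using o3 by (simp add: eval_nat_numeral)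
  have o5: "om ^ 5 = 1 - om" using o3 o2 by (simp add: eval_nat_numeral)
  have om2: "om * om = om - 1" "om * (om * c) = om * c - c" for c
    using o2 by (simp_all add: power2_eq_square mult.assoc[symmetric] left_diff_distrib)
  have lin: "p = q \<and> r = t" if "of_real p + of_real r * om = of_real q + of_real t * om" for p q r t
    using that by (simp add: om_Complex complex_eq_iff)
  have "0 \<le> d mod 6" "d mod 6 < 6" by simp_all
  then consider "d mod 6 = 0" | "d mod 6 = 1" | "d mod 6 = 2" | "d mod 6 = 3" | "d mod 6 = 4" | "d mod 6 = 5"
    by linarith
  then show ?thesis
  proof cases
    case 1
    then show ?thesis using E lin[of x y x' y'] by (simp add: d_def dvd_eq_mod_eq_0)
  next
    case 2
    then have "of_real x + of_real y * om = of_real (- y') + of_real (x' + y') * om"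
      using E by (simp add:  algebra_simps om2)
    then show ?thesis using lin pos by fastforce
  next
    case 3
    then have "of_real x + of_real y * om = of_real (- x' - y') + of_real x' * om"
      using E by (simp add: power2_eq_square algebra_simps om2)
    then show ?thesis using lin pos by fastforce
  next
    case 4
    then have "of_real x + of_real y * om = of_real (- x') + of_real (- y') * om"
      using E o3 by (simp add: algebra_simps)
    then show ?thesis using lin pos by fastforce
  next
    case 5
    then have "of_real x + of_real y * om = of_real y' + of_real (- x' - y') * om"
      using E by (simp add: o4 algebra_simps om2)
    then show ?thesis using lin pos by fastforce
  next
    case 6
    then have "of_real x + of_real y * om = of_real (x' + y') + of_real (- x') * om"
      using E by (simp add: o5 algebra_simps om2)
    then show ?thesis using lin pos by fastforce
  qed
qed


lemma cnj_om: "cnj om = 1 - om"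
  by (simp add: om_Complex complex_eq_iff)

lemma lw_om: "lw S = (if (1 \<in> S) = (2 \<in> S) then 1 else if 1 \<in> S then om else cnj om)"
  using set3_cases[of S] by (elim disjE) (simp_all add: lw_simps om_Complex complex_eq_iff)

lemma int_pointsE:
  assumes "v \<in> int_points"
  obtains i1 i2 i3 :: int where "v $ 1 = i1" "v $ 2 = i2" "v $ 3 = i3"
proof -
  have "v $ 1 \<in> \<int>" "v $ 2 \<in> \<int>" "v $ 3 \<in> \<int>"
    using assms by (simp_all add: int_points_def)
  then show ?thesis using that by (metis Ints_cases)
qed

section \<open>Open cells in sector coordinates\<close>

context growing
begin

abbreviation cp :: "real^3 \<Rightarrow> 3 set \<Rightarrow> real^5" where
  "cp v \<equiv> \<lambda>S. pt e s h (v + ind S)"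

lemma facet_lower:
  assumes "u = of_real a + of_real c * om"
  shows "facet n 2 False z u = Im z - Yb n a c" "facet n 1 True z u = Yt n a c - Im z"
    "facet n 3 False z u = Rt n a c z" "facet n 3 True z u = Lt n a c z"
  unfolding assms
  by (simp_all add: facet_def fz_def fw_def inner_complex_def om_Complex Yb_def Yt_def Rt_def Lt_def field_simps)

lemma facet_upper:
  assumes "u = of_real a + of_real c * cnj om"
  shows "facet n 1 False z u = Im z - Yb n a c" "facet n 2 True z u = Yt n a c - Im z"
    "facet n 3 False z u = Rt n a c z" "facet n 3 True z u = Lt n a c z"
  unfolding assms
  by (simp_all add: facet_def fz_def fw_def inner_complex_def om_Complex Yb_def Yt_def Rt_def Lt_def field_simps)

text \<open>The total weight is sorted by the three possible directions 1, \<open>om\<close> and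
  \<open>cnj om\<close> of the second component. Since \<open>om + cnj om = 1\<close>, the smaller
  of the last two weights can be traded for the first, which places the point in one of the two
  sectors next to the base ray. The final clauses let \<open>I\<close> be recovered from the
  point.\<close>

lemma ocone_local:
  assumes n: "coord_sum v = real n" and x: "x \<in> ocone (cp v) (Pow I)"
  obtains z p q t where
    "x = emb e s (cis (pi / 2 * v $ 3) * z) (cis (pi / 3 * (v $ 1 - v $ 2 - (if t then 0 else 1))) * (of_real p + of_real q * om))"
    "0 < p" "0 \<le> q" "\<not> t \<longrightarrow> 0 < q" "slab n (sides t p q) (sides t q p) z"
    "3 \<in> I \<longleftrightarrow> Rt n (sides t p q) (sides t q p) z \<noteq> 0"
    "t \<longrightarrow> (2 \<in> I \<longleftrightarrow> Yb n p q < Im z) \<and> (1 \<in> I \<longleftrightarrow> 0 < q \<or> 2 \<in> I)"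
    "\<not> t \<longrightarrow> 2 \<in> I \<and> (1 \<in> I \<longleftrightarrow> Yb n q p < Im z)"
proof -
  obtain c where c: "x = (\<Sum>S\<in>Pow I. c S *\<^sub>R cp v S)" "\<forall>S\<in>Pow I. 0 < c S"
    using x by (auto simp: ocone_def)
  define z where "z = (\<Sum>S\<in>Pow I. c S *\<^sub>R lz h n S)"
  define u where "u = (\<Sum>S\<in>Pow I. c S *\<^sub>R lw S)"
  let ?c = "cis (pi / 2 * v $ 3)" and ?d = "cis (pi / 3 * (v $ 1 - v $ 2))"
  have xe: "x = emb e s (?c * z) (?d * u)"
    unfolding c(1) pt_local[OF n] emb_sum z_def u_def by (simp add: sum_distrib_left)
  have F: "emb e s (?c * fz n i t) (?d * fw n i t) \<bullet> x = facet n i t z u" for i t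
    unfolding xe emb_inner cis_inner facet_def ..
  have G: "0 \<le> emb e s (?c * fz n i t) (?d * fw n i t) \<bullet> cp v S" for i t S
    unfolding facet_pt[OF n] using facet_sign by blast
  have F0: "0 \<le> facet n i t z u" for i t
    using inner_ocone_nonneg[OF x G] unfolding F .
  have Fz: "facet n i t z u = 0 \<longleftrightarrow> (\<forall>S\<in>Pow I. (i \<in> S) = t)" for i t
    using inner_ocone_zero_iff[OF x finite G, of i t] unfolding F facet_pt[OF n] using facet_sign by simp
  have FF: "facet n i False z u = 0 \<longleftrightarrow> i \<notin> I" for i
    unfolding Fz by auto
  \<comment> \<open>No facet with \<open>t = True\<close> is active, since the vertex
    \<open>{}\<close> contains no direction. This is the source of the strict inequalities in
    \<open>slab\<close>.\<close>
  have FT: "0 < facet n i True z u" for i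
  proof -
    have "facet n i True z u \<noteq> 0" unfolding Fz by auto
    then show ?thesis using F0[of i True] by simp
  qed
  define C0 where "C0 = (\<Sum>S\<in>Pow I. if (1 \<in> S) = (2 \<in> S) then c S else 0)"
  define C1 where "C1 = (\<Sum>S\<in>Pow I. if 1 \<in> S \<and> 2 \<notin> S then c S else 0)"
  define C2 where "C2 = (\<Sum>S\<in>Pow I. if 2 \<in> S \<and> 1 \<notin> S then c S else 0)"
  have C0: "0 < C0"
    unfolding C0_def using c(2) by (intro sum_pos2[of _ "{}"]) (auto simp: less_imp_le)
  have C1: "0 \<le> C1" "0 < C1 \<longleftrightarrow> 1 \<in> I"
  proof -
    show "0 \<le> C1" unfolding C1_def using c(2) by (intro sum_nonneg) (auto simp: less_imp_le)
    have "0 < C1" if "1 \<in> I"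
      unfolding C1_def using c(2) that by (intro sum_pos2[of _ "{1}"]) (auto simp: less_imp_le)
    moreover have "C1 = 0" if "1 \<notin> I"
      unfolding C1_def using that by (intro sum.neutral) auto
    ultimately show "0 < C1 \<longleftrightarrow> 1 \<in> I" by auto
  qed
  have C2: "0 \<le> C2" "0 < C2 \<longleftrightarrow> 2 \<in> I"
  proof -
    show "0 \<le> C2" unfolding C2_def using c(2) by (intro sum_nonneg) (auto simp: less_imp_le)
    have "0 < C2" if "2 \<in> I"
      unfolding C2_def using c(2) that by (intro sum_pos2[of _ "{2}"]) (auto simp: less_imp_le)
    moreover have "C2 = 0" if "2 \<notin> I"
      unfolding C2_def using that by (intro sum.neutral) auto
    ultimately show "0 < C2 \<longleftrightarrow> 2 \<in> I" by auto
  qed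
  have u: "u = of_real C0 + of_real C1 * om + of_real C2 * cnj om"
    unfolding u_def C0_def C1_def C2_def of_real_sum sum_distrib_right sum.distrib[symmetric]
    by (intro sum.cong refl) (auto simp: lw_om scaleR_conv_of_real)
  show ?thesis
  proof (cases "C2 \<le> C1")
    case True
    define a d where "a = C0 + C2" and "d = C1 - C2"
    have ua: "u = of_real a + of_real d * om"
      unfolding u cnj_om a_def d_def by (simp add: algebra_simps)
    note f = facet_lower[OF ua, of n z]
    have "0 < d \<or> 2 \<in> I \<longleftrightarrow> 1 \<in> I"
      using C1 C2 True unfolding d_def by linarith
    moreover have "2 \<in> I \<longleftrightarrow> Yb n a d < Im z"
      using FF[of 2] F0[of 2 False] unfolding f by auto
    moreover have "slab n a d z"
      using F0[of 2 False] FT[of 1] F0[of 3 False] FT[of 3] unfolding f slab_def by simp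
    moreover have "3 \<in> I \<longleftrightarrow> Rt n a d z \<noteq> 0"
      using FF[of 3] unfolding f by auto
    moreover have "0 < a" "0 \<le> d"
      using C0 C2 True by (auto simp: a_def d_def)
    moreover have "x = emb e s (?c * z) (cis (pi / 3 * (v $ 1 - v $ 2 - (if True then 0 else 1))) * (of_real a + of_real d * om))"
      unfolding xe ua by simp
    ultimately show ?thesis
      using that[of z True a d] by (simp add: sides_def)
  next
    case False
    define a d where "a = C0 + C1" and "d = C2 - C1"
    have ua: "u = of_real a + of_real d * cnj om"
      unfolding u cnj_om a_def d_def by (simp add: algebra_simps)
    note f = facet_upper[OF ua, of n z]
    have "2 \<in> I"
      using C1 C2 False by linarith
    moreover have "1 \<in> I \<longleftrightarrow> Yb n a d < Im z"
      using FF[of 1] F0[of 1 False] unfolding f by auto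
    moreover have "slab n a d z"
      using F0[of 1 False] FT[of 2] F0[of 3 False] FT[of 3] unfolding f slab_def by simp
    moreover have "3 \<in> I \<longleftrightarrow> Rt n a d z \<noteq> 0"
      using FF[of 3] unfolding f by auto
    moreover have "0 < a" "0 < d"
      using C0 C1 False by (auto simp: a_def d_def)
    \<comment> \<open>Here the base ray is the second ray of the sector, so the sector starts a
      sixth of a turn earlier and the coordinates change places.\<close>
    moreover have "x = emb e s (?c * z) (cis (pi / 3 * (v $ 1 - v $ 2 - (if False then 0 else 1))) * (of_real d + of_real a * om))"
    proof -
      have "om * cnj om = 1" by (simp add: om_Complex complex_eq_iff)
      then have "om * u = of_real d + of_real a * om"
        unfolding ua by (simp add: algebra_simps)
      moreover have "?d = cis (pi / 3 * (v $ 1 - v $ 2 - 1)) * om"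
        unfolding om_def cis_mult by (simp add: algebra_simps)
      ultimately show ?thesis
        unfolding xe by (simp add: mult.assoc)
    qed
    ultimately show ?thesis
      using that[of z False d a] by (simp add: sides_def)
  qed
qed

text \<open>The second component fixes the sector modulo full turns and the coordinates
  \<open>p\<close>, \<open>q\<close> in it; the first components then differ by a power of \<i>. A
  half turn is excluded by positive imaginary parts, quarter turns by
  \<open>slab_quarter_turn\<close>, and without a turn the levels agree. What remains is a lattice
  translation.\<close>

lemma open_cell_unique:
  assumes v: "v \<in> int_points" "coord_sum v = real n" and v': "v' \<in> int_points" "coord_sum v' = real n'"
    and x: "x \<in> ocone (cp v) (Pow I)" "x \<in> ocone (cp v') (Pow I')"
  shows "I = I' \<and> (\<exists>l\<in>Lam. v' = l + v)"
proof -
  obtain i1 i2 i3 :: int where i: "v $ 1 = i1" "v $ 2 = i2" "v $ 3 = i3"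
    using int_pointsE[OF v(1)] .
  obtain j1 j2 j3 :: int where j: "v' $ 1 = j1" "v' $ 2 = j2" "v' $ 3 = j3"
    using int_pointsE[OF v'(1)] .
  have n: "int n = i1 + i2 + i3" and n': "int n' = j1 + j2 + j3"
    using v(2) v'(2) i j by (simp_all add: coord_sum_def)
  obtain z p q t where L:
    "x = emb e s (cis (pi / 2 * v $ 3) * z) (cis (pi / 3 * (v $ 1 - v $ 2 - (if t then 0 else 1))) * (of_real p + of_real q * om))"
    "0 < p" "0 \<le> q" "\<not> t \<longrightarrow> 0 < q" "slab n (sides t p q) (sides t q p) z"
    "3 \<in> I \<longleftrightarrow> Rt n (sides t p q) (sides t q p) z \<noteq> 0"
    "t \<longrightarrow> (2 \<in> I \<longleftrightarrow> Yb n p q < Im z) \<and> (1 \<in> I \<longleftrightarrow> 0 < q \<or> 2 \<in> I)"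
    "\<not> t \<longrightarrow> 2 \<in> I \<and> (1 \<in> I \<longleftrightarrow> Yb n q p < Im z)"
    by (rule ocone_local[OF v(2) x(1)]) (rule that)
  obtain z' p' q' t' where L':
    "x = emb e s (cis (pi / 2 * v' $ 3) * z') (cis (pi / 3 * (v' $ 1 - v' $ 2 - (if t' then 0 else 1))) * (of_real p' + of_real q' * om))"
    "0 < p'" "0 \<le> q'" "\<not> t' \<longrightarrow> 0 < q'" "slab n' (sides t' p' q') (sides t' q' p') z'"
    "3 \<in> I' \<longleftrightarrow> Rt n' (sides t' p' q') (sides t' q' p') z' \<noteq> 0"
    "t' \<longrightarrow> (2 \<in> I' \<longleftrightarrow> Yb n' p' q' < Im z') \<and> (1 \<in> I' \<longleftrightarrow> 0 < q' \<or> 2 \<in> I')"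
    "\<not> t' \<longrightarrow> 2 \<in> I' \<and> (1 \<in> I' \<longleftrightarrow> Yb n' q' p' < Im z')"
    by (rule ocone_local[OF v'(2) x(2)]) (rule that)
  define \<sigma> \<sigma>' where "\<sigma> = i1 - i2 - (if t then 0 else 1)" and "\<sigma>' = j1 - j2 - (if t' then 0 else 1)"
  have sig: "v $ 1 - v $ 2 - (if t then 0 else 1) = real_of_int \<sigma>" "v' $ 1 - v' $ 2 - (if t' then 0 else 1) = real_of_int \<sigma>'"
    by (simp_all add: \<sigma>_def \<sigma>'_def i j)
  have "emb e s (cis (pi / 2 * i3) * z) (cis (pi / 3 * \<sigma>) * (of_real p + of_real q * om))
      = emb e s (cis (pi / 2 * j3) * z') (cis (pi / 3 * \<sigma>') * (of_real p' + of_real q' * om))"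
    using trans[OF L(1)[symmetric] L'(1)] by (simp only: sig i(3) j(3))
  then have Z: "cis (pi / 2 * i3) * z = cis (pi / 2 * j3) * z'"
    and W: "cis (pi / 3 * \<sigma>) * (of_real p + of_real q * om) = cis (pi / 3 * \<sigma>') * (of_real p' + of_real q' * om)"
    by (simp_all add: emb_eq_iff)
  have sec: "6 dvd (\<sigma>' - \<sigma>)" "p = p'" "q = q'"
    using sector_unique[OF W] L L' by auto
  define d where "d = j3 - i3"
  have Zd: "z = \<i> ^ nat (d mod 4) * z'"
  proof -
    have c: "cis (- (pi / 2 * i3)) * cis (pi / 2 * i3) = 1"
      "cis (- (pi / 2 * i3)) * cis (pi / 2 * j3) = cis (pi / 2 * of_int d)"
      by (simp_all add: cis_mult d_def field_simps)
    have "cis (- (pi / 2 * i3)) * (cis (pi / 2 * i3) * z) = cis (- (pi / 2 * i3)) * (cis (pi / 2 * j3) * z')"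
      unfolding Z ..
    then show ?thesis
      unfolding mult.assoc[symmetric] c unfolding cis_pi2_int by simp
  qed
  \<comment> \<open>\<open>n - i3 - \<sigma>\<close> is \<open>2 * i2\<close>, plus 1 if
    \<open>t\<close> is false. This parity ties the position of the base ray to level and
    phase.\<close>
  have par: "t \<longleftrightarrow> even (int n - i3 - \<sigma>)" "t' \<longleftrightarrow> even (int n' - j3 - \<sigma>')"
    unfolding n n' \<sigma>_def \<sigma>'_def by auto
  obtain r where r: "\<sigma>' - \<sigma> = 6 * r" using sec(1) by (auto elim: dvdE)
  have S: "slab n (sides t p q) (sides t q p) z" "slab n' (sides t' p q) (sides t' q p) z'"
    using L(5) L'(5) sec by simp_all
  have pq: "0 \<le> p" "0 \<le> q" using L by auto
  have pos: "0 \<le> sides t p q" "0 \<le> sides t q p" "0 < sides t p q + sides t q p"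
      "0 \<le> sides t' p q" "0 \<le> sides t' q p" "0 < sides t' p q + sides t' q p"
    using L(2,3) by (auto simp: sides_def)
  have Im: "0 < Im z" "0 < Im z'"
    using slab_Im_pos[OF S(1)] slab_Im_pos[OF S(2)] pos by auto
  have par': "(t = t') \<longleftrightarrow> even (int n - int n' + d)"
  proof -
    have gen: "(even A = even (A - B - 6 * r)) \<longleftrightarrow> even B" for A B :: int
      by auto
    have "int n' - j3 - \<sigma>' = (int n - i3 - \<sigma>) - (int n - int n' + d) - 6 * r"
      using r by (simp add: d_def)
    then show ?thesis unfolding par by (simp only: gen)
  qed
  have "0 \<le> d mod 4" "d mod 4 < 4" by simp_all
  then consider "d mod 4 = 0" | "d mod 4 = 1" | "d mod 4 = 2" | "d mod 4 = 3"
    by linarith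
  then show ?thesis
  proof cases
    case 1
    then have zz: "z = z'" using Zd by simp
    obtain k where k: "d = 4 * k" using 1 by (auto simp: mod_eq_0_iff_dvd elim: dvdE)
    have "t = t' \<longleftrightarrow> even (n + n')"
      unfolding par' k by auto
    then have nn: "n = n'"
      using slab_level_unique[OF pq S(1), of n' t'] S(2) zz by simp
    then have tt: "t = t'" unfolding par' k by simp
    have "I = I'"
    proof -
      have "i \<in> I \<longleftrightarrow> i \<in> I'" for i
      proof -
        have "1 \<in> I \<longleftrightarrow> 1 \<in> I'" "2 \<in> I \<longleftrightarrow> 2 \<in> I'" "3 \<in> I \<longleftrightarrow> 3 \<in> I'"
          using L(6-8) L'(6-8) sec(2,3) zz nn tt by (cases t; simp)+
        then show ?thesis using exhaust_3[of i] by auto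
      qed
      then show ?thesis by blast
    qed
    moreover have "v' - v \<in> Lam"
    proof -
      \<comment> \<open>Equal sector modulo 6, equal phase modulo 4 and equal layer determine the
        three coordinates up to the two generators of \<open>Lam\<close>.\<close>
      have e: "j3 = i3 + 4 * k" "j1 - j2 = i1 - i2 + 6 * r" "j1 + j2 + j3 = i1 + i2 + i3"
        using k r tt nn n n' by (auto simp: d_def \<sigma>_def \<sigma>'_def)
      then have "j1 - i1 = 3 * r - 2 * k" "j2 - i2 = - 3 * r - 2 * k" "j3 - i3 = 4 * k"
        by linarith+
      then have "real_of_int j1 - i1 = 3 * r - 2 * k" "real_of_int j2 - i2 = - 3 * r - 2 * k" "real_of_int j3 - i3 = 4 * k"
        by linarith+
      then show ?thesis
        unfolding Lam_iff by (intro exI[of _ r] exI[of _ k]) (simp add: i j)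
    qed
    ultimately show ?thesis by (intro conjI bexI[of _ "v' - v"]) auto
  next
    case 2
    then have "z = \<i> * z'" using Zd by simp
    moreover have "t = t' \<longleftrightarrow> odd (n + n')"
    proof -
      have "odd d" using 2 by presburger
      then show ?thesis unfolding par' by auto
    qed
    ultimately show ?thesis
      using slab_quarter_turn[OF pq, of n t z' n' t'] S by simp
  next
    case 3
    then have "z = - z'" using Zd by (simp add: power2_eq_square)
    then show ?thesis using Im by simp
  next
    case 4
    then have "z = - (\<i> * z')" using Zd by (simp add: power3_eq_cube)
    then have "z' = \<i> * z" by simp
    moreover have "t' = t \<longleftrightarrow> odd (n' + n)"
    proof -
      have "odd d" using 4 by presburger
      then show ?thesis using par' by auto
    qed
    ultimately show ?thesis
      using slab_quarter_turn[OF pq, of n' t' z n t] S by simp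
  qed
qed

end


section \<open>The model complex\<close>

text \<open>The vertices of all representatives enter, so none has to be chosen; by
  \<open>pt_Lam\<close> they give the same points as the vertices of any single one.\<close>

definition mlab :: "complex \<Rightarrow> real \<Rightarrow> (nat \<Rightarrow> complex) \<Rightarrow> labelling" where
  "mlab e s h C = sph_hull (pt e s h ` {v. \<exists>F\<in>C. {v} face_of F})"

lemma mlab_cell: "mlab e s h (orbit (cell v I)) = sph_hull ((\<lambda>S. pt e s h (v + ind S)) ` Pow I)"
proof -
  have "{u. \<exists>F\<in>orbit (cell v I). {u} face_of F} = {l + (v + ind S) | l S. l \<in> Lam \<and> S \<subseteq> I}"
  proof -
    have "(\<exists>F\<in>orbit (cell v I). {u} face_of F) \<longleftrightarrow> (\<exists>l\<in>Lam. \<exists>S\<subseteq>I. u = l + v + ind S)" for u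
      unfolding orbit_cell using cell_vertex_iff by blast
    then show ?thesis by (auto simp only: add.assoc)
  qed
  moreover have "pt e s h ` {l + (v + ind S) | l S. l \<in> Lam \<and> S \<subseteq> I} = (\<lambda>S. pt e s h (v + ind S)) ` Pow I"
  proof
    show "pt e s h ` {l + (v + ind S) | l S. l \<in> Lam \<and> S \<subseteq> I} \<subseteq> (\<lambda>S. pt e s h (v + ind S)) ` Pow I"
      using pt_Lam by auto
    show "(\<lambda>S. pt e s h (v + ind S)) ` Pow I \<subseteq> pt e s h ` {l + (v + ind S) | l S. l \<in> Lam \<and> S \<subseteq> I}"
    proof
      fix x assume "x \<in> (\<lambda>S. pt e s h (v + ind S)) ` Pow I"
      then obtain S where "S \<subseteq> I" "x = pt e s h (0 + (v + ind S))" by auto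
      then show "x \<in> pt e s h ` {l + (v + ind S) | l S. l \<in> Lam \<and> S \<subseteq> I}"
        using Lam_zero by blast
    qed
  qed
  ultimately show ?thesis
    unfolding mlab_def by simp
qed

lemma mlab_empty [simp]: "mlab e s h (orbit {}) = {}"
  by (auto simp: mlab_def orbit_empty face_of_singleton extreme_point_of_def)

lemma sph_hull_mono: "X \<subseteq> Y \<Longrightarrow> sph_hull X \<subseteq> sph_hull Y"
  unfolding sph_hull_def using hull_mono[of X Y convex_cone] by blast

lemma ocone_reindex:
  assumes "x \<in> ocone p (f ` A)" "inj_on f A"
  shows "x \<in> ocone (\<lambda>i. p (f i)) A"
proof -
  obtain c where c: "x = (\<Sum>i\<in>f ` A. c i *\<^sub>R p i)" "\<forall>i\<in>f ` A. 0 < c i"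
    using assms(1) by (auto simp: ocone_def)
  then have "x = (\<Sum>i\<in>A. c (f i) *\<^sub>R p (f i))"
    using assms(2) by (simp add: sum.reindex)
  then show ?thesis using c(2) by (auto simp: ocone_def)
qed

lemma ind_Un: "A \<inter> S = {} \<Longrightarrow> ind (A \<union> S) = ind A + ind S"
  by (auto simp: vec_eq_iff)

lemma ivl_eq_image: "A \<subseteq> B \<Longrightarrow> ivl A B = (\<union>) A ` Pow (B - A)"
proof
  assume "A \<subseteq> B"
  show "ivl A B \<subseteq> (\<union>) A ` Pow (B - A)"
  proof
    fix S assume "S \<in> ivl A B"
    then have "S = A \<union> (S - A)" "S - A \<in> Pow (B - A)" by (auto simp: ivl_def)
    then show "S \<in> (\<union>) A ` Pow (B - A)" by blast
  qed
  show "(\<union>) A ` Pow (B - A) \<subseteq> ivl A B" using \<open>A \<subseteq> B\<close> by (auto simp: ivl_def)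
qed

text \<open>A face of a cell is itself a cell, with base vertex \<open>v + ind A\<close> and
  directions \<open>B - A\<close>. This carries the uniqueness of open cells over to faces.\<close>

lemma ocone_ivl:
  assumes "x \<in> ocone (\<lambda>S. q (v + ind S)) (ivl A B)" "A \<subseteq> B"
  shows "x \<in> ocone (\<lambda>S. q (v + ind A + ind S)) (Pow (B - A))"
proof -
  have "inj_on ((\<union>) A) (Pow (B - A))" by (auto simp: inj_on_def)
  from ocone_reindex[OF assms(1)[unfolded ivl_eq_image[OF assms(2)]] this]
  have "x \<in> ocone (\<lambda>S. q (v + ind (A \<union> S))) (Pow (B - A))" .
  moreover have "ocone (\<lambda>S. q (v + ind (A \<union> S))) (Pow (B - A)) = ocone (\<lambda>S. q (v + ind A + ind S)) (Pow (B - A))"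
  proof -
    have "q (v + ind (A \<union> S)) = q (v + ind A + ind S)" if "S \<in> Pow (B - A)" for S
      using that by (subst ind_Un) (auto simp: add.assoc)
    then have "(\<Sum>S\<in>Pow (B - A). c S *\<^sub>R q (v + ind (A \<union> S))) = (\<Sum>S\<in>Pow (B - A). c S *\<^sub>R q (v + ind A + ind S))" for c
      by (intro sum.cong refl) simp
    then show ?thesis unfolding ocone_def by simp
  qed
  ultimately show ?thesis by simp
qed

lemma image_ivl:
  assumes "A \<subseteq> B"
  shows "(\<lambda>S. q (v + ind S)) ` ivl A B = (\<lambda>S. q (v + ind A + ind S)) ` Pow (B - A)"
  unfolding ivl_eq_image[OF assms] image_image
proof (intro image_cong refl)
  fix S assume "S \<in> Pow (B - A)"
  then show "q (v + ind (A \<union> S)) = q (v + ind A + ind S)"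
    by (subst ind_Un) (auto simp: add.assoc)
qed

lemma strip_cell_face:
  assumes "strip_cell K v I" "A \<subseteq> B" "B \<subseteq> I"
  shows "strip_cell K (v + ind A) (B - A)"
proof -
  have "card A + card (B - A) = card B" "card B \<le> card I"
    using assms by (auto simp: card_Diff_subset card_mono)
  then have "real (card A) + real (card (B - A)) \<le> card I"
    by linarith
  then show ?thesis
    using assms(1) by (auto simp: strip_cell_def int_points_add int_points_ind)
qed

context growing
begin

definition M :: "nat \<Rightarrow> (real^5) set set" where
  "M K = mlab e s h ` torus_complex K"

lemma strip_config: "strip_cell K v I \<Longrightarrow> cube_config (cp v)"
  by (simp add: strip_cell_def model_config)

lemma M_E:
  assumes "P \<in> M K"
  obtains "P = {}" | v I where "strip_cell K v I" "P = sph_hull (cp v ` Pow I)"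
  using assms unfolding M_def torus_complex_eq by (auto simp: mlab_cell)

lemma M_cell: "strip_cell K v I \<Longrightarrow> sph_hull (cp v ` Pow I) \<in> M K"
  unfolding M_def using torus_complexI mlab_cell by (metis imageI)

lemma M_empty: "{} \<in> M K"
  unfolding M_def using orbit_empty_in mlab_empty by (metis imageI)

lemma ivl_unique:
  assumes "strip_cell K v I" "strip_cell K' u J"
    and AB: "A \<subseteq> B" "A' \<subseteq> B'"
    and x: "x \<in> ocone (cp v) (ivl A B)" "x \<in> ocone (cp u) (ivl A' B')"
  shows "B - A = B' - A' \<and> (\<exists>l\<in>Lam. u + ind A' = l + (v + ind A))"
proof -
  have v: "v + ind A \<in> int_points" "u + ind A' \<in> int_points" "0 \<le> coord_sum (v + ind A)" "0 \<le> coord_sum (u + ind A')"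
    using assms(1,2) by (auto simp: strip_cell_def int_points_add int_points_ind)
  show ?thesis
    using open_cell_unique[OF v(1) int_points_coord_sum_nat[OF v(1,3)] v(2) int_points_coord_sum_nat[OF v(2,4)]
        ocone_ivl[OF x(1) AB(1)] ocone_ivl[OF x(2) AB(2)]] .
qed

lemma finite_M: "finite (M K)"
proof -
  \<comment> \<open>Four phases of the first component, six of the second and \<open>K + 1\<close>
    layers bound the number of vertices.\<close>
  let ?Q = "(\<lambda>(a, c, n). emb e s (\<i> ^ a * h n) (om ^ c)) ` ({..<4} \<times> {..<6} \<times> {..K})"
  have "M K \<subseteq> insert {} (sph_hull ` Pow ?Q)"
  proof
    fix P assume "P \<in> M K"
    then show "P \<in> insert {} (sph_hull ` Pow ?Q)"
    proof (cases rule: M_E)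
      case (2 v I)
      have "cp v S \<in> ?Q" if "S \<subseteq> I" for S
      proof -
        have iv: "v + ind S \<in> int_points"
          using 2 by (auto simp: strip_cell_def int_points_add int_points_ind)
        obtain i1 i2 i3 :: int where i: "(v + ind S) $ 1 = i1" "(v + ind S) $ 2 = i2" "(v + ind S) $ 3 = i3"
          using int_pointsE[OF iv] .
        have "card S \<le> card I" using that by (simp add: card_mono)
        then have "coord_sum (v + ind S) \<le> K"
          using 2 by (simp add: strip_cell_def)
        then have N: "nat \<lfloor>coord_sum (v + ind S)\<rfloor> \<le> K" by linarith
        have "cp v S = emb e s (\<i> ^ nat (i3 mod 4) * h (nat \<lfloor>coord_sum (v + ind S)\<rfloor>)) (om ^ nat ((i1 - i2) mod 6))"
          unfolding pt_def i of_int_diff[symmetric] cis_pi2_int cis_pi3_int ..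
        moreover have "nat (i3 mod 4) < 4" "nat ((i1 - i2) mod 6) < 6"
          by (simp_all add: nat_less_iff)
        ultimately show ?thesis
          using N by (intro image_eqI[where x = "(nat (i3 mod 4), nat ((i1 - i2) mod 6), nat \<lfloor>coord_sum (v + ind S)\<rfloor>)"]) auto
      qed
      then have "cp v ` Pow I \<in> Pow ?Q" by blast
      then show ?thesis using 2 by blast
    qed simp
  qed
  then show ?thesis
    by (rule finite_subset) simp
qed

text \<open>By \<open>cube_config_inter_face\<close> it is enough that open faces that meet have the
  same vertices; they agree up to \<open>Lam\<close>, which \<open>pt\<close> does not see.\<close>

lemma M_inter:
  assumes "P \<in> M K" "Q \<in> M K"
  shows "(P \<inter> Q) sph_face_of P"
  using assms(1)
proof (cases rule: M_E)
  case 1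
  then show ?thesis by (auto simp: sph_face_of_def)
next
  case (2 v I)
  note cc = strip_config[OF 2(1)]
  show ?thesis
    using assms(2)
  proof (cases rule: M_E)
    case 1
    then show ?thesis
      unfolding 1 2 Int_empty_right cube_config_faces[OF cc]
      by (intro bexI[of _ "{}"]) (auto simp: subcubes_def)
  next
    case (2 u J)
    show ?thesis
      unfolding 2 \<open>P = sph_hull (cp v ` Pow I)\<close>
    proof (rule cube_config_inter_face[OF cc strip_config[OF 2(1)]])
      fix A B A' B' x
      assume AB: "A \<subseteq> B" "A' \<subseteq> B'" and x: "x \<in> ocone (cp v) (ivl A B)" "x \<in> ocone (cp u) (ivl A' B')"
      obtain l where l: "B - A = B' - A'" "l \<in> Lam" "u + ind A' = l + (v + ind A)"
        using ivl_unique[OF \<open>strip_cell K v I\<close> 2(1) AB x] by blast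
      show "cp v ` ivl A B = cp u ` ivl A' B'"
        unfolding image_ivl[OF AB(1)] image_ivl[OF AB(2)] l(1,3)
        using pt_Lam[OF l(2), of e s h] by (simp add: add.assoc)
    qed
  qed
qed

lemma M_polytopal: "polytopal_complex (M K)"
  unfolding polytopal_complex_def
proof (intro conjI ballI allI impI)
  show "finite (M K)" by (rule finite_M)
  show "sph_polytope P" if "P \<in> M K" for P
    using that
  proof (cases rule: M_E)
    case 1
    then show ?thesis using sph_polytope_image[of "{}" 0 id] by simp
  next
    case (2 v I)
    then show ?thesis using cube_config_polytope strip_config by blast
  qed
  show "F \<in> M K" if PF: "P \<in> M K" "F sph_face_of P" for P F
    using PF(1)
  proof (cases rule: M_E)
    case 1
    then show ?thesis using PF(2) by (auto simp: sph_face_of_def M_empty)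
  next
    case (2 v I)
    then obtain W where W: "W \<in> subcubes I" "F = sph_hull (cp v ` W)"
      using PF(2) cube_config_faces[OF strip_config[OF 2(1)]] by blast
    show ?thesis
    proof (cases "W = {}")
      case True
      then show ?thesis using W M_empty by simp
    next
      case False
      then obtain A B where AB: "A \<subseteq> B" "B \<subseteq> I" "W = ivl A B"
        using W(1) by (auto simp: subcubes_def)
      show ?thesis
        unfolding W(2) AB(3) image_ivl[OF AB(1)]
        by (rule M_cell[OF strip_cell_face[OF 2(1) AB(1,2)]])
    qed
  qed
  show "(P \<inter> Q) sph_face_of P" if "P \<in> M K" "Q \<in> M K" for P Q
    by (rule M_inter[OF that])
  show "(P \<inter> Q) sph_face_of Q" if "P \<in> M K" "Q \<in> M K" for P Q
    using M_inter[OF that(2,1)] by (simp add: Int_commute)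
qed

lemma M_cubical: "cubical_complex (M K)"
  unfolding cubical_complex_def
proof (intro conjI ballI impI M_polytopal)
  fix P assume "P \<in> M K" "P \<noteq> {}"
  then show "sph_cube P"
    by (cases rule: M_E) (auto intro: cube_config_sph_cube strip_config)
qed

lemma mlab_subset_iff:
  assumes "strip_cell K v I" "strip_cell K' u J"
  shows "mlab e s h (orbit (cell v I)) \<subseteq> mlab e s h (orbit (cell u J)) \<longleftrightarrow>
    orbit_le (orbit (cell v I)) (orbit (cell u J))"
proof
  assume L: "mlab e s h (orbit (cell v I)) \<subseteq> mlab e s h (orbit (cell u J))"
  note cv = strip_config[OF assms(1)] and cu = strip_config[OF assms(2)]
  \<comment> \<open>An inner point of the first cell. It lies in some open face of the second cell,
    and uniqueness of open cells identifies that face with the whole first cell.\<close>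
  define x where "x = (\<Sum>S\<in>Pow I. cp v S)"
  have xo: "x \<in> ocone (cp v) (Pow I)"
    unfolding x_def ocone_def by (auto intro!: exI[of _ "\<lambda>_. 1"])
  obtain a where a: "\<forall>S. 0 < a \<bullet> cp v S" using cube_config_pointed[OF cv] by blast
  have "0 < a \<bullet> x"
    unfolding x_def inner_sum_right using a by (intro sum_pos) auto
  then have x0: "x \<noteq> 0" by auto
  have "x /\<^sub>R norm x \<in> sph_hull (cp u ` Pow J)"
    using L unit_mem_sph_hull[OF finite _ x0, of "cp v" "Pow I"] xo ocone_subset_cspan
    unfolding mlab_cell by blast
  then have y: "x /\<^sub>R norm x \<in> cspan (cp u) (Pow J)"
    by (simp add: sph_hull_image)
  have "norm x *\<^sub>R (x /\<^sub>R norm x) \<in> cspan (cp u) (Pow J)"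
    by (rule cspan_scale[OF y]) simp
  moreover have "norm x *\<^sub>R (x /\<^sub>R norm x) = x" using x0 by simp
  ultimately have "x \<in> cspan (cp u) (Pow J)" by (simp only:)
  then obtain A B where AB: "A \<subseteq> B" "B \<subseteq> J" "x \<in> ocone (cp u) (ivl A B)"
    using cube_config_ocone[OF cu _ x0] by blast
  obtain l where l: "I - {} = B - A" "l \<in> Lam" "u + ind A = l + (v + ind {})"
    using ivl_unique[OF assms _ AB(1), of "{}" I x] xo AB(3) by (auto simp: ivl_empty)
  have "v = - l + u + ind A" using l(3) by (simp add: algebra_simps)
  moreover have "A \<inter> I = {}" "A \<union> I \<subseteq> J" using l(1) AB by auto
  ultimately show "orbit_le (orbit (cell v I)) (orbit (cell u J))"
    using orbit_le_cell_iff[of v u I J] assms Lam_uminus[OF l(2)] unfolding strip_cell_def by blast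
next
  assume "orbit_le (orbit (cell v I)) (orbit (cell u J))"
  then obtain l A where A: "l \<in> Lam" "v = l + u + ind A" "A \<inter> I = {}" "A \<union> I \<subseteq> J"
    using orbit_le_cell_iff[of v u I J] assms unfolding strip_cell_def by blast
  have "cp v S = cp u (A \<union> S)" if "S \<subseteq> I" for S
  proof -
    have "v + ind S = l + (u + ind (A \<union> S))"
      using A(2,3) that by (subst ind_Un) (auto simp: add.assoc)
    then show ?thesis using pt_Lam[OF A(1)] by simp
  qed
  moreover have "A \<union> S \<in> Pow J" if "S \<subseteq> I" for S
    using A(4) that by blast
  ultimately have "cp v ` Pow I \<subseteq> cp u ` Pow J" by blast
  then show "mlab e s h (orbit (cell v I)) \<subseteq> mlab e s h (orbit (cell u J))"
    unfolding mlab_cell by (rule sph_hull_mono)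
qed

lemma mlab_cell_nonempty: "strip_cell K v I \<Longrightarrow> mlab e s h (orbit (cell v I)) \<noteq> {}"
  unfolding mlab_cell
  using unit_mem_sph_hull[OF finite cspan_gen[of "Pow I" "{}" "cp v"]] cube_config_nz[OF strip_config, of K v I "{}"] by fastforce

lemma M_is_cct: "is_cct K (M K) (mlab e s h)"
  unfolding is_cct_def
proof (intro conjI ballI M_cubical)
  show le: "mlab e s h C \<subseteq> mlab e s h D \<longleftrightarrow> orbit_le C D"
    if C: "C \<in> torus_complex K" and D: "D \<in> torus_complex K" for C D
  proof -
    consider "C = orbit {}" | v I where "strip_cell K v I" "C = orbit (cell v I)"
      using torus_complexE[OF C] by blast
    then show ?thesis
    proof cases
      case 1
      have "\<exists>F. D = orbit F" using D by (auto simp: torus_complex_def)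
      then show ?thesis using 1 orbit_le_empty by auto
    next
      case (2 v I)
      consider "D = orbit {}" | u J where "strip_cell K u J" "D = orbit (cell u J)"
        using torus_complexE[OF D] by blast
      then show ?thesis
      proof cases
        case 1
        then show ?thesis using 2 mlab_cell_nonempty not_orbit_le_empty by auto
      next
        case (2 u J)
        then show ?thesis using \<open>strip_cell K v I\<close> \<open>C = orbit (cell v I)\<close> mlab_subset_iff by blast
      qed
    qed
  qed
  have "inj_on (mlab e s h) (torus_complex K)"
  proof (rule inj_onI)
    fix C D assume C: "C \<in> torus_complex K" and D: "D \<in> torus_complex K" and eq: "mlab e s h C = mlab e s h D"
    consider "C = orbit {}" | v I where "strip_cell K v I" "C = orbit (cell v I)"
      using torus_complexE[OF C] by blast
    then show "C = D"
    proof cases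
      case 1
      then show ?thesis using D eq mlab_cell_nonempty by (metis mlab_empty torus_complexE)
    next
      case (2 v I)
      then obtain u J where 3: "strip_cell K u J" "D = orbit (cell u J)"
        using D eq mlab_cell_nonempty by (metis mlab_empty torus_complexE)
      have i: "v \<in> int_points" "u \<in> int_points"
        using 2 3 by (auto simp: strip_cell_def)
      have "orbit_le C D" "orbit_le D C"
        using le[OF C D] le[OF D C] eq by auto
      then obtain l A m B where A: "l \<in> Lam" "v = l + u + ind A" "A \<inter> I = {}" "A \<union> I \<subseteq> J"
        and B: "m \<in> Lam" "u = m + v + ind B" "B \<inter> J = {}" "B \<union> J \<subseteq> I"
        using i unfolding 2 3 orbit_le_cell_iff[OF i] orbit_le_cell_iff[OF i(2,1)] by blast
      then have "I = J" "A = {}" by blast+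
      then show ?thesis
        using orbit_cell_eq_iff[OF i, of I J] A 2 3 by auto
    qed
  qed
  then show "bij_betw (mlab e s h) (torus_complex K) (M K)"
    by (simp add: bij_betw_def M_def)
qed

end


section \<open>Symmetry of the model\<close>

lemma sph_hull_isometry:
  assumes "linear g" "\<And>x. norm (g x) = norm x"
  shows "g ` sph_hull X = sph_hull (g ` X)"
  unfolding sph_hull_def convex_cone_hull_linear_image[OF assms(1)] using assms(2) by auto

lemma rot12_props: "linear r12" "norm (r12 x) = norm x" "r12 (emb e s z u) = emb e s (\<i> * z) u"
proof -
  show "linear r12"
    unfolding linear_iff r12_def rot_def by (simp add: vec_eq_iff)
  have "r12 x \<bullet> r12 x = x \<bullet> x"
    by (simp add: r12_def rot_def inner_vec_def sum_5)
  then show "norm (r12 x) = norm x" by (simp add: norm_eq_sqrt_inner)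
  show "r12 (emb e s z u) = emb e s (\<i> * z) u"
    by (simp add: r12_def rot_def vec_eq_iff forall_5 algebra_simps)
qed

lemma rot34_props: "linear r34" "norm (r34 x) = norm x" "r34 (emb e s z u) = emb e s z (om * u)"
proof -
  show "linear r34"
    unfolding linear_iff r34_def rot_def by (simp add: vec_eq_iff algebra_simps)
  have s: "sqrt 3 * sqrt 3 = (3::real)" "sqrt 3 * (sqrt 3 * t) = 3 * t" for t by (simp_all add: mult.assoc[symmetric])
  have "r34 x \<bullet> r34 x = x \<bullet> x"
    by (simp add: r34_def rot_def inner_vec_def sum_5 cos_60 sin_60 algebra_simps s)
  then show "norm (r34 x) = norm x" by (simp add: norm_eq_sqrt_inner)
  show "r34 (emb e s z u) = emb e s z (om * u)"
    by (simp add: r34_def rot_def vec_eq_iff forall_5 om_Complex cos_60 sin_60 algebra_simps)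
qed

lemma refl4_props: "linear refl4" "norm (refl4 x) = norm x" "refl4 (emb e s z u) = emb e s z (cnj u)"
proof -
  show "linear refl4"
    unfolding linear_iff refl4_def by (simp add: vec_eq_iff)
  have "refl4 x \<bullet> refl4 x = x \<bullet> x"
    by (simp add: refl4_def inner_vec_def sum_5)
  then show "norm (refl4 x) = norm x" by (simp add: norm_eq_sqrt_inner)
  show "refl4 (emb e s z u) = emb e s z (cnj u)"
    by (simp add: refl4_def vec_eq_iff forall_5)
qed

lemma r3434_pt: "(r34 \<circ> r34) (pt e s h v) = pt e s h (vector [1, -1, 0] + v)"
proof -
  have "om * (om * cis (pi / 3 * (v $ 1 - v $ 2))) = cis (pi / 3 * ((vector [1, -1, 0] + v) $ 1 - (vector [1, -1, 0] + v) $ 2))"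
    unfolding om_def cis_mult by (rule arg_cong[of _ _ cis]) (simp add: field_simps)
  moreover have "coord_sum (vector [1, -1, 0] + v) = coord_sum v"
    by (simp add: coord_sum_def)
  ultimately show ?thesis
    by (simp add: pt_def rot34_props(3))
qed

lemma r3412_pt: "(r34 \<circ> r12) (pt e s h v) = pt e s h (vector [0, -1, 1] + v)"
proof -
  have "om * cis (pi / 3 * (v $ 1 - v $ 2)) = cis (pi / 3 * ((vector [0, -1, 1] + v) $ 1 - (vector [0, -1, 1] + v) $ 2))"
    unfolding om_def cis_mult by (rule arg_cong[of _ _ cis]) (simp add: field_simps)
  moreover have "\<i> * cis (pi / 2 * v $ 3) = cis (pi / 2 * (vector [0, -1, 1] + v) $ 3)"
    unfolding cis_pi_half[symmetric] cis_mult by (simp add: algebra_simps)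
  moreover have "coord_sum (vector [0, -1, 1] + v) = coord_sum v"
    by (simp add: coord_sum_def)
  ultimately show ?thesis
    by (simp add: pt_def rot34_props(3) rot12_props(3) mult.assoc[symmetric])
qed

lemma swap12_nth [simp]: "swap12 v $ 1 = v $ 2" "swap12 v $ 2 = v $ 1" "swap12 v $ 3 = v $ 3"
  by (simp_all add: swap12_def)

lemma refl4_pt: "refl4 (pt e s h v) = pt e s h (swap12 v)"
proof -
  have "cnj (cis (pi / 3 * (v $ 1 - v $ 2))) = cis (pi / 3 * (swap12 v $ 1 - swap12 v $ 2))"
    by (simp add: cis_cnj algebra_simps)
  moreover have "coord_sum (swap12 v) = coord_sum v"
    by (simp add: coord_sum_def)
  ultimately show ?thesis
    by (simp add: pt_def refl4_props(3))
qed

definition sw :: "3 \<Rightarrow> 3" where "sw i = (if i = 1 then 2 else if i = 2 then 1 else 3)"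

lemma sw_involution [simp]: "sw (sw i) = i"
  using exhaust_3[of i] by (auto simp: sw_def)

lemma sw_image_mem: "1 \<in> sw ` S \<longleftrightarrow> 2 \<in> S" "2 \<in> sw ` S \<longleftrightarrow> 1 \<in> S" "3 \<in> sw ` S \<longleftrightarrow> 3 \<in> S"
proof -
  have "i \<in> sw ` S \<longleftrightarrow> sw i \<in> S" for i
    by (metis image_iff sw_involution)
  then show "1 \<in> sw ` S \<longleftrightarrow> 2 \<in> S" "2 \<in> sw ` S \<longleftrightarrow> 1 \<in> S" "3 \<in> sw ` S \<longleftrightarrow> 3 \<in> S"
    by (simp_all add: sw_def)
qed

lemma sw_sw: "sw ` sw ` S = S"
  by (simp add: set_eq_iff forall_3 sw_image_mem)

lemma card_sw: "card (sw ` S) = card S"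
proof (rule card_image)
  show "inj_on sw S"
    by (rule inj_on_inverseI[of _ sw]) simp
qed

lemma swap12_add: "swap12 (u + v) = swap12 u + swap12 v"
  by (simp add: vec_eq_iff forall_3)

lemma swap12_ind: "swap12 (ind S) = ind (sw ` S)"
  by (simp add: vec_eq_iff forall_3 sw_image_mem)

lemma swap12_swap12 [simp]: "swap12 (swap12 v) = v"
  by (simp add: vec_eq_iff forall_3)

lemma swap12_cell: "swap12 ` cell v I = cell (swap12 v) (sw ` I)"
proof -
  have "swap12 x \<in> cell v I \<longleftrightarrow> x \<in> cell (swap12 v) (sw ` I)" for x
    by (auto simp: cell_def mem_box_cart forall_3 sw_image_mem)
  moreover have "x \<in> swap12 ` cell v I \<longleftrightarrow> swap12 x \<in> cell v I" for x
    by (metis image_iff swap12_swap12)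
  ultimately show ?thesis by blast
qed

lemma swap12_Lam: "l \<in> Lam \<Longrightarrow> swap12 l \<in> Lam"
proof -
  assume "l \<in> Lam"
  then obtain a b where "l $ 1 = 3 * of_int a - 2 * of_int b" "l $ 2 = - 3 * of_int a - 2 * of_int b" "l $ 3 = 4 * of_int b"
    unfolding Lam_iff by blast
  then show ?thesis
    unfolding Lam_iff by (intro exI[of _ "- a"] exI[of _ b]) simp
qed

lemma induced_swap12: "induced swap12 (orbit (cell v I)) = orbit (cell (swap12 v) (sw ` I))"
proof -
  have "induced swap12 (orbit (cell v I)) = {cell (swap12 l + swap12 v) (sw ` I) | l. l \<in> Lam}"
    unfolding induced_def orbit_cell using swap12_cell swap12_add by (auto simp: image_iff) metis
  also have "\<dots> = {cell (l + swap12 v) (sw ` I) | l. l \<in> Lam}"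
    using swap12_Lam swap12_swap12 by (metis (no_types, lifting))
  finally show ?thesis by (simp add: orbit_cell)
qed

lemma induced_empty: "induced f (orbit {}) = orbit {}"
  by (simp add: induced_def orbit_empty)

lemma strip_cell_translate:
  assumes "t \<in> int_points" "coord_sum t = 0"
  shows "strip_cell K (t + v) I \<longleftrightarrow> strip_cell K v I"
proof -
  have "t + v \<in> int_points \<longleftrightarrow> v \<in> int_points"
    using assms(1) int_points_add[of t v] int_points_add[of "t + v" "- t"]
    by (auto simp: int_points_def)
  then show ?thesis using assms(2) by (simp add: strip_cell_def)
qed

lemma strip_cell_swap: "strip_cell K (swap12 v) (sw ` I) \<longleftrightarrow> strip_cell K v I"
  by (auto simp: strip_cell_def int_points_def forall_3 coord_sum_def card_sw)

lemma torus_translate: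
  assumes "t \<in> int_points" "coord_sum t = 0"
  shows "induced ((+) t) ` torus_complex K = torus_complex K"
proof
  show "induced ((+) t) ` torus_complex K \<subseteq> torus_complex K"
  proof clarify
    fix C assume "C \<in> torus_complex K"
    then show "induced ((+) t) C \<in> torus_complex K"
      by (cases rule: torus_complexE)
        (simp_all add: induced_empty orbit_empty_in induced_translate_cell torus_complexI strip_cell_translate[OF assms])
  qed
  have m: "- t \<in> int_points" "coord_sum (- t) = 0" using assms by (auto simp: int_points_def coord_sum_def)
  show "torus_complex K \<subseteq> induced ((+) t) ` torus_complex K"
  proof
    fix C assume "C \<in> torus_complex K"
    then show "C \<in> induced ((+) t) ` torus_complex K"
    proof (cases rule: torus_complexE)
      case 1
      then show ?thesis using induced_empty orbit_empty_in by (metis imageI)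
    next
      case (2 v I)
      then have "strip_cell K (- t + v) I" using strip_cell_translate[OF m] by blast
      moreover have "C = induced ((+) t) (orbit (cell (- t + v) I))"
        using 2 by (simp add: induced_translate_cell)
      ultimately show ?thesis using torus_complexI by blast
    qed
  qed
qed

lemma torus_swap: "induced swap12 ` torus_complex K = torus_complex K"
proof
  show "induced swap12 ` torus_complex K \<subseteq> torus_complex K"
  proof clarify
    fix C assume "C \<in> torus_complex K"
    then show "induced swap12 C \<in> torus_complex K"
      by (cases rule: torus_complexE)
        (simp_all add: induced_empty orbit_empty_in induced_swap12 torus_complexI strip_cell_swap)
  qed
  show "torus_complex K \<subseteq> induced swap12 ` torus_complex K"
  proof
    fix C assume "C \<in> torus_complex K"
    then show "C \<in> induced swap12 ` torus_complex K"
    proof (cases rule: torus_complexE)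
      case 1
      then show ?thesis using induced_empty orbit_empty_in by (metis imageI)
    next
      case (2 v I)
      then have "strip_cell K (swap12 v) (sw ` I)" using strip_cell_swap by blast
      moreover have "C = induced swap12 (orbit (cell (swap12 v) (sw ` I)))"
        using 2 by (simp add: induced_swap12 sw_sw)
      ultimately show ?thesis using torus_complexI by blast
    qed
  qed
qed

lemma corresponds_mlab:
  assumes g: "linear g" "\<And>x. norm (g x) = norm x"
    and f: "induced f ` torus_complex K = torus_complex K"
    and gf: "\<And>v I. strip_cell K v I \<Longrightarrow> g ` mlab e s h (orbit (cell v I)) = mlab e s h (induced f (orbit (cell v I)))"
  shows "corresponds K (mlab e s h ` torus_complex K) (mlab e s h) g f"
proof -
  have *: "g ` mlab e s h C = mlab e s h (induced f C)" if C: "C \<in> torus_complex K" for C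
    using C by (cases rule: torus_complexE) (auto simp: induced_empty gf)
  have "(\<lambda>P. g ` P) ` mlab e s h ` torus_complex K = mlab e s h ` induced f ` torus_complex K"
    unfolding image_image using * by (intro image_cong) auto
  then show ?thesis
    unfolding corresponds_def f using * by (intro conjI ballI)
qed

lemma corresponds_translate:
  assumes g: "linear g" "\<And>x. norm (g x) = norm x"
    and t: "t \<in> int_points" "coord_sum t = 0" and gp: "\<And>v. g (pt e s h v) = pt e s h (t + v)"
  shows "corresponds K (mlab e s h ` torus_complex K) (mlab e s h) g ((+) t)"
proof (rule corresponds_mlab[OF g torus_translate[OF t]])
  fix v I
  show "g ` mlab e s h (orbit (cell v I)) = mlab e s h (induced ((+) t) (orbit (cell v I)))"
    unfolding induced_translate_cell mlab_cell sph_hull_isometry[OF g] image_image gp by (simp add: add.assoc)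
qed

lemma corresponds_swap: "corresponds K (mlab e s h ` torus_complex K) (mlab e s h) refl4 swap12"
proof (rule corresponds_mlab[OF refl4_props(1,2) torus_swap])
  fix v I
  have "(\<lambda>S. pt e s h (swap12 (v + ind S))) ` Pow I = (\<lambda>S. pt e s h (swap12 v + ind S)) ` Pow (sw ` I)"
  proof
    show "(\<lambda>S. pt e s h (swap12 (v + ind S))) ` Pow I \<subseteq> (\<lambda>S. pt e s h (swap12 v + ind S)) ` Pow (sw ` I)"
      by (auto simp: swap12_add swap12_ind)
    show "(\<lambda>S. pt e s h (swap12 v + ind S)) ` Pow (sw ` I) \<subseteq> (\<lambda>S. pt e s h (swap12 (v + ind S))) ` Pow I"
    proof
      fix x assume "x \<in> (\<lambda>S. pt e s h (swap12 v + ind S)) ` Pow (sw ` I)"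
      then obtain S where "S \<subseteq> sw ` I" "x = pt e s h (swap12 v + ind S)" by blast
      then have "sw ` S \<subseteq> I" "x = pt e s h (swap12 (v + ind (sw ` S)))"
        using image_mono[of S "sw ` I" sw] by (auto simp: swap12_add swap12_ind sw_sw)
      then show "x \<in> (\<lambda>S. pt e s h (swap12 (v + ind S))) ` Pow I" by blast
    qed
  qed
  then show "refl4 ` mlab e s h (orbit (cell v I)) = mlab e s h (induced swap12 (orbit (cell v I)))"
    unfolding induced_swap12 mlab_cell sph_hull_isometry[OF refl4_props(1,2)] image_image refl4_pt by simp
qed

lemma tvecs: "vector [1, -1, 0] \<in> int_points" "coord_sum (vector [1, -1, 0]) = 0"
   "vector [0, -1, 1] \<in> int_points" "coord_sum (vector [0, -1, 1]) = 0"
  by (auto simp: int_points_def forall_3 coord_sum_def)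

lemma (in growing) M_symmetric: "symmetric_cct K (M K) (mlab e s h)"
  unfolding symmetric_cct_def
proof (intro conjI M_is_cct)
  show "corresponds K (M K) (mlab e s h) refl4 swap12"
    unfolding M_def by (rule corresponds_swap)
  show "corresponds K (M K) (mlab e s h) (r34 \<circ> r34) ((+) (vector [1, -1, 0]))"
    unfolding M_def
    by (rule corresponds_translate[OF linear_compose[OF rot34_props(1) rot34_props(1)] _ tvecs(1,2) r3434_pt])
       (simp add: rot34_props(2))
  show "corresponds K (M K) (mlab e s h) (r34 \<circ> r12) ((+) (vector [0, -1, 1]))"
    unfolding M_def
    by (rule corresponds_translate[OF linear_compose[OF rot12_props(1) rot34_props(1)] _ tvecs(3,4) r3412_pt])
       (simp add: rot34_props(2) rot12_props(2))
qed

text \<open>Serves to replace a shifted labelling by the labelling of a shifted model, with which it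
  agrees only on the torus complex.\<close>

lemma symmetric_cct_cong:
  assumes "symmetric_cct K T \<phi>" "\<And>C. C \<in> torus_complex K \<Longrightarrow> \<phi>' C = \<phi> C"
  shows "symmetric_cct K T \<phi>'"
proof -
  have c: "corresponds K T \<phi>' g f" if "corresponds K T \<phi> g f" "induced f ` torus_complex K = torus_complex K" for g f
    using that assms(2) unfolding corresponds_def by (metis imageI)
  have "is_cct K T \<phi>'"
    using assms unfolding symmetric_cct_def is_cct_def by (metis bij_betw_cong)
  moreover have "corresponds K T \<phi>' refl4 swap12"
    using assms(1) c[OF _ torus_swap] unfolding symmetric_cct_def by blast
  moreover have "corresponds K T \<phi>' (r34 \<circ> r34) ((+) (vector [1, -1, 0]))"
    using assms(1) c[OF _ torus_translate[OF tvecs(1,2)]] unfolding symmetric_cct_def by blast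
  moreover have "corresponds K T \<phi>' (r34 \<circ> r12) ((+) (vector [0, -1, 1]))"
    using assms(1) c[OF _ torus_translate[OF tvecs(3,4)]] unfolding symmetric_cct_def by blast
  ultimately show ?thesis
    unfolding symmetric_cct_def by (intro conjI)
qed

section \<open>Restriction to consecutive layers\<close>

lemma sph_hull_single:
  assumes p: "p \<noteq> 0"
  shows "sph_hull {p} = {p /\<^sub>R norm p}"
proof -
  have e: "sph_hull {p} = cspan id {p} \<inter> sphere 0 1"
    using sph_hull_image[of "{p}" id] by simp
  have 1: "x = p /\<^sub>R norm p" if "x \<in> cspan id {p}" "norm x = 1" for x
  proof -
    from that(1) obtain f where f: "x = (\<Sum>i\<in>{p}. f i *\<^sub>R id i)" "\<forall>i\<in>{p}. 0 \<le> f i"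
      unfolding cspan_def by blast
    define c where "c = f p"
    have c: "x = c *\<^sub>R p" "0 \<le> c" using f by (simp_all add: c_def)
    then have "c * norm p = 1" using that(2) by simp
    then have "c = inverse (norm p)" using p by (simp add: field_simps)
    then show ?thesis using c(1) by (simp only:)
  qed
  have 2: "p /\<^sub>R norm p \<in> sph_hull {p}"
    using unit_mem_sph_hull[of "{p}" p id] cspan_gen[of "{p}" p id] p by simp
  show ?thesis
  proof (intro subset_antisym subsetI)
    fix x assume "x \<in> sph_hull {p}"
    then have "x \<in> cspan id {p}" "norm x = 1" by (simp_all add: e)
    then show "x \<in> {p /\<^sub>R norm p}" using 1 by blast
  qed (use 2 in blast)
qed

context growing
begin

definition nv :: "real^3 \<Rightarrow> real^5" where
  "nv v = pt e s h v /\<^sub>R norm (pt e s h v)"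

lemma pt_nz: "v \<in> int_points \<Longrightarrow> 0 \<le> coord_sum v \<Longrightarrow> pt e s h v \<noteq> 0"
  using cube_config_nz[OF model_config, of v "{}"] by simp

lemma mlab_vertex: "v \<in> int_points \<Longrightarrow> 0 \<le> coord_sum v \<Longrightarrow> mlab e s h (orbit {v}) = {nv v}"
  using mlab_cell[of e s h v "{}"] sph_hull_single[OF pt_nz] by (simp add: nv_def)

text \<open>A vertex is an open cell without directions, so the uniqueness of open cells applies to
  it.\<close>

lemma nv_eqD:
  assumes "v \<in> int_points" "0 \<le> coord_sum v" "u \<in> int_points" "0 \<le> coord_sum u" "nv v = nv u"
  shows "\<exists>l\<in>Lam. u = l + v"
proof -
  have o: "pt e s h v /\<^sub>R norm (pt e s h v) \<in> ocone (cp v) (Pow {})" if "v \<in> int_points" "0 \<le> coord_sum v" for v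
  proof -
    have "pt e s h v \<in> ocone (cp v) (Pow {})"
      by (auto simp: ocone_def intro!: exI[of _ "\<lambda>_. 1"])
    then show ?thesis using pt_nz[OF that] by (intro ocone_scale) auto
  qed
  show ?thesis
    using open_cell_unique[OF assms(1) int_points_coord_sum_nat[OF assms(1,2)] assms(3) int_points_coord_sum_nat[OF assms(3,4)]
       o[OF assms(1,2)]] o[OF assms(3,4)] assms(5) unfolding nv_def by metis
qed

lemma nv_layer_iff:
  assumes "v \<in> int_points" "0 \<le> coord_sum v"
  shows "nv v \<in> layer (mlab e s h) l \<longleftrightarrow> coord_sum v = real l"
proof
  assume "nv v \<in> layer (mlab e s h) l"
  then obtain u where u: "u \<in> int_points" "coord_sum u = real l" "nv v = nv u"
    using mlab_vertex by (auto simp: layer_def)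
  then show "coord_sum v = real l"
    using nv_eqD[OF assms u(1) _ u(3)] coord_sum_Lam by auto
next
  assume "coord_sum v = real l"
  then show "nv v \<in> layer (mlab e s h) l"
    using assms mlab_vertex unfolding layer_def by blast
qed

lemma cell_vertex_face:
  assumes "strip_cell K v I"
  shows "{x} sph_face_of sph_hull (cp v ` Pow I) \<longleftrightarrow> (\<exists>S\<subseteq>I. x = nv (v + ind S))"
proof
  assume "{x} sph_face_of sph_hull (cp v ` Pow I)"
  then obtain W where W: "W \<in> subcubes I" "{x} = sph_hull (cp v ` W)"
    using cube_config_faces[OF strip_config[OF assms]] by blast
  then have "W \<noteq> {}" by auto
  then obtain S where S: "S \<in> W" by blast
  then have "sph_hull (cp v ` {S}) \<subseteq> {x}"
    unfolding W(2) by (intro sph_hull_mono) auto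
  moreover have "sph_hull (cp v ` {S}) = {nv (v + ind S)}"
    using sph_hull_single[OF cube_config_nz[OF strip_config[OF assms]]] by (simp add: nv_def)
  ultimately show "\<exists>S\<subseteq>I. x = nv (v + ind S)"
    using S subcubes_Pow[OF W(1)] by blast
next
  assume "\<exists>S\<subseteq>I. x = nv (v + ind S)"
  then obtain S where S: "S \<subseteq> I" "x = nv (v + ind S)" by blast
  have "{x} = sph_hull (cp v ` {S})"
    using sph_hull_single[OF cube_config_nz[OF strip_config[OF assms]]] S by (simp add: nv_def)
  moreover have "{S} = ivl S S" by (auto simp: ivl_def)
  then have "{S} \<in> subcubes I" using S(1) unfolding subcubes_def by (intro CollectI disjI2 exI[of _ S]) auto
  ultimately show "{x} sph_face_of sph_hull (cp v ` Pow I)"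
    using cube_config_faces[OF strip_config[OF assms]] by blast
qed

lemma restr_M:
  assumes "m \<le> K"
  shows "restr (M K) (mlab e s h) {j..m} =
    insert {} {sph_hull (cp v ` Pow I) | v I. strip_cell m v I \<and> real j \<le> coord_sum v}"
proof -
  have cell: "(\<forall>x. {x} sph_face_of sph_hull (cp v ` Pow I) \<longrightarrow> x \<in> (\<Union>l\<in>{j..m}. layer (mlab e s h) l)) \<longleftrightarrow>
      strip_cell m v I \<and> real j \<le> coord_sum v" (is "?L \<longleftrightarrow> ?R") if v: "strip_cell K v I" for v I
  proof -
    have vi: "v + ind S \<in> int_points" "0 \<le> coord_sum (v + ind S)" for S
      using v by (auto simp: strip_cell_def int_points_add int_points_ind)
    have nl: "nv (v + ind S) \<in> (\<Union>l\<in>{j..m}. layer (mlab e s h) l) \<longleftrightarrow> j \<le> coord_sum (v + ind S) \<and> coord_sum (v + ind S) \<le> m" for S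
    proof -
      obtain n where n: "coord_sum (v + ind S) = real n" using int_points_coord_sum_nat[OF vi] by blast
      show ?thesis using nv_layer_iff[OF vi, of S] unfolding n by auto
    qed
    show ?thesis
    proof
      assume ?L
      then have "nv (v + ind S) \<in> (\<Union>l\<in>{j..m}. layer (mlab e s h) l)" if "S \<subseteq> I" for S
        using that cell_vertex_face[OF v] by blast
      \<comment> \<open>The lowest and the highest vertex of the cell suffice.\<close>
      from this[of "{}"] this[of I] show ?R
        unfolding nl using v by (simp add: strip_cell_def)
    next
      assume R: ?R
      have "real (card S) \<le> card I" if "S \<subseteq> I" for S using that by (simp add: card_mono)
      then have "j \<le> coord_sum (v + ind S) \<and> coord_sum (v + ind S) \<le> m" if "S \<subseteq> I" for S
        using R that unfolding strip_cell_def coord_sum_add coord_sum_ind by (smt (verit) of_nat_0_le_iff)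
      then show ?L
        unfolding cell_vertex_face[OF v] using nl by blast
    qed
  qed
  have mK: "strip_cell K v I" if "strip_cell m v I" for v I
    using that assms by (simp add: strip_cell_def)
  have emp: "\<not> ({x} sph_face_of {})" for x by (auto simp: sph_face_of_def)
  show ?thesis
  proof
    show "restr (M K) (mlab e s h) {j..m} \<subseteq> insert {} {sph_hull (cp v ` Pow I) | v I. strip_cell m v I \<and> real j \<le> coord_sum v}"
    proof
      fix P assume "P \<in> restr (M K) (mlab e s h) {j..m}"
      then have P: "P \<in> M K" "\<forall>x. {x} sph_face_of P \<longrightarrow> x \<in> (\<Union>l\<in>{j..m}. layer (mlab e s h) l)"
        by (auto simp: restr_def induced_subcomplex_def)
      from P(1) show "P \<in> insert {} {sph_hull (cp v ` Pow I) | v I. strip_cell m v I \<and> real j \<le> coord_sum v}"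
      proof (cases rule: M_E)
        case (2 v I)
        then have "strip_cell m v I \<and> real j \<le> coord_sum v" using P(2) cell[OF 2(1)] by simp
        then show ?thesis using 2(2) by blast
      qed simp
    qed
    show "insert {} {sph_hull (cp v ` Pow I) | v I. strip_cell m v I \<and> real j \<le> coord_sum v} \<subseteq> restr (M K) (mlab e s h) {j..m}"
    proof
      fix P assume "P \<in> insert {} {sph_hull (cp v ` Pow I) | v I. strip_cell m v I \<and> real j \<le> coord_sum v}"
      then consider "P = {}" | v I where "strip_cell m v I" "real j \<le> coord_sum v" "P = sph_hull (cp v ` Pow I)"
        by blast
      then show "P \<in> restr (M K) (mlab e s h) {j..m}"
      proof cases
        case 1
        then show ?thesis using M_empty emp by (simp add: restr_def induced_subcomplex_def)
      next
        case (2 v I)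
        then have "\<forall>x. {x} sph_face_of P \<longrightarrow> x \<in> (\<Union>l\<in>{j..m}. layer (mlab e s h) l)"
          using cell[OF mK[OF 2(1)]] by simp
        then show ?thesis
          using M_cell[OF mK[OF 2(1)]] 2(3) by (simp add: restr_def induced_subcomplex_def)
      qed
    qed
  qed
qed

text \<open>\<open>shift_lab\<close> moves along the third axis, each step of which turns the first
  component; hence the rotation of the frame by \<open>j\<close> quarter turns.\<close>

lemma pt_shift:
  assumes "0 \<le> coord_sum v"
  shows "pt (cis (pi / 2 * real j) * e) s (eta (\<lambda>n. w (n + j))) v = pt e s h (vector [0, 0, real j] + v)"
proof -
  have "nat \<lfloor>coord_sum (vector [0, 0, real j] + v)\<rfloor> = nat \<lfloor>coord_sum v\<rfloor> + j"
  proof -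
    have "coord_sum (vector [0, 0, real j] + v) = coord_sum v + of_int (int j)"
      by (simp add: coord_sum_def)
    then show ?thesis using assms by (simp only: floor_add_int[symmetric]) (simp add: nat_add_distrib)
  qed
  moreover have "emb (cis (pi / 2 * real j) * e) s z u = emb e s (cis (pi / 2 * real j) * z) u" for z u
  proof -
    have "cis (pi / 2 * real j) * e * z = e * (cis (pi / 2 * real j) * z)" by (simp only: mult_ac)
    then show ?thesis by (simp only: emb_def)
  qed
  moreover have "cis (pi / 2 * real j) * cis (pi / 2 * v $ 3) = cis (pi / 2 * (vector [0, 0, real j] + v) $ 3)"
    unfolding cis_mult by (simp add: algebra_simps)
  moreover have "eta (\<lambda>n. w (n + j)) n = h (n + j)" for n
    by (simp add: eta_def)
  ultimately show ?thesis
    by (simp add: pt_def mult.assoc[symmetric])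
qed

lemma shift_vec: "vector [0, 0, real j] \<in> int_points" "coord_sum (vector [0, 0, real j]) = real j"
  by (auto simp: int_points_def forall_3 coord_sum_def)

lemma mlab_shift:
  assumes "C \<in> torus_complex m"
  shows "shift_lab j (mlab e s h) C = mlab (cis (pi / 2 * real j) * e) s (eta (\<lambda>n. w (n + j))) C"
  using assms
proof (cases rule: torus_complexE)
  case 1
  then show ?thesis by (simp add: shift_lab_def induced_empty)
next
  case (2 v I)
  have "pt (cis (pi / 2 * real j) * e) s (eta (\<lambda>n. w (n + j))) (v + ind S) = pt e s h (vector [0, 0, real j] + v + ind S)" for S
    using pt_shift[of "v + ind S" j] 2(1) by (simp add: strip_cell_def add.assoc)
  then show ?thesis
    unfolding shift_lab_def 2(2) induced_translate_cell mlab_cell by simp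
qed

lemma restr_shift:
  assumes "j + m \<le> K"
  shows "restr (M K) (mlab e s h) {j..j + m} = mlab (cis (pi / 2 * real j) * e) s (eta (\<lambda>n. w (n + j))) ` torus_complex m"
proof -
  let ?t = "vector [0, 0, real j] :: real^3"
  have mt: "- ?t \<in> int_points" by (auto simp: int_points_def forall_3)
  have "{sph_hull (cp v ` Pow I) | v I. strip_cell (j + m) v I \<and> real j \<le> coord_sum v} =
      {sph_hull (cp (?t + v) ` Pow I) | v I. strip_cell m v I}"
  proof -
    have 1: "strip_cell (j + m) (?t + v) I \<and> real j \<le> coord_sum (?t + v)" if "strip_cell m v I" for v I
      using that shift_vec[of j] by (auto simp: strip_cell_def int_points_add)
    have 2: "strip_cell m (- ?t + v) I" if "strip_cell (j + m) v I" "real j \<le> coord_sum v" for v I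
      using that shift_vec[of j] int_points_add[OF mt, of v] by (auto simp: strip_cell_def coord_sum_def)
    have 3: "v = ?t + (- ?t + v)" for v by simp
    show ?thesis
    proof (intro subset_antisym subsetI)
      fix P assume "P \<in> {sph_hull (cp v ` Pow I) | v I. strip_cell (j + m) v I \<and> real j \<le> coord_sum v}"
      then obtain v I where "P = sph_hull (cp v ` Pow I)" "strip_cell (j + m) v I" "real j \<le> coord_sum v" by blast
      then show "P \<in> {sph_hull (cp (?t + v) ` Pow I) | v I. strip_cell m v I}"
        using 2 3[of v] by (intro CollectI exI[of _ "- ?t + v"] exI[of _ I]) auto
    next
      fix P assume "P \<in> {sph_hull (cp (?t + v) ` Pow I) | v I. strip_cell m v I}"
      then show "P \<in> {sph_hull (cp v ` Pow I) | v I. strip_cell (j + m) v I \<and> real j \<le> coord_sum v}"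
        using 1 by blast
    qed
  qed
  moreover have "mlab (cis (pi / 2 * real j) * e) s (eta (\<lambda>n. w (n + j))) (orbit (cell v I)) = sph_hull (cp (?t + v) ` Pow I)"
    if "strip_cell m v I" for v I
    using mlab_shift[OF torus_complexI[OF that], of j] unfolding shift_lab_def induced_translate_cell mlab_cell by simp
  then have "mlab (cis (pi / 2 * real j) * e) s (eta (\<lambda>n. w (n + j))) ` torus_complex m =
      insert {} {sph_hull (cp (?t + v) ` Pow I) | v I. strip_cell m v I}"
    unfolding torus_complex_eq by (auto simp: image_iff) metis+
  ultimately show ?thesis
    unfolding restr_M[OF assms] by simp
qed

end


section \<open>Transversality\<close>

context frame
begin

lemma part12_emb: "part12 (emb e s z u) = emb e s z 0"
  by (simp add: part12_def vec_eq_iff forall_5)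

lemma part34_emb: "part34 (emb e s z u) = emb e s 0 u"
  by (simp add: part34_def vec_eq_iff forall_5)

lemma norm_emb_z: "norm (emb e s z 0) = norm z" and norm_emb_u: "norm (emb e s 0 u) = norm u"
  by (simp_all add: emb_norm)

lemma proj1_emb: "proj1 (emb e s z u) = emb e s (z /\<^sub>R (sqrt 2 * norm z)) (u /\<^sub>R (sqrt 2 * norm u))"
  unfolding proj1_def part12_emb part34_emb norm_emb_z norm_emb_u emb_scale emb_add by simp

text \<open>\<open>proj1\<close> normalises the two components separately, so it forgets one
  positive factor in each and nothing else.\<close>

lemma proj1_eqD:
  assumes "proj1 (emb e s z u) = proj1 (emb e s z' u')" "z \<noteq> 0" "z' \<noteq> 0" "u \<noteq> 0" "u' \<noteq> 0"
  obtains a b where "0 < a" "0 < b" "z = a *\<^sub>R z'" "u = b *\<^sub>R u'"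
proof -
  have "z /\<^sub>R (sqrt 2 * norm z) = z' /\<^sub>R (sqrt 2 * norm z')" "u /\<^sub>R (sqrt 2 * norm u) = u' /\<^sub>R (sqrt 2 * norm u')"
    using assms(1) unfolding proj1_emb emb_eq_iff by auto
  moreover have "x = (c / c') *\<^sub>R y" if "x /\<^sub>R c = y /\<^sub>R c'" "c \<noteq> 0" for x y :: complex and c c' :: real
  proof -
    have "x = c *\<^sub>R (x /\<^sub>R c)" using that(2) by simp
    also have "\<dots> = (c / c') *\<^sub>R y" unfolding that(1) by (simp add: divide_inverse)
    finally show ?thesis .
  qed
  ultimately have "z = ((sqrt 2 * norm z) / (sqrt 2 * norm z')) *\<^sub>R z'" "u = ((sqrt 2 * norm u) / (sqrt 2 * norm u')) *\<^sub>R u'"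
    using assms(2,4) by (metis mult_eq_0_iff norm_eq_zero real_sqrt_eq_zero_cancel_iff zero_neq_numeral)+
  moreover have "0 < (sqrt 2 * norm z) / (sqrt 2 * norm z')" "0 < (sqrt 2 * norm u) / (sqrt 2 * norm u')"
    using assms(2-5) by simp_all
  ultimately show ?thesis using that by blast
qed

lemma proj1_emb_scale: "0 < a \<Longrightarrow> 0 < b \<Longrightarrow> proj1 (emb e s (a *\<^sub>R z) (b *\<^sub>R u)) = proj1 (emb e s z u)"
  unfolding proj1_emb by (simp add: field_simps)

lemma emb_S3eq_iff: "emb e s z u \<in> S3eq \<longleftrightarrow> (norm z)\<^sup>2 + (norm u)\<^sup>2 = 1"
  by (simp add: S3eq_def emb_norm)

lemma emb_coords: "(emb e s z u $ 1)\<^sup>2 + (emb e s z u $ 2)\<^sup>2 = (norm z)\<^sup>2"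
  "(emb e s z u $ 3)\<^sup>2 + (emb e s z u $ 4)\<^sup>2 = (norm u)\<^sup>2"
proof -
  have "(emb e s z u $ 1)\<^sup>2 + (emb e s z u $ 2)\<^sup>2 = (norm (e * z))\<^sup>2"
    by (simp add: cmod_power2)
  then show "(emb e s z u $ 1)\<^sup>2 + (emb e s z u $ 2)\<^sup>2 = (norm z)\<^sup>2"
    by (simp add: norm_mult norm_e)
  have "(emb e s z u $ 3)\<^sup>2 + (emb e s z u $ 4)\<^sup>2 = (s * s) * (norm u)\<^sup>2"
    by (simp add: cmod_power2 power_mult_distrib power2_eq_square[of s] distrib_left)
  then show "(emb e s z u $ 3)\<^sup>2 + (emb e s z u $ 4)\<^sup>2 = (norm u)\<^sup>2"
    by (simp add: s2)
qed

lemma emb_Clif_iff: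
  assumes "emb e s z u \<in> S3eq"
  shows "emb e s z u \<in> Clif 0 \<longleftrightarrow> u = 0" "emb e s z u \<in> Clif 2 \<longleftrightarrow> z = 0"
  using assms unfolding Clif_def mem_Collect_eq emb_coords by (auto simp: emb_S3eq_iff)

end

context growing
begin

text \<open>A section of the union of the cells between layers 0 and 2 is a polygon, star-shaped about
  the origin; \<open>rim\<close> describes the two of its eight sides that belong to one cube.\<close>

definition rim :: "real \<Rightarrow> real \<Rightarrow> complex \<Rightarrow> bool" where
  "rim a c z \<longleftrightarrow> (Rt 0 a c z = 0 \<and> Yb 0 a c \<le> Im z \<and> Im z \<le> Yt 0 a c) \<or>
     (Im z = Yb 0 a c \<and> 0 \<le> Rt 0 a c z \<and> 0 < Lt 0 a c z)"

text \<open>A cell between layers 0 and 2 has at most two directions. If it is based in layer 0, it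
  therefore lies in a side or the bottom of a cube based there. A cell based in layer 1 is seen from
  a cube of layer 0 whose base ray is the other one, hence the exchanged \<open>sides\<close>; a
  vertex of layer 2 is a top corner of a section.\<close>

lemma M2_local:
  assumes "strip_cell 2 v I" "x \<in> ocone (cp v) (Pow I)"
  obtains z p q t and k m :: int where
    "x = emb e s (cis (pi / 2 * k) * z) (cis (pi / 3 * m) * (of_real p + of_real q * om))"
    "0 < p" "0 \<le> q" "t \<longleftrightarrow> even (k + m)" "rim (sides t p q) (sides t q p) z"
proof -
  have v: "v \<in> int_points" "0 \<le> coord_sum v" using assms(1) by (auto simp: strip_cell_def)
  obtain n where n: "coord_sum v = real n" using int_points_coord_sum_nat[OF v] by blast
  obtain i1 i2 i3 :: int where i: "v $ 1 = i1" "v $ 2 = i2" "v $ 3 = i3"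
    using int_pointsE[OF v(1)] .
  have ni: "int n = i1 + i2 + i3" using n i by (simp add: coord_sum_def)
  obtain z p q t where L:
    "x = emb e s (cis (pi / 2 * v $ 3) * z) (cis (pi / 3 * (v $ 1 - v $ 2 - (if t then 0 else 1))) * (of_real p + of_real q * om))"
    "0 < p" "0 \<le> q" "\<not> t \<longrightarrow> 0 < q" "slab n (sides t p q) (sides t q p) z"
    "3 \<in> I \<longleftrightarrow> Rt n (sides t p q) (sides t q p) z \<noteq> 0"
    "t \<longrightarrow> (2 \<in> I \<longleftrightarrow> Yb n p q < Im z) \<and> (1 \<in> I \<longleftrightarrow> 0 < q \<or> 2 \<in> I)"
    "\<not> t \<longrightarrow> 2 \<in> I \<and> (1 \<in> I \<longleftrightarrow> Yb n q p < Im z)"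
    by (rule ocone_local[OF n assms(2)]) (rule that)
  define m where "m = i1 - i2 - (if t then 0 else 1)"
  have "v $ 1 - v $ 2 - (if t then 0 else 1) = real_of_int m" by (simp add: m_def i)
  then have xe: "x = emb e s (cis (pi / 2 * i3) * z) (cis (pi / 3 * m) * (of_real p + of_real q * om))"
    using L(1) by (simp only: i(3))
  have par: "t \<longleftrightarrow> even (int n - i3 - m)" unfolding ni m_def by auto
  have le: "n + card I \<le> 2" using assms(1) n by (simp add: strip_cell_def)
  let ?a = "sides t p q" and ?c = "sides t q p"
  have c12: "card I = 3" if "1 \<in> I" "2 \<in> I" "3 \<in> I"
  proof -
    have "I = UNIV" using that by (auto simp: set_eq_iff forall_3)
    then show ?thesis by simp
  qed
  have r2: "w 2 = 2 * w 1 + b * (2 * w 1 - w 0)" "w 3 = 2 * w 2 + b * (2 * w 2 - w 1)"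
    using rec[of 0] rec[of 1] by (simp_all add: eval_nat_numeral)
  consider "n = 0" | "n = 1" | "n = 2" using le by linarith
  then show ?thesis
  proof cases
    case 1
    have "rim ?a ?c z"
    proof (cases "3 \<in> I")
      case False
      then show ?thesis using L(5,6) 1 by (auto simp: rim_def slab_def)
    next
      case True
      then have "\<not> (1 \<in> I \<and> 2 \<in> I)" using le c12 1 by auto
      then have "\<not> Yb n ?a ?c < Im z" using L(7,8) by (cases t) (auto simp: sides_def)
      then show ?thesis using L(5) 1 by (auto simp: rim_def slab_def)
    qed
    then show ?thesis using that[OF xe L(2,3) _ , of t] par 1 by auto
  next
    case 2
    have sI: "card I \<le> 1" using le 2 by simp
    have not2: "\<not> (i \<in> I \<and> j \<in> I)" if "i \<noteq> j" for i j
      using sI that card_mono[of I "{i, j}"] by auto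
    have n12: "\<not> (1 \<in> I \<and> 2 \<in> I)" "\<not> (2 \<in> I \<and> 3 \<in> I)" "\<not> (1 \<in> I \<and> 3 \<in> I)" by (rule not2; simp)+
    have Y: "Im z = Yb 1 ?a ?c"
    proof -
      have "\<not> Yb 1 ?a ?c < Im z" using L(7,8) n12 2 by (cases t) (auto simp: sides_def)
      then show ?thesis using L(5) 2 by (auto simp: slab_def)
    qed
    have Y': "Im z = Yt 0 ?c ?a" unfolding Y by (simp add: Yb_def Yt_def eval_nat_numeral)
    have dp: "0 < dl 2" "0 < dl 1" using w_d'[of 1] w_d'[of 2] by (simp_all add: eval_nat_numeral)
    have "rim ?c ?a z"
    proof (cases "3 \<in> I")
      case False
      then have R: "Rt 1 ?a ?c z = 0" using L(6) 2 by simp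
      have "Rt 1 ?a ?c z = - (dl 2 * (Re z - (w 2 * ?c + w 1 * ?a)))"
        using Rt_corner[of 1 ?a ?c z] unfolding Rt_def Y Yb_def using r2
        by (simp add: eval_nat_numeral) (simp add: algebra_simps add_divide_distrib)
      then have X: "Re z = w 2 * ?c + w 1 * ?a" using R dp by simp
      have "Rt 0 ?c ?a z = 0"
        unfolding Rt_corner Y' using X by (simp add: eval_nat_numeral)
      moreover have "Yb 0 ?c ?a \<le> Yt 0 ?c ?a"
      proof -
        have "w 1 * ?c \<le> w 3 * ?c"
          using L(2,3) w_mono[of 1 3] by (intro mult_right_mono) (auto simp: sides_def)
        then show ?thesis by (simp add: Yb_def Yt_def)
      qed
      ultimately show ?thesis using Y' by (simp add: rim_def)
    next
      case True
      then have t: t using L(8) n12 by blast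
      then have q: "q = 0" using L(7) n12 True L(3) by auto
      have s: "?a = p" "?c = 0" using t q by (auto simp: sides_def)
      have Yp: "Im z = w 2 * p" using Y s by (simp add: Yb_def eval_nat_numeral)
      have "Rt 1 p 0 z = dl 2 * (w 1 * p - Re z)"
        unfolding Rt_def Yp by (simp add: eval_nat_numeral algebra_simps)
      then have X1: "Re z \<le> w 1 * p" using L(5) 2 s dp by (simp add: slab_def zero_le_mult_iff)
      have "Lt 1 p 0 z = dl 2 * (Re z + w 3 * p)"
        unfolding Lt_def Yp by (simp add: eval_nat_numeral algebra_simps)
      then have X2: "0 < Re z + w 3 * p" using L(5) 2 s dp by (simp add: slab_def zero_less_mult_iff)
      have "Rt 0 0 p z = dl 1 * (w 1 * p - Re z)"
        unfolding Rt_def Yp by (simp add: eval_nat_numeral algebra_simps add_divide_distrib)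
      moreover have "Lt 0 0 p z = dl 1 * (Re z + w 3 * p)"
        unfolding Lt_def Yp by (simp add: eval_nat_numeral algebra_simps add_divide_distrib)
      moreover have "Im z = Yb 0 0 p" using Yp by (simp add: Yb_def numeral_2_eq_2)
      ultimately show ?thesis
        unfolding rim_def s using X1 X2 dp by simp
    qed
    moreover have "?c = sides (\<not> t) p q" "?a = sides (\<not> t) q p" by (auto simp: sides_def)
    moreover have "(\<not> t) \<longleftrightarrow> even (i3 + m)" unfolding par 2 by auto
    ultimately show ?thesis using that[OF xe L(2,3), of "\<not> t"] by simp
  next
    case 3
    then have "I = {}" using le by simp
    then have t: t and q: "q = 0" using L(3,7,8) by auto
    have s: "?a = p" "?c = 0" using t q by (auto simp: sides_def)
    have Y: "Im z = w 3 * p"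
      using L(5,7) t q \<open>I = {}\<close> 3 by (simp add: slab_def sides_def Yb_def)
    have dp: "0 < dl 3" using w_d'[of 3] by simp
    have "Rt 2 p 0 z = dl 3 * (w 2 * p - Re z)"
      unfolding Rt_def Y by (simp add: eval_nat_numeral algebra_simps)
    then have X: "Re z = w 2 * p" using L(6) \<open>I = {}\<close> 3 s dp by simp
    have "Im z = Yt 0 p 0" using Y by (simp add: Yt_def)
    moreover have "Rt 0 p 0 z = 0"
      unfolding Rt_corner Yt_def using X Y by (simp add: numeral_2_eq_2)
    moreover have "w 1 * p \<le> w 3 * p"
      using L(2) w_mono[of 1 3] by (intro mult_right_mono) auto
    ultimately have "rim p 0 z" by (simp add: rim_def Yb_def Yt_def)
    moreover have "t \<longleftrightarrow> even (i3 + m)" unfolding par 3 by auto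
    ultimately show ?thesis using that[OF xe L(2,3), of t] s by simp
  qed
qed

text \<open>The upper corner of the rim, at height \<open>Yt 0 a c\<close>, where the rim of the
  adjoining quarter begins.\<close>

definition Qc :: "real \<Rightarrow> real \<Rightarrow> complex" where
  "Qc a c = Complex (w 2 * a + w 1 * c) (w 3 * a + w 2 * c)"

text \<open>The rim stays in the wedge from the ray of \<open>Qc a c\<close>, included,
  counterclockwise to that of \<open>\<i> * Qc c a\<close>, excluded; the wedges of successive
  quarter turns, with \<open>a\<close> and \<open>c\<close> exchanged each time, are therefore
  disjoint. The remaining claims place the rim on the boundary of an intersection of two
  half-planes, neither of which contains the origin.\<close>

lemma rim_wedge:
  assumes ac: "0 \<le> a" "0 \<le> c" "0 < a + c" and z: "rim a c z"
  shows "0 \<le> (\<i> * Qc a c) \<bullet> z" "0 < Qc c a \<bullet> z"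
    "Yb 0 a c \<le> Im z" "(w 1 * w 1 - w 0 * w 2) * (2 * a + c) \<le> dl 0 * Im z - dl 1 * Re z"
    "Im z = Yb 0 a c \<or> dl 0 * Im z - dl 1 * Re z = (w 1 * w 1 - w 0 * w 2) * (2 * a + c)"
    "0 < Yb 0 a c"
proof -
  have r2: "w 2 = 2 * w 1 + b * (2 * w 1 - w 0)" "w 3 = 2 * w 2 + b * (2 * w 2 - w 1)"
    using rec[of 0] rec[of 1] by (simp_all add: eval_nat_numeral)
  have wp: "0 < w 1" "0 < w 2" "0 < w 3" by (auto intro: w_pos)
  have dp: "0 < dl 0" "0 < dl 1" using w_d'[of 0] w_d'[of 1] by simp_all
  define E where "E = w 1 * w 1 - w 0 * w 2"
  have E: "0 < E" using det0 by (simp add: E_def)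
  have f: "Rt 0 a c z = dl 0 * Im z - dl 1 * Re z - E * (2 * a + c)"
    unfolding Rt_def E_def by (simp add: algebra_simps eval_nat_numeral)
  show Y0: "0 < Yb 0 a c"
  proof -
    have "0 < w 1 * a + w 2 * c"
      using ac wp by (cases "a = 0") (auto intro: add_pos_nonneg add_nonneg_pos)
    then show ?thesis by (simp add: Yb_def numeral_2_eq_2)
  qed
  show i3: "Yb 0 a c \<le> Im z" using z by (auto simp: rim_def)
  show "(w 1 * w 1 - w 0 * w 2) * (2 * a + c) \<le> dl 0 * Im z - dl 1 * Re z"
    "Im z = Yb 0 a c \<or> dl 0 * Im z - dl 1 * Re z = (w 1 * w 1 - w 0 * w 2) * (2 * a + c)"
    using z f unfolding rim_def E_def by auto
  \<comment> \<open>The corner \<open>Qc a c\<close> lies on the slanted side of the rim.\<close>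
  have key: "dl 0 * (w 3 * a + w 2 * c) - dl 1 * (w 2 * a + w 1 * c) = E * (2 * a + c)"
  proof -
    have q2: "w (Suc (Suc n)) = 2 * w (Suc n) + b * (2 * w (Suc n) - w n)" for n
      using rec[of n] by (simp add: numeral_2_eq_2)
    show ?thesis
      by (simp add: E_def eval_nat_numeral q2[of "Suc 0", unfolded q2[of 0]] q2[of 0] algebra_simps)
  qed
  have X: "0 < (w 0 * a + w 1 * c) + (w 2 * a + w 3 * c)"
  proof -
    have "0 < w 0 + w 2" "0 < w 1 + w 3" using w02 wp by auto
    then have "0 < (w 0 + w 2) * a + (w 1 + w 3) * c"
      using ac by (cases "a = 0") (auto intro: add_pos_nonneg add_nonneg_pos)
    then show ?thesis by (simp add: algebra_simps)
  qed
  have q1: "(\<i> * Qc a c) \<bullet> z = (w 2 * a + w 1 * c) * Im z - (w 3 * a + w 2 * c) * Re z"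
    by (simp add: Qc_def inner_complex_def algebra_simps)
  have q2: "Qc c a \<bullet> z = Yb 0 a c * Re z + (w 2 * a + w 3 * c) * Im z"
    by (simp add: Qc_def inner_complex_def Yb_def add.commute eval_nat_numeral)
  \<comment> \<open>The slanted side meets the lower side at abscissa
    \<open>w 0 * a + w 1 * c\<close>.\<close>
  have P: "dl 1 * (w 0 * a + w 1 * c) = dl 0 * Yb 0 a c - E * (2 * a + c)"
    unfolding E_def Yb_def by (simp add: algebra_simps eval_nat_numeral)
  have Q1: "0 < w 3 * a + w 2 * c" "0 < w 2 * a + w 3 * c"
    using ac wp by (cases "a = 0"; auto intro: add_pos_nonneg add_nonneg_pos)+
  consider (R) "dl 1 * Re z = dl 0 * Im z - E * (2 * a + c)" "Im z \<le> Yt 0 a c"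
    | (B) "Im z = Yb 0 a c" "dl 1 * Re z \<le> dl 0 * Im z - E * (2 * a + c)" "0 < Lt 0 a c z"
    using z f unfolding rim_def by fastforce
  then have "0 \<le> (\<i> * Qc a c) \<bullet> z \<and> 0 < Qc c a \<bullet> z"
  proof cases
    case R
    have "dl 1 * ((\<i> * Qc a c) \<bullet> z) = (w 2 * a + w 1 * c) * dl 1 * Im z - (w 3 * a + w 2 * c) * (dl 1 * Re z)"
      unfolding q1 by (simp add: algebra_simps)
    also have "\<dots> = E * (2 * a + c) * ((w 3 * a + w 2 * c) - Im z)"
      unfolding R(1) using key by algebra
    also have "0 \<le> \<dots>"
      using E ac R(2) by (intro mult_nonneg_nonneg) (auto simp: Yt_def numeral_2_eq_2)
    finally have g: "0 \<le> (\<i> * Qc a c) \<bullet> z" using dp by (simp add: zero_le_mult_iff)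
    have "dl 1 * (w 0 * a + w 1 * c) \<le> dl 1 * Re z"
      unfolding P R(1) using dp i3 by simp
    then have "w 0 * a + w 1 * c \<le> Re z" using dp by simp
    then have "Yb 0 a c * (w 0 * a + w 1 * c) + (w 2 * a + w 3 * c) * Yb 0 a c \<le> Qc c a \<bullet> z"
      unfolding q2 using Y0 i3 Q1 by (intro add_mono mult_left_mono) auto
    moreover have "0 < Yb 0 a c * ((w 0 * a + w 1 * c) + (w 2 * a + w 3 * c))"
      using X Y0 by (rule mult_pos_pos[rotated])
    ultimately have "0 < Qc c a \<bullet> z" by (simp add: algebra_simps)
    with g show ?thesis by blast
  next
    case B
    have "dl 1 * Re z \<le> dl 1 * (w 0 * a + w 1 * c)"
      using B(2) unfolding P B(1) .
    then have rz: "Re z \<le> w 0 * a + w 1 * c" using dp by simp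
    have "dl 1 * ((w 2 * a + w 1 * c) * Yb 0 a c - (w 3 * a + w 2 * c) * (w 0 * a + w 1 * c))
        = (w 2 * a + w 1 * c) * dl 1 * Yb 0 a c - (w 3 * a + w 2 * c) * (dl 1 * (w 0 * a + w 1 * c))"
      by (simp add: algebra_simps)
    also have "\<dots> = E * (2 * a + c) * ((w 3 * a + w 2 * c) - Yb 0 a c)"
      unfolding P using key by algebra
    also have "0 \<le> \<dots>"
    proof -
      have "w 1 * a \<le> w 3 * a" using ac w_mono[of 1 3] by (intro mult_right_mono) auto
      then show ?thesis using E ac by (intro mult_nonneg_nonneg) (auto simp: Yb_def numeral_2_eq_2)
    qed
    finally have "0 \<le> (w 2 * a + w 1 * c) * Yb 0 a c - (w 3 * a + w 2 * c) * (w 0 * a + w 1 * c)"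
      using dp by (simp add: zero_le_mult_iff)
    also have "\<dots> \<le> (\<i> * Qc a c) \<bullet> z"
      unfolding q1 B(1) using mult_left_mono[OF rz, of "w 3 * a + w 2 * c"] Q1 by linarith
    finally have g: "0 \<le> (\<i> * Qc a c) \<bullet> z" .
    have "Lt 0 a c z = dl 1 * (Re z + (w 2 * a + w 3 * c))"
      unfolding Lt_def B(1) Yb_def by (simp add: eval_nat_numeral algebra_simps add_divide_distrib)
    then have "0 < Re z + (w 2 * a + w 3 * c)" using B(3) dp by (simp add: zero_less_mult_iff)
    then have "0 < Yb 0 a c * (Re z + (w 2 * a + w 3 * c))" using Y0 by simp
    then have "0 < Qc c a \<bullet> z" unfolding q2 B(1) by (simp add: algebra_simps)
    with g show ?thesis by blast
  qed
  then show "0 \<le> (\<i> * Qc a c) \<bullet> z" "0 < Qc c a \<bullet> z" by blast+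
qed

text \<open>On the rim two linear forms are bounded below by positive constants, and at each point
  one of the bounds is attained. Enlarging a point would leave neither attained, shrinking it would
  violate one.\<close>

lemma rim_ray_unique:
  assumes ac: "0 \<le> a" "0 \<le> c" "0 < a + c" and z: "rim a c z" "rim a c (r *\<^sub>R z)"
  shows "r = 1"
proof -
  note k = rim_wedge[OF ac z(1)] rim_wedge[OF ac z(2)]
  define C f where "C = (w 1 * w 1 - w 0 * w 2) * (2 * a + c)" and "f = dl 0 * Im z - dl 1 * Re z"
  have C: "0 < C" using det0 ac by (simp add: C_def)
  have fr: "dl 0 * Im (r *\<^sub>R z) - dl 1 * Re (r *\<^sub>R z) = r * f"
    by (simp add: f_def algebra_simps)
  have 1: "C \<le> f" "Im z = Yb 0 a c \<or> f = C" "C \<le> r * f" "r * Im z = Yb 0 a c \<or> r * f = C"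
      "Yb 0 a c \<le> Im z" "Yb 0 a c \<le> r * Im z" "0 < Yb 0 a c"
    using k unfolding C_def[symmetric] fr f_def[symmetric] by auto
  have r: "0 < r" using 1(1,3) C by (metis less_le_trans zero_less_mult_pos2)
  have up: "1 \<le> r" if "f = C" using 1(3) that C by simp
  have up': "1 \<le> r" if "Im z = Yb 0 a c" using 1(6,7) that by simp
  have "1 \<le> r" using 1(2) up up' by blast
  moreover have "r \<le> 1"
  proof (rule ccontr)
    assume "\<not> r \<le> 1"
    then have "Im z < r * Im z" "f < r * f" using 1 C by auto
    then show False using 1 by linarith
  qed
  ultimately show ?thesis by simp
qed

end


context growing
begin

lemma union_M2_local:
  assumes "x \<in> \<Union>(M 2)"
  obtains z p q t and k m :: int where
    "x = emb e s (cis (pi / 2 * k) * z) (cis (pi / 3 * m) * (of_real p + of_real q * om))"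
    "0 < p" "0 \<le> q" "t \<longleftrightarrow> even (k + m)" "rim (sides t p q) (sides t q p) z" "norm x = 1"
proof -
  obtain P where P: "P \<in> M 2" "x \<in> P" using assms by blast
  then obtain v I where v: "strip_cell 2 v I" "P = sph_hull (cp v ` Pow I)"
    by (auto elim: M_E)
  then have x: "x \<in> cspan (cp v) (Pow I)" "norm x = 1" using P by (auto simp: sph_hull_image)
  then have "x \<noteq> 0" by auto
  then obtain A B where AB: "A \<subseteq> B" "B \<subseteq> I" "x \<in> ocone (cp v) (ivl A B)"
    using cube_config_ocone[OF strip_config[OF v(1)] x(1)] by blast
  show ?thesis
    by (rule M2_local[OF strip_cell_face[OF v(1) AB(1,2)] ocone_ivl[OF AB(3,1)]]) (rule that; (assumption | rule x(2)))
qed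

lemma rim_nonzero: "rim a c z \<Longrightarrow> 0 \<le> a \<Longrightarrow> 0 \<le> c \<Longrightarrow> 0 < a + c \<Longrightarrow> z \<noteq> 0"
  using rim_wedge(2)[of a c z] by auto

lemma rim_scale:
  assumes "rim a c z" "0 < r"
  shows "rim (r * a) (r * c) (r *\<^sub>R z)"
proof -
  have "Rt 0 (r * a) (r * c) (r *\<^sub>R z) = r * Rt 0 a c z" "Lt 0 (r * a) (r * c) (r *\<^sub>R z) = r * Lt 0 a c z"
    "Yb 0 (r * a) (r * c) = r * Yb 0 a c" "Yt 0 (r * a) (r * c) = r * Yt 0 a c"
    by (simp_all add: Rt_def Lt_def Yb_def Yt_def field_simps)
  then show ?thesis
    using assms by (auto simp: rim_def)
qed

lemma sides_nonneg: "0 < p \<Longrightarrow> 0 \<le> q \<Longrightarrow> 0 \<le> sides t p q \<and> 0 \<le> sides t q p \<and> 0 < sides t p q + sides t q p"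
  by (auto simp: sides_def)

lemma p_om_nonzero: "0 < p \<Longrightarrow> 0 \<le> q \<Longrightarrow> of_real p + of_real q * om \<noteq> 0"
  by (auto simp: complex_eq_iff om_Complex)

text \<open>Equal images leave a positive ratio between the first components and a relative number
  \<open>d\<close> of quarter turns. If 4 divides \<open>d\<close>, the ray meets the rim once; in
  the other cases the wedges of \<open>rim_wedge\<close> are disjoint.\<close>

lemma M2_inj: "inj_on proj1 (\<Union>(M 2))"
proof (rule inj_onI)
  fix x x' assume x: "x \<in> \<Union>(M 2)" and x': "x' \<in> \<Union>(M 2)" and pj: "proj1 x = proj1 x'"
  obtain z p q t and k m :: int where L:
    "x = emb e s (cis (pi / 2 * k) * z) (cis (pi / 3 * m) * (of_real p + of_real q * om))"
    "0 < p" "0 \<le> q" "t \<longleftrightarrow> even (k + m)" "rim (sides t p q) (sides t q p) z" "norm x = 1"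
    by (rule union_M2_local[OF x]) (rule that)
  obtain z' p' q' t' and k' m' :: int where L':
    "x' = emb e s (cis (pi / 2 * k') * z') (cis (pi / 3 * m') * (of_real p' + of_real q' * om))"
    "0 < p'" "0 \<le> q'" "t' \<longleftrightarrow> even (k' + m')" "rim (sides t' p' q') (sides t' q' p') z'" "norm x' = 1"
    by (rule union_M2_local[OF x']) (rule that)
  have nz: "cis (pi / 2 * k) * z \<noteq> 0" "cis (pi / 2 * k') * z' \<noteq> 0"
    using rim_nonzero[OF L(5)] rim_nonzero[OF L'(5)] sides_nonneg[OF L(2,3)] sides_nonneg[OF L'(2,3)] by auto
  have nu: "cis (pi / 3 * m) * (of_real p + of_real q * om) \<noteq> 0" "cis (pi / 3 * m') * (of_real p' + of_real q' * om) \<noteq> 0"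
    using p_om_nonzero[OF L(2,3)] p_om_nonzero[OF L'(2,3)] by auto
  obtain r1 r2 where r: "0 < r1" "0 < r2" "cis (pi / 2 * k) * z = r1 *\<^sub>R (cis (pi / 2 * k') * z')"
    "cis (pi / 3 * m) * (of_real p + of_real q * om) = r2 *\<^sub>R (cis (pi / 3 * m') * (of_real p' + of_real q' * om))"
    using proj1_eqD[OF pj[unfolded L(1) L'(1)] nz nu] .
  have "cis (pi / 3 * m) * (of_real p + of_real q * om) = cis (pi / 3 * m') * (of_real (r2 * p') + of_real (r2 * q') * om)"
    unfolding r(4) by (simp add: scaleR_conv_of_real algebra_simps)
  then have sec: "6 dvd (m' - m)" "p = r2 * p'" "q = r2 * q'"
    using sector_unique[of m p q m' "r2 * p'" "r2 * q'"] L L' r by auto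
  define y where "y = r2 *\<^sub>R z'"
  have ry: "rim (sides t' p q) (sides t' q p) y"
    using rim_scale[OF L'(5) r(2)] unfolding y_def sec by (cases t') (simp_all add: sides_def)
  define d where "d = k' - k"
  define \<rho> where "\<rho> = r1 / r2"
  have \<rho>: "0 < \<rho>" using r by (simp add: \<rho>_def)
  have zy: "z = \<rho> *\<^sub>R (\<i> ^ nat (d mod 4) * y)"
  proof -
    have c: "cis (- (pi / 2 * k)) * cis (pi / 2 * k) = 1"
      "cis (- (pi / 2 * k)) * cis (pi / 2 * k') = cis (pi / 2 * of_int d)"
      by (simp_all add: cis_mult d_def field_simps)
    have "cis (- (pi / 2 * k)) * (cis (pi / 2 * k) * z) = r1 *\<^sub>R (cis (- (pi / 2 * k)) * (cis (pi / 2 * k') * z'))"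
      unfolding r(3) by simp
    then have "z = r1 *\<^sub>R (\<i> ^ nat (d mod 4) * z')"
      unfolding mult.assoc[symmetric] c unfolding cis_pi2_int by simp
    moreover have "z' = (1 / r2) *\<^sub>R y" using r(2) by (simp add: y_def)
    ultimately show ?thesis by (simp add: \<rho>_def)
  qed
  have par: "t = t' \<longleftrightarrow> even d"
  proof -
    have "even (m' - m)" using sec(1) by (rule dvd_trans[rotated]) simp
    then show ?thesis unfolding L(4) L'(4) d_def by auto
  qed
  let ?a = "sides t p q" and ?c = "sides t q p"
  have ac: "0 \<le> ?a" "0 \<le> ?c" "0 < ?a + ?c" "0 < ?c + ?a" using sides_nonneg[OF L(2,3)] by (auto simp: add.commute)
  have sw: "sides t' p q = ?c \<and> sides t' q p = ?a" if "t \<noteq> t'" using that by (auto simp: sides_def)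
  have in_i: "Q \<bullet> (\<i> * y) = - ((\<i> * Q) \<bullet> y)" for Q y by (simp add: inner_complex_def)
  have "0 \<le> d mod 4" "d mod 4 < 4" by simp_all
  then consider "d mod 4 = 0" | "d mod 4 = 1" | "d mod 4 = 2" | "d mod 4 = 3" by linarith
  then show "x = x'"
  proof cases
    case 1
    then have "even d" by presburger
    then have "t = t'" using par by simp
    moreover have "y = (1 / \<rho>) *\<^sub>R z" using zy 1 \<rho> by simp
    ultimately have "1 / \<rho> = 1"
      using rim_ray_unique[OF ac(1-3) L(5), of "1 / \<rho>"] ry by simp
    then have "r1 = r2" using r by (simp add: \<rho>_def field_simps)
    then have "x = r2 *\<^sub>R x'"
      unfolding L(1) L'(1) emb_scale using r by simp
    then have "r2 = 1" using L(6) L'(6) r(2) by simp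
    with \<open>x = r2 *\<^sub>R x'\<close> show ?thesis by simp
  next
    case 2
    then have "odd d" by presburger
    then have s: "sides t' p q = ?c" "sides t' q p = ?a" using par sw by auto
    have "0 \<le> (\<i> * Qc ?c ?a) \<bullet> y" using rim_wedge(1)[OF ac(2,1,4)] ry s by simp
    moreover have "0 < Qc ?c ?a \<bullet> z" using rim_wedge(2)[OF ac(1-3) L(5)] .
    moreover have "z = \<rho> *\<^sub>R (\<i> * y)" using zy 2 by simp
    ultimately have "\<rho> * ((\<i> * Qc ?c ?a) \<bullet> y) < 0" "0 \<le> \<rho> * ((\<i> * Qc ?c ?a) \<bullet> y)"
      using \<rho> in_i by simp_all
    then show ?thesis by linarith
  next
    case 3
    then have "even d" by presburger
    then have t: "t = t'" using par by simp
    have "0 < Qc ?c ?a \<bullet> z" using rim_wedge(2)[OF ac(1-3) L(5)] .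
    moreover have "0 < Qc ?c ?a \<bullet> y" using rim_wedge(2)[OF ac(1-3)] ry t by simp
    moreover have "z = - (\<rho> *\<^sub>R y)" using zy 3 by (simp add: power2_eq_square)
    ultimately show ?thesis using \<rho> by (simp add: zero_less_mult_iff mult_less_0_iff)
  next
    case 4
    then have "odd d" by presburger
    then have s: "sides t' p q = ?c" "sides t' q p = ?a" using par sw by auto
    have "0 < Qc ?a ?c \<bullet> y" using rim_wedge(2)[OF ac(2,1,4)] ry s by simp
    moreover have "0 \<le> (\<i> * Qc ?a ?c) \<bullet> z" using rim_wedge(1)[OF ac(1-3) L(5)] .
    moreover have "\<i> * z = \<rho> *\<^sub>R y" using zy 4 by (simp add: power3_eq_cube)
    then have "Qc ?a ?c \<bullet> (\<i> * z) = \<rho> * (Qc ?a ?c \<bullet> y)" by simp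
    moreover have "0 < \<rho> * (Qc ?a ?c \<bullet> y)" using \<rho> \<open>0 < Qc ?a ?c \<bullet> y\<close> by simp
    ultimately show ?thesis using in_i[of "Qc ?a ?c" z] by linarith
  qed
qed

lemma M2_transversal2: "transversal2 (M 2) (mlab e s h)"
  unfolding transversal2_def
proof (intro conjI M_symmetric M2_inj subsetI)
  fix x assume x: "x \<in> \<Union>(M 2)"
  obtain z p q t and k m :: int where L:
    "x = emb e s (cis (pi / 2 * k) * z) (cis (pi / 3 * m) * (of_real p + of_real q * om))"
    "0 < p" "0 \<le> q" "t \<longleftrightarrow> even (k + m)" "rim (sides t p q) (sides t q p) z" "norm x = 1"
    by (rule union_M2_local[OF x]) (rule that)
  have S: "x \<in> S3eq" using L(1,6) by (simp add: S3eq_def)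
  moreover have "x \<notin> Clif 0" "x \<notin> Clif 2"
    using emb_Clif_iff[OF S[unfolded L(1)]] p_om_nonzero[OF L(2,3)] rim_nonzero[OF L(5)] sides_nonneg[OF L(2,3)]
    unfolding L(1) by auto
  ultimately show "x \<in> S3eq - (Clif 0 \<union> Clif 2)" by blast
qed

lemma M_restr_transversal2:
  assumes "j + 2 \<le> K"
  shows "transversal2 (restr (M K) (mlab e s h) {j..j + 2}) (shift_lab j (mlab e s h))"
proof -
  interpret sh: growing "cis (pi / 2 * real j) * e" s "\<lambda>n. w (n + j)" b
    by (rule growing_shift)
  have e: "restr (M K) (mlab e s h) {j..j + 2} = sh.M 2"
    unfolding restr_shift[OF assms] sh.M_def ..
  show ?thesis
    unfolding e transversal2_def
    using sh.M2_transversal2 symmetric_cct_cong[OF sh.M_symmetric, of 2 "shift_lab j (mlab e s h)"] mlab_shift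
    unfolding transversal2_def by blast
qed

lemma M_transversal: "transversal K (M K) (mlab e s h)"
  unfolding transversal_def
proof (intro conjI M_symmetric allI impI)
  fix i assume i: "1 \<le> i \<and> i + 1 \<le> K"
  then have "{i - 1, i, i + 1} = {i - 1..i - 1 + 2}" by auto
  then show "transversal2 (restr (M K) (mlab e s h) {i - 1, i, i + 1}) (shift_lab (i - 1) (mlab e s h))"
    using M_restr_transversal2[of "i - 1" K] i by simp
qed

section \<open>Slope of the model\<close>

text \<open>An edge of the complex is a cell with just two vertices, hence with a single direction,
  and from the top layer it can only descend. This pins down the middle vertex in the definition of
  the slope.\<close>

lemma M2_neighbour:
  assumes v: "v \<in> int_points" "coord_sum v = 2" and a: "adjacent (M 2) (nv v) y"
  obtains i where "y = nv (v - ind {i})"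
proof -
  let ?P = "sph_hull {nv v, y}"
  have P: "?P \<in> M 2" "{nv v} \<in> M 2" "{y} \<in> M 2" "nv v \<noteq> y"
    using a by (auto simp: adjacent_def)
  have nvin: "x \<in> ?P \<and> norm x = 1" if "{x} \<in> M 2" "x \<in> {nv v, y}" for x
  proof -
    have "norm x = 1" using that(1) by (auto elim!: M_E simp: sph_hull_def)
    then show ?thesis
      using that(2) unfolding sph_hull_def by (auto intro: hull_inc)
  qed
  obtain c I where c: "strip_cell 2 c I" "?P = sph_hull (cp c ` Pow I)"
    using P(1) nvin[OF P(2)] by (auto elim!: M_E)
  have vert: "\<exists>S\<subseteq>I. x = nv (c + ind S)" if x: "{x} \<in> M 2" "x \<in> {nv v, y}" for x
  proof -
    have "{x} \<inter> ?P = {x}" using nvin[OF x] by auto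
    then have "{x} sph_face_of ?P"
      using M_inter[OF P(1) x(1)] by (simp add: Int_commute)
    then show ?thesis using cell_vertex_face[OF c(1)] c(2) by simp
  qed
  obtain S1 where S1: "S1 \<subseteq> I" "nv v = nv (c + ind S1)" using vert[OF P(2)] by auto
  obtain S2 where S2: "S2 \<subseteq> I" "y = nv (c + ind S2)" using vert[OF P(3)] by auto
  have nz: "nv v \<noteq> 0" "y \<noteq> 0" using nvin[OF P(2)] nvin[OF P(3)] by auto
  have only: "nv (c + ind S) \<in> {nv v, y}" if "S \<subseteq> I" for S
  proof -
    have f: "{nv (c + ind S)} sph_face_of sph_hull (id ` {nv v, y})"
      using cell_vertex_face[OF c(1)] that c(2) by auto
    have nz': "\<And>i. i \<in> {nv v, y} \<Longrightarrow> id i \<noteq> 0" using nz by auto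
    from iffD1[OF sph_face_of_sph_hull_iff[OF _ nz'] f]
    have "\<exists>a. {nv (c + ind S)} = sph_hull (id ` {i \<in> {nv v, y}. a \<bullet> id i = 0})"
      by blast
    then obtain a where a: "{nv (c + ind S)} = sph_hull {i \<in> {nv v, y}. a \<bullet> i = 0}" by auto
    then have "{i \<in> {nv v, y}. a \<bullet> i = 0} \<noteq> {}" by (metis insert_not_empty sph_hull_empty)
    then obtain i where i: "i \<in> {nv v, y}" "a \<bullet> i = 0" by blast
    have "norm i = 1" using i(1) nvin[OF P(2)] nvin[OF P(3)] by auto
    then have "i \<in> sph_hull {i \<in> {nv v, y}. a \<bullet> i = 0}"
      using i unfolding sph_hull_def by (auto intro!: hull_inc)
    then have "i \<in> {nv (c + ind S)}" unfolding a .
    then show ?thesis using i(1) by simp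
  qed
  have ci: "c + ind S \<in> int_points" "0 \<le> coord_sum (c + ind S)" for S
    using c(1) by (auto simp: strip_cell_def int_points_add int_points_ind)
  have inj: "S = S'" if eq: "nv (c + ind S) = nv (c + ind S')" for S S'
  proof -
    obtain l where l: "l \<in> Lam" "c + ind S' = l + (c + ind S)"
      using nv_eqD[OF ci ci eq] by blast
    then have "ind S' - ind S = l" by (simp add: algebra_simps)
    then show ?thesis using l(1) Lam_ind_diff by blast
  qed
  have ne: "S1 \<noteq> S2" using P(4) S1 S2 by auto
  have two: "S = S1 \<or> S = S2" if "S \<subseteq> I" for S
    using only[OF that] S1 S2 inj by auto
  obtain i where i: "i \<in> I" using ne S1(1) S2(1) by (cases "I = {}") auto
  have I: "I = {i}"
  proof (rule ccontr)
    assume "I \<noteq> {i}"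
    then obtain j where "j \<in> I" "j \<noteq> i" using i by blast
    then have "{} = S1 \<or> {} = S2" "{i} = S1 \<or> {i} = S2" "{j} = S1 \<or> {j} = S2"
      using i two[of "{}"] two[of "{i}"] two[of "{j}"] by auto
    then show False using \<open>j \<noteq> i\<close> by auto
  qed
  have cs: "coord_sum (c + ind S1) = 2"
  proof -
    obtain l where "l \<in> Lam" "c + ind S1 = l + v"
      using nv_eqD[OF v(1) _ ci S1(2)] v(2) by auto
    then show ?thesis using coord_sum_Lam v(2) by simp
  qed
  have cle: "coord_sum c + 1 \<le> 2" using c(1) I by (simp add: strip_cell_def)
  have "S1 = {i}"
  proof (rule ccontr)
    assume "S1 \<noteq> {i}"
    then have "S1 = {}" using S1(1) I by blast
    then show False using cs cle by simp
  qed
  moreover from this have "S2 = {}" using S2(1) I ne by blast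
  moreover obtain l where l: "l \<in> Lam" "v = l + (c + ind S1)"
    using nv_eqD[OF ci _ _ S1(2)[symmetric]] v by auto
  ultimately have "v - ind {i} = l + c" "y = nv c" using S2 by auto
  moreover have "nv (l + c) = nv c" using pt_Lam[OF l(1)] by (simp add: nv_def)
  ultimately show ?thesis using that[of i] by simp
qed

lemma M2_edge:
  assumes "c \<in> int_points" "coord_sum c = 1"
  shows "adjacent (M 2) (nv c) (nv (c + ind {i}))" "adjacent (M 2) (nv (c + ind {i})) (nv c)"
proof -
  have sc: "strip_cell 2 c {i}" "strip_cell 2 c {}" "strip_cell 2 (c + ind {i}) {}"
    using assms by (auto simp: strip_cell_def int_points_add int_points_ind)
  have n: "pt e s h c \<noteq> 0" "pt e s h (c + ind {i}) \<noteq> 0"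
    using pt_nz[of c] pt_nz[of "c + ind {i}"] sc by (auto simp: strip_cell_def)
  have "sph_hull (cp c ` Pow {i}) = sph_hull {nv c, nv (c + ind {i})}"
  proof -
    have "cp c ` Pow {i} = {pt e s h c, pt e s h (c + ind {i})}" by (auto simp: Pow_insert)
    have "convex_cone hull {p, q} = convex_cone hull {p /\<^sub>R norm p, q /\<^sub>R norm q}" if pq: "p \<noteq> 0" "q \<noteq> 0" for p q :: "real^5"
    proof (intro subset_antisym hull_minimal convex_cone_convex_cone_hull subsetI)
      fix x assume "x \<in> {p, q}"
      then have "norm x *\<^sub>R (x /\<^sub>R norm x) = x" "x /\<^sub>R norm x \<in> convex_cone hull {p /\<^sub>R norm p, q /\<^sub>R norm q}"
        using pq by (auto intro: hull_inc)
      then show "x \<in> convex_cone hull {p /\<^sub>R norm p, q /\<^sub>R norm q}"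
        using convex_cone_hull_mul[of "x /\<^sub>R norm x" _ "norm x"] by simp
    next
      fix x assume "x \<in> {p /\<^sub>R norm p, q /\<^sub>R norm q}"
      then obtain y where y: "y \<in> {p, q}" "x = inverse (norm y) *\<^sub>R y" by auto
      show "x \<in> convex_cone hull {p, q}"
        unfolding y(2) by (rule convex_cone_hull_mul) (use y(1) in \<open>auto intro: hull_inc\<close>)
    qed
    from this[OF n] show ?thesis
      unfolding sph_hull_def nv_def \<open>cp c ` Pow {i} = {pt e s h c, pt e s h (c + ind {i})}\<close> by (simp only:)
  qed
  then have E: "sph_hull {nv c, nv (c + ind {i})} \<in> M 2" using M_cell[OF sc(1)] by simp
  have V: "{nv c} \<in> M 2" "{nv (c + ind {i})} \<in> M 2"
    using M_cell[OF sc(2)] M_cell[OF sc(3)] sph_hull_single n by (simp_all add: nv_def)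
  have "nv c \<noteq> nv (c + ind {i})"
  proof
    assume "nv c = nv (c + ind {i})"
    then obtain l where "l \<in> Lam" "c + ind {i} = l + c"
      using nv_eqD[of c "c + ind {i}"] sc by (auto simp: strip_cell_def)
    then have "coord_sum (c + ind {i}) = coord_sum c" using coord_sum_Lam by simp
    then show False by simp
  qed
  then show "adjacent (M 2) (nv c) (nv (c + ind {i}))" "adjacent (M 2) (nv (c + ind {i})) (nv c)"
    using E V by (auto simp: adjacent_def insert_commute)
qed

end


context frame
begin

lemma proj0_emb: "proj0 (emb e s z u) = emb e s (z /\<^sub>R norm z) 0"
  unfolding proj0_def part12_emb norm_emb_z emb_scale by simp

lemma emb_continuous: "continuous_on X (\<lambda>(z, u). emb e s z u)"
proof -
  have "emb e s z u = Re z *\<^sub>R emb e s 1 0 + Im z *\<^sub>R emb e s \<i> 0 + Re u *\<^sub>R emb e s 0 1 + Im u *\<^sub>R emb e s 0 \<i>" for z u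
  proof -
    have "Re x *\<^sub>R 1 + Im x *\<^sub>R \<i> = x" for x by (simp add: complex_eq_iff)
    then show ?thesis unfolding emb_scale emb_add by simp
  qed
  then have "(\<lambda>(z, u). emb e s z u) = (\<lambda>p. Re (fst p) *\<^sub>R emb e s 1 0 + Im (fst p) *\<^sub>R emb e s \<i> 0 +
      Re (snd p) *\<^sub>R emb e s 0 1 + Im (snd p) *\<^sub>R emb e s 0 \<i>)"
    unfolding case_prod_beta by (intro ext)
  then show ?thesis
    by (simp only:) (intro continuous_intros)
qed

end

lemma tangent_inner:
  assumes "norm m = 1"
  shows "tangent_at m a \<bullet> tangent_at m c = a \<bullet> c - (a \<bullet> m) * (c \<bullet> m)"
proof -
  have "m \<bullet> m = 1" using assms by (simp add: norm_eq_1)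
  then show ?thesis
    by (simp add: tangent_at_def inner_diff_left inner_diff_right inner_commute algebra_simps)
qed

text \<open>By \<open>tangent_inner\<close> the hypothesis says that the tangential components have
  negative inner product.\<close>

lemma sph_angle_obtuse:
  assumes "norm m = 1" "a \<bullet> c < (a \<bullet> m) * (c \<bullet> m)"
  shows "pi / 2 < sph_angle m a c"
proof -
  let ?x = "tangent_at m a" and ?y = "tangent_at m c"
  have neg: "?x \<bullet> ?y < 0" using assms(2) unfolding tangent_inner[OF assms(1)] by simp
  then have "?x \<noteq> 0" "?y \<noteq> 0" by auto
  then have p: "0 < norm ?x * norm ?y" by simp
  have "- (norm ?x * norm ?y) \<le> ?x \<bullet> ?y"
    using Cauchy_Schwarz_ineq2[of ?x ?y] by linarith
  then have "- 1 \<le> (?x \<bullet> ?y) / (norm ?x * norm ?y)"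
    using p by (simp add: field_simps)
  moreover have "(?x \<bullet> ?y) / (norm ?x * norm ?y) < 0"
    using neg p by (simp add: divide_neg_pos)
  ultimately have "arccos 0 < arccos ((?x \<bullet> ?y) / (norm ?x * norm ?y))"
    by (intro arccos_less_arccos) auto
  then show ?thesis by (simp add: sph_angle_def)
qed

context growing
begin

lemma nv_translate: "(r34 \<circ> r34) (nv v) = nv (vector [1, -1, 0] + v)"
proof -
  have "(r34 \<circ> r34) (nv v) = (r34 \<circ> r34) (pt e s h v) /\<^sub>R norm (pt e s h v)"
    unfolding nv_def by (simp add: linear_scale[OF rot34_props(1)])
  moreover have "norm (pt e s h (vector [1, -1, 0] + v)) = norm (pt e s h v)"
    unfolding r3434_pt[symmetric] by (simp add: rot34_props(2))
  ultimately show ?thesis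
    unfolding r3434_pt by (simp add: nv_def)
qed

text \<open>Up to positive factors and common phases the midpoint is \<open>(2 * h 2, 1)\<close>,
  its projection \<open>(h 2, 0)\<close> and the middle vertex \<open>(h 1, 1)\<close>. The angle
  condition becomes \<open>h 1 \<bullet> h 2 < 2 * (h 2 \<bullet> h 2)\<close>, which growth
  provides.\<close>

lemma M2_slope: "pi / 2 < slope (M 2) (mlab e s h)"
proof -
  define s0 where "s0 = (SOME x. x \<in> layer (mlab e s h) 2)"
  have "nv (vector [0, 0, 2]) \<in> layer (mlab e s h) 2"
    using nv_layer_iff[of "vector [0, 0, 2]" 2] by (auto simp: int_points_def forall_3 coord_sum_def)
  then have "s0 \<in> layer (mlab e s h) 2" unfolding s0_def by (rule someI)
  then obtain v where v: "v \<in> int_points" "coord_sum v = 2" "s0 = nv v"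
    using mlab_vertex by (auto simp: layer_def)
  let ?t = "vector [1, -1, 0] + v"
  have t: "?t \<in> int_points" "coord_sum ?t = 2"
    using v tvecs int_points_add by auto
  \<comment> \<open>The common lower neighbour of \<open>v\<close> and of its translate by (1,-1,0),
    along direction 2 from the former and along direction 1 from the latter.\<close>
  define c where "c = v - ind {2}"
  have "- ind {2} \<in> int_points" by (simp add: int_points_def)
  then have c: "c \<in> int_points" "coord_sum c = 1"
    using int_points_add[OF v(1), of "- ind {2}"] v(2) by (auto simp: c_def coord_sum_def)
  have cv: "c + ind {2} = v" "c + ind {1} = ?t"
    by (simp_all add: c_def vec_eq_iff forall_3)
  have the: "(THE u. adjacent (M 2) s0 u \<and> adjacent (M 2) u ((r34 \<circ> r34) s0)) = nv c"
    unfolding v(3) nv_translate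
  proof (rule the_equality)
    show "adjacent (M 2) (nv v) (nv c) \<and> adjacent (M 2) (nv c) (nv ?t)"
      using M2_edge[OF c, of 2] M2_edge[OF c, of 1] unfolding cv by blast
  next
    fix u assume u: "adjacent (M 2) (nv v) u \<and> adjacent (M 2) u (nv ?t)"
    then have u2: "adjacent (M 2) (nv ?t) u" by (auto simp: adjacent_def insert_commute)
    obtain i where i: "u = nv (v - ind {i})" using M2_neighbour[OF v(1,2)] u by blast
    obtain j where j: "u = nv (?t - ind {j})" using M2_neighbour[OF t u2] by blast
    have mi: "- ind {i} \<in> int_points" for i :: 3 by (simp add: int_points_def)
    have ci: "x - ind {i} \<in> int_points \<and> 0 \<le> coord_sum (x - ind {i})" if "x \<in> int_points" "coord_sum x = 2" for x i
    proof -
      have "coord_sum (x - ind {i}) = coord_sum x - coord_sum (ind {i})" by (simp add: coord_sum_def)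
      then show ?thesis using int_points_add[OF that(1) mi[of i]] that(2) by simp
    qed
    obtain l where l: "l \<in> Lam" "?t - ind {j} = l + (v - ind {i})"
      using nv_eqD[of "v - ind {i}" "?t - ind {j}"] ci[OF v(1,2), of i] ci[OF t, of j] i j by auto
    obtain a b where ab: "l $ 1 = 3 * of_int a - 2 * of_int b" "l $ 2 = - 3 * of_int a - 2 * of_int b" "l $ 3 = 4 * of_int b"
      using l(1) unfolding Lam_iff by blast
    have le: "l $ 1 = 1 - ind {j} $ 1 + ind {i} $ 1" "l $ 2 = - 1 - ind {j} $ 2 + ind {i} $ 2" "l $ 3 = ind {i} $ 3 - ind {j} $ 3"
      using l(2) by (simp_all add: vec_eq_iff forall_3 algebra_simps)
    \<comment> \<open>A lattice vector with entries this small is zero, and then the second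
      coordinate forces \<open>i = 2\<close>.\<close>
    have "\<bar>l $ 3\<bar> \<le> 1" unfolding le by simp
    then have b0: "b = 0" unfolding ab by linarith
    have "0 \<le> l $ 1" "l $ 1 \<le> 2" unfolding le by simp_all
    then have a0: "a = 0" unfolding ab b0 by simp
    have "i = 2"
      using le(2) ab(2) a0 b0 by (auto split: if_splits)
    then show "u = nv c" using i by (simp add: c_def)
  qed
  let ?Z = "cis (pi / 2 * v $ 3)" and ?W = "cis (pi / 3 * (c $ 1 - c $ 2))"
  have pc: "pt e s h c = emb e s (?Z * h 1) (?W * 1)"
    unfolding pt_def using c(2) by (simp add: c_def)
  have pv: "pt e s h v = emb e s (?Z * h 2) (?W * cnj om)" and pt': "pt e s h ?t = emb e s (?Z * h 2) (?W * om)"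
    using pt_local[of c 1 e s h "{2}"] pt_local[of c 1 e s h "{1}"] c(2) unfolding cv
    by (simp_all add: lz_def lw_om c_def numeral_2_eq_2)
  define N where "N = norm (pt e s h v)"
  have N: "0 < N" "norm (pt e s h ?t) = N"
    using pt_nz[OF v(1)] v(2) rot34_props(2) r3434_pt[of e s h v] by (auto simp: N_def) (metis comp_apply rot34_props(2))
  have sum: "nv v + nv ?t = (1 / N) *\<^sub>R emb e s (?Z * (2 * h 2)) (?W * 1)"
  proof -
    have "nv v + nv ?t = (1 / N) *\<^sub>R (pt e s h v + pt e s h ?t)"
      unfolding nv_def N(2) N_def[symmetric] by (simp add: scaleR_add_right divide_inverse)
    also have "pt e s h v + pt e s h ?t = emb e s (?Z * (2 * h 2)) (?W * 1)"
      unfolding pv pt' emb_add distrib_left[symmetric] cnj_om by simp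
    finally show ?thesis .
  qed
  define m where "m = (nv v + nv ?t) /\<^sub>R norm (nv v + nv ?t)"
  define Nm where "Nm = norm (emb e s (?Z * (2 * h 2)) (?W * 1))"
  have Nm2: "Nm * Nm = 4 * (h 2 \<bullet> h 2) + 1"
  proof -
    have "Nm * Nm = emb e s (?Z * (2 * h 2)) (?W * 1) \<bullet> emb e s (?Z * (2 * h 2)) (?W * 1)"
      by (simp add: Nm_def dot_square_norm power2_eq_square)
    then show ?thesis unfolding emb_inner cis_inner by (simp add: inner_complex_def algebra_simps)
  qed
  have hh: "0 < h 2 \<bullet> h 2"
    using w_pos[of 2] by (auto simp: complex_eq_iff)
  have "Nm \<noteq> 0"
  proof
    assume "Nm = 0"
    then have "4 * (h 2 \<bullet> h 2) + 1 = 0" using Nm2 by simp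
    then show False using hh by linarith
  qed
  then have Nm: "0 < Nm" by (simp add: Nm_def)
  have m: "m = (1 / Nm) *\<^sub>R emb e s (?Z * (2 * h 2)) (?W * 1)"
  proof -
    have "norm ((1 / N) *\<^sub>R emb e s (?Z * (2 * h 2)) (?W * 1)) = Nm / N"
      unfolding norm_scaleR Nm_def[symmetric] using N(1) by simp
    moreover have "inverse (Nm / N) * (1 / N) = 1 / Nm" using N(1) Nm by simp
    ultimately show ?thesis
      unfolding m_def sum by (simp only: scaleR_scaleR)
  qed
  have nm: "norm m = 1" unfolding m norm_scaleR Nm_def[symmetric] using Nm by simp
  define n2 where "n2 = norm (h 2)"
  have n2: "0 < n2" "n2 * n2 = h 2 \<bullet> h 2" using hh by (auto simp: n2_def dot_square_norm power2_eq_square)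
  have p0: "proj0 m = (1 / n2) *\<^sub>R emb e s (?Z * h 2) (?W * 0)"
  proof -
    have "proj0 m = emb e s (((1 / Nm) *\<^sub>R (?Z * (2 * h 2))) /\<^sub>R norm ((1 / Nm) *\<^sub>R (?Z * (2 * h 2)))) 0"
      unfolding m emb_scale proj0_emb ..
    also have "((1 / Nm) *\<^sub>R (?Z * (2 * h 2))) /\<^sub>R norm ((1 / Nm) *\<^sub>R (?Z * (2 * h 2))) = (1 / n2) *\<^sub>R (?Z * h 2)"
    proof -
      have x: "(1 / Nm) *\<^sub>R (?Z * (2 * h 2)) = (2 / Nm) *\<^sub>R (?Z * h 2)"
        by (simp add: scaleR_conv_of_real)
      have y: "norm ((2 / Nm) *\<^sub>R (?Z * h 2)) = 2 / Nm * n2"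
        unfolding norm_scaleR using Nm by (simp add: norm_mult n2_def)
      have "inverse (2 / Nm * n2) * (2 / Nm) = 1 / n2" using Nm n2(1) by simp
      then show ?thesis unfolding x y by (simp only: scaleR_scaleR)
    qed
    finally show ?thesis by (simp add: emb_scale)
  qed
  define N1 where "N1 = norm (pt e s h c)"
  have N1: "0 < N1" using pt_nz[OF c(1)] c(2) by (simp add: N1_def)
  have nvc: "nv c = (1 / N1) *\<^sub>R emb e s (?Z * h 1) (?W * 1)"
    unfolding nv_def N1_def[symmetric] pc[symmetric] by (simp add: divide_inverse)
  have "proj0 m \<bullet> nv c < (proj0 m \<bullet> m) * (nv c \<bullet> m)"
  proof -
    have i1: "proj0 m \<bullet> nv c = (h 1 \<bullet> h 2) / (n2 * N1)"
      unfolding p0 nvc inner_scaleR_left inner_scaleR_right emb_inner cis_inner by (simp add: inner_commute)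
    have i2: "proj0 m \<bullet> m = 2 * (h 2 \<bullet> h 2) / (n2 * Nm)"
      unfolding p0 unfolding m inner_scaleR_left inner_scaleR_right emb_inner cis_inner
      by (simp add: inner_complex_def algebra_simps add_divide_distrib)
    have i3: "nv c \<bullet> m = (2 * (h 1 \<bullet> h 2) + 1) / (N1 * Nm)"
      unfolding nvc m inner_scaleR_left inner_scaleR_right emb_inner cis_inner
      by (simp add: inner_complex_def algebra_simps add_divide_distrib)
    have key: "h 1 \<bullet> h 2 < 2 * (h 2 \<bullet> h 2)"
    proof -
      have "w 1 * w 2 \<le> w 2 * w 2" "w 2 * w 3 \<le> w 3 * w 3"
        using w_mono[of 1 2] w_mono[of 2 3] w_pos[of 2] w_pos[of 3] by (auto intro!: mult_right_mono)
      moreover have "0 < w 2 * w 2" using w_pos[of 2] by simp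
      moreover have "h 1 \<bullet> h 2 = w 1 * w 2 + w 2 * w 3" "h 2 \<bullet> h 2 = w 2 * w 2 + w 3 * w 3"
        by (simp_all add: inner_complex_def eval_nat_numeral)
      moreover have "0 \<le> w 3 * w 3" by simp
      ultimately show ?thesis by linarith
    qed
    have "(h 1 \<bullet> h 2) * (Nm * Nm) < 2 * (h 2 \<bullet> h 2) * (2 * (h 1 \<bullet> h 2) + 1)"
      unfolding Nm2 using key by (simp add: algebra_simps)
    then show ?thesis
      unfolding i1 i2 i3 using n2(1) N1 Nm by (simp add: field_simps)
  qed
  then have "pi / 2 < sph_angle m (proj0 m) (nv c)"
    by (rule sph_angle_obtuse[OF nm])
  moreover have "slope (M 2) (mlab e s h) = sph_angle m (proj0 m) (nv c)"
    unfolding slope_def s0_def[symmetric] slope_at_def Let_def the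
    unfolding v(3) nv_translate m_def ..
  ultimately show ?thesis by simp
qed

lemma M_slope:
  assumes "2 \<le> K"
  shows "pi / 2 < slope (restr (M K) (mlab e s h) {K - 2, K - 1, K}) (shift_lab (K - 2) (mlab e s h))"
proof -
  let ?j = "K - 2"
  interpret sh: growing "cis (pi / 2 * real ?j) * e" s "\<lambda>n. w (n + ?j)" b
    by (rule growing_shift)
  have "{K - 2, K - 1, K} = {?j..?j + 2}" using assms by auto
  then have e: "restr (M K) (mlab e s h) {K - 2, K - 1, K} = sh.M 2"
    using restr_shift[of ?j 2 K] assms unfolding sh.M_def by simp
  have "layer (shift_lab ?j (mlab e s h)) 2 = layer (mlab (cis (pi / 2 * real ?j) * e) s sh.h) 2"
  proof -
    have "orbit {v} \<in> torus_complex 2" if "v \<in> int_points" "coord_sum v = real 2" for v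
      using torus_complexI[of 2 v "{}"] that by (simp add: strip_cell_def)
    then have "shift_lab ?j (mlab e s h) (orbit {v}) = mlab (cis (pi / 2 * real ?j) * e) s sh.h (orbit {v})"
      if "v \<in> {v \<in> int_points. coord_sum v = real 2}" for v
      using that by (intro mlab_shift) blast
    then show ?thesis
      unfolding layer_def by (intro SUP_cong refl)
  qed
  then show ?thesis
    using sh.M2_slope unfolding e slope_def by simp
qed

section \<open>The component of the complement at the core circle\<close>

text \<open>Above index 0 this is the doubling of the sequence. The term \<open>w 0\<close> may be
  negative and is compared with \<open>w 2\<close> instead, whose double is at most
  \<open>w 3\<close>; here \<open>3 \<le> K\<close> enters.\<close>

lemma eta_norm_le:
  assumes "j < K" "3 \<le> K"
  shows "2 * norm (h j) \<le> norm (h K)"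
proof -
  have "2 * \<bar>w j\<bar> \<le> w K \<and> 2 * \<bar>w (j + 1)\<bar> \<le> w (K + 1)"
  proof (cases "j = 0")
    case True
    have a: "2 * w 2 \<le> w 3" "2 * w 1 \<le> w 2"
      using w_double[of 1] w_double[of 0] by (simp_all add: eval_nat_numeral)
    have b: "w 3 \<le> w K" "w 2 \<le> w (K + 1)" using assms by (auto intro!: w_mono)
    have "\<bar>w 0\<bar> \<le> w 2" using d0 w02 a by linarith
    then show ?thesis using True a b w1 by simp
  next
    case False
    then obtain i where i: "j = i + 1" by (metis Suc_eq_plus1 not0_implies_Suc)
    have "2 * w j \<le> w (j + 1)" "2 * w (j + 1) \<le> w (j + 2)"
      using w_double[of i] w_double[of j] i by (simp_all add: eval_nat_numeral)
    moreover have "w (j + 1) \<le> w K" "w (j + 2) \<le> w (K + 1)"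
      using assms by (auto intro!: w_mono)
    moreover have "0 < w j" "0 < w (j + 1)" using False by (auto intro: w_pos)
    ultimately show ?thesis by simp
  qed
  then have "(2 * \<bar>w j\<bar>)\<^sup>2 \<le> (w K)\<^sup>2" "(2 * \<bar>w (j + 1)\<bar>)\<^sup>2 \<le> (w (K + 1))\<^sup>2"
    by (intro power_mono; simp)+
  then have "(2 * norm (h j))\<^sup>2 \<le> (norm (h K))\<^sup>2"
    unfolding power_mult_distrib cmod_power2 eta_sel by simp
  then show ?thesis by (rule power2_le_imp_le) simp
qed

text \<open>Nestedness excludes \<open>om\<close> against \<open>cnj om\<close>, the only two of the
  three directions that enclose more than pi / 3.\<close>

lemma lw_top:
  assumes "S \<subseteq> I"
  shows "1/2 \<le> lw I \<bullet> lw S" "lw I \<bullet> lw I = 1"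
proof -
  show "1/2 \<le> lw I \<bullet> lw S"
    using assms unfolding lw_om
    by (cases "1 \<in> S"; cases "2 \<in> S"; cases "1 \<in> I"; cases "2 \<in> I")
      (auto simp: inner_complex_def om_Complex)
  show "lw I \<bullet> lw I = 1"
    unfolding lw_om by (auto simp: inner_complex_def om_Complex)
qed

text \<open>Second components are measured along the direction \<open>lw I\<close> of the highest
  vertex. Every other vertex keeps at least half its length in that direction, while its first
  component is at most half of \<open>norm (h K)\<close>; the two halves cancel.\<close>

lemma cell_bound:
  assumes v: "strip_cell K v I" and K: "3 \<le> K" and x: "emb e s z u \<in> cspan (cp v) (Pow I)"
  shows "norm z \<le> norm (h K) * norm u"
proof -
  have vi: "v \<in> int_points" "0 \<le> coord_sum v" using v by (auto simp: strip_cell_def)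
  obtain n where n: "coord_sum v = real n" using int_points_coord_sum_nat[OF vi] by blast
  have nK: "n + card I \<le> K" using v n by (simp add: strip_cell_def)
  obtain c where c: "emb e s z u = (\<Sum>S\<in>Pow I. c S *\<^sub>R cp v S)" "\<forall>S\<in>Pow I. 0 \<le> c S"
    using x by (auto simp: cspan_def)
  let ?c = "cis (pi / 2 * v $ 3)" and ?d = "cis (pi / 3 * (v $ 1 - v $ 2))"
  have zu: "z = ?c * (\<Sum>S\<in>Pow I. c S *\<^sub>R lz h n S)" "u = ?d * (\<Sum>S\<in>Pow I. c S *\<^sub>R lw S)"
  proof -
    have "emb e s z u = emb e s (?c * (\<Sum>S\<in>Pow I. c S *\<^sub>R lz h n S)) (?d * (\<Sum>S\<in>Pow I. c S *\<^sub>R lw S))"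
      unfolding c(1) pt_local[OF n] emb_sum by (simp add: sum_distrib_left)
    then show "z = ?c * (\<Sum>S\<in>Pow I. c S *\<^sub>R lz h n S)" "u = ?d * (\<Sum>S\<in>Pow I. c S *\<^sub>R lw S)"
      unfolding emb_eq_iff by auto
  qed
  have "norm z = norm (\<Sum>S\<in>Pow I. c S *\<^sub>R lz h n S)"
    unfolding zu by (simp add: norm_mult)
  also have "\<dots> \<le> (\<Sum>S\<in>Pow I. c S * norm (h (n + card S)))"
    by (rule order_trans[OF norm_sum]) (use c(2) in \<open>auto simp: lz_def norm_mult intro!: sum_mono\<close>)
  also have "\<dots> \<le> (\<Sum>S\<in>Pow I. c S * (norm (h K) * (lw I \<bullet> lw S)))"
  proof (intro sum_mono mult_left_mono)
    fix S assume S: "S \<in> Pow I"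
    show "norm (h (n + card S)) \<le> norm (h K) * (lw I \<bullet> lw S)"
    proof (cases "S = I")
      case True
      have "norm (h (n + card I)) \<le> norm (h K)"
      proof (cases "n + card I = K")
        case False
        then have "2 * norm (h (n + card I)) \<le> norm (h K)" using nK by (intro eta_norm_le K) simp
        then show ?thesis using norm_ge_zero[of "h (n + card I)"] by linarith
      qed simp
      then show ?thesis using True lw_top(2)[of I] by simp
    next
      case False
      then have "card S < card I" using S by (intro psubset_card_mono) auto
      then have "2 * norm (h (n + card S)) \<le> norm (h K)"
        using nK by (intro eta_norm_le K) simp
      moreover have "norm (h K) * (1/2) \<le> norm (h K) * (lw I \<bullet> lw S)"
        using lw_top(1)[of S I] S by (intro mult_left_mono) auto
      ultimately show ?thesis by simp
    qed
  qed (use c(2) in auto)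
  also have "\<dots> = norm (h K) * (lw I \<bullet> (\<Sum>S\<in>Pow I. c S *\<^sub>R lw S))"
    by (simp add: inner_sum_right sum_distrib_left algebra_simps)
  also have "\<dots> \<le> norm (h K) * norm (\<Sum>S\<in>Pow I. c S *\<^sub>R lw S)"
  proof -
    have "norm (lw I) = 1" using lw_top(2)[of I] by (simp add: norm_eq_1)
    then have "lw I \<bullet> (\<Sum>S\<in>Pow I. c S *\<^sub>R lw S) \<le> norm (\<Sum>S\<in>Pow I. c S *\<^sub>R lw S)"
      using norm_cauchy_schwarz[of "lw I" "\<Sum>S\<in>Pow I. c S *\<^sub>R lw S"] by simp
    then show ?thesis by (rule mult_left_mono) simp
  qed
  also have "norm (\<Sum>S\<in>Pow I. c S *\<^sub>R lw S) = norm u"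
    unfolding zu by (simp add: norm_mult)
  finally show ?thesis .
qed

text \<open>By \<open>cell_bound\<close> the open tube about the core circle in which
  \<open>norm u\<close> is less than \<open>norm z / norm (h K)\<close> misses the complex. It is
  connected, so it lies in one component, and vertices of layer \<open>K\<close> lie in its
  closure.\<close>

lemma M_component:
  assumes K: "3 \<le> K"
  shows "\<exists>Q\<in>components (S3eq - \<Union>(M K)). Clif 0 \<subseteq> Q \<and> closure Q \<inter> layer (mlab e s h) K \<noteq> {}"
proof -
  define R where "R = norm (h K)"
  have "0 < w K" using K by (intro w_pos) simp
  then have R: "0 < R" by (auto simp: R_def complex_eq_iff)
  define f where "f = (\<lambda>(z, u). emb e s z u /\<^sub>R norm (emb e s z u))"
  \<comment> \<open>With the first component scaled to modulus 1 the tube is the image of the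
    product of a circle and a disc, which makes connectedness and closure immediate.\<close>
  define D where "D = sphere (0::complex) 1 \<times> ball (0::complex) (1 / R)"
  have nz: "emb e s z u \<noteq> 0" if "norm z = 1" for z u
    using that by (auto simp: emb_eq_0_iff)
  have fc: "continuous_on (sphere 0 1 \<times> UNIV) f"
    unfolding f_def case_prod_beta
    using emb_continuous[unfolded case_prod_beta] nz
    by (intro continuous_intros) auto
  have "connected D"
    unfolding D_def by (intro connected_Times connected_sphere) auto
  then have conn: "connected (f ` D)"
    by (rule connected_continuous_image[rotated]) (auto intro!: continuous_on_subset[OF fc] simp: D_def)
  have fS: "f (z, u) \<in> S3eq" if "norm z = 1" for z u
    using nz[OF that, of u] by (simp add: f_def S3eq_def)
  have sub: "f ` D \<subseteq> S3eq - \<Union>(M K)"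
  proof
    fix x assume "x \<in> f ` D"
    then obtain z u where zu: "x = f (z, u)" "norm z = 1" "norm u < 1 / R"
      by (auto simp: D_def)
    have "x \<notin> P" if P: "P \<in> M K" for P
    proof
      assume "x \<in> P"
      then obtain v I where v: "strip_cell K v I" "x \<in> cspan (cp v) (Pow I)"
        using P by (auto elim!: M_E simp: sph_hull_image)
      have "x = emb e s (z /\<^sub>R norm (emb e s z u)) (u /\<^sub>R norm (emb e s z u))"
        unfolding zu(1) f_def by (simp add: emb_scale)
      then have "norm (z /\<^sub>R norm (emb e s z u)) \<le> R * norm (u /\<^sub>R norm (emb e s z u))"
        unfolding R_def using v(2) by (intro cell_bound[OF v(1) K]) (simp only:)
      then have "norm z \<le> R * norm u"
        using nz[OF zu(2), of u] by (simp add: field_simps)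
      then show False using zu R by (simp add: field_simps)
    qed
    then show "x \<in> S3eq - \<Union>(M K)" using fS zu by auto
  qed
  have Cl: "Clif 0 \<subseteq> f ` D"
  proof
    fix x assume x: "x \<in> Clif 0"
    then have xS: "x \<in> S3eq" "x $ 5 = 0" by (auto simp: Clif_def S3eq_def)
    obtain z u where zu: "x = emb e s z u" using emb_surj[OF frame_axioms xS(2)] .
    have u: "u = 0" using emb_Clif_iff(1) x xS zu by blast
    have n: "norm x = 1" using xS by (simp add: S3eq_def)
    then have "norm z = 1" unfolding zu u norm_emb_z .
    moreover have "x = f (z, 0)" using n unfolding zu u f_def by simp
    ultimately show "x \<in> f ` D" using R by (auto simp: D_def)
  qed
  then have "f ` D \<noteq> {}" using R by (auto simp: D_def)
  then obtain Q where Q: "Q \<in> components (S3eq - \<Union>(M K))" "f ` D \<subseteq> Q"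
    using exists_component_superset[OF sub _ conn] sub by blast
  let ?v = "vector [0, 0, real K] :: real^3"
  have v: "?v \<in> int_points" "coord_sum ?v = real K"
    by (auto simp: int_points_def forall_3 coord_sum_def)
  have "nv ?v \<in> closure (f ` D)"
  proof -
    define z0 where "z0 = (cis (pi / 2 * K) * h K) /\<^sub>R R"
    define u0 where "u0 = complex_of_real (1 / R)"
    have p: "pt e s h ?v = R *\<^sub>R emb e s z0 u0"
    proof -
      have "R *\<^sub>R u0 = 1" using R by (simp add: u0_def scaleR_conv_of_real)
      moreover have "R *\<^sub>R z0 = cis (pi / 2 * K) * h K" using R by (simp add: z0_def)
      ultimately show ?thesis unfolding pt_def v(2) emb_scale by simp
    qed
    then have "nv ?v = f (z0, u0)" using R by (simp add: nv_def f_def)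
    moreover have "(z0, u0) \<in> closure D"
    proof -
      have "norm u0 = 1 / R" unfolding u0_def norm_of_real using R by simp
      moreover have "norm z0 = 1" using R by (simp add: z0_def norm_mult R_def[symmetric])
      ultimately show ?thesis using R unfolding D_def closure_Times by simp
    qed
    moreover have "f ` closure D \<subseteq> closure (f ` D)"
    proof (rule image_closure_subset)
      show "continuous_on (closure D) f"
        by (rule continuous_on_subset[OF fc]) (auto simp: D_def closure_Times)
    qed (auto simp: closure_subset)
    ultimately show ?thesis by blast
  qed
  then have "nv ?v \<in> closure Q" using closure_mono[OF Q(2)] by blast
  moreover have "nv ?v \<in> layer (mlab e s h) K" using nv_layer_iff[OF v(1)] v(2) by simp
  ultimately have "closure Q \<inter> layer (mlab e s h) K \<noteq> {}" by blast
  moreover have "Clif 0 \<subseteq> Q" using Cl Q(2) by (rule subset_trans)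
  ultimately show ?thesis using Q(1) by (intro bexI[of _ Q] conjI)
qed

lemma M_S3eq: "\<Union>(M K) \<subseteq> S3eq"
proof
  fix x assume "x \<in> \<Union>(M K)"
  then obtain v I where "x \<in> cspan (cp v) (Pow I)" "norm x = 1"
    by (auto elim!: M_E simp: sph_hull_image)
  then obtain c where "x = (\<Sum>S\<in>Pow I. c S *\<^sub>R cp v S)" by (auto simp: cspan_def)
  then have "x $ 5 = 0" by (simp add: pt_def)
  then show "x \<in> S3eq" using \<open>norm x = 1\<close> by (simp add: S3eq_def)
qed

lemma M_ideal:
  assumes "3 \<le> K"
  shows "ideal_cct K (M K) (mlab e s h)"
  unfolding ideal_cct_def using M_transversal M_slope[of K] M_component[OF assms] assms by auto

lemma M_extends: "restr (M (k + 1)) (mlab e s h) {0..k} = M k"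
proof -
  have "restr (M (k + 1)) (mlab e s h) {0..k} = insert {} {sph_hull (cp v ` Pow I) | v I. strip_cell k v I \<and> real 0 \<le> coord_sum v}"
    by (rule restr_M) simp
  also have "\<dots> = M k"
  proof -
    have "strip_cell k v I \<and> real 0 \<le> coord_sum v \<longleftrightarrow> strip_cell k v I" for v I
      by (auto simp: strip_cell_def)
    moreover have "M k = insert {} {sph_hull (cp v ` Pow I) | v I. strip_cell k v I}"
    proof (intro equalityI subsetI)
      fix P assume "P \<in> M k"
      then show "P \<in> insert {} {sph_hull (cp v ` Pow I) | v I. strip_cell k v I}"
        by (rule M_E) blast+
    next
      fix P assume "P \<in> insert {} {sph_hull (cp v ` Pow I) | v I. strip_cell k v I}"
      then show "P \<in> M k" using M_empty M_cell by blast
    qed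
    ultimately show ?thesis by simp
  qed
  finally show ?thesis .
qed

end


section \<open>Vertices and cells of a CCT\<close>

text \<open>Scaling the generators to \<open>a \<bullet> u = 1\<close> puts them into an affine
  hyperplane, where \<open>v\<close> is strictly separated from the hull of the others; subtracting
  the right multiple of \<open>a\<close> makes the separating form vanish at
  \<open>v\<close>.\<close>

lemma sph_polytope_exposed_vertex:
  assumes V: "finite V" "\<forall>v\<in>V. 0 < a \<bullet> v" and v: "v \<in> V" "v \<notin> convex_cone hull (V - {v})" "norm v = 1"
  shows "{v} sph_face_of sph_hull V"
proof -
  define q where "q u = u /\<^sub>R (a \<bullet> u)" for u
  have q: "a \<bullet> q u = 1" if "u \<in> V" for u
    using V(2) that by (force simp: q_def)
  let ?H = "convex hull (q ` (V - {v}))"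
  have "q v \<notin> ?H"
  proof
    assume "q v \<in> ?H"
    also have "?H \<subseteq> convex_cone hull (V - {v})"
    proof (intro hull_minimal convex_convex_cone_hull subsetI)
      fix x assume "x \<in> q ` (V - {v})"
      then obtain u where u: "u \<in> V - {v}" "x = inverse (a \<bullet> u) *\<^sub>R u" by (auto simp: q_def)
      show "x \<in> convex_cone hull (V - {v})"
        unfolding u(2) using u(1) V(2) by (intro convex_cone_hull_mul hull_inc) (auto simp: less_imp_le)
    qed
    finally have "(a \<bullet> v) *\<^sub>R q v \<in> convex_cone hull (V - {v})"
      using V(2) v(1) by (intro convex_cone_hull_mul) (auto simp: less_imp_le)
    moreover have "(a \<bullet> v) *\<^sub>R q v = v" using V(2) v(1) by (force simp: q_def)
    ultimately show False using v(2) by simp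
  qed
  moreover have "closed ?H"
    using V(1) by (intro compact_imp_closed compact_convex_hull finite_imp_compact) auto
  ultimately obtain b c where bc: "b \<bullet> q v < c" "\<forall>x\<in>?H. c < b \<bullet> x"
    using separating_hyperplane_closed_point[of ?H "q v"] convex_convex_hull by blast
  define d where "d = b - (b \<bullet> q v) *\<^sub>R a"
  have dq: "d \<bullet> q u = b \<bullet> q u - b \<bullet> q v" if "u \<in> V" for u
    using q[OF that] by (simp add: d_def inner_diff_left)
  have uq: "d \<bullet> u = (a \<bullet> u) * (d \<bullet> q u)" if "u \<in> V" for u
    using V(2) that by (force simp: q_def)
  have dv: "d \<bullet> v = 0" using uq[OF v(1)] dq[OF v(1)] by simp
  have du: "0 < d \<bullet> u" if "u \<in> V" "u \<noteq> v" for u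
  proof -
    have "q u \<in> ?H" using that by (intro hull_inc) auto
    then have "0 < d \<bullet> q u" using bc dq[OF that(1)] by fastforce
    then show ?thesis using uq[OF that(1)] V(2) that(1) by simp
  qed
  have dn: "0 \<le> d \<bullet> id u" if "u \<in> V" for u
    using dv du[OF that] by (cases "u = v") auto
  have "{x \<in> sph_hull (id ` V). d \<bullet> x = 0} = sph_hull (id ` {i \<in> V. d \<bullet> id i = 0})"
    by (rule sph_hull_face[OF V(1) dn])
  moreover have "{i \<in> V. d \<bullet> id i = 0} = {v}" using dv du v(1) by force
  moreover have "v \<noteq> 0" using v(3) by auto
  ultimately have "{x \<in> sph_hull V. d \<bullet> x = 0} = {v}"
    using sph_hull_single[of v] v(3) by simp
  moreover have "\<forall>x\<in>sph_hull V. 0 \<le> d \<bullet> x"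
  proof
    fix x assume "x \<in> sph_hull V"
    then have "x \<in> cspan id V" using sph_hull_image[OF V(1), of id] by simp
    then show "0 \<le> d \<bullet> x"
      by (rule inner_cspan_nonneg[OF _ dn])
  qed
  ultimately show ?thesis unfolding sph_face_of_def by blast
qed

text \<open>In a minimal generating set no generator lies in the cone of the others, so every
  generator is an exposed vertex.\<close>

lemma sph_polytope_vertices:
  assumes "sph_polytope P"
  shows "P = sph_hull {x. {x} sph_face_of P}"
proof -
  obtain V a where V: "finite V" "V \<subseteq> sphere 0 1" "\<forall>v\<in>V. 0 < a \<bullet> v" "P = sph_hull V"
    using assms unfolding sph_polytope_def by blast
  define \<U> where "\<U> = {U. U \<subseteq> V \<and> sph_hull U = P}"
  have "finite \<U>" unfolding \<U>_def using V(1) by (auto intro: finite_subset[of _ "Pow V"])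
  moreover have "V \<in> \<U>" using V by (simp add: \<U>_def)
  ultimately obtain U where U: "U \<in> \<U>" "\<And>W. W \<in> \<U> \<Longrightarrow> W \<subseteq> U \<Longrightarrow> W = U"
    using finite_has_minimal2[of \<U> V] by metis
  have Uf: "finite U" "U \<subseteq> V" "sph_hull U = P" using U(1) V(1) finite_subset by (auto simp: \<U>_def)
  have ex: "{v} sph_face_of P" if v: "v \<in> U" for v
  proof -
    have "v \<notin> convex_cone hull (U - {v})"
    proof
      assume "v \<in> convex_cone hull (U - {v})"
      then have "convex_cone hull (U - {v}) = convex_cone hull U"
        using hull_redundant[of v convex_cone "U - {v}"] v by (simp add: insert_absorb)
      then have "U - {v} \<in> \<U>" using Uf by (auto simp: \<U>_def sph_hull_def)
      then show False using U(2)[of "U - {v}"] v by blast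
    qed
    moreover have "norm v = 1" using v Uf V by auto
    ultimately show ?thesis
      using sph_polytope_exposed_vertex[of U a v] v Uf V by auto
  qed
  have "P \<subseteq> sph_hull {x. {x} sph_face_of P}"
    unfolding Uf(3)[symmetric] using ex Uf(3) by (intro sph_hull_mono) auto
  moreover have "sph_hull {x. {x} sph_face_of P} \<subseteq> P"
  proof -
    have "{x. {x} sph_face_of P} \<subseteq> P" by (auto simp: sph_face_of_def)
    also have "P \<subseteq> convex_cone hull V" using V(4) by (simp add: sph_hull_def)
    finally have "convex_cone hull {x. {x} sph_face_of P} \<subseteq> convex_cone hull V"
      by (intro hull_minimal convex_cone_convex_cone_hull)
    then show ?thesis unfolding V(4) sph_hull_def by blast
  qed
  ultimately show ?thesis by blast
qed

locale cct =
  fixes k :: nat and T :: "(real^5) set set" and \<phi> :: labelling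
  assumes is_cct: "is_cct k T \<phi>"
begin

lemma lab_in: "C \<in> torus_complex k \<Longrightarrow> \<phi> C \<in> T"
  using is_cct by (auto simp: is_cct_def bij_betw_def)

lemma lab_onto: "P \<in> T \<Longrightarrow> \<exists>C\<in>torus_complex k. P = \<phi> C"
  using is_cct by (auto simp: is_cct_def bij_betw_def)

lemma lab_inj: "C \<in> torus_complex k \<Longrightarrow> D \<in> torus_complex k \<Longrightarrow> \<phi> C = \<phi> D \<Longrightarrow> C = D"
  using is_cct by (auto simp: is_cct_def bij_betw_def inj_on_def)

lemma lab_le: "C \<in> torus_complex k \<Longrightarrow> D \<in> torus_complex k \<Longrightarrow> \<phi> C \<subseteq> \<phi> D \<longleftrightarrow> orbit_le C D"
  using is_cct by (auto simp: is_cct_def)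

lemma polytopal: "polytopal_complex T"
  using is_cct by (auto simp: is_cct_def cubical_complex_def)

lemma face_in: "P \<in> T \<Longrightarrow> F sph_face_of P \<Longrightarrow> F \<in> T"
  using polytopal unfolding polytopal_complex_def by blast

lemma polytope: "P \<in> T \<Longrightarrow> sph_polytope P"
  using polytopal unfolding polytopal_complex_def by blast

lemma inter_face: "P \<in> T \<Longrightarrow> Q \<in> T \<Longrightarrow> (P \<inter> Q) sph_face_of Q"
  using polytopal unfolding polytopal_complex_def by blast

lemma sub_face: "P \<in> T \<Longrightarrow> Q \<in> T \<Longrightarrow> P \<subseteq> Q \<Longrightarrow> P sph_face_of Q"
  using inter_face[of P Q] by (simp add: Int_absorb2)

text \<open>The empty face of this polytope belongs to the complex, so it has a label; that label
  lies below \<open>orbit {}\<close>, below which there is nothing else.\<close>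

lemma lab_empty: "\<phi> (orbit {}) = {}"
proof -
  have O: "orbit {} \<in> torus_complex k" by (rule orbit_empty_in)
  have "{} sph_face_of \<phi> (orbit {})"
  proof -
    obtain V a where V: "finite V" "\<forall>v\<in>V. 0 < a \<bullet> v" "\<phi> (orbit {}) = sph_hull V"
      using polytope[OF lab_in[OF O]] unfolding sph_polytope_def by blast
    have x: "x \<in> cspan id V \<and> norm x = 1" if "x \<in> sph_hull V" for x
      using that sph_hull_image[OF V(1), of id] by simp
    have nn: "\<forall>x\<in>sph_hull V. 0 \<le> a \<bullet> x"
      using inner_cspan_nonneg[of _ id V a] V(2) x by (auto simp: less_imp_le)
    have e: "{i \<in> V. a \<bullet> id i = 0} = {}" using V(2) by force
    have "{x \<in> sph_hull (id ` V). a \<bullet> x = 0} = sph_hull (id ` {i \<in> V. a \<bullet> id i = 0})"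
      using V by (intro sph_hull_face) (auto simp: less_imp_le)
    then have "{x \<in> sph_hull V. a \<bullet> x = 0} = {}" unfolding e by simp
    with nn show ?thesis unfolding V(3) sph_face_of_def by (intro exI[of _ a]) simp
  qed
  then obtain C where C: "C \<in> torus_complex k" "{} = \<phi> C"
    using face_in[OF lab_in[OF O]] lab_onto by blast
  then have "orbit_le C (orbit {})" using lab_le[OF C(1) O] by blast
  then have "C = orbit {}" using C(1) not_orbit_le_empty by (metis torus_complexE)
  then show ?thesis using C by simp
qed

text \<open>The polytope has a vertex, and the label of that vertex lies below the class of
  \<open>v\<close>; as it is not the empty class, it is the class of \<open>v\<close>.\<close>

lemma lab_vertex_ex:
  assumes "strip_cell k v {}"
  shows "\<exists>x. \<phi> (orbit {v}) = {x}"
proof -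
  have C: "orbit {v} \<in> torus_complex k" using torus_complexI[OF assms] by simp
  have "orbit {v} \<noteq> orbit {}" using orbit_cell_ne_empty[of v "{}"] by simp
  then have ne: "\<phi> (orbit {v}) \<noteq> {}" using lab_inj[OF C orbit_empty_in] lab_empty by metis
  then have "{x. {x} sph_face_of \<phi> (orbit {v})} \<noteq> {}"
    using sph_polytope_vertices[OF polytope[OF lab_in[OF C]]] by (metis sph_hull_empty)
  then obtain x where x: "{x} sph_face_of \<phi> (orbit {v})" by blast
  then have "{x} \<in> T" using face_in lab_in[OF C] by blast
  then obtain D where D: "D \<in> torus_complex k" "{x} = \<phi> D" using lab_onto by blast
  have "\<phi> D \<subseteq> \<phi> (orbit {v})" using x D by (auto simp: sph_face_of_def)
  then have le: "orbit_le D (orbit (cell v {}))" using lab_le[OF D(1) C] by simp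
  have "D \<noteq> orbit {}" using D lab_empty by auto
  then obtain u J where u: "strip_cell k u J" "D = orbit (cell u J)" using D(1) by (metis torus_complexE)
  have i: "u \<in> int_points" "v \<in> int_points" using u assms by (auto simp: strip_cell_def)
  obtain l A where "l \<in> Lam" "u = l + v + ind A" "A \<union> J \<subseteq> {}"
    using le unfolding u(2) orbit_le_cell_iff[OF i] by blast
  then have "D = orbit {v}" using u orbit_translate[of l v "{}"] by auto
  then show ?thesis using D(2) by (intro exI[of _ x]) simp
qed

definition pv :: "real^3 \<Rightarrow> real^5" where
  "pv v = the_elem (\<phi> (orbit {v}))"

lemma lab_vertex: "strip_cell k v {} \<Longrightarrow> \<phi> (orbit {v}) = {pv v}"
proof -
  assume "strip_cell k v {}"
  then obtain x where x: "\<phi> (orbit {v}) = {x}" using lab_vertex_ex by blast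
  show ?thesis unfolding pv_def x by simp
qed

lemma strip_vertex: "strip_cell k v I \<Longrightarrow> S \<subseteq> I \<Longrightarrow> strip_cell k (v + ind S) {}"
  using strip_cell_face[of k v I S S] by simp

lemma pv_mem_iff:
  assumes u: "strip_cell k u {}" and v: "strip_cell k v I"
  shows "pv u \<in> \<phi> (orbit (cell v I)) \<longleftrightarrow> (\<exists>l\<in>Lam. \<exists>A\<subseteq>I. u = l + v + ind A)"
proof -
  have i: "u \<in> int_points" "v \<in> int_points" using u v by (auto simp: strip_cell_def)
  have "pv u \<in> \<phi> (orbit (cell v I)) \<longleftrightarrow> \<phi> (orbit (cell u {})) \<subseteq> \<phi> (orbit (cell v I))"
    using lab_vertex[OF u] by simp
  also have "\<dots> \<longleftrightarrow> orbit_le (orbit (cell u {})) (orbit (cell v I))"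
    by (rule lab_le[OF torus_complexI[OF u] torus_complexI[OF v]])
  also have "\<dots> \<longleftrightarrow> (\<exists>l\<in>Lam. \<exists>A\<subseteq>I. u = l + v + ind A)"
    unfolding orbit_le_cell_iff[OF i] by auto
  finally show ?thesis .
qed

lemma pv_mem_cell_iff:
  assumes v: "strip_cell k v I" and S: "S \<subseteq> I" and J: "J \<subseteq> I"
  shows "pv (v + ind S) \<in> \<phi> (orbit (cell v J)) \<longleftrightarrow> S \<subseteq> J"
proof -
  have vJ: "strip_cell k v J" using strip_cell_face[OF v, of "{}" J] J by simp
  show ?thesis
    unfolding pv_mem_iff[OF strip_vertex[OF v S] vJ]
  proof
    assume "\<exists>l\<in>Lam. \<exists>A\<subseteq>J. v + ind S = l + v + ind A"
    then obtain l A where "l \<in> Lam" "A \<subseteq> J" "v + ind S = l + v + ind A" by blast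
    then have "ind S - ind A \<in> Lam" by (simp add: algebra_simps)
    then have "S = A" by (rule Lam_ind_diff)
    then show "S \<subseteq> J" using \<open>A \<subseteq> J\<close> by simp
  next
    assume "S \<subseteq> J"
    then show "\<exists>l\<in>Lam. \<exists>A\<subseteq>J. v + ind S = l + v + ind A"
      using Lam_zero by (intro bexI[of _ 0] exI[of _ S]) auto
  qed
qed

lemma lab_vertices:
  assumes v: "strip_cell k v I"
  shows "{x} sph_face_of \<phi> (orbit (cell v I)) \<longleftrightarrow> (\<exists>S\<subseteq>I. x = pv (v + ind S))"
proof
  note C = torus_complexI[OF v]
  assume x: "{x} sph_face_of \<phi> (orbit (cell v I))"
  then obtain D where D: "D \<in> torus_complex k" "{x} = \<phi> D" using face_in lab_in[OF C] lab_onto by blast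
  have "D \<noteq> orbit {}" using D lab_empty by auto
  then obtain u J where u: "strip_cell k u J" "D = orbit (cell u J)" using D(1) by (metis torus_complexE)
  have us: "strip_cell k u {}" using strip_vertex[OF u(1), of "{}"] by simp
  have "pv u \<in> \<phi> D" unfolding u(2) pv_mem_iff[OF us u(1)] using Lam_zero by (intro bexI[of _ 0] exI[of _ "{}"]) auto
  then have xu: "x = pv u" unfolding D(2)[symmetric] by simp
  moreover have "x \<in> \<phi> (orbit (cell v I))" using x by (auto simp: sph_face_of_def)
  ultimately obtain l A where A: "l \<in> Lam" "A \<subseteq> I" "u = l + v + ind A"
    using pv_mem_iff[OF us v] by blast
  have "orbit {u} = orbit {v + ind A}"
    using orbit_translate[OF A(1), of "v + ind A" "{}"] A(3) by (simp add: add.assoc)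
  then show "\<exists>S\<subseteq>I. x = pv (v + ind S)" using A(2) xu by (auto simp: pv_def)
next
  assume "\<exists>S\<subseteq>I. x = pv (v + ind S)"
  then obtain S where S: "S \<subseteq> I" "x = pv (v + ind S)" by blast
  note sv = strip_vertex[OF v S(1)]
  have "\<phi> (orbit (cell (v + ind S) {})) = {x}" using lab_vertex[OF sv] S by simp
  then have "{x} \<in> T" using lab_in[OF torus_complexI[OF sv]] by simp
  moreover have "x \<in> \<phi> (orbit (cell v I))" using pv_mem_cell_iff[OF v S(1) order_refl] S by simp
  ultimately show "{x} sph_face_of \<phi> (orbit (cell v I))"
    by (intro sub_face lab_in torus_complexI v) auto
qed

lemma lab_cell:
  assumes "strip_cell k v I"
  shows "\<phi> (orbit (cell v I)) = sph_hull ((\<lambda>S. pv (v + ind S)) ` Pow I)"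
proof -
  have "{x. {x} sph_face_of \<phi> (orbit (cell v I))} = (\<lambda>S. pv (v + ind S)) ` Pow I"
    using lab_vertices[OF assms] by auto
  then show ?thesis
    using sph_polytope_vertices[OF polytope[OF lab_in[OF torus_complexI[OF assms]]]] by simp
qed

lemma pv_norm:
  assumes "strip_cell k v {}"
  shows "norm (pv v) = 1"
proof -
  have "pv v \<in> \<phi> (orbit {v})" using lab_vertex[OF assms] by simp
  moreover obtain V where "\<phi> (orbit {v}) = sph_hull V"
    using polytope[OF lab_in[OF torus_complexI[OF assms]]] unfolding sph_polytope_def by auto
  ultimately show ?thesis by (simp add: sph_hull_def)
qed

lemma cell_pointed:
  assumes "strip_cell k v I"
  obtains a where "\<And>S. S \<subseteq> I \<Longrightarrow> 0 < a \<bullet> pv (v + ind S)"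
proof -
  obtain V a where V: "finite V" "\<forall>v\<in>V. 0 < a \<bullet> v" "\<phi> (orbit (cell v I)) = sph_hull V"
    using polytope[OF lab_in[OF torus_complexI[OF assms]]] unfolding sph_polytope_def by blast
  have "0 < a \<bullet> x" if x: "x \<in> sph_hull V" for x
  proof -
    have xs: "x \<in> cspan id V" "norm x = 1" using x sph_hull_image[OF V(1), of id] by auto
    then have "0 \<le> a \<bullet> x" using V(2) by (intro inner_cspan_nonneg[of x id V a]) (auto simp: less_imp_le)
    moreover have "a \<bullet> x \<noteq> 0"
    proof
      assume "a \<bullet> x = 0"
      then have "x \<in> cspan id {i \<in> V. a \<bullet> id i = 0}"
        using cspan_face[OF V(1), of a id] xs V(2) by (auto simp: less_imp_le)
      moreover have "{i \<in> V. a \<bullet> id i = 0} = {}" using V(2) by force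
      ultimately have "x \<in> cspan id {}" by (simp only:)
      then show False using xs(2) by simp
    qed
    ultimately show ?thesis by simp
  qed
  moreover have "pv (v + ind S) \<in> sph_hull V" if "S \<subseteq> I" for S
    using pv_mem_cell_iff[OF assms that order_refl] that V(3) by simp
  ultimately show ?thesis using that by blast
qed

text \<open>The labelling makes the face with vertex set \<open>ivl A B\<close> a cell contained in
  the given one, and in a polytopal complex containment implies the face relation, hence a
  supporting functional.\<close>

lemma face_functional:
  assumes v: "strip_cell k v I" and AB: "A \<subseteq> B" "B \<subseteq> I"
  obtains a where "\<And>S. S \<subseteq> I \<Longrightarrow> 0 \<le> a \<bullet> pv (v + ind S)" "\<And>S. S \<subseteq> I \<Longrightarrow> a \<bullet> pv (v + ind S) = 0 \<longleftrightarrow> A \<subseteq> S \<and> S \<subseteq> B"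
proof -
  note vf = strip_cell_face[OF v AB]
  have i: "v + ind A \<in> int_points" "v \<in> int_points" using v vf by (auto simp: strip_cell_def)
  have "orbit_le (orbit (cell (v + ind A) (B - A))) (orbit (cell v I))"
    unfolding orbit_le_cell_iff[OF i] using Lam_zero AB by (intro bexI[of _ 0] exI[of _ A]) auto
  then have "\<phi> (orbit (cell (v + ind A) (B - A))) sph_face_of \<phi> (orbit (cell v I))"
    using lab_le[OF torus_complexI[OF vf] torus_complexI[OF v]]
    by (intro sub_face lab_in torus_complexI vf v) simp
  then obtain a where a: "\<forall>x\<in>\<phi> (orbit (cell v I)). 0 \<le> a \<bullet> x"
    "\<phi> (orbit (cell (v + ind A) (B - A))) = {x \<in> \<phi> (orbit (cell v I)). a \<bullet> x = 0}"
    unfolding sph_face_of_def by blast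
  have m: "pv (v + ind S) \<in> \<phi> (orbit (cell v I))" if "S \<subseteq> I" for S
    using pv_mem_cell_iff[OF v that order_refl] that by simp
  have "a \<bullet> pv (v + ind S) = 0 \<longleftrightarrow> A \<subseteq> S \<and> S \<subseteq> B" if S: "S \<subseteq> I" for S
  proof -
    have "a \<bullet> pv (v + ind S) = 0 \<longleftrightarrow> pv (v + ind S) \<in> \<phi> (orbit (cell (v + ind A) (B - A)))"
      using a(2) m[OF S] by blast
    also have "\<dots> \<longleftrightarrow> (\<exists>l\<in>Lam. \<exists>R\<subseteq>B - A. v + ind S = l + (v + ind A) + ind R)"
      by (rule pv_mem_iff[OF strip_vertex[OF v S] vf])
    also have "\<dots> \<longleftrightarrow> A \<subseteq> S \<and> S \<subseteq> B"
    proof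
      assume "\<exists>l\<in>Lam. \<exists>R\<subseteq>B - A. v + ind S = l + (v + ind A) + ind R"
      then obtain l R where R: "l \<in> Lam" "R \<subseteq> B - A" "v + ind S = l + (v + ind A) + ind R" by blast
      have AR: "ind (A \<union> R) = ind A + ind R" using R(2) by (intro ind_Un) auto
      have "ind S - ind (A \<union> R) = l" using R(3) unfolding AR by (simp add: algebra_simps)
      then have "S = A \<union> R" using R(1) Lam_ind_diff by blast
      then show "A \<subseteq> S \<and> S \<subseteq> B" using R(2) AB by auto
    next
      assume S': "A \<subseteq> S \<and> S \<subseteq> B"
      then have "ind S = ind A + ind (S - A)" using ind_Un[of A "S - A"] by (simp add: Un_absorb1)
      then show "\<exists>l\<in>Lam. \<exists>R\<subseteq>B - A. v + ind S = l + (v + ind A) + ind R"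
        using Lam_zero S' by (intro bexI[of _ 0] exI[of _ "S - A"]) (auto simp: add.assoc)
    qed
    finally show ?thesis .
  qed
  then show ?thesis using that[of a] a(1) m by blast
qed

end


section \<open>Planarity of the squares\<close>

lemma functional_on_independent:
  fixes B :: "(real^5) set"
  assumes "independent B"
  obtains b where "\<And>x. x \<in> B \<Longrightarrow> b \<bullet> x = f x"
proof -
  obtain g :: "real^5 \<Rightarrow> real" where g: "linear g" "\<forall>x\<in>B. g x = f x"
    using linear_independent_extend[OF assms, of f] by blast
  have "adjoint g 1 \<bullet> x = g x" for x
    using adjoint_works[OF g(1), of x 1] by (simp add: inner_commute)
  then show ?thesis using that g(2) by metis
qed

lemma opposite_signs:
  fixes x y f g :: real
  assumes "x * f + y * g = 0" "0 < f" "0 < g"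
  shows "(0 < x \<longleftrightarrow> y < 0) \<and> (x = 0 \<longleftrightarrow> y = 0)"
proof -
  have "x * f = - y * g" using assms(1) by simp
  then have "0 < x * f \<longleftrightarrow> 0 < - y * g" "x * f = 0 \<longleftrightarrow> - y * g = 0" by simp_all
  then show ?thesis using assms(2,3) by (auto simp: zero_less_mult_iff mult_less_0_iff)
qed

lemma (in cct) face_functional_ex:
  assumes "strip_cell k v I" "A \<subseteq> B" "B \<subseteq> I"
  shows "\<exists>a. \<forall>S\<subseteq>I. 0 \<le> a \<bullet> pv (v + ind S) \<and> (a \<bullet> pv (v + ind S) = 0 \<longleftrightarrow> A \<subseteq> S \<and> S \<subseteq> B)"
proof (rule face_functional[OF assms])
  fix a
  assume "\<And>S. S \<subseteq> I \<Longrightarrow> 0 \<le> a \<bullet> pv (v + ind S)" "\<And>S. S \<subseteq> I \<Longrightarrow> a \<bullet> pv (v + ind S) = 0 \<longleftrightarrow> A \<subseteq> S \<and> S \<subseteq> B"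
  then show ?thesis by (intro exI[of _ a] allI impI conjI)
qed

text \<open>Four independent vectors would admit a functional that is 0 on one diagonal and 1 at the
  other two vertices. Its zero set would be a face with two opposite vertices but not the whole
  square; the labelling has no such cell.\<close>

lemma (in cct) square_dependent:
  assumes v: "strip_cell k v {i, j}" and ij: "i \<noteq> j"
  obtains c0 c1 c2 c3 where "c0 *\<^sub>R pv (v + ind {}) + c1 *\<^sub>R pv (v + ind {i}) + c2 *\<^sub>R pv (v + ind {j}) + c3 *\<^sub>R pv (v + ind {i, j}) = 0"
    "c0 \<noteq> 0 \<or> c1 \<noteq> 0 \<or> c2 \<noteq> 0 \<or> c3 \<noteq> 0"
proof -
  let ?p = "\<lambda>S. pv (v + ind S)"
  have neq: "?p S \<noteq> ?p S'" if SS: "S \<subseteq> {i, j}" "S' \<subseteq> {i, j}" "S \<noteq> S'" for S S'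
  proof
    assume eq: "?p S = ?p S'"
    obtain a where "\<forall>R\<subseteq>{i, j}. 0 \<le> a \<bullet> ?p R \<and> (a \<bullet> ?p R = 0 \<longleftrightarrow> S \<subseteq> R \<and> R \<subseteq> S)"
      using face_functional_ex[OF v order_refl SS(1)] by (rule exE)
    then have a: "a \<bullet> ?p R = 0 \<longleftrightarrow> S \<subseteq> R \<and> R \<subseteq> S" if "R \<subseteq> {i, j}" for R
      using that by (elim allE[of _ R]) (simp only: simp_thms)
    have "a \<bullet> ?p S = 0" using a[OF SS(1)] by simp
    then have "a \<bullet> ?p S' = 0" using eq by simp
    then show False using a[OF SS(2)] SS(3) by auto
  qed
  let ?B = "{?p {}, ?p {i}, ?p {j}, ?p {i, j}}"
  have d: "?p {} \<noteq> ?p {i}" "?p {} \<noteq> ?p {j}" "?p {} \<noteq> ?p {i, j}" "?p {i} \<noteq> ?p {j}" "?p {i} \<noteq> ?p {i, j}" "?p {j} \<noteq> ?p {i, j}"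
    by (rule neq; use ij in auto)+
  have "dependent ?B"
  proof (rule ccontr)
    assume "independent ?B"
    then obtain b where b: "\<And>x. x \<in> ?B \<Longrightarrow> b \<bullet> x = (if x = ?p {i} \<or> x = ?p {j} then 1 else 0)"
      using functional_on_independent[of ?B "\<lambda>x. if x = ?p {i} \<or> x = ?p {j} then 1 else 0"] by blast
    have bv: "b \<bullet> ?p {} = 0" "b \<bullet> ?p {i} = 1" "b \<bullet> ?p {j} = 1" "b \<bullet> ?p {i, j} = 0"
      using b d by auto
    have sub: "S = {} \<or> S = {i} \<or> S = {j} \<or> S = {i, j}" if "S \<subseteq> {i, j}" for S
      using that by auto
    have bn: "0 \<le> b \<bullet> ?p S" if "S \<in> Pow {i, j}" for S
    proof -
      have "S \<subseteq> {i, j}" using that by simp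
      from sub[OF this] bv show ?thesis by (elim disjE) simp_all
    qed
    let ?P = "\<phi> (orbit (cell v {i, j}))"
    let ?F = "{x \<in> ?P. b \<bullet> x = 0}"
    have Pe: "?P = sph_hull (?p ` Pow {i, j})" by (rule lab_cell[OF v])
    have "\<forall>x\<in>?P. 0 \<le> b \<bullet> x"
    proof
      fix x assume "x \<in> ?P"
      then have "x \<in> cspan ?p (Pow {i, j})" unfolding Pe by (simp add: sph_hull_image)
      then show "0 \<le> b \<bullet> x" by (rule inner_cspan_nonneg[OF _ bn])
    qed
    then have "?F sph_face_of ?P" unfolding sph_face_of_def by blast
    then obtain D where D: "D \<in> torus_complex k" "?F = \<phi> D"
      using face_in[OF lab_in[OF torus_complexI[OF v]]] lab_onto by blast
    have mem: "?p S \<in> ?P" if "S \<subseteq> {i, j}" for S using pv_mem_cell_iff[OF v that order_refl] that by simp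
    have in0: "?p {} \<in> \<phi> D" "?p {i, j} \<in> \<phi> D" "?p {i} \<notin> \<phi> D"
      using mem[of "{}"] mem[of "{i, j}"] bv unfolding D(2)[symmetric] by auto
    then have "D \<noteq> orbit {}" using lab_empty by auto
    then obtain u J where u: "strip_cell k u J" "D = orbit (cell u J)" using D(1) by (metis torus_complexE)
    have "\<phi> D \<subseteq> ?P" using D(2) by blast
    then have "orbit_le (orbit (cell u J)) (orbit (cell v {i, j}))"
      using lab_le[OF D(1) torus_complexI[OF v]] u(2) by simp
    then obtain l A where A: "l \<in> Lam" "u = l + v + ind A" "A \<inter> J = {}" "A \<union> J \<subseteq> {i, j}"
      using orbit_le_cell_iff[of u v J "{i, j}"] u v unfolding strip_cell_def by blast
    have look: "S \<in> ivl A (A \<union> J)" if S: "S \<subseteq> {i, j}" "?p S \<in> \<phi> D" for S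
    proof -
      obtain l' A' where A': "l' \<in> Lam" "A' \<subseteq> J" "v + ind S = l' + u + ind A'"
        using pv_mem_iff[OF strip_vertex[OF v S(1)] u(1)] S(2) u(2) by blast
      have e: "ind (A \<union> A') = ind A + ind A'" using A(3) A'(2) by (intro ind_Un) auto
      have "ind S - ind (A \<union> A') = l' + l" using A'(3) A(2) unfolding e by (simp add: algebra_simps)
      then have "S = A \<union> A'" using Lam_add[OF A'(1) A(1)] Lam_ind_diff by metis
      then show ?thesis using A'(2) by (auto simp: ivl_def)
    qed
    have "A = {}" using look[of "{}"] in0 by (auto simp: ivl_def)
    moreover have "J = {i, j}" using look[of "{i, j}"] in0 A(4) \<open>A = {}\<close> by (auto simp: ivl_def)
    ultimately have "D = orbit (cell v {i, j})" using u(2) A orbit_translate by simp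
    then show False using in0(3) mem[of "{i}"] by simp
  qed
  then obtain u where u: "\<exists>x\<in>?B. u x \<noteq> 0" "(\<Sum>x\<in>?B. u x *\<^sub>R x) = 0"
    using dependent_finite[of ?B] by auto
  have "(\<Sum>x\<in>?B. u x *\<^sub>R x) = u (?p {}) *\<^sub>R ?p {} + u (?p {i}) *\<^sub>R ?p {i} + u (?p {j}) *\<^sub>R ?p {j} + u (?p {i, j}) *\<^sub>R ?p {i, j}"
    using d by (simp add: add.assoc)
  then show ?thesis using u that by auto
qed

text \<open>Applied to the dependence, a functional exposing an edge annihilates the vertices of
  that edge and is positive on the opposite one, whose coefficients therefore have opposite signs.
  Going around the square, the signs alternate.\<close>

lemma (in cct) square_relation:
  assumes v: "strip_cell k v {i, j}" and ij: "i \<noteq> j"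
  shows "\<exists>\<alpha> \<beta> \<gamma> \<delta>. 0 < \<alpha> \<and> 0 < \<beta> \<and> 0 < \<gamma> \<and> 0 < \<delta> \<and>
    \<alpha> *\<^sub>R pv (v + ind {}) + \<beta> *\<^sub>R pv (v + ind {i, j}) = \<gamma> *\<^sub>R pv (v + ind {i}) + \<delta> *\<^sub>R pv (v + ind {j})"
proof -
  let ?p = "\<lambda>S. pv (v + ind S)"
  obtain c0 c1 c2 c3 where rel: "c0 *\<^sub>R ?p {} + c1 *\<^sub>R ?p {i} + c2 *\<^sub>R ?p {j} + c3 *\<^sub>R ?p {i, j} = 0"
    and nz: "c0 \<noteq> 0 \<or> c1 \<noteq> 0 \<or> c2 \<noteq> 0 \<or> c3 \<noteq> 0"
    using square_dependent[OF v ij] .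
  have inn: "c0 * (a \<bullet> ?p {}) + c1 * (a \<bullet> ?p {i}) + c2 * (a \<bullet> ?p {j}) + c3 * (a \<bullet> ?p {i, j}) = 0" for a
    using arg_cong[OF rel, of "(\<bullet>) a"] by (simp add: inner_add_right)
  have F: "\<exists>a. \<forall>S\<in>{{}, {i}, {j}, {i, j}}. 0 \<le> a \<bullet> ?p S \<and> (a \<bullet> ?p S = 0 \<longleftrightarrow> A \<subseteq> S \<and> S \<subseteq> B)"
    if AB: "A \<subseteq> B" "B \<subseteq> {i, j}" for A B
  proof -
    have sub: "S \<subseteq> {i, j}" if "S \<in> {{}, {i}, {j}, {i, j}}" for S using that by auto
    obtain a where a: "\<forall>S\<subseteq>{i, j}. 0 \<le> a \<bullet> ?p S \<and> (a \<bullet> ?p S = 0 \<longleftrightarrow> A \<subseteq> S \<and> S \<subseteq> B)"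
      using face_functional_ex[OF v AB] by (rule exE)
    show ?thesis by (intro exI[of _ a] ballI mp[OF spec[OF a]] sub)
  qed
  have s1: "(0 < c2 \<longleftrightarrow> c3 < 0) \<and> (c2 = 0 \<longleftrightarrow> c3 = 0)"
  proof -
    obtain a where a: "\<forall>S\<in>{{}, {i}, {j}, {i, j}}. 0 \<le> a \<bullet> ?p S \<and> (a \<bullet> ?p S = 0 \<longleftrightarrow> {} \<subseteq> S \<and> S \<subseteq> {i})"
      using F[of "{}" "{i}"] by auto
    then have "a \<bullet> ?p {} = 0" "a \<bullet> ?p {i} = 0" "0 < a \<bullet> ?p {j}" "0 < a \<bullet> ?p {i, j}"
      using ij by (auto simp: less_le)
    then show ?thesis using inn[of a] by (intro opposite_signs[of _ "a \<bullet> ?p {j}" _ "a \<bullet> ?p {i, j}"]) auto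
  qed
  have s2: "(0 < c1 \<longleftrightarrow> c3 < 0) \<and> (c1 = 0 \<longleftrightarrow> c3 = 0)"
  proof -
    obtain a where a: "\<forall>S\<in>{{}, {i}, {j}, {i, j}}. 0 \<le> a \<bullet> ?p S \<and> (a \<bullet> ?p S = 0 \<longleftrightarrow> {} \<subseteq> S \<and> S \<subseteq> {j})"
      using F[of "{}" "{j}"] by auto
    then have "a \<bullet> ?p {} = 0" "a \<bullet> ?p {j} = 0" "0 < a \<bullet> ?p {i}" "0 < a \<bullet> ?p {i, j}"
      using ij by (auto simp: less_le)
    then show ?thesis using inn[of a] by (intro opposite_signs[of _ "a \<bullet> ?p {i}" _ "a \<bullet> ?p {i, j}"]) auto
  qed
  have s3: "(0 < c0 \<longleftrightarrow> c2 < 0) \<and> (c0 = 0 \<longleftrightarrow> c2 = 0)"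
  proof -
    obtain a where a: "\<forall>S\<in>{{}, {i}, {j}, {i, j}}. 0 \<le> a \<bullet> ?p S \<and> (a \<bullet> ?p S = 0 \<longleftrightarrow> {i} \<subseteq> S \<and> S \<subseteq> {i, j})"
      using F[of "{i}" "{i, j}"] by auto
    then have "a \<bullet> ?p {i} = 0" "a \<bullet> ?p {i, j} = 0" "0 < a \<bullet> ?p {}" "0 < a \<bullet> ?p {j}"
      using ij by (auto simp: less_le)
    then show ?thesis using inn[of a] by (intro opposite_signs[of _ "a \<bullet> ?p {}" _ "a \<bullet> ?p {j}"]) auto
  qed
  have s4: "(0 < c0 \<longleftrightarrow> c1 < 0) \<and> (c0 = 0 \<longleftrightarrow> c1 = 0)"
  proof -
    obtain a where a: "\<forall>S\<in>{{}, {i}, {j}, {i, j}}. 0 \<le> a \<bullet> ?p S \<and> (a \<bullet> ?p S = 0 \<longleftrightarrow> {j} \<subseteq> S \<and> S \<subseteq> {i, j})"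
      using F[of "{j}" "{i, j}"] by auto
    then have "a \<bullet> ?p {j} = 0" "a \<bullet> ?p {i, j} = 0" "0 < a \<bullet> ?p {}" "0 < a \<bullet> ?p {i}"
      using ij by (auto simp: less_le)
    then show ?thesis using inn[of a] by (intro opposite_signs[of _ "a \<bullet> ?p {}" _ "a \<bullet> ?p {i}"]) auto
  qed
  have "c0 \<noteq> 0" using nz s1 s2 s3 s4 by metis
  then consider "0 < c0" | "c0 < 0" by linarith
  then show ?thesis
  proof cases
    case 1
    then have "c1 < 0" "c2 < 0" "0 < c3" using s1 s2 s3 s4 by linarith+
    moreover have "c0 *\<^sub>R ?p {} + c3 *\<^sub>R ?p {i, j} = (- c1) *\<^sub>R ?p {i} + (- c2) *\<^sub>R ?p {j}"
      using rel by (simp add: algebra_simps eq_neg_iff_add_eq_0)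
    ultimately show ?thesis
      using 1 by (intro exI[of _ c0] exI[of _ c3] exI[of _ "- c1"] exI[of _ "- c2"] conjI) auto
  next
    case 2
    then have "0 < c1" "0 < c2" "c3 < 0" using s1 s2 s3 s4 by linarith+
    moreover have "(- c0) *\<^sub>R ?p {} + (- c3) *\<^sub>R ?p {i, j} = c1 *\<^sub>R ?p {i} + c2 *\<^sub>R ?p {j}"
    proof -
      have "c1 *\<^sub>R ?p {i} + c2 *\<^sub>R ?p {j} + (c0 *\<^sub>R ?p {} + c3 *\<^sub>R ?p {i, j}) = 0"
        using rel by (simp add: add_ac)
      then have "c1 *\<^sub>R ?p {i} + c2 *\<^sub>R ?p {j} = - (c0 *\<^sub>R ?p {} + c3 *\<^sub>R ?p {i, j})"
        by (simp only: eq_neg_iff_add_eq_0)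
      then show ?thesis by simp
    qed
    ultimately show ?thesis
      using 2 by (intro exI[of _ "- c0"] exI[of _ "- c3"] exI[of _ c1] exI[of _ c2] conjI) auto
  qed
qed

lemma sph_hull_rescale:
  assumes "finite A" "\<And>i. i \<in> A \<Longrightarrow> 0 < c i"
  shows "sph_hull ((\<lambda>i. c i *\<^sub>R p i) ` A) = sph_hull (p ` A)"
proof -
  have "convex_cone hull ((\<lambda>i. c i *\<^sub>R p i) ` A) = convex_cone hull (p ` A)"
  proof (intro subset_antisym hull_minimal convex_cone_convex_cone_hull subsetI)
    fix x assume "x \<in> (\<lambda>i. c i *\<^sub>R p i) ` A"
    then obtain i where i: "i \<in> A" "x = c i *\<^sub>R p i" by blast
    show "x \<in> convex_cone hull (p ` A)"
      unfolding i(2) using i(1) assms(2)[OF i(1)] by (intro convex_cone_hull_mul hull_inc) auto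
  next
    fix x assume "x \<in> p ` A"
    then obtain i where i: "i \<in> A" "x = p i" by blast
    then have e: "x = inverse (c i) *\<^sub>R (c i *\<^sub>R p i)" using assms(2)[OF i(1)] by simp
    show "x \<in> convex_cone hull ((\<lambda>i. c i *\<^sub>R p i) ` A)"
      unfolding e using i(1) assms(2)[OF i(1)]
      by (intro convex_cone_hull_mul[of "c i *\<^sub>R p i"] hull_inc) (auto simp: less_imp_le)
  qed
  then show ?thesis by (simp add: sph_hull_def)
qed

section \<open>Transversality and symmetry of a given CCT\<close>

locale tcct =
  fixes k :: nat and T :: "(real^5) set set" and \<phi> :: labelling
  assumes tr: "transversal k T \<phi>" and k2: "2 \<le> k" and TS: "\<Union>T \<subseteq> S3eq"
begin

sublocale cct k T \<phi>
  using tr by unfold_locales (auto simp: transversal_def symmetric_cct_def)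

lemma trip: "j + 2 \<le> k \<Longrightarrow> transversal2 (restr T \<phi> {j..j + 2}) (shift_lab j \<phi>)"
proof -
  assume j: "j + 2 \<le> k"
  have "{j, j + 1, j + 1 + 1} = {j..j + 2}" by auto
  then show ?thesis
    using tr[unfolded transversal_def, THEN conjunct2, rule_format, of "j + 1"] j by simp
qed

lemma cell_in_restr:
  assumes v: "strip_cell k v I" "real j \<le> coord_sum v" "coord_sum v + card I \<le> real (j + 2)"
  shows "\<phi> (orbit (cell v I)) \<in> restr T \<phi> {j..j + 2}"
proof -
  have "x \<in> (\<Union>l\<in>{j..j + 2}. layer \<phi> l)" if x: "{x} sph_face_of \<phi> (orbit (cell v I))" for x
  proof -
    obtain S where S: "S \<subseteq> I" "x = pv (v + ind S)" using lab_vertices[OF v(1)] x by blast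
    note sv = strip_vertex[OF v(1) S(1)]
    then have svi: "v + ind S \<in> int_points" "0 \<le> coord_sum (v + ind S)" by (auto simp: strip_cell_def)
    obtain n where n: "coord_sum (v + ind S) = real n" using int_points_coord_sum_nat[OF svi] by blast
    have "card S \<le> card I" using S(1) by (simp add: card_mono)
    then have "real j \<le> real n" "real n \<le> real (j + 2)" using v n by auto
    then have "n \<in> {j..j + 2}" by (simp only: of_nat_le_iff atLeastAtMost_iff)
    moreover have "x \<in> layer \<phi> n"
      using lab_vertex[OF sv] S n svi unfolding layer_def by blast
    ultimately show ?thesis by blast
  qed
  then show ?thesis
    using lab_in[OF torus_complexI[OF v(1)]] by (simp add: restr_def induced_subcomplex_def)
qed

lemma cell_Clif:
  assumes v: "strip_cell k v I" "card I \<le> 2" and x: "x \<in> \<phi> (orbit (cell v I))"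
  shows "x \<in> S3eq" "x \<notin> Clif 0" "x \<notin> Clif 2"
proof -
  have vi: "v \<in> int_points" "0 \<le> coord_sum v" using v by (auto simp: strip_cell_def)
  obtain n where n: "coord_sum v = real n" using int_points_coord_sum_nat[OF vi] by blast
  \<comment> \<open>The lowest layer of a window of three layers that contains the cell; near the
    top the window is moved down so as to end at layer \<open>k\<close>.\<close>
  define j where "j = min n (k - 2)"
  have nk: "n + card I \<le> k" using v n by (simp add: strip_cell_def)
  have "j + 2 \<le> k" "j \<le> n" "n + card I \<le> j + 2" using k2 nk v(2) by (auto simp: j_def)
  then have "\<phi> (orbit (cell v I)) \<in> restr T \<phi> {j..j + 2}"
    using v(1) n by (intro cell_in_restr) auto
  then have "x \<in> S3eq - (Clif 0 \<union> Clif 2)"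
    using trip[OF \<open>j + 2 \<le> k\<close>] x unfolding transversal2_def by blast
  then show "x \<in> S3eq" "x \<notin> Clif 0" "x \<notin> Clif 2" by auto
qed

lemma pv_equivariant:
  assumes "strip_cell k v {}"
  shows "pv (vector [1, -1, 0] + v) = (r34 \<circ> r34) (pv v)" "pv (vector [0, -1, 1] + v) = (r34 \<circ> r12) (pv v)"
    "pv (swap12 v) = refl4 (pv v)"
proof -
  note C = torus_complexI[OF assms]
  have sy: "symmetric_cct k T \<phi>" using tr by (simp add: transversal_def)
  have s1: "strip_cell k (vector [1, -1, 0] + v) {}" "strip_cell k (vector [0, -1, 1] + v) {}"
    using assms strip_cell_translate tvecs by blast+
  have s3: "strip_cell k (swap12 v) {}" using strip_cell_swap[of k v "{}"] assms by simp
  have 1: "(r34 \<circ> r34) ` \<phi> (orbit (cell v {})) = \<phi> (orbit (cell (vector [1, -1, 0] + v) {}))"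
    using sy C unfolding symmetric_cct_def corresponds_def by (metis induced_translate_cell)
  have 2: "(r34 \<circ> r12) ` \<phi> (orbit (cell v {})) = \<phi> (orbit (cell (vector [0, -1, 1] + v) {}))"
    using sy C unfolding symmetric_cct_def corresponds_def by (metis induced_translate_cell)
  have 3: "refl4 ` \<phi> (orbit (cell v {})) = \<phi> (orbit (cell (swap12 v) {}))"
    using sy C induced_swap12[of v "{}"] unfolding symmetric_cct_def corresponds_def by (metis image_empty)
  show "pv (vector [1, -1, 0] + v) = (r34 \<circ> r34) (pv v)"
    using 1 lab_vertex[OF assms] lab_vertex[OF s1(1)] by simp
  show "pv (vector [0, -1, 1] + v) = (r34 \<circ> r12) (pv v)"
    using 2 lab_vertex[OF assms] lab_vertex[OF s1(2)] by simp
  show "pv (swap12 v) = refl4 (pv v)"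
    using 3 lab_vertex[OF assms] lab_vertex[OF s3] by simp
qed

end


section \<open>Coordinates for a transversal CCT\<close>

text \<open>One vertex per layer, chosen on the axis fixed by the swap of the first two coordinates;
  the other vertices of the layer are its images under the two translations.\<close>

abbreviation ax :: "nat \<Rightarrow> real^3" where
  "ax l \<equiv> vector [0, 0, real l]"

lemma coord_sum_ax: "coord_sum (ax l) = real l"
  by (simp add: coord_sum_def)

lemma ax_strip: "l + card I \<le> k \<Longrightarrow> strip_cell k (ax l) I"
  by (auto simp: strip_cell_def coord_sum_ax int_points_def forall_3)

lemma ax_ind3: "ax l + ind {3} = ax (l + 1)"
  by (simp add: vec_eq_iff forall_3)

lemma S3eq_Clif0:
  assumes "x \<in> S3eq" "x $ 3 = 0" "x $ 4 = 0"
  shows "x \<in> Clif 0"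
proof -
  have "x $ 5 = 0" "norm x = 1" using assms(1) by (auto simp: S3eq_def)
  then have "x \<bullet> x = 1" by (simp add: norm_eq_1)
  then show ?thesis using assms \<open>x $ 5 = 0\<close>
    by (simp add: Clif_def inner_vec_def sum_5 power2_eq_square)
qed

lemma isometry_inj:
  assumes "linear f" "\<And>x. norm (f x) = norm x" "f x = f y"
  shows "x = y"
proof -
  have "norm (f (x - y)) = 0" using assms(1,3) by (simp add: linear_diff)
  then show ?thesis unfolding assms(2) by simp
qed

lemma int_translates:
  fixes t :: "'a::real_vector"
  assumes "\<And>u. P (t + u) \<longleftrightarrow> P u"
  shows "P (of_int a *\<^sub>R t + u) \<longleftrightarrow> P u"
proof (induction a rule: int_induct[of _ 0])
  case base
  then show ?case by simp
next
  case (step1 i)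
  have "of_int (i + 1) *\<^sub>R t + u = t + (of_int i *\<^sub>R t + u)" by (simp add: algebra_simps)
  then show ?case using step1 assms by metis
next
  case (step2 i)
  have "t + (of_int (i - 1) *\<^sub>R t + u) = of_int i *\<^sub>R t + u" by (simp add: algebra_simps)
  then show ?case using step2 assms by metis
qed

lemma emb_rotate: "emb e s (c * z) u = emb (e * c) s z u"
  by (simp add: vec_eq_iff forall_5 algebra_simps)

lemma (in cct) cell_point:
  assumes "strip_cell k v I" "y \<in> cspan (\<lambda>S. pv (v + ind S)) (Pow I)" "y \<noteq> 0"
  shows "y /\<^sub>R norm y \<in> \<phi> (orbit (cell v I))"
  unfolding lab_cell[OF assms(1)] using assms by (intro unit_mem_sph_hull) auto

context tcct
begin

lemma pv_S3eq: "strip_cell k v {} \<Longrightarrow> pv v \<in> S3eq" "strip_cell k v {} \<Longrightarrow> pv v \<notin> Clif 0"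
  using cell_Clif[of v "{}" "pv v"] lab_vertex by simp_all

definition xx :: "nat \<Rightarrow> real^5" where "xx l = pv (ax l)"
definition rr :: "nat \<Rightarrow> real" where "rr l = \<bar>xx l $ 3\<bar>"
definition sg :: real where "sg = sgn (xx 0 $ 3)"
text \<open>The first component of \<open>xx l\<close>, divided by the modulus of the second and
  turned back by the phase that \<open>pt\<close> attaches to the third coordinate.\<close>

definition H :: "nat \<Rightarrow> complex" where
  "H l = cis (- (pi / 2 * l)) * (Complex (xx l $ 1) (xx l $ 2) / of_real (rr l))"

lemma xx4: "l \<le> k \<Longrightarrow> xx l $ 4 = 0"
proof -
  assume "l \<le> k"
  then have "strip_cell k (ax l) {}" by (intro ax_strip) simp
  moreover have "swap12 (ax l) = ax l" by (simp add: vec_eq_iff forall_3)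
  ultimately have "refl4 (xx l) = xx l" using pv_equivariant(3)[of "ax l"] by (simp add: xx_def)
  then have "refl4 (xx l) $ 4 = xx l $ 4" by simp
  then show ?thesis by (simp add: refl4_def)
qed

lemma xx3: "l \<le> k \<Longrightarrow> xx l $ 3 \<noteq> 0"
  using S3eq_Clif0[of "xx l"] pv_S3eq[OF ax_strip[of l "{}" k]] xx4[of l] by (auto simp: xx_def)

lemma rr_pos: "l \<le> k \<Longrightarrow> 0 < rr l"
  using xx3 by (simp add: rr_def)

text \<open>If the sign changed along an edge, a positive combination of its ends would have
  vanishing second component, so the edge would meet \<open>Clif 0\<close>.\<close>

lemma xx3_same_sign:
  assumes l: "l + 1 \<le> k"
  shows "sgn (xx (l + 1) $ 3) = sgn (xx l $ 3)"
proof (rule ccontr)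
  assume ne: "sgn (xx (l + 1) $ 3) \<noteq> sgn (xx l $ 3)"
  have nz: "xx l $ 3 \<noteq> 0" "xx (l + 1) $ 3 \<noteq> 0" "xx l $ 4 = 0" "xx (l + 1) $ 4 = 0"
    using xx3[of l] xx3[of "l + 1"] xx4[of l] xx4[of "l + 1"] l by simp_all
  have sc: "strip_cell k (ax l) {3}" using l by (intro ax_strip) simp
  obtain a where a: "\<And>S. S \<subseteq> {3} \<Longrightarrow> 0 < a \<bullet> pv (ax l + ind S)" using cell_pointed[OF sc] by blast
  define y where "y = rr (l + 1) *\<^sub>R pv (ax l + ind {}) + rr l *\<^sub>R pv (ax l + ind {3})"
  have p: "pv (ax l + ind {}) = xx l" "pv (ax l + ind {3}) = xx (l + 1)" unfolding ax_ind3 by (simp_all add: xx_def)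
  have r: "0 < rr l" "0 < rr (l + 1)" using nz by (simp_all add: rr_def)
  have "0 < a \<bullet> y"
    unfolding y_def inner_add_right inner_scaleR_right
    using r a[of "{}"] a[of "{3}"] by (intro add_pos_pos mult_pos_pos) auto
  then have y0: "y \<noteq> 0" by auto
  have "y \<in> cspan (\<lambda>S. pv (ax l + ind S)) (Pow {3})"
    unfolding y_def using r by (intro cspan_add cspan_scale cspan_gen) auto
  then have m: "y /\<^sub>R norm y \<in> \<phi> (orbit (cell (ax l) {3}))" using cell_point[OF sc] y0 by blast
  have "y $ 3 = 0" "y $ 4 = 0"
    unfolding y_def p using ne nz by (auto simp: rr_def sgn_if abs_if split: if_splits)
  then have "y /\<^sub>R norm y \<in> Clif 0"
    using cell_Clif(1)[OF sc _ m] by (intro S3eq_Clif0) auto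
  then show False using cell_Clif(2)[OF sc _ m] by simp
qed

lemma xx3_sg: "l \<le> k \<Longrightarrow> xx l $ 3 = sg * rr l"
proof -
  assume "l \<le> k"
  then have "sgn (xx l $ 3) = sg"
    by (induction l) (use xx3_same_sign in \<open>auto simp: sg_def\<close>)
  then show ?thesis unfolding rr_def by (metis mult.commute abs_mult_sgn)
qed

lemma sg_square: "sg * sg = 1"
  using xx3[of 0] by (simp add: sg_def sgn_if)

lemma frame_one: "norm c = 1 \<Longrightarrow> frame c sg"
  using sg_square by (simp add: frame_def)

lemma xx_pt: "l \<le> k \<Longrightarrow> xx l = rr l *\<^sub>R pt 1 sg H (ax l)"
proof -
  assume l: "l \<le> k"
  have "nat \<lfloor>coord_sum (ax l)\<rfloor> = l" by (simp add: coord_sum_ax)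
  moreover have "cis (pi / 2 * l) * H l = Complex (xx l $ 1) (xx l $ 2) / of_real (rr l)"
    unfolding H_def mult.assoc[symmetric] cis_mult by simp
  ultimately have "pt 1 sg H (ax l) = emb 1 sg (Complex (xx l $ 1) (xx l $ 2) / of_real (rr l)) 1"
    by (simp add: pt_def)
  moreover have "xx l $ 5 = 0" using pv_S3eq(1)[OF ax_strip[of l "{}" k]] l by (simp add: xx_def S3eq_def)
  ultimately show ?thesis
    using l xx4[OF l] xx3_sg[OF l] rr_pos[OF l] by (simp add: vec_eq_iff forall_5)
qed

text \<open>Both sides are transformed by the same isometries under the two translations, and every
  vertex of layer \<open>n\<close> arises from \<open>ax n\<close> by such translations.\<close>

lemma pv_pt:
  assumes v: "strip_cell k v {}" "coord_sum v = real n"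
  shows "pv v = rr n *\<^sub>R pt 1 sg H v"
proof -
  define G where "G u \<longleftrightarrow> strip_cell k u {} \<and> coord_sum u = real n \<and> pv u = rr n *\<^sub>R pt 1 sg H u" for u
  have G: "G (t + u) \<longleftrightarrow> G u"
    if t: "t \<in> int_points" "coord_sum t = 0" and f: "linear f" "\<And>x. norm (f x) = norm x"
      and fp: "\<And>u. f (pt 1 sg H u) = pt 1 sg H (t + u)" and fv: "\<And>u. strip_cell k u {} \<Longrightarrow> pv (t + u) = f (pv u)"
    for t u f
  proof -
    have "pv (t + u) = rr n *\<^sub>R pt 1 sg H (t + u) \<longleftrightarrow> pv u = rr n *\<^sub>R pt 1 sg H u" if su: "strip_cell k u {}"
    proof -
      have "rr n *\<^sub>R pt 1 sg H (t + u) = f (rr n *\<^sub>R pt 1 sg H u)"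
        unfolding fp[symmetric] using f(1) by (simp add: linear_scale)
      then show ?thesis unfolding fv[OF su] using isometry_inj[OF f] by metis
    qed
    then show ?thesis unfolding G_def strip_cell_translate[OF t] using t(2) by auto
  qed
  have n: "n \<le> k" using v by (simp add: strip_cell_def)
  have G1: "G (vector [1, -1, 0] + u) \<longleftrightarrow> G u" for u
    by (rule G[OF tvecs(1,2) linear_compose[OF rot34_props(1) rot34_props(1)] _ r3434_pt pv_equivariant(1)])
       (simp add: rot34_props(2))
  have G2: "G (vector [0, -1, 1] + u) \<longleftrightarrow> G u" for u
    by (rule G[OF tvecs(3,4) linear_compose[OF rot12_props(1) rot34_props(1)] _ r3412_pt pv_equivariant(2)])
       (simp add: rot34_props(2) rot12_props(2))
  have "v \<in> int_points" using v by (simp add: strip_cell_def)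
  then obtain i1 i2 i3 :: int where i: "v $ 1 = i1" "v $ 2 = i2" "v $ 3 = i3" by (rule int_pointsE)
  have s: "real_of_int i1 + real_of_int i2 + real_of_int i3 = real n" using v(2) i by (simp add: coord_sum_def)
  have "v = of_int i1 *\<^sub>R vector [1, -1, 0] + (of_int (i3 - int n) *\<^sub>R vector [0, -1, 1] + ax n)"
    using s by (simp add: vec_eq_iff forall_3 i)
  moreover have "G (ax n)"
    using ax_strip[of n "{}" k] n xx_pt[OF n] unfolding G_def coord_sum_ax xx_def by simp
  ultimately have "G v" using int_translates[of G, OF G1] int_translates[of G, OF G2] by metis
  then show ?thesis by (simp add: G_def)
qed

lemma pv_local:
  assumes "l + card S \<le> k"
  shows "pv (ax l + ind S) = rr (l + card S) *\<^sub>R emb (cis (pi / 2 * l)) sg (lz H l S) (lw S)"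
proof -
  have "strip_cell k (ax l + ind S) {}" using strip_vertex[OF ax_strip[of l S k], of S] assms by simp
  moreover have "coord_sum (ax l + ind S) = real (l + card S)" by (simp add: coord_sum_ax)
  ultimately have "pv (ax l + ind S) = rr (l + card S) *\<^sub>R pt 1 sg H (ax l + ind S)" by (rule pv_pt)
  then show ?thesis unfolding pt_local[OF coord_sum_ax] by (simp add: emb_rotate)
qed

text \<open>Planarity of the square in directions 1 and 2. The second components force the weights
  of the two side vertices to be \<open>a + b\<close> each; the first components then give the
  recurrence with factor \<open>a / b\<close>.\<close>

lemma H_rec:
  assumes l: "l + 2 \<le> k"
  shows "\<exists>b>0. H (l + 2) = 2 * H (l + 1) + of_real b * (2 * H (l + 1) - H l)"
proof -
  interpret f: frame "cis (pi / 2 * l)" sg by (rule frame_one) simp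
  have sc: "strip_cell k (ax l) {1, 2}" using l by (intro ax_strip) simp
  obtain \<alpha> \<beta> \<gamma> \<delta> where pos: "0 < \<alpha>" "0 < \<beta>" "0 < \<gamma>" "0 < \<delta>"
    and rel: "\<alpha> *\<^sub>R pv (ax l + ind {}) + \<beta> *\<^sub>R pv (ax l + ind {1, 2})
      = \<gamma> *\<^sub>R pv (ax l + ind {1}) + \<delta> *\<^sub>R pv (ax l + ind {2})"
    using square_relation[OF sc] by auto
  define a b c d where "a = \<alpha> * rr l" and "b = \<beta> * rr (l + 2)" and "c = \<gamma> * rr (l + 1)" and "d = \<delta> * rr (l + 1)"
  have ab: "0 < a" "0 < b" using pos rr_pos[of l] rr_pos[of "l + 2"] l by (simp_all add: a_def b_def)
  have p: "pv (ax l + ind {}) = rr l *\<^sub>R emb (cis (pi / 2 * l)) sg (H l) 1"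
    "pv (ax l + ind {1, 2}) = rr (l + 2) *\<^sub>R emb (cis (pi / 2 * l)) sg (H (l + 2)) 1"
    "pv (ax l + ind {1}) = rr (l + 1) *\<^sub>R emb (cis (pi / 2 * l)) sg (H (l + 1)) (Complex (1/2) (sqrt 3 / 2))"
    "pv (ax l + ind {2}) = rr (l + 1) *\<^sub>R emb (cis (pi / 2 * l)) sg (H (l + 1)) (Complex (1/2) (- sqrt 3 / 2))"
    using pv_local[of l "{}"] pv_local[of l "{1}"] pv_local[of l "{2}"] pv_local[of l "{1,2}"] l
    unfolding lz_simps lw_simps by simp_all
  have "emb (cis (pi / 2 * l)) sg (a *\<^sub>R H l + b *\<^sub>R H (l + 2)) (a *\<^sub>R 1 + b *\<^sub>R 1) =
    emb (cis (pi / 2 * l)) sg (c *\<^sub>R H (l + 1) + d *\<^sub>R H (l + 1)) (c *\<^sub>R Complex (1/2) (sqrt 3 / 2) + d *\<^sub>R Complex (1/2) (- sqrt 3 / 2))"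
    using rel unfolding p scaleR_scaleR a_def[symmetric] b_def[symmetric] c_def[symmetric] d_def[symmetric] emb_scale emb_add .
  then have z: "a *\<^sub>R H l + b *\<^sub>R H (l + 2) = c *\<^sub>R H (l + 1) + d *\<^sub>R H (l + 1)"
    and u: "a *\<^sub>R 1 + b *\<^sub>R 1 = c *\<^sub>R Complex (1/2) (sqrt 3 / 2) + d *\<^sub>R Complex (1/2) (- sqrt 3 / 2)"
    unfolding f.emb_eq_iff by blast+
  have "c = d" "c / 2 + d / 2 = a + b" using arg_cong[OF u, of Im] arg_cong[OF u, of Re] by simp_all
  then have cd: "c = a + b" "d = a + b" by simp_all
  have "b *\<^sub>R H (l + 2) = b *\<^sub>R (2 * H (l + 1) + of_real (a / b) * (2 * H (l + 1) - H l))"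
  proof -
    have "complex_of_real b * of_real (a / b) = of_real a" using ab by simp
    moreover have "B * z = B * (2 * y + R * (2 * y - x))"
      if "B * R = A" "A * x + B * z = (A + B) * y + (A + B) * y" for A B R x y z :: complex
      using that(2) unfolding distrib_left mult.assoc[symmetric] that(1) by (simp add: algebra_simps)
    ultimately show ?thesis using z unfolding cd scaleR_conv_of_real of_real_add by blast
  qed
  then have "H (l + 2) = 2 * H (l + 1) + of_real (a / b) * (2 * H (l + 1) - H l)" using ab by simp
  then show ?thesis using ab by (intro exI[of _ "a / b"]) simp
qed

text \<open>Planarity of the square in directions 1 and 3. The second components, combinations of 1
  and \<open>om\<close>, force \<open>c = b\<close> and \<open>d = a\<close>, so the gaps of two
  successive steps are proportional.\<close>

lemma H_ratio:
  assumes l: "l + 2 \<le> k"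
  shows "\<exists>\<rho>>0. H (l + 1) - \<i> * H (l + 2) = of_real \<rho> * (H l - \<i> * H (l + 1))"
proof -
  interpret f: frame "cis (pi / 2 * l)" sg by (rule frame_one) simp
  have sc: "strip_cell k (ax l) {1, 3}" using l by (intro ax_strip) simp
  obtain \<alpha> \<beta> \<gamma> \<delta> where pos: "0 < \<alpha>" "0 < \<beta>" "0 < \<gamma>" "0 < \<delta>"
    and rel: "\<alpha> *\<^sub>R pv (ax l + ind {}) + \<beta> *\<^sub>R pv (ax l + ind {1, 3})
      = \<gamma> *\<^sub>R pv (ax l + ind {1}) + \<delta> *\<^sub>R pv (ax l + ind {3})"
    using square_relation[OF sc] by auto
  define a b c d where "a = \<alpha> * rr l" and "b = \<beta> * rr (l + 2)" and "c = \<gamma> * rr (l + 1)" and "d = \<delta> * rr (l + 1)"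
  have ab: "0 < a" "0 < b" using pos rr_pos[of l] rr_pos[of "l + 2"] l by (simp_all add: a_def b_def)
  have p: "pv (ax l + ind {}) = rr l *\<^sub>R emb (cis (pi / 2 * l)) sg (H l) 1"
    "pv (ax l + ind {1, 3}) = rr (l + 2) *\<^sub>R emb (cis (pi / 2 * l)) sg (\<i> * H (l + 2)) (Complex (1/2) (sqrt 3 / 2))"
    "pv (ax l + ind {1}) = rr (l + 1) *\<^sub>R emb (cis (pi / 2 * l)) sg (H (l + 1)) (Complex (1/2) (sqrt 3 / 2))"
    "pv (ax l + ind {3}) = rr (l + 1) *\<^sub>R emb (cis (pi / 2 * l)) sg (\<i> * H (l + 1)) 1"
    using pv_local[of l "{}"] pv_local[of l "{1}"] pv_local[of l "{3}"] pv_local[of l "{1,3}"] l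
    unfolding lz_simps lw_simps by simp_all
  have "emb (cis (pi / 2 * l)) sg (a *\<^sub>R H l + b *\<^sub>R (\<i> * H (l + 2))) (a *\<^sub>R 1 + b *\<^sub>R Complex (1/2) (sqrt 3 / 2)) =
    emb (cis (pi / 2 * l)) sg (c *\<^sub>R H (l + 1) + d *\<^sub>R (\<i> * H (l + 1))) (c *\<^sub>R Complex (1/2) (sqrt 3 / 2) + d *\<^sub>R 1)"
    using rel unfolding p scaleR_scaleR a_def[symmetric] b_def[symmetric] c_def[symmetric] d_def[symmetric] emb_scale emb_add .
  then have z: "a *\<^sub>R H l + b *\<^sub>R (\<i> * H (l + 2)) = c *\<^sub>R H (l + 1) + d *\<^sub>R (\<i> * H (l + 1))"
    and u: "a *\<^sub>R 1 + b *\<^sub>R Complex (1/2) (sqrt 3 / 2) = c *\<^sub>R Complex (1/2) (sqrt 3 / 2) + d *\<^sub>R 1"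
    unfolding f.emb_eq_iff by blast+
  have "b = c" "a + b / 2 = c / 2 + d" using arg_cong[OF u, of Im] arg_cong[OF u, of Re] by simp_all
  then have cd: "c = b" "d = a" by simp_all
  have "b *\<^sub>R (H (l + 1) - \<i> * H (l + 2)) = b *\<^sub>R (of_real (a / b) * (H l - \<i> * H (l + 1)))"
  proof -
    have "complex_of_real b * of_real (a / b) = of_real a" using ab by simp
    moreover have "B * (y - \<i> * z) = B * (R * (x - \<i> * y))"
      if "B * R = A" "A * x + B * (\<i> * z) = B * y + A * (\<i> * y)" for A B R x y z :: complex
      using that(2) unfolding distrib_left mult.assoc[symmetric] that(1) by (simp add: algebra_simps)
    ultimately show ?thesis using z unfolding cd scaleR_conv_of_real by blast
  qed
  then have "H (l + 1) - \<i> * H (l + 2) = of_real (a / b) * (H l - \<i> * H (l + 1))" using ab by simp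
  then show ?thesis using ab by (intro exI[of _ "a / b"]) simp
qed

text \<open>Otherwise the vertices at \<open>ax 0\<close> and \<open>ax 1\<close> would lie on one
  ray and coincide.\<close>

lemma H_gap_nz: "H 0 - \<i> * H 1 \<noteq> 0"
proof
  assume "H 0 - \<i> * H 1 = 0"
  then have eq: "\<i> * H 1 = H 0" by simp
  have sc: "strip_cell k (ax 0) {3}" using k2 by (intro ax_strip) simp
  define q where "q = emb 1 sg (H 0) 1"
  have p: "pv (ax 0 + ind {}) = rr 0 *\<^sub>R q" "pv (ax 0 + ind {3}) = rr 1 *\<^sub>R q"
    using pv_local[of 0 "{}"] pv_local[of 0 "{3}"] k2
    unfolding lz_simps lw_simps by (simp_all add: eq[simplified] q_def)
  have r: "0 < rr 0" "0 < rr 1" using rr_pos k2 by simp_all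
  have n: "norm (pv (ax 0 + ind S)) = 1" if "S \<subseteq> {3}" for S using pv_norm[OF strip_vertex[OF sc that]] .
  have "rr 0 * norm q = 1" "rr 1 * norm q = 1" using n[of "{}"] n[of "{3}"] r unfolding p by simp_all
  then have "rr 0 = rr 1" by (metis mult_cancel_right mult_zero_right zero_neq_one)
  then have "pv (ax 0 + ind {3}) = pv (ax 0 + ind {})" unfolding p by simp
  moreover have "pv (ax 0 + ind {}) \<in> \<phi> (orbit (cell (ax 0) {}))" "pv (ax 0 + ind {3}) \<notin> \<phi> (orbit (cell (ax 0) {}))"
    using pv_mem_cell_iff[OF sc, of "{}" "{}"] pv_mem_cell_iff[OF sc, of "{3}" "{}"] by simp_all
  ultimately show False by simp
qed

text \<open>By \<open>H_ratio\<close> all gaps \<open>H l - \<i> * H (l + 1)\<close> point in the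
  direction \<open>e\<close> of the first one. Divided by \<open>e\<close> they are positive reals:
  the vanishing imaginary part identifies the imaginary part of a layer with the real part of the
  next, and the positive real part reads \<open>0 < w l + w (l + 2)\<close>.\<close>

lemma coordinates:
  "\<exists>e s w. frame e s \<and> (\<forall>C\<in>torus_complex k. \<phi> C = mlab e s (eta w) C) \<and>
    (\<forall>l. l + 1 \<le> k \<longrightarrow> 0 < w l + w (l + 2)) \<and>
    (\<forall>l. l + 2 \<le> k \<longrightarrow> (\<exists>b>0. w (l + 2) = 2 * w (l + 1) + b * (2 * w (l + 1) - w l) \<and>
       w (l + 3) = 2 * w (l + 2) + b * (2 * w (l + 2) - w (l + 1))))"
proof -
  define g where "g l = H l - \<i> * H (l + 1)" for l
  have g0: "g 0 \<noteq> 0" using H_gap_nz by (simp add: g_def)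
  define e where "e = sgn (g 0)"
  have ne: "norm e = 1" using g0 by (simp add: e_def norm_sgn)
  then have e0: "e \<noteq> 0" by auto
  have ge: "\<exists>q>0. g l / e = of_real q" if "l + 1 \<le> k" for l
    using that
  proof (induction l)
    case 0
    have "g 0 / e = of_real (norm (g 0))" using g0 by (simp add: e_def sgn_eq)
    then show ?case using g0 by (intro exI[of _ "norm (g 0)"]) simp
  next
    case (Suc l)
    then obtain q where q: "0 < q" "g l / e = of_real q" by auto
    obtain \<rho> where \<rho>: "0 < \<rho>" "H (l + 1) - \<i> * H (l + 2) = of_real \<rho> * g l"
      using H_ratio[of l] Suc.prems by (auto simp: g_def)
    then have "g (Suc l) / e = of_real \<rho> * (g l / e)"
      by (simp add: g_def numeral_2_eq_2)
    then have "g (Suc l) / e = of_real (\<rho> * q)" using q by simp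
    then show ?case using q \<rho> by (intro exI[of _ "\<rho> * q"]) simp
  qed
  define K where "K l = H l / e" for l
  \<comment> \<open>Real parts are available up to layer \<open>k\<close>; the imaginary part of
    that layer supplies \<open>w (k + 1)\<close>, the last value read by
    \<open>eta w k\<close>.\<close>
  define w where "w l = (if l \<le> k then Re (K l) else Im (K k))" for l
  have gK: "g l / e = K l - \<i> * K (l + 1)" for l by (simp add: g_def K_def diff_divide_distrib)
  have Im_K: "Im (K l) = w (l + 1)" if "l \<le> k" for l
  proof (cases "l = k")
    case True
    then show ?thesis by (simp add: w_def)
  next
    case False
    then obtain q where "g l / e = of_real q" using ge[of l] \<open>l \<le> k\<close> by auto
    then have "Im (K l - \<i> * K (l + 1)) = 0" unfolding gK[symmetric] by simp
    then show ?thesis using False that by (simp add: w_def)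
  qed
  have eta: "eta w l = K l" if "l \<le> k" for l
    using Im_K[OF that] that by (simp add: complex_eq_iff w_def)
  have sum: "0 < w l + w (l + 2)" if l: "l + 1 \<le> k" for l
  proof -
    obtain q where "0 < q" "g l / e = of_real q" using ge[OF l] by auto
    then have "Re (eta w l - \<i> * eta w (l + 1)) = q" using l unfolding gK by (simp add: eta)
    then show ?thesis using \<open>0 < q\<close> by simp
  qed
  have rec: "\<exists>b>0. w (l + 2) = 2 * w (l + 1) + b * (2 * w (l + 1) - w l) \<and>
       w (l + 3) = 2 * w (l + 2) + b * (2 * w (l + 2) - w (l + 1))" if l: "l + 2 \<le> k" for l
  proof -
    obtain b where b: "0 < b" "H (l + 2) = 2 * H (l + 1) + of_real b * (2 * H (l + 1) - H l)"
      using H_rec[OF l] by blast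
    have "K (l + 2) = 2 * K (l + 1) + of_real b * (2 * K (l + 1) - K l)"
      unfolding K_def b(2) using e0 by (simp add: field_simps)
    then have "eta w (l + 2) = 2 * eta w (l + 1) + of_real b * (2 * eta w (l + 1) - eta w l)"
      using l by (simp add: eta)
    from arg_cong[OF this, of Re] arg_cong[OF this, of Im] b(1) show ?thesis
      by (intro exI[of _ b]) (simp add: eval_nat_numeral)
  qed
  have pvw: "pv v = rr (nat \<lfloor>coord_sum v\<rfloor>) *\<^sub>R pt e sg (eta w) v \<and> 0 < rr (nat \<lfloor>coord_sum v\<rfloor>)"
    if v: "strip_cell k v {}" for v
  proof -
    obtain n where n: "coord_sum v = real n"
      using int_points_coord_sum_nat[of v] v unfolding strip_cell_def by blast
    have nk: "n \<le> k" using v n by (simp add: strip_cell_def)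
    have "H n = e * eta w n" using eta[OF nk] e0 by (simp add: K_def)
    then have "pt 1 sg H v = pt e sg (eta w) v"
      using n emb_rotate[of 1 sg e] by (simp add: pt_def mult.left_commute)
    then show ?thesis using pv_pt[OF v n] rr_pos[OF nk] n by simp
  qed
  have lab: "\<phi> C = mlab e sg (eta w) C" if C: "C \<in> torus_complex k" for C
    using C
  proof (cases rule: torus_complexE)
    case 1
    then show ?thesis using lab_empty by simp
  next
    case (2 v I)
    let ?r = "\<lambda>S. rr (nat \<lfloor>coord_sum (v + ind S)\<rfloor>)"
    have "(\<lambda>S. pv (v + ind S)) ` Pow I = (\<lambda>S. ?r S *\<^sub>R pt e sg (eta w) (v + ind S)) ` Pow I"
      using pvw strip_vertex[OF 2(1)] by (intro image_cong) auto
    moreover have "0 < ?r S" if "S \<in> Pow I" for S using that pvw strip_vertex[OF 2(1)] by blast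
    ultimately show ?thesis
      unfolding 2(2) lab_cell[OF 2(1)] mlab_cell by (simp only: sph_hull_rescale[OF finite])
  qed
  show ?thesis
    by (rule exI[of _ e], rule exI[of _ sg], rule exI[of _ w])
       (intro conjI allI ballI impI frame_one ne lab sum rec; assumption)
qed

end


section \<open>Sign conditions imposed by transversality\<close>

lemma om_of_reals: "Re (of_real a + of_real c * om) = a + c / 2" "Im (of_real a + of_real c * om) = c * sqrt 3 / 2"
  by (simp_all add: om_Complex)

lemma a_c_om_nz: "0 \<le> a \<Longrightarrow> 0 \<le> c \<Longrightarrow> 0 < a + c \<Longrightarrow> of_real a + of_real c * om \<noteq> 0"
proof
  assume ac: "0 \<le> a" "0 \<le> c" "0 < a + c" and "of_real a + of_real c * om = 0"
  then have "a + c / 2 = 0" using om_of_reals(1)[of a c] by simp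
  then show False using ac by simp
qed

locale coord_cct = tcct k T \<phi> + frame e s
  for k T \<phi> and e :: complex and s :: real +
  fixes w :: "nat \<Rightarrow> real"
  assumes lab: "C \<in> torus_complex k \<Longrightarrow> \<phi> C = mlab e s (eta w) C"
    and sum_pos: "l + 1 \<le> k \<Longrightarrow> 0 < w l + w (l + 2)"
    and recs: "l + 2 \<le> k \<Longrightarrow> \<exists>b>0. w (l + 2) = 2 * w (l + 1) + b * (2 * w (l + 1) - w l) \<and>
       w (l + 3) = 2 * w (l + 2) + b * (2 * w (l + 2) - w (l + 1))"
begin

abbreviation h :: "nat \<Rightarrow> complex" where "h \<equiv> eta w"

abbreviation cn :: "real^3 \<Rightarrow> 3 set \<Rightarrow> (real^5) set" where
  "cn v I \<equiv> cspan (\<lambda>S. pt e s h (v + ind S)) (Pow I)"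

lemma lab_cn: "strip_cell k v I \<Longrightarrow> \<phi> (orbit (cell v I)) = cn v I \<inter> sphere 0 1"
  using lab[OF torus_complexI] by (simp add: mlab_cell sph_hull_image)

lemma cn_cell:
  assumes "strip_cell k v I" "y \<in> cn v I" "y \<noteq> 0"
  shows "y /\<^sub>R norm y \<in> \<phi> (orbit (cell v I))"
  unfolding lab_cn[OF assms(1)] using assms by (auto intro: cspan_scale)

text \<open>Homogeneous form of the condition that cells with at most two directions avoid
  \<open>Clif 2\<close>.\<close>

lemma cn_z_nz:
  assumes v: "strip_cell k v I" "card I \<le> 2" and f: "frame E s" and y: "emb E s z u \<in> cn v I" and u: "u \<noteq> 0"
  shows "z \<noteq> 0"
proof
  interpret F: frame E s by fact
  assume z: "z = 0"
  let ?y = "emb E s z u"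
  have "?y \<noteq> 0" using u by (simp add: F.emb_eq_0_iff)
  then have m: "?y /\<^sub>R norm ?y \<in> \<phi> (orbit (cell v I))" using cn_cell[OF v(1) y] by blast
  have "?y /\<^sub>R norm ?y = emb E s (z /\<^sub>R norm ?y) (u /\<^sub>R norm ?y)" by (simp only: emb_scale)
  then show False using cell_Clif[OF v m] F.emb_Clif_iff(2) z by (metis scaleR_zero_right)
qed

text \<open>Homogeneous form of the injectivity of \<open>proj1\<close> on three consecutive layers:
  over a pair of rays there is at most one point up to a common factor.\<close>

lemma cn_ray:
  assumes f: "frame E s" and j: "j + 2 \<le> k"
    and v: "strip_cell k v I" "real j \<le> coord_sum v" "coord_sum v + card I \<le> real (j + 2)"
    and v': "strip_cell k v' I'" "real j \<le> coord_sum v'" "coord_sum v' + card I' \<le> real (j + 2)"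
    and y: "emb E s z u \<in> cn v I" and y': "emb E s (a *\<^sub>R z) (b *\<^sub>R u) \<in> cn v' I'"
    and ab: "0 < a" "0 < b" and u: "u \<noteq> 0"
  shows "a = b"
proof -
  interpret F: frame E s by fact
  have cI: "card I \<le> 2" using v(2,3) by simp
  have z: "z \<noteq> 0" by (rule cn_z_nz[OF v(1) cI f y u])
  define y1 y2 where "y1 = emb E s z u" and "y2 = emb E s (a *\<^sub>R z) (b *\<^sub>R u)"
  have nz: "y1 \<noteq> 0" "y2 \<noteq> 0" using u ab by (simp_all add: y1_def y2_def F.emb_eq_0_iff)
  have m: "y1 /\<^sub>R norm y1 \<in> \<Union>(restr T \<phi> {j..j + 2})" "y2 /\<^sub>R norm y2 \<in> \<Union>(restr T \<phi> {j..j + 2})"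
    using cn_cell[OF v(1)] cell_in_restr[OF v] cn_cell[OF v'(1)] cell_in_restr[OF v'] y y' nz
    unfolding y1_def y2_def by blast+
  have s1: "y1 /\<^sub>R norm y1 = emb E s (inverse (norm y1) *\<^sub>R z) (inverse (norm y1) *\<^sub>R u)"
    by (simp add: y1_def emb_scale)
  have s2: "y2 /\<^sub>R norm y2 = emb E s ((inverse (norm y2) * a) *\<^sub>R z) ((inverse (norm y2) * b) *\<^sub>R u)"
    by (simp add: y2_def emb_scale)
  have "proj1 (y1 /\<^sub>R norm y1) = proj1 (y2 /\<^sub>R norm y2)"
    unfolding s1 s2 using nz ab by (subst (1 2) F.proj1_emb_scale) auto
  then have "y1 /\<^sub>R norm y1 = y2 /\<^sub>R norm y2"
    using trip[OF j] m unfolding transversal2_def inj_on_def by blast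
  then have "inverse (norm y1) *\<^sub>R z = (inverse (norm y2) * a) *\<^sub>R z" "inverse (norm y1) *\<^sub>R u = (inverse (norm y2) * b) *\<^sub>R u"
    unfolding s1 s2 F.emb_eq_iff by blast+
  then have "inverse (norm y2) * a = inverse (norm y2) * b" using z u by (metis scaleR_cancel_right)
  then show ?thesis using nz by simp
qed

abbreviation E :: "nat \<Rightarrow> complex" where "E l \<equiv> e * cis (pi / 2 * l)"

lemma frame_E: "frame (E l) s"
  using norm_e s2 by (simp add: frame_def norm_mult)

lemma pt_ax: "pt e s h (ax l + ind S) = emb (E l) s (lz h l S) (lw S)"
  unfolding pt_local[OF coord_sum_ax] by (simp add: emb_rotate)

lemma cn_ge:
  assumes "\<And>S. S \<in> \<S> \<Longrightarrow> 0 \<le> c S" "\<S> \<subseteq> Pow I"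
  shows "emb (E l) s (\<Sum>S\<in>\<S>. c S *\<^sub>R lz h l S) (\<Sum>S\<in>\<S>. c S *\<^sub>R lw S) \<in> cn (ax l) I"
proof -
  have "emb (E l) s (\<Sum>S\<in>\<S>. c S *\<^sub>R lz h l S) (\<Sum>S\<in>\<S>. c S *\<^sub>R lw S) = (\<Sum>S\<in>\<S>. c S *\<^sub>R pt e s h (ax l + ind S))"
    unfolding pt_ax emb_sum ..
  also have "\<dots> \<in> cspan (\<lambda>S. pt e s h (ax l + ind S)) \<S>" by (rule cspanI[OF assms(1)])
  also have "\<dots> \<subseteq> cn (ax l) I" by (rule cspan_mono[OF assms(2)]) simp
  finally show ?thesis .
qed

lemma B_mem:
  assumes "0 \<le> a" "0 \<le> c" "0 \<le> a'" "0 \<le> c'"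
  shows "emb (E l) s (a *\<^sub>R h l + c *\<^sub>R h (l + 1) + \<i> * (a' *\<^sub>R h (l + 1) + c' *\<^sub>R h (l + 2)))
    (of_real (a + a') + of_real (c + c') * om) \<in> cn (ax l) {1, 3}"
proof -
  define f where "f S = (if S = {} then a else if S = {1} then c else if S = {3} then a' else c')" for S :: "3 set"
  have "emb (E l) s (\<Sum>S\<in>{{}, {1}, {3}, {1, 3}}. f S *\<^sub>R lz h l S) (\<Sum>S\<in>{{}, {1}, {3}, {1, 3}}. f S *\<^sub>R lw S) \<in> cn (ax l) {1, 3}"
    by (rule cn_ge) (use assms in \<open>auto simp: f_def\<close>)
  moreover have d: "({1} :: 3 set) \<noteq> {3}" "({1} :: 3 set) \<noteq> {1, 3}" "({3} :: 3 set) \<noteq> {1, 3}" by auto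
  have "(\<Sum>S\<in>{{}, {1}, {3}, {1, 3}}. f S *\<^sub>R lz h l S) = a *\<^sub>R h l + c *\<^sub>R h (l + 1) + \<i> * (a' *\<^sub>R h (l + 1) + c' *\<^sub>R h (l + 2))"
    using d by (simp add: f_def lz_simps algebra_simps)
  moreover have "(\<Sum>S\<in>{{}, {1}, {3}, {1, 3}}. f S *\<^sub>R lw S) = of_real (a + a') + of_real (c + c') * om"
    using d by (simp add: f_def lw_om scaleR_conv_of_real algebra_simps)
  ultimately show ?thesis by simp
qed

lemma edge_mem:
  assumes "0 \<le> a" "0 \<le> c"
  shows "emb (E l) s (a *\<^sub>R h l + \<i> * (c *\<^sub>R h (l + 1))) (of_real (a + c)) \<in> cn (ax l) {3}"
proof -
  have "emb (E l) s (\<Sum>S\<in>{{}, {3}}. (if S = {} then a else c) *\<^sub>R lz h l S) (\<Sum>S\<in>{{}, {3}}. (if S = {} then a else c) *\<^sub>R lw S) \<in> cn (ax l) {3}"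
    by (rule cn_ge) (use assms in auto)
  then show ?thesis by (simp add: lz_simps lw_simps scaleR_conv_of_real mult.left_commute[of \<i>])
qed

lemma A_mem:
  assumes "0 \<le> a" "0 \<le> c" "0 \<le> c'" "0 \<le> d"
  shows "emb (E l) s (a *\<^sub>R h l + (c + c') *\<^sub>R h (l + 1) + d *\<^sub>R h (l + 2)) (of_real (a + d) + of_real c * om + of_real c' * cnj om) \<in> cn (ax l) {1, 2}"
proof -
  define f where "f S = (if S = {} then a else if S = {1} then c else if S = {2} then c' else d)" for S :: "3 set"
  have "emb (E l) s (\<Sum>S\<in>{{}, {1}, {2}, {1, 2}}. f S *\<^sub>R lz h l S) (\<Sum>S\<in>{{}, {1}, {2}, {1, 2}}. f S *\<^sub>R lw S) \<in> cn (ax l) {1, 2}"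
    by (rule cn_ge) (use assms in \<open>auto simp: f_def\<close>)
  moreover have d: "({1} :: 3 set) \<noteq> {2}" "({1} :: 3 set) \<noteq> {1, 2}" "({2} :: 3 set) \<noteq> {1, 2}" by auto
  have "(\<Sum>S\<in>{{}, {1}, {2}, {1, 2}}. f S *\<^sub>R lz h l S) = a *\<^sub>R h l + (c + c') *\<^sub>R h (l + 1) + d *\<^sub>R h (l + 2)"
    using d by (simp add: f_def lz_simps algebra_simps)
  moreover have "(\<Sum>S\<in>{{}, {1}, {2}, {1, 2}}. f S *\<^sub>R lw S) = of_real (a + d) + of_real c * om + of_real c' * cnj om"
    using d by (simp add: f_def lw_om scaleR_conv_of_real algebra_simps)
  ultimately show ?thesis by simp
qed

text \<open>Over the ray of \<open>(1 - t) + t * om\<close> the square in directions 1 and 3 has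
  first components \<open>p * X - q * Y\<close> plus \<i> times \<open>p + q\<close> times the given
  interpolation. If that were 0, all these would be real. As they avoid 0, \<open>X\<close> and
  \<open>- Y\<close> have the same sign, so transversality equates them, against
  \<open>0 < X + Y\<close>.\<close>

lemma w_interp_nz:
  assumes l: "l + 2 \<le> k" and t: "0 \<le> t" "t \<le> 1"
  shows "(1 - t) * w (l + 1) + t * w (l + 2) \<noteq> 0"
proof
  assume 0: "(1 - t) * w (l + 1) + t * w (l + 2) = 0"
  have sc: "strip_cell k (ax l) {1, 3}" using l by (intro ax_strip) simp
  define X Y U where "X = (1 - t) * w l + t * w (l + 1)" and "Y = (1 - t) * w (l + 2) + t * w (l + 3)"
    and "U = of_real (1 - t) + of_real t * om"
  have U: "U \<noteq> 0" unfolding U_def using t by (intro a_c_om_nz) auto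
  have XY: "0 < X + Y"
  proof -
    have "0 < w l + w (l + 2)" "0 < w (l + 1) + w (l + 3)"
      using sum_pos[of l] sum_pos[of "l + 1"] l by (simp_all add: eval_nat_numeral)
    then have "0 < (1 - t) * (w l + w (l + 2)) + t * (w (l + 1) + w (l + 3))"
      using t by (cases "t = 0") (auto intro!: add_nonneg_pos)
    then show ?thesis by (simp add: X_def Y_def algebra_simps)
  qed
  have mem: "emb (E l) s (of_real (p * X - q * Y)) (of_real (p + q) * U) \<in> cn (ax l) {1, 3}" if pq: "0 \<le> p" "0 \<le> q" for p q
  proof -
    have "(p * (1 - t)) *\<^sub>R h l + (p * t) *\<^sub>R h (l + 1) + \<i> * ((q * (1 - t)) *\<^sub>R h (l + 1) + (q * t) *\<^sub>R h (l + 2)) = of_real (p * X - q * Y)"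
    proof (rule complex_eqI)
      have "p * (1 - t) * w (l + 1) + p * t * w (l + 2) + (q * (1 - t) * w (l + 1) + q * t * w (l + 2))
        = (p + q) * ((1 - t) * w (l + 1) + t * w (l + 2))" by algebra
      then show "Im ((p * (1 - t)) *\<^sub>R h l + (p * t) *\<^sub>R h (l + 1) + \<i> * ((q * (1 - t)) *\<^sub>R h (l + 1) + (q * t) *\<^sub>R h (l + 2))) = Im (of_real (p * X - q * Y))"
        using 0 by (simp add: eta_def)
    qed (simp add: X_def Y_def eta_def eval_nat_numeral algebra_simps)
    moreover have "of_real (p * (1 - t) + q * (1 - t)) + of_real (p * t + q * t) * om = of_real (p + q) * U"
      by (simp add: U_def algebra_simps)
    ultimately show ?thesis
      using B_mem[of "p * (1 - t)" "p * t" "q * (1 - t)" "q * t" l] t pq by simp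
  qed
  have nz: "p * X - q * Y \<noteq> 0" if "0 \<le> p" "0 \<le> q" "0 < p + q" for p q
  proof -
    have "complex_of_real (p * X - q * Y) \<noteq> 0"
      by (rule cn_z_nz[OF sc _ frame_E mem[OF that(1,2)]]) (use U that in \<open>simp_all flip: of_real_add\<close>)
    then show ?thesis by (simp only: of_real_eq_0_iff not_False_eq_True)
  qed
  have "X \<noteq> 0" "Y \<noteq> 0" using nz[of 1 0] nz[of 0 1] by auto
  moreover have "\<not> (0 < X \<and> 0 < Y)" using nz[of Y X] by (auto simp: mult.commute)
  ultimately have neg: "0 < - Y / X" using XY by (auto simp: zero_less_divide_iff divide_less_0_iff)
  have m1: "emb (E l) s (of_real X) U \<in> cn (ax l) {1, 3}" using mem[of 1 0] by simp
  have m2: "emb (E l) s ((- Y / X) *\<^sub>R of_real X) (1 *\<^sub>R U) \<in> cn (ax l) {1, 3}"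
    using mem[of 0 1] \<open>X \<noteq> 0\<close> by (simp add: scaleR_conv_of_real)
  have "- Y / X = 1"
    by (rule cn_ray[OF frame_E l sc _ _ sc _ _ m1 m2 neg _ U]) (simp_all add: coord_sum_ax)
  then have "X + Y = 0" using \<open>X \<noteq> 0\<close> by (simp add: field_simps)
  then show False using XY by simp
qed

text \<open>As the interpolation never vanishes, the two terms have the same sign. If both were
  negative, their outer neighbours would be positive, and the recurrence would make each less than
  twice the other, which is impossible for negative numbers.\<close>

lemma w_pos2:
  assumes l: "l + 2 \<le> k"
  shows "0 < w (l + 1) \<and> 0 < w (l + 2)"
proof -
  have "0 < w (l + 1) * w (l + 2)"
  proof (rule ccontr)
    assume n: "\<not> 0 < w (l + 1) * w (l + 2)"
    have 1: "w (l + 1) \<noteq> 0" using w_interp_nz[OF l, of 0] by simp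
    have 2: "w (l + 2) \<noteq> 0" using w_interp_nz[OF l, of 1] by simp
    define t where "t = w (l + 1) / (w (l + 1) - w (l + 2))"
    have d: "w (l + 1) - w (l + 2) \<noteq> 0" "0 \<le> t" "t \<le> 1"
      using n 1 2 by (auto simp: t_def divide_simps zero_less_mult_iff)
    then have "(1 - t) * w (l + 1) + t * w (l + 2) = 0"
      by (simp add: t_def field_simps)
    then show False using w_interp_nz[OF l d(2,3)] by blast
  qed
  then consider "0 < w (l + 1)" "0 < w (l + 2)" | "w (l + 1) < 0" "w (l + 2) < 0"
    by (auto simp: zero_less_mult_iff)
  then show ?thesis
  proof cases
    case 2
    obtain b where b: "0 < b" "w (l + 2) = 2 * w (l + 1) + b * (2 * w (l + 1) - w l)"
      "w (l + 3) = 2 * w (l + 2) + b * (2 * w (l + 2) - w (l + 1))" using recs[OF l] by blast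
    have "0 < w l" "0 < w (l + 3)" using sum_pos[of l] sum_pos[of "l + 1"] l 2 by (simp_all add: eval_nat_numeral)
    then have "b * (2 * w (l + 1) - w l) < 0" "0 < b * (2 * w (l + 2) - w (l + 1))"
      using b 2 by (auto simp: mult_less_0_iff)
    then have "w (l + 2) < 2 * w (l + 1)" "w (l + 1) < 2 * w (l + 2)"
      using b(1,2) by (auto simp: zero_less_mult_iff)
    then show ?thesis using 2 by simp
  qed simp
qed

lemma w_det_step:
  assumes "l + 2 \<le> k"
  shows "\<exists>b>0. w (l + 2) * w (l + 2) - w (l + 1) * w (l + 3) = b * (w (l + 1) * w (l + 1) - w l * w (l + 2))"
proof -
  obtain b where b: "0 < b" "w (l + 2) = 2 * w (l + 1) + b * (2 * w (l + 1) - w l)"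
    "w (l + 3) = 2 * w (l + 2) + b * (2 * w (l + 2) - w (l + 1))" using recs[OF assms] by blast
  have "y * y - x * (2 * y + b * (2 * y - x)) = b * (x * x - u * y)" if "y = 2 * x + b * (2 * x - u)" for u x y :: real
    unfolding that by algebra
  from this[OF b(2)] show ?thesis using b(1) unfolding b(3) by blast
qed

text \<open>Equality would make \<open>h (l + 2)\<close> a multiple of \<open>h l\<close>, which
  transversality and the recurrence exclude. If the inequality is reversed, the edge in direction 3
  meets the ray of \<open>h (l + 1)\<close> over the same second component as a diagonal of the
  square in directions 1 and 2; transversality makes the two points equal, and this pushes the
  vertex \<open>{1, 2}\<close> onto the edge.\<close>

lemma w_det2:
  assumes l: "l + 2 \<le> k"
  shows "w l * w (l + 2) < w (l + 1) * w (l + 1)"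
proof (rule ccontr)
  assume n: "\<not> w l * w (l + 2) < w (l + 1) * w (l + 1)"
  have p: "0 < w (l + 1)" "0 < w (l + 2)" using w_pos2[OF l] by auto
  have scA: "strip_cell k (ax l) {1, 2}" and scE: "strip_cell k (ax l) {3}" using l by (auto intro!: ax_strip)
  have w0: "0 < w l"
  proof -
    have "0 < w l * w (l + 2)" using n mult_pos_pos[OF p(1) p(1)] by linarith
    then show ?thesis using p(2) by (simp add: zero_less_mult_iff)
  qed
  obtain b where b: "0 < b" "w (l + 2) = 2 * w (l + 1) + b * (2 * w (l + 1) - w l)"
    "w (l + 3) = 2 * w (l + 2) + b * (2 * w (l + 2) - w (l + 1))" using recs[OF l] by blast
  have h0: "emb (E l) s (h l) 1 \<in> cn (ax l) {1, 2}" using A_mem[of 1 0 0 0 l] by simp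
  have h2: "emb (E l) s (h (l + 2)) 1 \<in> cn (ax l) {1, 2}" using A_mem[of 0 0 0 1 l] by simp
  have h1: "emb (E l) s (2 *\<^sub>R h (l + 1)) 1 \<in> cn (ax l) {1, 2}" using A_mem[of 0 1 1 0 l] by (simp add: cnj_om)
  show False
  proof (cases "w l * w (l + 2) = w (l + 1) * w (l + 1)")
    case True
    define \<tau> where "\<tau> = w (l + 2) / w l"
    have \<tau>: "0 < \<tau>" using p w0 by (simp add: \<tau>_def)
    have "w (l + 2) * w (l + 2) = w (l + 1) * w (l + 3)" using w_det_step[OF l] True by auto
    moreover have "w (l + 1) * (\<tau> * w (l + 1)) = \<tau> * (w l * w (l + 2))" unfolding True by simp
    moreover have "\<tau> * (w l * w (l + 2)) = w (l + 2) * w (l + 2)" using w0 by (simp add: \<tau>_def)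
    ultimately have "w (l + 1) * w (l + 3) = w (l + 1) * (\<tau> * w (l + 1))" by metis
    then have "w (l + 3) = \<tau> * w (l + 1)" using p by simp
    moreover have "w (l + 2) = \<tau> * w l" using w0 by (simp add: \<tau>_def)
    ultimately have "h (l + 2) = \<tau> *\<^sub>R h l" by (simp add: complex_eq_iff eval_nat_numeral)
    then have "emb (E l) s (\<tau> *\<^sub>R h l) (1 *\<^sub>R 1) \<in> cn (ax l) {1, 2}" using h2 by simp
    then have "\<tau> = 1"
      by (intro cn_ray[OF frame_E l scA _ _ scA _ _ h0 _ \<tau>]) (simp_all add: coord_sum_ax)
    then have "w (l + 2) = w l" using w0 by (simp add: \<tau>_def)
    then have "w (l + 1) = w l" using True w0 p power2_eq_imp_eq[of "w (l + 1)" "w l"] by (simp add: power2_eq_square)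
    then have "w l + b * w l = 0" using b(2) \<open>w (l + 2) = w l\<close> by (simp add: algebra_simps)
    then show False using w0 b(1) by (simp add: add_nonneg_eq_0_iff)
  next
    case False
    then have gt: "w (l + 1) * w (l + 1) < w l * w (l + 2)" using n by linarith
    \<comment> \<open>\<open>r\<close> and \<open>a\<close> solve for the point of the edge, with
      weights \<open>a\<close> and \<open>1 - a\<close>, that lies on the ray of
      \<open>h (l + 1)\<close>.\<close>
    define r where "r = w (l + 1) / w (l + 2)"
    define a where "a = (r * w (l + 1) + w (l + 2)) / (w l + w (l + 2))"
    have r: "0 < r" "r * w (l + 2) = w (l + 1)" using p by (simp_all add: r_def)
    have rl: "r * w (l + 1) < w l" using gt p by (simp add: r_def field_simps)
    have s0: "0 < w l + w (l + 2)" using w0 p by simp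
    have a: "0 \<le> a" "a \<le> 1" "a * (w l + w (l + 2)) = r * w (l + 1) + w (l + 2)"
      using rl r p s0 by (auto simp: a_def field_simps)
    have "a *\<^sub>R h l + \<i> * ((1 - a) *\<^sub>R h (l + 1)) = r *\<^sub>R h (l + 1)"
    proof (rule complex_eqI)
      have "a * w l - (1 - a) * w (l + 2) = a * (w l + w (l + 2)) - w (l + 2)" by algebra
      then show "Re (a *\<^sub>R h l + \<i> * ((1 - a) *\<^sub>R h (l + 1))) = Re (r *\<^sub>R h (l + 1))"
        unfolding a(3) by (simp add: eta_def)
      show "Im (a *\<^sub>R h l + \<i> * ((1 - a) *\<^sub>R h (l + 1))) = Im (r *\<^sub>R h (l + 1))"
        using r(2) by (simp add: eta_def algebra_simps)
    qed
    then have m: "emb (E l) s (r *\<^sub>R h (l + 1)) 1 \<in> cn (ax l) {3}"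
      using edge_mem[of a "1 - a" l] a by simp
    have m': "emb (E l) s ((2 / r) *\<^sub>R (r *\<^sub>R h (l + 1))) (1 *\<^sub>R 1) \<in> cn (ax l) {1, 2}"
      using h1 r by simp
    have "2 / r = 1"
      by (rule cn_ray[OF frame_E l scE _ _ scA _ _ m m']) (use r in \<open>simp_all add: coord_sum_ax\<close>)
    then have r2: "r = 2" using r by (simp add: field_simps)
    then have w12: "w (l + 1) = 2 * w (l + 2)" using r by simp
    then have w3: "w (l + 3) = w (l + 1)" using b(3) by simp
    \<comment> \<open>The weight at which the edge passes through \<open>h (l + 2)\<close>, now that
      \<open>w (l + 3) = w (l + 1)\<close>.\<close>
    define c where "c = 2 * w (l + 2) / (w l + w (l + 2))"
    have "4 * w (l + 2) < w l" using rl r2 w12 by simp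
    then have c: "0 \<le> c" "c \<le> 1" "c * (w l + w (l + 2)) = 2 * w (l + 2)" using p s0 by (simp_all add: c_def)
    have "c *\<^sub>R h l + \<i> * ((1 - c) *\<^sub>R h (l + 1)) = h (l + 2)"
    proof (rule complex_eqI)
      have "c * w l - (1 - c) * w (l + 2) = c * (w l + w (l + 2)) - w (l + 2)" by algebra
      then show "Re (c *\<^sub>R h l + \<i> * ((1 - c) *\<^sub>R h (l + 1))) = Re (h (l + 2))"
        unfolding c(3) by (simp add: eta_def)
      show "Im (c *\<^sub>R h l + \<i> * ((1 - c) *\<^sub>R h (l + 1))) = Im (h (l + 2))"
        using w3 by (simp add: eta_def algebra_simps eval_nat_numeral)
    qed
    then have "emb (E l) s (h (l + 2)) 1 \<in> cn (ax l) {3}"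
      using edge_mem[of c "1 - c" l] c by simp
    then have pm: "pt e s h (ax l + ind {1, 2}) \<in> cn (ax l) {3}"
      unfolding pt_ax lz_simps lw_simps .
    have sv: "strip_cell k (ax l + ind {1, 2}) {}" using strip_vertex[OF scA, of "{1, 2}"] by simp
    interpret F: frame "E l" s by (rule frame_E)
    have ptnz: "pt e s h (ax l + ind {1, 2}) \<noteq> 0"
      unfolding pt_ax lw_simps F.emb_eq_0_iff by simp
    have "\<phi> (orbit {ax l + ind {1, 2}}) = {pt e s h (ax l + ind {1, 2}) /\<^sub>R norm (pt e s h (ax l + ind {1, 2}))}"
      using lab[OF torus_complexI[OF sv]] mlab_cell[of e s h "ax l + ind {1, 2}" "{}"] sph_hull_single[OF ptnz] by simp
    then have "pv (ax l + ind {1, 2}) \<in> \<phi> (orbit (cell (ax l) {3}))"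
      using cn_cell[OF scE pm ptnz] lab_vertex[OF sv] by simp
    then obtain l' A where A: "l' \<in> Lam" "A \<subseteq> {3}" "ax l + ind {1, 2} = l' + ax l + ind A"
      using pv_mem_iff[OF sv scE] by blast
    then have "ind {1, 2} - ind A = l'" by (simp add: algebra_simps)
    then have "{1, 2} = A" using A(1) Lam_ind_diff by blast
    then show False using A(2) by auto
  qed
qed

end


section \<open>The growing case\<close>

fun solution :: "real \<Rightarrow> real \<Rightarrow> real \<Rightarrow> nat \<Rightarrow> real" where
  "solution b x y 0 = x"
| "solution b x y (Suc 0) = y"
| "solution b x y (Suc (Suc n)) = 2 * solution b x y (Suc n) + b * (2 * solution b x y (Suc n) - solution b x y n)"

lemma mlab_cong:
  assumes C: "C \<in> torus_complex k" and h: "\<And>n. n \<le> k \<Longrightarrow> h n = h' n"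
  shows "mlab e s h C = mlab e s h' C"
  using C
proof (cases rule: torus_complexE)
  case (2 v I)
  have "pt e s h (v + ind S) = pt e s h' (v + ind S)" if S: "S \<subseteq> I" for S
  proof -
    have "card S \<le> card I" using S by (simp add: card_mono)
    then have "coord_sum (v + ind S) \<le> real k" using 2(1) by (simp add: strip_cell_def)
    then have "nat \<lfloor>coord_sum (v + ind S)\<rfloor> \<le> k" by linarith
    then show ?thesis unfolding pt_def by (simp only: h)
  qed
  then have "(\<lambda>S. pt e s h (v + ind S)) ` Pow I = (\<lambda>S. pt e s h' (v + ind S)) ` Pow I"
    by (intro image_cong) auto
  then show ?thesis unfolding 2(2) mlab_cell by simp
qed simp

context coord_cct
begin

lemma T_eq: "T = \<phi> ` torus_complex k"
  using is_cct by (simp add: is_cct_def bij_betw_def)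

lemma growing_extension:
  assumes k3: "3 \<le> k" and d0: "w 0 < 2 * w 1"
  shows "\<exists>T' \<phi>'. \<Union>T' \<subseteq> S3eq \<and> ideal_cct (k + 1) T' \<phi>' \<and> extends (k + 1) T' \<phi>' k T"
proof -
  obtain b where b: "0 < b" "w (0 + 2) = 2 * w (0 + 1) + b * (2 * w (0 + 1) - w 0)"
      "w (0 + 3) = 2 * w (0 + 2) + b * (2 * w (0 + 2) - w (0 + 1))" using recs[of 0] k2 by auto
  have d: "w l < 2 * w (l + 1)" if "l + 1 \<le> k" for l
    using that
  proof (induction l)
    case 0
    then show ?case using d0 by simp
  next
    case (Suc l)
    then have l: "l + 2 \<le> k" by simp
    obtain c where c: "0 < c" "w (l + 2) = 2 * w (l + 1) + c * (2 * w (l + 1) - w l)" using recs[OF l] by blast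
    have "0 < c * (2 * w (l + 1) - w l)" using Suc c(1) by simp
    then show ?case using c(2) w_pos2[OF l] by simp
  qed
  have rec: "w (l + 2) = 2 * w (l + 1) + b * (2 * w (l + 1) - w l) \<and>
    w (l + 3) = 2 * w (l + 2) + b * (2 * w (l + 2) - w (l + 1))" if "l + 2 \<le> k" for l
    using that
  proof (induction l)
    case 0
    then show ?case using b by simp
  next
    case (Suc l)
    then have l: "l + 2 \<le> k" "Suc l + 2 \<le> k" by simp_all
    obtain c where c: "w (Suc l + 2) = 2 * w (Suc l + 1) + c * (2 * w (Suc l + 1) - w (Suc l))"
      "w (Suc l + 3) = 2 * w (Suc l + 2) + c * (2 * w (Suc l + 2) - w (Suc l + 1))" using recs[OF l(2)] by blast
    \<comment> \<open>The second equation at \<open>l\<close> and the first at \<open>Suc l\<close>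
      give the same term, and what multiplies the factor is nonzero; so the factor is still
      \<open>b\<close>.\<close>
    have "w (Suc l + 2) = 2 * w (Suc l + 1) + b * (2 * w (Suc l + 1) - w (Suc l))"
      using Suc.IH[OF l(1)] by (simp add: eval_nat_numeral)
    moreover have "2 * w (Suc l + 1) - w (Suc l) \<noteq> 0" using d[of "Suc l"] l by simp
    ultimately have "c = b" using c(1) by simp
    then show ?case using c by simp
  qed
  define W where "W = solution b (w 0) (w 1)"
  have WS: "W (n + 2) = 2 * W (n + 1) + b * (2 * W (n + 1) - W n)" for n by (simp add: W_def)
  have W: "W n = w n" if "n \<le> k + 1" for n
    using that
  proof (induction n rule: less_induct)
    case (less n)
    \<comment> \<open>The term \<open>w (k + 1)\<close> is reached only by the second equation of
      the recurrence, hence the fourth case.\<close>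
    consider "n = 0" | "n = 1" | m where "n = m + 2" "m + 2 \<le> k" | m where "n = m + 3" "m + 2 \<le> k"
    proof -
      have "n = 0 \<or> n = 1 \<or> n = (n - 2) + 2 \<and> (n - 2) + 2 \<le> k \<or> n = (n - 3) + 3 \<and> (n - 3) + 2 \<le> k"
        using less.prems k3 by linarith
      then show thesis using that by blast
    qed
    then show ?case
    proof cases
      case (3 m)
      have "W m = w m" "W (m + 1) = w (m + 1)" using less.IH 3 by simp_all
      then show ?thesis unfolding 3(1) WS using rec[OF 3(2)] by simp
    next
      case (4 m)
      have "W (m + 1) = w (m + 1)" "W (m + 2) = w (m + 2)" using less.IH 4 by simp_all
      then have "W (m + 1 + 2) = 2 * w (m + 2) + b * (2 * w (m + 2) - w (m + 1))"
        using WS[of "m + 1"] by (simp add: eval_nat_numeral)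
      then show ?thesis unfolding 4(1) using rec[OF 4(2)] by (simp add: eval_nat_numeral)
    qed (simp_all add: W_def)
  qed
  have W012: "W 0 = w 0" "W 1 = w 1" "W 2 = w 2" using W[of 0] W[of 1] W[of 2] k3 by simp_all
  interpret G: growing e s W b
  proof
    show "W (n + 2) = 2 * W (n + 1) + b * (2 * W (n + 1) - W n)" for n by (rule WS)
    show "0 < b" by (rule b)
    show "0 < W 1" "W 0 < 2 * W 1" "0 < W 0 + W 2" "W 0 * W 2 < W 1 * W 1"
      unfolding W012 using w_pos2[of 0] d0 sum_pos[of 0] w_det2[of 0] k3 by (simp_all add: numeral_2_eq_2)
  qed
  have "mlab e s h C = mlab e s (eta W) C" if "C \<in> torus_complex k" for C
    by (rule mlab_cong[OF that]) (simp add: eta_def W)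
  then have "T = G.M k" unfolding T_eq G.M_def using lab by (auto intro!: image_cong)
  then have "extends (k + 1) (G.M (k + 1)) (mlab e s (eta W)) k T"
    using G.M_extends[of k] by (simp add: extends_def)
  moreover have "ideal_cct (k + 1) (G.M (k + 1)) (mlab e s (eta W))" using k3 by (intro G.M_ideal) simp
  ultimately show ?thesis using G.M_S3eq[of "k + 1"] by blast
qed

end


section \<open>The shrinking case\<close>

lemma cspan_linear_image:
  assumes x: "x \<in> cspan p A" and f: "linear f" and q: "\<And>i. i \<in> A \<Longrightarrow> f (p i) \<in> cspan q B"
  shows "f x \<in> cspan q B"
proof -
  obtain c where c: "x = (\<Sum>i\<in>A. c i *\<^sub>R p i)" "\<forall>i\<in>A. 0 \<le> c i" using x by (auto simp: cspan_def)
  have "f x = (\<Sum>i\<in>A. c i *\<^sub>R f (p i))" unfolding c(1) using f by (simp add: linear_sum linear_scale)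
  also have "\<dots> \<in> cspan q B"
    using c(2) q
  proof (induction A rule: infinite_finite_induct)
    case (insert i A)
    then show ?case by (auto intro!: cspan_add cspan_scale)
  qed (auto simp: cspan_def intro!: exI[of _ "\<lambda>_. 0"])
  finally show ?thesis .
qed

text \<open>The sup norm of the plane: it is invariant under quarter turns and can be bounded below
  through a single coordinate, which suits estimates by terms of the real sequence.\<close>

definition mx :: "complex \<Rightarrow> real" where
  "mx z = max \<bar>Re z\<bar> \<bar>Im z\<bar>"

lemma mx_scale: "0 \<le> c \<Longrightarrow> mx (c *\<^sub>R z) = c * mx z"
  by (simp add: mx_def abs_mult max_mult_distrib_left)

lemma mx_quarter_turn: "mx (cis (pi / 2 * of_int d) * z) = mx z"
proof -
  have 1: "mx (\<i> * z) = mx z" for z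
    by (simp add: mx_def max.commute)
  have "mx (\<i> ^ n * z) = mx z" for n
    by (induction n) (simp, simp only: power_Suc mult.assoc 1)
  then show ?thesis by (simp only: cis_pi2_int)
qed

text \<open>The oriented area; its sign tells on which side of the line through \<open>x\<close> the
  point \<open>y\<close> lies.\<close>

definition dt :: "complex \<Rightarrow> complex \<Rightarrow> real" where
  "dt x y = Re x * Im y - Im x * Re y"

text \<open>Cramer's rule: the two signs are those of the coefficients of \<open>d\<close> in the
  basis \<open>x\<close>, \<open>y\<close>.\<close>

lemma dt_wedge:
  assumes D: "0 < dt x y" and d: "0 \<le> dt x d" "dt y d \<le> 0" "d \<noteq> 0"
  obtains p q where "0 \<le> p" "0 \<le> q" "0 < p + q" "d = p *\<^sub>R x + q *\<^sub>R y"
proof -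
  define p q where "p = - dt y d / dt x y" and "q = dt x d / dt x y"
  have pq: "0 \<le> p" "0 \<le> q" using D d by (simp_all add: p_def q_def divide_nonneg_pos divide_nonpos_pos)
  have "dt x y *\<^sub>R d = (- dt y d) *\<^sub>R x + dt x d *\<^sub>R y"
    by (simp add: complex_eq_iff dt_def algebra_simps)
  then have "d = inverse (dt x y) *\<^sub>R ((- dt y d) *\<^sub>R x + dt x d *\<^sub>R y)"
    using D by (metis less_irrefl real_vector_eq_affinity scaleR_scaleR left_inverse scaleR_one)
  then have e: "d = p *\<^sub>R x + q *\<^sub>R y"
    by (simp add: p_def q_def scaleR_diff_right divide_inverse mult.commute)
  then have "p \<noteq> 0 \<or> q \<noteq> 0" using d(3) by auto
  then show ?thesis using that[OF pq _ e] pq by linarith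
qed

lemma om_square: "om * om = om - 1"
  by (simp add: om_Complex complex_eq_iff)

lemma om_cube: "om * (om * om) = -1"
  unfolding om_square by (simp add: algebra_simps om_square)

lemma sector_exists:
  assumes "u \<noteq> 0"
  obtains n a c where "0 \<le> a" "0 \<le> c" "0 < a + c" "u = om ^ n * (of_real a + of_real c * om)"
proof -
  define n where "n = nat \<lfloor>Arg2pi u / (pi / 3)\<rfloor>"
  define \<theta> where "\<theta> = Arg2pi u - real n * (pi / 3)"
  have "0 \<le> Arg2pi u / (pi / 3)" using Arg2pi_ge_0 by simp
  then have "real n \<le> Arg2pi u / (pi / 3)" "Arg2pi u / (pi / 3) < real n + 1"
    unfolding n_def by linarith+
  then have \<theta>: "0 \<le> \<theta>" "\<theta> \<le> pi / 3" by (simp_all add: \<theta>_def field_simps)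
  \<comment> \<open>Law of sines: \<open>2 / sqrt 3\<close> is the inverse of the sine of pi / 3,
    the angle between the two boundary rays.\<close>
  define r where "r = norm u * 2 / sqrt 3"
  have r: "0 < r" using assms by (simp add: r_def)
  define a c where "a = r * sin (pi / 3 - \<theta>)" and "c = r * sin \<theta>"
  have ac: "0 \<le> a" "0 \<le> c" using r \<theta> by (auto simp: a_def c_def intro!: mult_nonneg_nonneg sin_ge_zero)
  have "u = of_real (norm u) * cis (Arg2pi u)"
    using Arg2pi_eq[of u] by (simp add: cis_conv_exp mult.commute)
  also have "cis (Arg2pi u) = om ^ n * cis \<theta>"
  proof -
    have "om ^ n = cis (real n * (pi / 3))" by (simp only: om_def Complex.DeMoivre)
    then show ?thesis by (simp only: cis_mult \<theta>_def) simp
  qed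
  also have "of_real (norm u) * (om ^ n * cis \<theta>) = om ^ n * (of_real (norm u) * cis \<theta>)" by simp
  also have "of_real (norm u) * cis \<theta> = of_real a + of_real c * om"
  proof (rule complex_eqI)
    show "Im (of_real (norm u) * cis \<theta>) = Im (of_real a + of_real c * om)"
      unfolding om_of_reals by (simp add: c_def r_def)
    have "a + c / 2 = r * (sqrt 3 / 2 * cos \<theta>)"
      by (simp add: a_def c_def sin_diff sin_60 cos_60 algebra_simps)
    then show "Re (of_real (norm u) * cis \<theta>) = Re (of_real a + of_real c * om)"
      unfolding om_of_reals by (simp add: r_def)
  qed
  finally have u: "u = om ^ n * (of_real a + of_real c * om)" .
  have "a \<noteq> 0 \<or> c \<noteq> 0" using u assms by auto
  then show ?thesis using that[OF ac _ u] ac by linarith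
qed

locale shrinking_cct = coord_cct +
  assumes k3: "3 \<le> k" and shrink: "2 * w 1 \<le> w 0"
begin

text \<open>The determinant inequality says that the ratio of successive terms decreases, so a ratio
  of at most 1/2 at the start persists.\<close>

lemma w_halves: "l + 1 \<le> k \<Longrightarrow> 2 * w (l + 1) \<le> w l"
proof (induction l)
  case 0
  then show ?case using shrink by simp
next
  case (Suc l)
  then have l: "l + 2 \<le> k" by simp
  have p: "0 < w (l + 1)" "0 < w (l + 2)" using w_pos2[OF l] by auto
  have "2 * w (l + 1) * w (l + 2) \<le> w l * w (l + 2)" using Suc p by (intro mult_right_mono) auto
  then have "w (l + 1) * (2 * w (l + 2)) < w (l + 1) * w (l + 1)" using w_det2[OF l] by (simp add: mult_ac)
  then show ?case using p by simp
qed

lemma w_pos: "n \<le> k \<Longrightarrow> 0 < w n"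
proof -
  have 1: "0 < w 1" using w_pos2[of 0] k3 by simp
  assume "n \<le> k"
  consider "n = 0" | "n = 1" | "n = (n - 2) + 2" by linarith
  then show ?thesis
  proof cases
    case 3
    then show ?thesis using w_pos2[of "n - 2"] \<open>n \<le> k\<close> by simp
  qed (use 1 shrink in auto)
qed

lemma w_antimono: "m \<le> n \<Longrightarrow> n \<le> k \<Longrightarrow> w n \<le> w m"
proof (induction n rule: dec_induct)
  case (step n)
  then show ?case using w_halves[of n] w_pos[of "n + 1"] by simp
qed simp

text \<open>Both coordinates of \<open>h k\<close> are needed. The second may be negative: it is
  bounded above through the determinant inequality and below through \<open>sum_pos\<close>. Since
  \<open>3 \<le> k\<close>, the term \<open>w (k - 1)\<close> is at most \<open>w 2\<close>.\<close>

lemma w_top: "\<bar>w k\<bar> < w 2" "\<bar>w (k + 1)\<bar> < w 2"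
proof -
  have p: "0 < w k" "0 < w (k - 1)" using w_pos by simp_all
  have k: "w (k - 1) \<le> w 2" using k3 by (intro w_antimono) auto
  have hk: "2 * w k \<le> w (k - 1)" using w_halves[of "k - 1"] k3 by simp
  show "\<bar>w k\<bar> < w 2" using p k hk by linarith
  have e: "k - 2 + 2 = k" "k - 2 + 1 = k - 1" "k - 2 + 3 = k + 1" using k3 by simp_all
  obtain b where "0 < b" "w k * w k - w (k - 1) * w (k + 1) = b * (w (k - 1) * w (k - 1) - w (k - 2) * w k)"
    using w_det_step[of "k - 2"] unfolding e by auto
  moreover have "w (k - 2) * w k < w (k - 1) * w (k - 1)" using w_det2[of "k - 2"] unfolding e by simp
  ultimately have "0 < w k * w k - w (k - 1) * w (k + 1)" by simp
  then have lt: "w (k - 1) * w (k + 1) < w k * w k" by simp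
  have "w (k + 1) < w k"
  proof (rule ccontr)
    assume "\<not> w (k + 1) < w k"
    then have "w k * w k \<le> w (k - 1) * w (k + 1)" using p hk by (intro mult_mono) auto
    then show False using lt by simp
  qed
  moreover have "0 < w (k - 1) + w (k + 1)"
  proof -
    have "k - 1 + 2 = k + 1" using k3 by simp
    then show ?thesis using sum_pos[of "k - 1"] k3 by simp
  qed
  ultimately show "\<bar>w (k + 1)\<bar> < w 2" using k p hk by linarith
qed

text \<open>Homogeneous form of the torus formed by layers 0 to 2, in which transversality and
  symmetry become statements about pairs of rays.\<close>

definition C2 :: "complex \<Rightarrow> complex \<Rightarrow> bool" where
  "C2 z u \<longleftrightarrow> u \<noteq> 0 \<and> (\<exists>v I. strip_cell 2 v I \<and> emb e s z u \<in> cn v I)"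

lemma strip2: "strip_cell 2 v I \<Longrightarrow> strip_cell k v I \<and> card I \<le> 2"
  using k2 by (auto simp: strip_cell_def)

lemma C2_nz: "C2 z u \<Longrightarrow> z \<noteq> 0 \<and> u \<noteq> 0"
  unfolding C2_def using cn_z_nz[OF _ _ frame_axioms] strip2 by blast

lemma C2_scale: "C2 z u \<Longrightarrow> 0 < c \<Longrightarrow> C2 (c *\<^sub>R z) (c *\<^sub>R u)"
proof -
  assume "C2 z u" "0 < c"
  then obtain v I where v: "u \<noteq> 0" "strip_cell 2 v I" "emb e s z u \<in> cn v I" unfolding C2_def by blast
  have "emb e s (c *\<^sub>R z) (c *\<^sub>R u) \<in> cn v I"
    unfolding emb_scale[symmetric] using v(3) \<open>0 < c\<close> by (intro cspan_scale) auto
  then show ?thesis unfolding C2_def using v \<open>0 < c\<close> by auto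
qed

lemma C2_ray:
  assumes "C2 z u" "C2 (a *\<^sub>R z) (b *\<^sub>R u)" "0 < a" "0 < b"
  shows "a = b"
proof -
  obtain v I v' I' where v: "u \<noteq> 0" "strip_cell 2 v I" "emb e s z u \<in> cn v I"
    "strip_cell 2 v' I'" "emb e s (a *\<^sub>R z) (b *\<^sub>R u) \<in> cn v' I'" using assms(1,2) unfolding C2_def by blast
  have "0 + 2 \<le> k" "strip_cell k v I" "strip_cell k v' I'" "real 0 \<le> coord_sum v" "real 0 \<le> coord_sum v'"
    "coord_sum v + card I \<le> real (0 + 2)" "coord_sum v' + card I' \<le> real (0 + 2)"
    using v(2,4) k2 by (auto simp: strip_cell_def)
  then show ?thesis using cn_ray[OF frame_axioms _ _ _ _ _ _ _ v(3) v(5) assms(3,4) v(1)] by blast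
qed

lemma cn_translate:
  assumes "x \<in> cn v I" "linear f" "\<And>u. f (pt e s h u) = pt e s h (t + u)"
  shows "f x \<in> cn (t + v) I"
proof (rule cspan_linear_image[OF assms(1,2)])
  fix S assume "S \<in> Pow I"
  then show "f (pt e s h (v + ind S)) \<in> cn (t + v) I"
    unfolding assms(3) using cspan_gen[of "Pow I" S "\<lambda>S. pt e s h (t + v + ind S)"] by (simp add: add.assoc)
qed

lemma C2_turn: "C2 z u \<Longrightarrow> C2 (\<i> * z) (om * u)"
proof -
  assume "C2 z u"
  then obtain v I where v: "u \<noteq> 0" "strip_cell 2 v I" "emb e s z u \<in> cn v I" unfolding C2_def by blast
  have "(r34 \<circ> r12) (emb e s z u) \<in> cn (vector [0, -1, 1] + v) I"
    by (rule cn_translate[OF v(3) linear_compose[OF rot12_props(1) rot34_props(1)] r3412_pt])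
  then have "emb e s (\<i> * z) (om * u) \<in> cn (vector [0, -1, 1] + v) I" by (simp add: rot12_props rot34_props)
  moreover have "strip_cell 2 (vector [0, -1, 1] + v) I" using v(2) strip_cell_translate[OF tvecs(3,4)] by blast
  moreover have "om * u \<noteq> 0" using v(1) by (simp add: om_def)
  ultimately show ?thesis unfolding C2_def by blast
qed

lemma C2_third: "C2 z u \<Longrightarrow> C2 z (om * (om * u))"
proof -
  assume "C2 z u"
  then obtain v I where v: "u \<noteq> 0" "strip_cell 2 v I" "emb e s z u \<in> cn v I" unfolding C2_def by blast
  have "(r34 \<circ> r34) (emb e s z u) \<in> cn (vector [1, -1, 0] + v) I"
    by (rule cn_translate[OF v(3) linear_compose[OF rot34_props(1) rot34_props(1)] r3434_pt])
  then have "emb e s z (om * (om * u)) \<in> cn (vector [1, -1, 0] + v) I" by (simp add: rot34_props)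
  moreover have "strip_cell 2 (vector [1, -1, 0] + v) I" using v(2) strip_cell_translate[OF tvecs(1,2)] by blast
  moreover have "om * (om * u) \<noteq> 0" using v(1) by (simp add: om_def)
  ultimately show ?thesis unfolding C2_def by blast
qed

lemma C2_cnj: "C2 z u \<Longrightarrow> C2 z (cnj u)"
proof -
  assume "C2 z u"
  then obtain v I where v: "u \<noteq> 0" "strip_cell 2 v I" "emb e s z u \<in> cn v I" unfolding C2_def by blast
  have "refl4 (emb e s z u) \<in> cn (swap12 v) (sw ` I)"
  proof (rule cspan_linear_image[OF v(3) refl4_props(1)])
    fix S assume "S \<in> Pow I"
    then have "sw ` S \<in> Pow (sw ` I)" by blast
    then show "refl4 (pt e s h (v + ind S)) \<in> cn (swap12 v) (sw ` I)"
      unfolding refl4_pt swap12_add swap12_ind by (intro cspan_gen) simp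
  qed
  then have "emb e s z (cnj u) \<in> cn (swap12 v) (sw ` I)" by (simp add: refl4_props)
  moreover have "strip_cell 2 (swap12 v) (sw ` I)" using v(2) strip_cell_swap by blast
  ultimately show ?thesis unfolding C2_def using v(1) by auto
qed

text \<open>Two quarter turns negate \<open>z\<close> and turn \<open>u\<close> by
  \<open>om ^ 2\<close>; two applications of \<open>C2_third\<close> complete this to
  \<open>om ^ 6 = 1\<close>.\<close>

lemma C2_uminus: "C2 z u \<Longrightarrow> C2 (- z) u"
proof -
  assume "C2 z u"
  then have "C2 (\<i> * (\<i> * z)) (om * (om * (om * (om * (om * (om * u))))))"
    by (intro C2_turn C2_third)
  moreover have "om * (om * (om * (om * (om * (om * u))))) = (om * (om * om)) * (om * (om * om)) * u"
    by (simp only: mult.assoc)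
  moreover have "\<dots> = u" unfolding om_cube by simp
  moreover have "\<i> * (\<i> * z) = - z" by (simp add: mult.assoc[symmetric])
  ultimately show ?thesis by simp
qed

text \<open>Up to a quarter turn one coordinate is at least \<open>w 2\<close> at every vertex of
  the cell: the real part if direction 3 is absent; otherwise the imaginary part, because a vertex
  without direction 3 is then not the highest and its imaginary part is still a term of index at
  most 2.\<close>

lemma C2_bound:
  assumes "C2 z u"
  shows "w 2 * norm u \<le> mx z"
proof -
  obtain v I where v: "strip_cell 2 v I" "emb e s z u \<in> cn v I" using assms unfolding C2_def by blast
  have vi: "v \<in> int_points" "0 \<le> coord_sum v" "coord_sum v + card I \<le> 2" using v(1) by (auto simp: strip_cell_def)
  obtain n where n: "coord_sum v = real n" using int_points_coord_sum_nat[OF vi(1,2)] by blast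
  have nI: "n + card I \<le> 2" using vi(3) n by simp
  obtain i1 i2 i3 :: int where i: "v $ 3 = i3" using int_pointsE[OF vi(1)] by metis
  obtain c where c: "emb e s z u = (\<Sum>S\<in>Pow I. c S *\<^sub>R pt e s h (v + ind S))" "\<forall>S\<in>Pow I. 0 \<le> c S"
    using v(2) by (auto simp: cspan_def)
  define Z where "Z = (\<Sum>S\<in>Pow I. c S *\<^sub>R lz h n S)"
  have "emb e s z u = emb e s (\<Sum>S\<in>Pow I. c S *\<^sub>R (cis (pi / 2 * v $ 3) * lz h n S)) (\<Sum>S\<in>Pow I. c S *\<^sub>R (cis (pi / 3 * (v $ 1 - v $ 2)) * lw S))"
    unfolding c(1) pt_local[OF n] emb_sum ..
  then have z: "z = (\<Sum>S\<in>Pow I. c S *\<^sub>R (cis (pi / 2 * v $ 3) * lz h n S))"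
    and u: "u = (\<Sum>S\<in>Pow I. c S *\<^sub>R (cis (pi / 3 * (v $ 1 - v $ 2)) * lw S))" unfolding emb_eq_iff by blast+
  have "z = cis (pi / 2 * of_int i3) * Z"
    unfolding z i Z_def by (simp add: sum_distrib_left)
  then have mz: "mx z = mx Z" by (simp only: mx_quarter_turn)
  have "norm u \<le> (\<Sum>S\<in>Pow I. norm (c S *\<^sub>R (cis (pi / 3 * (v $ 1 - v $ 2)) * lw S)))" unfolding u by (rule norm_sum)
  also have "\<dots> = (\<Sum>S\<in>Pow I. c S)" using c(2) by (intro sum.cong) (auto simp: norm_mult lw_def)
  finally have nu: "norm u \<le> (\<Sum>S\<in>Pow I. c S)" .
  have w2: "w 2 \<le> w m" if "m \<le> 2" for m using that k3 by (intro w_antimono) auto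
  have cS: "card S \<le> card I" if "S \<in> Pow I" for S using that by (simp add: card_mono)
  have "w 2 * (\<Sum>S\<in>Pow I. c S) \<le> mx Z"
  proof (cases "3 \<in> I")
    case False
    have "w 2 * (\<Sum>S\<in>Pow I. c S) = (\<Sum>S\<in>Pow I. c S * w 2)" by (simp add: sum_distrib_right mult.commute)
    also have "\<dots> \<le> (\<Sum>S\<in>Pow I. c S * Re (lz h n S))"
    proof (intro sum_mono mult_left_mono)
      fix S assume S: "S \<in> Pow I"
      then have "3 \<notin> S" using False by blast
      then show "w 2 \<le> Re (lz h n S)" using w2[of "n + card S"] cS[OF S] nI by (simp add: lz_def)
    qed (use c(2) in blast)
    also have "\<dots> = Re Z" by (simp add: Z_def)
    finally show ?thesis by (simp add: mx_def)
  next
    case True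
    have "w 2 * (\<Sum>S\<in>Pow I. c S) = (\<Sum>S\<in>Pow I. c S * w 2)" by (simp add: sum_distrib_right mult.commute)
    also have "\<dots> \<le> (\<Sum>S\<in>Pow I. c S * Im (lz h n S))"
    proof (intro sum_mono mult_left_mono)
      fix S assume S: "S \<in> Pow I"
      show "w 2 \<le> Im (lz h n S)"
      proof (cases "3 \<in> S")
        case True
        then show ?thesis using w2[of "n + card S"] cS[OF S] nI by (simp add: lz_def)
      next
        case False
        then have "S \<subset> I" using S True by blast
        then have "card S < card I" by (simp add: psubset_card_mono)
        then show ?thesis using False w2[of "n + card S + 1"] nI by (simp add: lz_def)
      qed
    qed (use c(2) in blast)
    also have "\<dots> = Im Z" by (simp add: Z_def)
    finally show ?thesis by (simp add: mx_def)
  qed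
  moreover have "w 2 * norm u \<le> w 2 * (\<Sum>S\<in>Pow I. c S)"
    using nu w_pos[of 2] k3 by (intro mult_left_mono) auto
  ultimately show ?thesis using mz by simp
qed

end


lemma normalise_multiple:
  fixes x y :: "'a::real_normed_vector"
  assumes "x = c *\<^sub>R y" "0 < c" "norm y = 1"
  shows "x /\<^sub>R norm x = y"
  using assms by simp

context shrinking_cct
begin

text \<open>For fixed \<open>u = a + c \<omega>\<close> and with primes exchanging \<open>a\<close> and \<open>c\<close>, the points
  \<open>Q, P, i Q', i P', - Q\<close> go half way around the polygon in which \<open>u\<close> meets layers 0 to 2;
  consecutive points lie in a common square.\<close>

definition Pz :: "real \<Rightarrow> real \<Rightarrow> complex" where "Pz a c = a *\<^sub>R h 0 + c *\<^sub>R h 1"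
definition Qz :: "real \<Rightarrow> real \<Rightarrow> complex" where "Qz a c = a *\<^sub>R h 2 + c *\<^sub>R h 1"
definition sc :: "real \<Rightarrow> real \<Rightarrow> complex" where "sc a c = of_real a + of_real c * om"

lemma sc_nz: "0 \<le> a \<Longrightarrow> 0 \<le> c \<Longrightarrow> 0 < a + c \<Longrightarrow> 0 < t \<Longrightarrow> t *\<^sub>R sc a c \<noteq> 0"
  using a_c_om_nz[of a c] by (simp add: sc_def)

lemma sc_flip: "om * cnj (t *\<^sub>R sc c a) = t *\<^sub>R sc a c"
proof -
  have "om * (of_real c + of_real a * (1 - om)) = of_real c * om + of_real a * (om - om * om)" by (simp add: algebra_simps)
  then have "om * cnj (sc c a) = sc a c" by (simp add: sc_def cnj_om om_square)
  then show ?thesis by (simp add: scaleR_conv_of_real)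
qed

lemma seg_A:
  assumes "0 \<le> a" "0 \<le> c" "0 < a + c" "0 \<le> p" "0 \<le> q" "0 < p + q"
  shows "C2 (p *\<^sub>R Qz a c + q *\<^sub>R Pz a c) ((p + q) *\<^sub>R sc a c)"
proof -
  have "strip_cell 2 (ax 0) {1, 2}" by (intro ax_strip) simp
  moreover have "emb e s (p *\<^sub>R Qz a c + q *\<^sub>R Pz a c) ((p + q) *\<^sub>R sc a c) \<in> cn (ax 0) {1, 2}"
  proof -
    have "(q * a) *\<^sub>R h 0 + ((p + q) * c + 0) *\<^sub>R h (0 + 1) + (p * a) *\<^sub>R h (0 + 2) = p *\<^sub>R Qz a c + q *\<^sub>R Pz a c"
      by (simp add: Pz_def Qz_def algebra_simps numeral_2_eq_2)
    moreover have "of_real (q * a + p * a) + of_real ((p + q) * c) * om + of_real 0 * cnj om = (p + q) *\<^sub>R sc a c"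
      by (simp add: sc_def scaleR_conv_of_real algebra_simps)
    moreover have "E 0 = e" by simp
    ultimately show ?thesis
      using A_mem[of "q * a" "(p + q) * c" 0 "p * a" 0] assms by (simp only: mult_nonneg_nonneg add_nonneg_nonneg order_refl simp_thms)
  qed
  ultimately show ?thesis unfolding C2_def using sc_nz[OF assms(1-3,6)] by blast
qed

lemma seg_B:
  assumes "0 \<le> a" "0 \<le> c" "0 < a + c" "0 \<le> p" "0 \<le> q" "0 < p + q"
  shows "C2 (p *\<^sub>R Pz a c + q *\<^sub>R (\<i> * Qz c a)) ((p + q) *\<^sub>R sc a c)"
proof -
  have "strip_cell 2 (ax 0) {1, 3}" by (intro ax_strip) simp
  moreover have "emb e s (p *\<^sub>R Pz a c + q *\<^sub>R (\<i> * Qz c a)) ((p + q) *\<^sub>R sc a c) \<in> cn (ax 0) {1, 3}"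
  proof -
    have "(p * a) *\<^sub>R h 0 + (p * c) *\<^sub>R h (0 + 1) + \<i> * ((q * a) *\<^sub>R h (0 + 1) + (q * c) *\<^sub>R h (0 + 2)) = p *\<^sub>R Pz a c + q *\<^sub>R (\<i> * Qz c a)"
      by (simp add: Pz_def Qz_def algebra_simps numeral_2_eq_2)
    moreover have "of_real (p * a + q * a) + of_real (p * c + q * c) * om = (p + q) *\<^sub>R sc a c"
      by (simp add: sc_def scaleR_conv_of_real algebra_simps)
    moreover have "E 0 = e" by simp
    ultimately show ?thesis
      using B_mem[of "p * a" "p * c" "q * a" "q * c" 0] assms by (simp only: mult_nonneg_nonneg add_nonneg_nonneg order_refl simp_thms)
  qed
  ultimately show ?thesis unfolding C2_def using sc_nz[OF assms(1-3,6)] by blast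
qed

text \<open>Reflection in the bisector of the sector exchanges \<open>a\<close> and
  \<open>c\<close>, at the price of a quarter turn of the first component.\<close>

lemma C2_flip: "C2 z (t *\<^sub>R sc c a) \<Longrightarrow> C2 (\<i> * z) (t *\<^sub>R sc a c)"
  using C2_turn[OF C2_cnj] sc_flip by metis

lemma w_dets: "w 0 * w 2 < w 1 * w 1" "w 1 * w 3 < w 2 * w 2"
proof -
  show d: "w 0 * w 2 < w 1 * w 1" using w_det2[of 0] k3 by (simp add: eval_nat_numeral)
  obtain b where b: "0 < b" "w 2 * w 2 - w 1 * w 3 = b * (w 1 * w 1 - w 0 * w 2)"
    using w_det_step[of 0] k3 by (auto simp: eval_nat_numeral)
  have "0 < b * (w 1 * w 1 - w 0 * w 2)" using b(1) d by simp
  then show "w 1 * w 3 < w 2 * w 2" unfolding b(2)[symmetric] by simp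
qed

text \<open>The product of the two inequalities of \<open>w_dets\<close>, divided by
  \<open>w 1 * w 2\<close>.\<close>

lemma w3_bound: "w 3 * w 0 < w 2 * w 1"
proof (cases "0 < w 3")
  case True
  have p: "0 < w 0" "0 < w 1" "0 < w 2" using w_pos k3 by simp_all
  have "(w 1 * w 3) * (w 0 * w 2) < (w 2 * w 2) * (w 1 * w 1)"
    by (rule mult_strict_mono) (use w_dets p True in simp_all)
  then have "(w 1 * w 2) * (w 3 * w 0) < (w 1 * w 2) * (w 2 * w 1)" by (simp add: mult_ac)
  then show ?thesis using p by simp
next
  case False
  then have "w 3 * w 0 \<le> 0" using w_pos[of 0] by (simp add: mult_nonpos_nonneg)
  moreover have "0 < w 2 * w 1" using w_pos k3 by simp
  ultimately show ?thesis by linarith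
qed

lemma dt_A: "0 < a \<Longrightarrow> 0 \<le> c \<Longrightarrow> 0 < dt (Qz a c) (Pz a c)"
proof -
  assume ac: "0 < a" "0 \<le> c"
  have "dt (Qz a c) (Pz a c) = a * a * (w 2 * w 1 - w 3 * w 0) + a * c * (w 2 * w 2 - w 1 * w 3) + a * c * (w 1 * w 1 - w 0 * w 2)"
    by (simp add: dt_def Qz_def Pz_def eta_def eval_nat_numeral algebra_simps)
  also have "0 < \<dots>"
    using ac w_dets w3_bound by (intro add_pos_nonneg mult_pos_pos mult_nonneg_nonneg) auto
  finally show ?thesis .
qed

lemma dt_B: "0 \<le> a \<Longrightarrow> 0 \<le> c \<Longrightarrow> 0 < a + c \<Longrightarrow> 0 < dt (Pz a c) (\<i> * Qz c a)"
proof -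
  assume ac: "0 \<le> a" "0 \<le> c" "0 < a + c"
  have pos: "0 < a * x + c * y" if "0 < x" "0 < y" for x y
    using ac that by (cases "a = 0") (auto intro!: add_pos_nonneg)
  have s: "0 < w 0 + w 2" "0 < w 1 + w 3" using sum_pos[of 0] sum_pos[of 1] k3 by (simp_all add: eval_nat_numeral)
  have "dt (Pz a c) (\<i> * Qz c a) = (a * w 1 + c * w 2) * (a * (w 0 + w 2) + c * (w 1 + w 3))"
    by (simp add: dt_def Qz_def Pz_def eta_def eval_nat_numeral algebra_simps)
  also have "0 < \<dots>" using pos[OF s] pos[of "w 1" "w 2"] w_pos k3 by simp
  finally show ?thesis .
qed

lemma dt_i: "dt (\<i> * x) (\<i> * y) = dt x y"
  by (simp add: dt_def)

text \<open>The points of the half polygon follow each other counterclockwise, so a direction on the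
  left of \<open>Qz a c\<close> lies between two consecutive ones, found at the first change of sign
  of \<open>dt\<close>.\<close>

lemma cover_half:
  assumes ac: "0 \<le> a" "0 \<le> c" "0 < a + c" and d: "d \<noteq> 0" "0 \<le> dt (Qz a c) d"
  shows "\<exists>t>0. C2 d (t *\<^sub>R sc a c)"
proof -
  have ca: "0 < c + a" using ac by simp
  consider "dt (Pz a c) d < 0" | "0 \<le> dt (Pz a c) d" "dt (\<i> * Qz c a) d < 0"
    | "0 \<le> dt (\<i> * Qz c a) d" "dt (\<i> * Pz c a) d < 0" | "0 \<le> dt (\<i> * Pz c a) d" by linarith
  then show ?thesis
  proof cases
    case 1
    then have "a \<noteq> 0" using d(2) by (auto simp: Pz_def Qz_def)
    then have "0 < dt (Qz a c) (Pz a c)" using ac by (intro dt_A) auto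
    then obtain p q where pq: "0 \<le> p" "0 \<le> q" "0 < p + q" "d = p *\<^sub>R Qz a c + q *\<^sub>R Pz a c"
      using dt_wedge[of "Qz a c" "Pz a c" d] 1 d by (metis less_imp_le)
    then show ?thesis using seg_A[OF ac pq(1-3)] by blast
  next
    case 2
    obtain p q where pq: "0 \<le> p" "0 \<le> q" "0 < p + q" "d = p *\<^sub>R Pz a c + q *\<^sub>R (\<i> * Qz c a)"
      using dt_wedge[of "Pz a c" "\<i> * Qz c a" d] dt_B[OF ac] 2 d by (metis less_imp_le)
    then show ?thesis using seg_B[OF ac pq(1-3)] by blast
  next
    case 3
    then have "c \<noteq> 0" by (auto simp: Pz_def Qz_def)
    then have "0 < dt (\<i> * Qz c a) (\<i> * Pz c a)" unfolding dt_i using ac by (intro dt_A) auto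
    then obtain p q where pq: "0 \<le> p" "0 \<le> q" "0 < p + q" "d = p *\<^sub>R (\<i> * Qz c a) + q *\<^sub>R (\<i> * Pz c a)"
      using dt_wedge[of "\<i> * Qz c a" "\<i> * Pz c a" d] 3 d by (metis less_imp_le)
    have "d = \<i> * (p *\<^sub>R Qz c a + q *\<^sub>R Pz c a)" unfolding pq(4) by (simp add: distrib_left)
    then show ?thesis using C2_flip[OF seg_A[OF ac(2,1) ca pq(1-3)]] pq(3) by metis
  next
    case 4
    have D: "0 < dt (\<i> * Pz c a) (\<i> * (\<i> * Qz a c))" unfolding dt_i using dt_B[OF ac(2,1) ca] .
    have "dt (\<i> * (\<i> * Qz a c)) d \<le> 0" using d(2) by (simp add: dt_def)
    then obtain p q where pq: "0 \<le> p" "0 \<le> q" "0 < p + q" "d = p *\<^sub>R (\<i> * Pz c a) + q *\<^sub>R (\<i> * (\<i> * Qz a c))"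
      using dt_wedge[OF D 4] d(1) by metis
    have "d = \<i> * (p *\<^sub>R Pz c a + q *\<^sub>R (\<i> * Qz a c))" unfolding pq(4) by (simp add: distrib_left)
    then show ?thesis using C2_flip[OF seg_B[OF ac(2,1) ca pq(1-3)]] pq(3) by metis
  qed
qed

text \<open>Existence in the graph property whose uniqueness is \<open>C2_ray\<close>.
  \<open>cover_half\<close> serves a half-plane over the first sector, \<open>C2_uminus\<close> the
  opposite half-plane, \<open>C2_turn\<close> the other sectors.\<close>

lemma C2_cover:
  assumes "z \<noteq> 0" "u \<noteq> 0"
  shows "\<exists>t>0. C2 z (t *\<^sub>R u)"
proof -
  obtain n a c where ac: "0 \<le> a" "0 \<le> c" "0 < a + c" and u: "u = om ^ n * (of_real a + of_real c * om)"
    using sector_exists[OF assms(2)] by metis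
  have "\<exists>t>0. C2 z (t *\<^sub>R (om ^ m * sc a c))" if "z \<noteq> 0" for m z
    using that
  proof (induction m arbitrary: z)
    case 0
    show ?case
    proof (cases "0 \<le> dt (Qz a c) z")
      case True
      then show ?thesis using cover_half[OF ac 0] by simp
    next
      case False
      then have "0 \<le> dt (Qz a c) (- z)" by (simp add: dt_def)
      then obtain t where "0 < t" "C2 (- z) (t *\<^sub>R sc a c)" using cover_half[OF ac, of "- z"] 0 by auto
      then show ?thesis using C2_uminus[of "- z"] by auto
    qed
  next
    case (Suc m)
    have "- (\<i> * z) \<noteq> 0" using Suc.prems by simp
    from Suc.IH[OF this] obtain t where t: "0 < t" "C2 (- (\<i> * z)) (t *\<^sub>R (om ^ m * sc a c))" by blast
    have "\<i> * (- (\<i> * z)) = z" by (simp add: mult.assoc[symmetric])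
    moreover have "om * (t *\<^sub>R (om ^ m * sc a c)) = t *\<^sub>R (om ^ Suc m * sc a c)" by simp
    ultimately show ?case using C2_turn[OF t(2)] t(1) by metis
  qed
  then show ?thesis using assms(1) u by (simp add: sc_def)
qed

section \<open>Separation of the sphere by the torus of layers 0 to 2\<close>

definition Sig :: "(real^5) set" where
  "Sig = \<Union>{\<phi> (orbit (cell v I)) | v I. strip_cell 2 v I}"

lemma Sig_iff: "x \<in> Sig \<longleftrightarrow> norm x = 1 \<and> (\<exists>z u. x = emb e s z u \<and> C2 z u)"
proof
  assume "x \<in> Sig"
  then obtain v I where v: "strip_cell 2 v I" "x \<in> \<phi> (orbit (cell v I))" by (auto simp: Sig_def)
  then have vk: "strip_cell k v I" "card I \<le> 2" using strip2 by auto
  have x: "x \<in> S3eq" "x \<notin> Clif 0" using cell_Clif[OF vk v(2)] by auto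
  have cn: "x \<in> cn v I" "norm x = 1" using v(2) lab_cn[OF vk(1)] by auto
  obtain z u where zu: "x = emb e s z u" using emb_surj[OF frame_axioms, of x] x(1) by (auto simp: S3eq_def)
  have "u \<noteq> 0" using emb_Clif_iff(1)[of z u] x zu by blast
  then have "C2 z u" unfolding C2_def using v(1) cn(1) zu by blast
  then show "norm x = 1 \<and> (\<exists>z u. x = emb e s z u \<and> C2 z u)" using cn(2) zu by blast
next
  assume "norm x = 1 \<and> (\<exists>z u. x = emb e s z u \<and> C2 z u)"
  then obtain v I where v: "norm x = 1" "strip_cell 2 v I" "x \<in> cn v I" unfolding C2_def by blast
  have "x \<in> \<phi> (orbit (cell v I))" unfolding lab_cn[OF strip2[OF v(2), THEN conjunct1]] using v by simp
  then show "x \<in> Sig" unfolding Sig_def using v(2) by blast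
qed

lemma Sig_normalise:
  assumes "C2 z u"
  obtains r where "0 < r" "emb e s (r *\<^sub>R z) (r *\<^sub>R u) \<in> Sig"
proof -
  define r where "r = inverse (norm (emb e s z u))"
  have nz: "emb e s z u \<noteq> 0" using C2_nz[OF assms] by (simp add: emb_eq_0_iff)
  then have r: "0 < r" by (simp add: r_def)
  have "norm (emb e s (r *\<^sub>R z) (r *\<^sub>R u)) = 1"
    unfolding emb_scale[symmetric] using nz by (simp add: r_def)
  then have "emb e s (r *\<^sub>R z) (r *\<^sub>R u) \<in> Sig" unfolding Sig_iff using C2_scale[OF assms r] by blast
  then show ?thesis using that r by blast
qed

lemma Sig_image:
  assumes "y \<in> f ` (Sig \<times> {0..1})"
  obtains z u t where "C2 z u" "0 \<le> t" "t \<le> 1" "y = f (emb e s z u, t)"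
proof -
  obtain x t where x: "x \<in> Sig" "t \<in> {0..1}" "y = f (x, t)" using assms by blast
  obtain z u where "x = emb e s z u" "C2 z u" using x(1) unfolding Sig_iff by blast
  then show ?thesis using that x by auto
qed

lemma Sig_sub: "Sig \<subseteq> \<Union>T"
  unfolding Sig_def using lab_in[OF torus_complexI] strip2 by blast

lemma compact_Sig: "compact Sig"
proof -
  have sub: "{\<phi> (orbit (cell v I)) | v I. strip_cell 2 v I} \<subseteq> T"
    using lab_in[OF torus_complexI] strip2 by blast
  have "finite T" using polytopal unfolding polytopal_complex_def by blast
  then have "finite {\<phi> (orbit (cell v I)) | v I. strip_cell 2 v I}" using sub by (rule rev_finite_subset)
  moreover have "compact P" if PT: "P \<in> T" for P
  proof -
    obtain V where V: "finite V" "P = sph_hull V" using polytope[OF PT] unfolding sph_polytope_def by blast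
    have "closed (convex_cone hull V)" using V(1) by (rule closed_convex_cone_hull)
    then show ?thesis unfolding V(2) sph_hull_def by (metis closed_Int_compact compact_sphere)
  qed
  ultimately show ?thesis unfolding Sig_def using sub by (intro compact_Union) auto
qed

text \<open>The two maps sweep the torus to the circles \<open>u = 0\<close> and \<open>z = 0\<close>, respectively.\<close>

definition out_map :: "(real^5) \<times> real \<Rightarrow> real^5" where
  "out_map = (\<lambda>(x, t). (part12 x + t *\<^sub>R part34 x) /\<^sub>R norm (part12 x + t *\<^sub>R part34 x))"

definition in_map :: "(real^5) \<times> real \<Rightarrow> real^5" where
  "in_map = (\<lambda>(x, t). (t *\<^sub>R part12 x + part34 x) /\<^sub>R norm (t *\<^sub>R part12 x + part34 x))"

lemma out_map_emb: "out_map (emb e s z u, t) = emb e s z (t *\<^sub>R u) /\<^sub>R norm (emb e s z (t *\<^sub>R u))"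
  unfolding out_map_def part12_emb part34_emb prod.case emb_scale emb_add by simp

lemma in_map_emb: "in_map (emb e s z u, t) = emb e s (t *\<^sub>R z) u /\<^sub>R norm (emb e s (t *\<^sub>R z) u)"
  unfolding in_map_def part12_emb part34_emb prod.case emb_scale emb_add by simp

lemma closed_images: "closed (out_map ` (Sig \<times> {0..1}))" "closed (in_map ` (Sig \<times> {0..1}))"
proof -
  have "linear part12" by (rule linearI) (simp_all add: part12_def vec_eq_iff forall_5)
  moreover have "linear part34" by (rule linearI) (simp_all add: part34_def vec_eq_iff forall_5)
  ultimately have bl: "bounded_linear part12" "bounded_linear part34" using linear_conv_bounded_linear by blast+
  have c: "continuous_on X (\<lambda>p. part12 (fst p))" "continuous_on X (\<lambda>p. part34 (fst p))" for X :: "((real^5) \<times> real) set"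
    using bounded_linear.continuous_on[OF bl(1) continuous_on_fst[OF continuous_on_id]]
      bounded_linear.continuous_on[OF bl(2) continuous_on_fst[OF continuous_on_id]] .
  have nz: "part12 x + t *\<^sub>R part34 x \<noteq> 0" "t *\<^sub>R part12 x + part34 x \<noteq> 0" if x: "x \<in> Sig" for x t
  proof -
    obtain z u where zu: "x = emb e s z u" "C2 z u" using x unfolding Sig_iff by blast
    have "part12 x + t *\<^sub>R part34 x = emb e s z (t *\<^sub>R u)" "t *\<^sub>R part12 x + part34 x = emb e s (t *\<^sub>R z) u"
      unfolding zu(1) part12_emb part34_emb emb_scale emb_add by simp_all
    then show "part12 x + t *\<^sub>R part34 x \<noteq> 0" "t *\<^sub>R part12 x + part34 x \<noteq> 0"
      using C2_nz[OF zu(2)] by (simp_all add: emb_eq_0_iff)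
  qed
  have K: "compact (Sig \<times> {0..1::real})" by (intro compact_Times compact_Sig compact_Icc)
  have snd: "continuous_on X snd" for X :: "((real^5) \<times> real) set" by (intro continuous_intros)
  have "continuous_on (Sig \<times> {0..1}) out_map"
    unfolding out_map_def case_prod_beta
    by (intro continuous_on_scaleR continuous_on_inverse continuous_on_norm continuous_on_add c snd) (use nz(1) in fastforce)
  then show "closed (out_map ` (Sig \<times> {0..1}))"
    by (intro compact_imp_closed compact_continuous_image K)
  have "continuous_on (Sig \<times> {0..1}) in_map"
    unfolding in_map_def case_prod_beta
    by (intro continuous_on_scaleR continuous_on_inverse continuous_on_norm continuous_on_add c snd) (use nz(2) in fastforce)
  then show "closed (in_map ` (Sig \<times> {0..1}))"
    by (intro compact_imp_closed compact_continuous_image K)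
qed

text \<open>For nonzero components \<open>Z\<close>, \<open>U\<close> the torus has a point on the
  ray of \<open>(Z, t * U)\<close>. If \<open>1 \<le> t\<close>, shrinking its second component by
  \<open>1 / t\<close> gives the point; otherwise shrinking its first component by \<open>t\<close>
  does. On the two limit circles the parameter is 0.\<close>

lemma covered:
  assumes "y \<in> S3eq"
  shows "y \<in> out_map ` (Sig \<times> {0..1}) \<or> y \<in> in_map ` (Sig \<times> {0..1})"
proof -
  obtain Z U where y: "y = emb e s Z U" using emb_surj[OF frame_axioms, of y] assms by (auto simp: S3eq_def)
  have n: "norm (emb e s Z U) = 1" using assms y by (simp add: S3eq_def)
  have out: "y \<in> out_map ` (Sig \<times> {0..1})" if C: "C2 z u" and t: "0 \<le> t" "t \<le> 1" and k: "0 < \<kappa>" "z = \<kappa> *\<^sub>R Z" "t *\<^sub>R u = \<kappa> *\<^sub>R U" for z u t \<kappa>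
  proof -
    obtain r where r: "0 < r" and m: "emb e s (r *\<^sub>R z) (r *\<^sub>R u) \<in> Sig" using Sig_normalise[OF C] .
    have "emb e s (r *\<^sub>R z) (t *\<^sub>R r *\<^sub>R u) = (r * \<kappa>) *\<^sub>R emb e s Z U"
    proof -
      have "t *\<^sub>R r *\<^sub>R u = r *\<^sub>R (t *\<^sub>R u)" by simp
      also have "\<dots> = (r * \<kappa>) *\<^sub>R U" using k(3) by simp
      finally have "t *\<^sub>R r *\<^sub>R u = (r * \<kappa>) *\<^sub>R U" .
      moreover have "r *\<^sub>R z = (r * \<kappa>) *\<^sub>R Z" using k(2) by simp
      ultimately show ?thesis by (simp only: emb_scale)
    qed
    then have "out_map (emb e s (r *\<^sub>R z) (r *\<^sub>R u), t) = y"
      unfolding out_map_emb y by (rule normalise_multiple) (use n r k(1) in simp_all)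
    then show ?thesis using m t by (intro image_eqI[of _ _ "(emb e s (r *\<^sub>R z) (r *\<^sub>R u), t)"]) auto
  qed
  have inn: "y \<in> in_map ` (Sig \<times> {0..1})" if C: "C2 z u" and t: "0 \<le> t" "t \<le> 1" and k: "0 < \<kappa>" "t *\<^sub>R z = \<kappa> *\<^sub>R Z" "u = \<kappa> *\<^sub>R U" for z u t \<kappa>
  proof -
    obtain r where r: "0 < r" and m: "emb e s (r *\<^sub>R z) (r *\<^sub>R u) \<in> Sig" using Sig_normalise[OF C] .
    have "emb e s (t *\<^sub>R r *\<^sub>R z) (r *\<^sub>R u) = (r * \<kappa>) *\<^sub>R emb e s Z U"
    proof -
      have "t *\<^sub>R r *\<^sub>R z = r *\<^sub>R (t *\<^sub>R z)" by simp
      also have "\<dots> = (r * \<kappa>) *\<^sub>R Z" using k(2) by simp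
      finally have "t *\<^sub>R r *\<^sub>R z = (r * \<kappa>) *\<^sub>R Z" .
      moreover have "r *\<^sub>R u = (r * \<kappa>) *\<^sub>R U" using k(3) by simp
      ultimately show ?thesis by (simp only: emb_scale)
    qed
    then have "in_map (emb e s (r *\<^sub>R z) (r *\<^sub>R u), t) = y"
      unfolding in_map_emb y by (rule normalise_multiple) (use n r k(1) in simp_all)
    then show ?thesis using m t by (intro image_eqI[of _ _ "(emb e s (r *\<^sub>R z) (r *\<^sub>R u), t)"]) auto
  qed
  consider "U = 0" | "Z = 0" "U \<noteq> 0" | "Z \<noteq> 0" "U \<noteq> 0" by blast
  then show ?thesis
  proof cases
    case 1
    then have "Z \<noteq> 0" using n by (auto simp: emb_zero)
    then obtain t where "C2 Z (t *\<^sub>R 1)" using C2_cover[of Z 1] by auto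
    then show ?thesis using out[of Z "t *\<^sub>R 1" 0 1] 1 by simp
  next
    case 2
    obtain t where t: "0 < t" "C2 1 (t *\<^sub>R U)" using C2_cover[of 1 U] 2 by auto
    then show ?thesis using inn[of 1 "t *\<^sub>R U" 0 t] 2 by simp
  next
    case 3
    obtain t where t: "0 < t" "C2 Z (t *\<^sub>R U)" using C2_cover[OF 3] by auto
    show ?thesis
    proof (cases "1 \<le> t")
      case True
      then show ?thesis using out[OF t(2), of "1 / t" 1] t(1) by simp
    next
      case False
      then show ?thesis using inn[OF t(2), of t t] t(1) by simp
    qed
  qed
qed

text \<open>Uniqueness over a pair of rays forces \<open>t * t' = 1\<close> for two parameters in
  the unit interval, so the point has not been moved off the torus.\<close>

lemma in_out_Sig:
  assumes "y \<in> out_map ` (Sig \<times> {0..1})" "y \<in> in_map ` (Sig \<times> {0..1})"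
  shows "y \<in> Sig"
proof -
  obtain z u t where i: "C2 z u" "0 \<le> t" "t \<le> 1" "y = in_map (emb e s z u, t)"
    using Sig_image[OF assms(2)] .
  obtain z' u' t' where o: "C2 z' u'" "0 \<le> t'" "t' \<le> 1" "y = out_map (emb e s z' u', t')"
    using Sig_image[OF assms(1)] .
  define m m' where "m = inverse (norm (emb e s (t *\<^sub>R z) u))" and "m' = inverse (norm (emb e s z' (t' *\<^sub>R u')))"
  have nz: "z \<noteq> 0" "u \<noteq> 0" "z' \<noteq> 0" "u' \<noteq> 0" using C2_nz i(1) o(1) by auto
  then have m: "0 < m" "0 < m'" by (simp_all add: m_def m'_def emb_eq_0_iff)
  have y: "y = emb e s (m *\<^sub>R t *\<^sub>R z) (m *\<^sub>R u)" unfolding i(4) in_map_emb m_def emb_scale ..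
  have y': "y = emb e s (m' *\<^sub>R z') (m' *\<^sub>R t' *\<^sub>R u')" unfolding o(4) out_map_emb m'_def emb_scale ..
  have eq: "(m * t) *\<^sub>R z = m' *\<^sub>R z'" "m *\<^sub>R u = (m' * t') *\<^sub>R u'" using y y' emb_eq_iff by auto
  have t0: "t \<noteq> 0" "t' \<noteq> 0" using eq m nz by auto
  have "z' = (m * t / m') *\<^sub>R z" using arg_cong[OF eq(1), of "scaleR (inverse m')"] m by (simp add: divide_inverse mult_ac)
  moreover have "u' = (m / (m' * t')) *\<^sub>R u" using arg_cong[OF eq(2), of "scaleR (inverse (m' * t'))"] m t0 by (simp add: divide_inverse mult_ac)
  ultimately have "m * t / m' = m / (m' * t')"
    using C2_ray[OF i(1), of "m * t / m'" "m / (m' * t')"] o(1) m i(2) o(2) t0 by auto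
  then have "t * t' = 1" using m t0 by (simp add: field_simps)
  moreover have "t * t' \<le> t * 1" using i(2) o(3) by (intro mult_left_mono) auto
  ultimately have t: "t = 1" using i(3) by simp
  have "norm y = 1" unfolding i(4) in_map_emb using nz by (simp add: emb_eq_0_iff)
  moreover have "C2 (m *\<^sub>R t *\<^sub>R z) (m *\<^sub>R u)" unfolding t using C2_scale[OF i(1) m(1)] by simp
  ultimately show ?thesis unfolding Sig_iff using y by blast
qed

text \<open>\<open>out_map\<close> only decreases the second component relative to the first, so the
  estimate of \<open>C2_bound\<close> persists.\<close>

lemma out_bound:
  assumes "emb e s z u \<in> out_map ` (Sig \<times> {0..1})"
  shows "w 2 * norm u \<le> mx z"
proof -
  obtain z' u' t where o: "C2 z' u'" "0 \<le> t" "t \<le> 1" "emb e s z u = out_map (emb e s z' u', t)"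
    using Sig_image[OF assms] .
  define m where "m = inverse (norm (emb e s z' (t *\<^sub>R u')))"
  have m: "0 \<le> m" by (simp add: m_def)
  have "emb e s z u = emb e s (m *\<^sub>R z') (m *\<^sub>R t *\<^sub>R u')" unfolding o(4) out_map_emb m_def emb_scale ..
  then have zu: "z = m *\<^sub>R z'" "u = (m * t) *\<^sub>R u'" using emb_eq_iff by auto
  have "w 2 * norm u = (m * t) * (w 2 * norm u')" using m o(2) unfolding zu by simp
  also have "\<dots> \<le> (m * 1) * mx z'"
    using m o w_pos[of 2] k3 C2_bound[OF o(1)] by (intro mult_mono) auto
  also have "\<dots> = mx z" unfolding zu mx_scale[OF m] by simp
  finally show ?thesis .
qed

text \<open>The closed sets \<open>Out\<close> and \<open>Inn\<close> cover the sphere and meet only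
  in the torus, so the connected set \<open>K\<close> avoids one of them; as it contains the core
  circle, it lies in \<open>Out\<close>, and so does its closure. A vertex of layer \<open>k\<close>
  in \<open>Out\<close> would contradict \<open>out_bound\<close>, both coordinates of
  \<open>h k\<close> being below \<open>w 2\<close>.\<close>

lemma shrinking_not_ideal:
  assumes K: "K \<in> components (S3eq - \<Union>T)" "Clif 0 \<subseteq> K" and meet: "closure K \<inter> layer \<phi> k \<noteq> {}"
  shows False
proof -
  define Out Inn where "Out = out_map ` (Sig \<times> {0..1})" and "Inn = in_map ` (Sig \<times> {0..1})"
  have cl: "closed Out" "closed Inn" unfolding Out_def Inn_def by (rule closed_images)+
  have cov: "S3eq \<subseteq> Out \<union> Inn" unfolding Out_def Inn_def using covered by (intro subsetI UnCI) blast
  have int: "Out \<inter> Inn \<subseteq> \<Union>T" unfolding Out_def Inn_def using in_out_Sig Sig_sub by (intro subsetI) (elim IntE, blast)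
  have Ks: "K \<subseteq> S3eq - \<Union>T" "connected K"
    using in_components_subset[OF K(1)] in_components_connected[OF K(1)] by auto
  have "Out \<inter> Inn \<inter> K = {}" using int Ks(1) by blast
  moreover have KO: "K \<subseteq> Out \<union> Inn" using cov Ks(1) by blast
  ultimately have "Out \<inter> K = {} \<or> Inn \<inter> K = {}"
    using connected_closedD[OF Ks(2)] cl by metis
  moreover have "Out \<inter> K \<noteq> {}"
  proof -
    \<comment> \<open>A point of the core circle, which \<open>out_map\<close> reaches with
      parameter 0 from a point of the torus whose first component is a positive real.\<close>
    have S: "emb e s 1 0 \<in> S3eq" by (simp add: emb_S3eq_iff)
    then have c: "emb e s 1 0 \<in> Clif 0" using emb_Clif_iff(1) by simp
    obtain t where "0 < t" "C2 1 (t *\<^sub>R 1)" using C2_cover[of 1 1] by auto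
    then obtain r where r: "0 < r" and "emb e s (r *\<^sub>R 1) (r *\<^sub>R t *\<^sub>R 1) \<in> Sig" using Sig_normalise by blast
    moreover from r have "out_map (emb e s (r *\<^sub>R 1) (r *\<^sub>R t *\<^sub>R 1), 0) = emb e s 1 0"
    proof -
      have "emb e s (r *\<^sub>R 1) (0 *\<^sub>R r *\<^sub>R t *\<^sub>R 1) = r *\<^sub>R emb e s 1 0" by (simp add: emb_scale)
      moreover have "norm (emb e s 1 0) = 1" using S by (simp add: S3eq_def)
      ultimately show ?thesis unfolding out_map_emb by (intro normalise_multiple[OF _ r])
    qed
    ultimately have "emb e s 1 0 \<in> Out"
      unfolding Out_def by (intro image_eqI[of _ _ "(emb e s (r *\<^sub>R 1) (r *\<^sub>R t *\<^sub>R 1), 0)"]) auto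
    then show ?thesis using c K(2) by blast
  qed
  ultimately have "K \<subseteq> Out" using KO by blast
  then have "closure K \<subseteq> Out" using cl(1) by (rule closure_minimal)
  then obtain x where x: "x \<in> Out" "x \<in> layer \<phi> k" using meet by blast
  obtain v where v: "v \<in> int_points" "coord_sum v = real k" "x \<in> \<phi> (orbit {v})"
    using x(2) unfolding layer_def by blast
  have sv: "strip_cell k v {}" using v by (simp add: strip_cell_def)
  have "v + ind {} = v" by simp
  then have pt: "pt e s h v = emb e s (cis (pi / 2 * v $ 3) * h k) (cis (pi / 3 * (v $ 1 - v $ 2)))"
    using v(2) by (simp add: pt_def)
  have ptnz: "pt e s h v \<noteq> 0" unfolding pt emb_eq_0_iff by simp
  define r where "r = inverse (norm (pt e s h v))"
  have r: "0 < r" using ptnz by (simp add: r_def)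
  have "x = r *\<^sub>R pt e s h v"
    using v(3) lab[OF torus_complexI[OF sv]] mlab_cell[of e s h v "{}"] sph_hull_single[OF ptnz] by (simp add: r_def)
  then have "emb e s (r *\<^sub>R (cis (pi / 2 * v $ 3) * h k)) (r *\<^sub>R cis (pi / 3 * (v $ 1 - v $ 2))) \<in> Out"
    using x(1) unfolding pt emb_scale by simp
  from out_bound[OF this[unfolded Out_def]] have "w 2 * r \<le> mx (r *\<^sub>R (cis (pi / 2 * v $ 3) * h k))" using r by simp
  also have "\<dots> = r * mx (h k)"
  proof -
    obtain i3 :: int where "v $ 3 = i3" using int_pointsE[OF v(1)] by metis
    then show ?thesis using mx_scale[of r] r mx_quarter_turn by (metis less_imp_le)
  qed
  also have "\<dots> < r * w 2" using w_top r by (simp add: mx_def)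
  finally show False by simp
qed

end

theorem theorem4p2:
  fixes k :: nat and T :: "(real^5) set set" and \<phi> :: labelling
  assumes "3 \<le> k" and "\<Union>T \<subseteq> S3eq" and "ideal_cct k T \<phi>"
  shows "\<exists>T' \<phi>'. \<Union>T' \<subseteq> S3eq \<and> ideal_cct (k + 1) T' \<phi>' \<and> extends (k + 1) T' \<phi>' k T"
proof -
  interpret tcct k T \<phi>
    using assms by unfold_locales (auto simp: ideal_cct_def)
  obtain e s w where c: "frame e s" "\<forall>C\<in>torus_complex k. \<phi> C = mlab e s (eta w) C"
    "\<forall>l. l + 1 \<le> k \<longrightarrow> 0 < w l + w (l + 2)"
    "\<forall>l. l + 2 \<le> k \<longrightarrow> (\<exists>b>0. w (l + 2) = 2 * w (l + 1) + b * (2 * w (l + 1) - w l) \<and>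
       w (l + 3) = 2 * w (l + 2) + b * (2 * w (l + 2) - w (l + 1)))"
    using coordinates by (elim exE conjE)
  interpret frame e s by fact
  interpret coord_cct k T \<phi> e s w
    by unfold_locales (use c(2-4) in \<open>blast+\<close>)
  show ?thesis
  proof (cases "w 0 < 2 * w 1")
    case True
    then show ?thesis using growing_extension[OF assms(1)] by blast
  next
    case False
    then interpret shrinking_cct k T \<phi> e s w
      using assms(1) by unfold_locales auto
    show ?thesis using assms(3) shrinking_not_ideal unfolding ideal_cct_def by blast
  qed
qed

end
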